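(* For every prime number $p\equiv 1 \mod 4$ there is a sequence of primes $(q_k)_k$, each satisfying $q_k\equiv 1 \mod 4$, $q_k \neq p$ and $\left(\frac{p}{q_k}\right)=-1$, such that \[ \lim_{k\to\infty} \frac{\log(\mathrm{kiss}(X^{p,q_k}))}{\log(n_k)} = \frac{4}{3}, \] where $n_k$ is the number of vertices of $X^{p,q_k}$.
   Context: Let $p\neq q$ be primes with $p\equiv q\equiv 1 \mod 4$ and Legendre symbol $\left(\frac{p}{q}\right)=-1$. Let $\mathbb{H}(\mathbb{Z})=\{x_0+x_1 i+x_2 j+x_3 k : x_i\in\mathbb{Z}\}$ be the integral Hamiltonian quaternions ($i^2=j^2=k^2=ijk=-1$), with norm $N(x)=x_0^2+x_1^2+x_2^2+x_3^2$. Let $\Lambda(2)$ be the set of $x\in\mathbb{H}(\mathbb{Z})$ with $x\equiv 1 \mod 2$ (i.e. $x_0$ odd and $x_1,x_2,x_3$ even) and $N(x)=p^m$ for some integer $m\geq 0$, modulo the equivalence $x\sim y \iff x=\pm p^m y$ for some $m\in\mathbb{Z}$; quaternion multiplication makes $\Lambda(2)$ a group (it is free). Let $S\subset\Lambda(2)$ be the set of classes of $x$ with $N(x)=p$, $x_0>0$, $x_0$ odd; it is a symmetric generating set with $|S|=p+1$. Let $\Lambda(2q)$ be the normal subgroup of classes $[x_0+x_1i+x_2j+x_3k]\in\Lambda(2)$ with $2q\mid x_1,x_2,x_3$. The Lubotzky–Phillips–Sarnak graph is the Cayley graph $X^{p,q}=\mathrm{Cay}(\Lambda(2)/\Lambda(2q),S)$,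 a $(p+1)$-regular graph. The kissing number $\mathrm{kiss}(G)$ of a graph is the number of distinct shortest oriented cycles in $G$, i.e. oriented cycles whose length equals the girth (the smallest length of a non-backtracking closed walk). *)

theory Defs
  imports "HOL-Analysis.Analysis" "HOL-Number_Theory.Number_Theory"
begin

datatype hq = HQ (hq0: int) (hq1: int) (hq2: int) (hq3: int)

definition hq_mult :: "hq \<Rightarrow> hq \<Rightarrow> hq" where
  "hq_mult a b = HQ
     (hq0 a * hq0 b - hq1 a * hq1 b - hq2 a * hq2 b - hq3 a * hq3 b)
     (hq0 a * hq1 b + hq1 a * hq0 b + hq2 a * hq3 b - hq3 a * hq2 b)
     (hq0 a * hq2 b - hq1 a * hq3 b + hq2 a * hq0 b + hq3 a * hq1 b)
     (hq0 a * hq3 b + hq1 a * hq2 b - hq2 a * hq1 b + hq3 a * hq0 b)"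

definition hq_scale :: "int \<Rightarrow> hq \<Rightarrow> hq" where
  "hq_scale c x = HQ (c * hq0 x) (c * hq1 x) (c * hq2 x) (c * hq3 x)"

definition hq_norm :: "hq \<Rightarrow> int" where
  "hq_norm x = (hq0 x)^2 + (hq1 x)^2 + (hq2 x)^2 + (hq3 x)^2"

definition Lam2_set :: "int \<Rightarrow> hq set" where
  "Lam2_set p = {x. odd (hq0 x) \<and> even (hq1 x) \<and> even (hq2 x) \<and> even (hq3 x)
                   \<and> (\<exists>m::nat. hq_norm x = p ^ m)}"

text \<open>x ~ y iff x = +-p^m y for some integer m, i.e. p^a x = +- p^b y with a, b naturals.\<close>
definition lam_rel :: "int \<Rightarrow> (hq \<times> hq) set" where
  "lam_rel p = {(x, y). x \<in> Lam2_set p \<and> y \<in> Lam2_set p \<and>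
      (\<exists>(a::nat) (b::nat) (e::int). (e = 1 \<or> e = -1) \<and>
          hq_scale (p ^ a) x = hq_scale (e * p ^ b) y)}"

definition Lambda2 :: "int \<Rightarrow> hq set set" where
  "Lambda2 p = Lam2_set p // lam_rel p"

definition cmult :: "int \<Rightarrow> hq set \<Rightarrow> hq set \<Rightarrow> hq set" where
  "cmult p A B = lam_rel p `` {hq_mult x y | x y. x \<in> A \<and> y \<in> B}"

definition Lambda2q :: "int \<Rightarrow> int \<Rightarrow> hq set set" where
  "Lambda2q p q = {c \<in> Lambda2 p. \<exists>x\<in>c.
      (2*q) dvd hq1 x \<and> (2*q) dvd hq2 x \<and> (2*q) dvd hq3 x}"

definition LPS_S :: "int \<Rightarrow> hq set set" where
  "LPS_S p = {c \<in> Lambda2 p. \<exists>x\<in>c. hq_norm x = p \<and> hq0 x > 0 \<and> odd (hq0 x)}"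

definition LPS_vertices :: "int \<Rightarrow> int \<Rightarrow> hq set set set" where
  "LPS_vertices p q = {(\<lambda>h. cmult p c h) ` Lambda2q p q | c. c \<in> Lambda2 p}"

definition LPS_adj :: "int \<Rightarrow> int \<Rightarrow> hq set set \<Rightarrow> hq set set \<Rightarrow> bool" where
  "LPS_adj p q U V \<longleftrightarrow> (\<exists>s\<in>LPS_S p. V = (\<lambda>u. cmult p u s) ` U)"

definition nb_closed_walk :: "'v set \<Rightarrow> ('v \<Rightarrow> 'v \<Rightarrow> bool) \<Rightarrow> 'v list \<Rightarrow> bool" where
  "nb_closed_walk V E xs \<longleftrightarrow> xs \<noteq> [] \<and> set xs \<subseteq> V \<and>
     (\<forall>i < length xs. E (xs ! i) (xs ! ((i + 1) mod length xs))) \<and>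
     (\<forall>i < length xs. xs ! ((i + 2) mod length xs) \<noteq> xs ! i)"

definition girth :: "'v set \<Rightarrow> ('v \<Rightarrow> 'v \<Rightarrow> bool) \<Rightarrow> nat" where
  "girth V E = (LEAST n. \<exists>xs. nb_closed_walk V E xs \<and> length xs = n)"

definition shortest_oriented_cycles :: "'v set \<Rightarrow> ('v \<Rightarrow> 'v \<Rightarrow> bool) \<Rightarrow> 'v list set set" where
  "shortest_oriented_cycles V E =
     {{rotate k xs | k. True} | xs. nb_closed_walk V E xs \<and> length xs = girth V E}"

definition kiss :: "'v set \<Rightarrow> ('v \<Rightarrow> 'v \<Rightarrow> bool) \<Rightarrow> nat" where
  "kiss V E = card (shortest_oriented_cycles V E)"

end

theory Submission
  imports Defs "HOL-Library.Sublist" "HOL-Real_Asymp.Real_Asymp" "HOL-Computational_Algebra.Squarefree"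
begin

text \<open>
  A shortest cycle of the graph, of length \<open>2h\<close>, is read off from a quaternion of norm
  \<open>p\<^sup>2\<^sup>h\<close> that is not real but congruent to its real part modulo \<open>2q\<close>. Since
  \<open>p\<close> is not a square modulo \<open>q\<close>, its real part is \<open>\<plusminus>(p\<^sup>h - 2mq\<^sup>2)\<close> with
  \<open>m \<ge> 1\<close>, so its vector part is \<open>2q\<close> times an integral vector whose squared length is
  \<open>N = m(p\<^sup>h - mq\<^sup>2)\<close>. Here \<open>p\<^sup>h\<close> has the order of \<open>q\<^sup>2\<close>, because Legendre's
  theorem provides a vector with \<open>m \<in> {1, 2}\<close>. Up to factors \<open>q\<^sup>\<epsilon>\<close> the kissing number is
  therefore \<open>n\<close> times the number of representations of \<open>N\<close> as a sum of three squares, which is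
  at most \<open>N\<^sup>1\<^sup>/\<^sup>2\<^sup>+\<^sup>\<epsilon>\<close>. The same bound on closed walks gives \<open>n \<ge> q\<^sup>3\<^sup>-\<^sup>\<epsilon>\<close>,
  while \<open>n \<le> 2q\<^sup>3\<close>.

  For the lower bound on the number of representations no class number estimate is used. If
  \<open>l\<close> and \<open>l'\<close> are primes below \<open>q\<^sup>1\<^sup>/\<^sup>2\<^sup>-\<^sup>\<delta>\<close> modulo which \<open>-N\<close> is a square, a given
  representation can be conjugated by a quaternion of norm \<open>ll'\<close> to another one, and
  different pairs give different representations as long as \<open>N\<close> has no large square divisor.
  A second moment bound for sums of Legendre symbols shows that, for all but
  \<open>X\<^sup>1\<^sup>-\<^sup>\<delta>\<^sup>/\<^sup>2\<close> of the integers \<open>q \<le> X\<close>, a quarter of the primes \<open>l \<equiv> 5\<close> modulo 8 that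
  are nonresidues modulo \<open>p\<close> split in this way; large square divisors and small \<open>N\<close> are equally
  rare. The primes \<open>q \<equiv> 5\<close> modulo 8 that are nonresidues modulo \<open>p\<close> have lower density of order
  \<open>1 / log X\<close>, by Mertens' argument for real characters, so one of them is not exceptional.
\<close>

section \<open>Integral quaternions\<close>

text \<open>The number of vertices has order q^3 and each vertex carries about N^(1/2), hence about
  q, shortest cycles; so the kissing number has order q^4, which is where 4/3 comes from. The hard
  half is a lower bound for a single ternary representation number, in substance a lower bound for a
  class number; the freedom in choosing \<open>q\<close> takes its place. The sieve range is exactly
  right for this: a coincidence of two conjugates produces an element of norm up to B^4 that
  commutes with the given vector, so the primes may come close to N^(1/4), and pairs of such primes
  already number about N^(1/2). The girth depends on \<open>q\<close>, so the exceptional sets have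
  to be avoided for all admissible \<open>h\<close> and \<open>m\<close> at once; there are only
  O(log X) such pairs, and a power saving for each of them is enough against a supply of X / log X
  primes. For \<open>m = 2\<close> the number N is 6 modulo 8 and therefore always a sum of three
  squares, while for \<open>m = 1\<close> this can fail: hence the two cases in the determination of
  the girth.\<close>

lemma hq_eq_iff:
  "x = y \<longleftrightarrow> hq0 x = hq0 y \<and> hq1 x = hq1 y \<and> hq2 x = hq2 y \<and> hq3 x = hq3 y"
  by (cases x; cases y) auto

instantiation hq :: ring_1
begin
definition "0 = HQ 0 0 0 0"
definition "1 = HQ 1 0 0 0"
definition "x + y = HQ (hq0 x + hq0 y) (hq1 x + hq1 y) (hq2 x + hq2 y) (hq3 x + hq3 y)"
definition "- x = HQ (- hq0 x) (- hq1 x) (- hq2 x) (- hq3 x)"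
definition "x - y = HQ (hq0 x - hq0 y) (hq1 x - hq1 y) (hq2 x - hq2 y) (hq3 x - hq3 y)"
definition "x * y = hq_mult x y"
instance
  by standard
     (auto simp: hq_eq_iff zero_hq_def one_hq_def plus_hq_def uminus_hq_def minus_hq_def
       times_hq_def hq_mult_def algebra_simps)
end

lemma hq_sel_simps [simp]:
  "hq0 0 = 0" "hq1 0 = 0" "hq2 0 = 0" "hq3 0 = 0"
  "hq0 1 = 1" "hq1 1 = 0" "hq2 1 = 0" "hq3 1 = 0"
  "hq0 (x + y) = hq0 x + hq0 y" "hq1 (x + y) = hq1 x + hq1 y"
  "hq2 (x + y) = hq2 x + hq2 y" "hq3 (x + y) = hq3 x + hq3 y"
  "hq0 (x - y) = hq0 x - hq0 y" "hq1 (x - y) = hq1 x - hq1 y"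
  "hq2 (x - y) = hq2 x - hq2 y" "hq3 (x - y) = hq3 x - hq3 y"
  "hq0 (- x) = - hq0 x" "hq1 (- x) = - hq1 x" "hq2 (- x) = - hq2 x" "hq3 (- x) = - hq3 x"
  by (simp_all add: zero_hq_def one_hq_def plus_hq_def uminus_hq_def minus_hq_def)

lemma hq_sel_mult:
  "hq0 (x * y) = hq0 x * hq0 y - hq1 x * hq1 y - hq2 x * hq2 y - hq3 x * hq3 y"
  "hq1 (x * y) = hq0 x * hq1 y + hq1 x * hq0 y + hq2 x * hq3 y - hq3 x * hq2 y"
  "hq2 (x * y) = hq0 x * hq2 y - hq1 x * hq3 y + hq2 x * hq0 y + hq3 x * hq1 y"
  "hq3 (x * y) = hq0 x * hq3 y + hq1 x * hq2 y - hq2 x * hq1 y + hq3 x * hq0 y"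
  by (simp_all add: times_hq_def hq_mult_def)

lemma hq_of_nat_sel: "hq0 (of_nat n) = int n \<and> hq1 (of_nat n) = 0 \<and> hq2 (of_nat n) = 0 \<and> hq3 (of_nat n) = 0"
  by (induction n) auto

lemma hq_of_int_sel [simp]:
  "hq0 (of_int n) = n" "hq1 (of_int n) = 0" "hq2 (of_int n) = 0" "hq3 (of_int n) = 0"
  by (cases n rule: int_cases2; simp add: hq_of_nat_sel)+

lemma hq_of_int_mult_sel [simp]:
  "hq0 (of_int n * x) = n * hq0 x" "hq1 (of_int n * x) = n * hq1 x"
  "hq2 (of_int n * x) = n * hq2 x" "hq3 (of_int n * x) = n * hq3 x"
  "hq0 (x * of_int n) = n * hq0 x" "hq1 (x * of_int n) = n * hq1 x"
  "hq2 (x * of_int n) = n * hq2 x" "hq3 (x * of_int n) = n * hq3 x"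
  by (simp_all add: hq_sel_mult)

lemma hq_numeral_sel [simp]:
  "hq0 (numeral n) = numeral n" "hq1 (numeral n) = 0" "hq2 (numeral n) = 0" "hq3 (numeral n) = 0"
  "hq0 (numeral n * x) = numeral n * hq0 x" "hq1 (numeral n * x) = numeral n * hq1 x"
  "hq2 (numeral n * x) = numeral n * hq2 x" "hq3 (numeral n * x) = numeral n * hq3 x"
  using hq_of_int_sel[of "numeral n"] hq_of_int_mult_sel[where n = "numeral n" and x = x] by simp_all

lemma hq_scale_eq: "hq_scale c x = of_int c * x"
  by (simp add: hq_eq_iff hq_scale_def)

lemma of_int_hq_commute: "x * of_int n = of_int n * (x :: hq)"
  by (simp add: hq_eq_iff)

lemma of_int_hq_left_commute: "x * (of_int n * y) = of_int n * (x * (y :: hq))"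
  by (metis mult.assoc of_int_hq_commute)

lemma of_int_hq_cancel: "n \<noteq> 0 \<Longrightarrow> of_int n * x = of_int n * (y :: hq) \<longleftrightarrow> x = y"
  by (simp add: hq_eq_iff)

definition hq_conj :: "hq \<Rightarrow> hq" where
  "hq_conj x = HQ (hq0 x) (- hq1 x) (- hq2 x) (- hq3 x)"

lemma hq_conj_sel [simp]:
  "hq0 (hq_conj x) = hq0 x" "hq1 (hq_conj x) = - hq1 x"
  "hq2 (hq_conj x) = - hq2 x" "hq3 (hq_conj x) = - hq3 x"
  by (simp_all add: hq_conj_def)

lemma hq_conj_conj [simp]: "hq_conj (hq_conj x) = x"
  by (simp add: hq_eq_iff)

lemma hq_conj_mult: "hq_conj (x * y) = hq_conj y * hq_conj x"
  by (simp add: hq_eq_iff hq_sel_mult algebra_simps)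

lemma hq_conj_add: "hq_conj (x + y) = hq_conj x + hq_conj y"
  by (simp add: hq_eq_iff)

lemma hq_conj_of_int [simp]: "hq_conj (of_int n) = of_int n"
  by (simp add: hq_eq_iff)

lemma hq_conj_1 [simp]: "hq_conj 1 = 1"
  by (simp add: hq_eq_iff)

lemma hq_mult_conj: "x * hq_conj x = of_int (hq_norm x)" "hq_conj x * x = of_int (hq_norm x)"
  by (simp_all add: hq_eq_iff hq_sel_mult hq_norm_def power2_eq_square)

lemma hq_norm_mult: "hq_norm (x * y) = hq_norm x * hq_norm y"
  by (simp add: hq_norm_def hq_sel_mult power2_eq_square algebra_simps)

lemma hq_norm_add_of_int_mult:
  "hq_norm (w + of_int p * v) = hq_norm w + p * (2 * hq0 (w * hq_conj v) + p * hq_norm v)"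
  by (simp add: hq_norm_def hq_sel_mult power2_eq_square algebra_simps)

lemma hq_norm_conj [simp]: "hq_norm (hq_conj x) = hq_norm x"
  by (simp add: hq_norm_def)

lemma hq_norm_of_int [simp]: "hq_norm (of_int n) = n\<^sup>2"
  by (simp add: hq_norm_def)

lemma hq_norm_numeral [simp]: "hq_norm (numeral n) = (numeral n)\<^sup>2"
  by (simp add: hq_norm_def)

lemma hq_norm_1 [simp]: "hq_norm 1 = 1"
  by (simp add: hq_norm_def)

lemma hq_norm_uminus [simp]: "hq_norm (- x) = hq_norm x"
  by (simp add: hq_norm_def)

lemma hq_norm_nonneg [simp]: "hq_norm x \<ge> 0"
  by (simp add: hq_norm_def)

lemma hq_norm_eq_0_iff: "hq_norm x = 0 \<longleftrightarrow> x = 0"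
proof
  assume "hq_norm x = 0"
  hence "(hq0 x)\<^sup>2 + (hq1 x)\<^sup>2 = 0 \<and> (hq2 x)\<^sup>2 + (hq3 x)\<^sup>2 = 0"
    unfolding hq_norm_def
    by (smt (verit) zero_le_power2)
  thus "x = 0" by (simp add: hq_eq_iff sum_power2_eq_zero_iff)
qed (simp add: hq_norm_def)

section \<open>Divisibility by integers and one-sided ideals\<close>

definition qdvd :: "int \<Rightarrow> hq \<Rightarrow> bool" where
  "qdvd p x \<longleftrightarrow> p dvd hq0 x \<and> p dvd hq1 x \<and> p dvd hq2 x \<and> p dvd hq3 x"

lemma qdvd_iff: "qdvd p x \<longleftrightarrow> (\<exists>y. x = of_int p * y)"
proof
  assume "qdvd p x"
  then obtain a b c d where "hq0 x = p * a" "hq1 x = p * b" "hq2 x = p * c" "hq3 x = p * d"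
    unfolding qdvd_def by (auto elim!: dvdE)
  hence "x = of_int p * HQ a b c d" by (simp add: hq_eq_iff)
  thus "\<exists>y. x = of_int p * y" by blast
qed (auto simp: qdvd_def)

lemma qdvd_mult_left: "qdvd p x \<Longrightarrow> qdvd p (y * x)"
  unfolding qdvd_iff using of_int_hq_left_commute by blast

lemma qdvd_mult_right: "qdvd p x \<Longrightarrow> qdvd p (x * y)"
  unfolding qdvd_iff by (metis mult.assoc)

lemma qdvd_conj [simp]: "qdvd p (hq_conj x) = qdvd p x"
  by (simp add: qdvd_def)

lemma qdvd_uminus [simp]: "qdvd p (- x) = qdvd p x"
  by (simp add: qdvd_def)

lemma qdvd_of_int_mult: "coprime p n \<Longrightarrow> qdvd p (of_int n * x) = qdvd p x"
  by (simp add: qdvd_def coprime_dvd_mult_right_iff)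

lemma qdvd_norm: "qdvd p x \<Longrightarrow> p\<^sup>2 dvd hq_norm x"
  unfolding qdvd_iff by (auto simp: hq_norm_mult)

text \<open>Lipschitz quaternions are only almost Euclidean: dividing by an element of minimal norm of
  an ideal may leave a remainder of the same norm, but then the quotient is half-integral.\<close>

lemma left_ideal_generator:
  assumes add: "\<And>x y. x \<in> I \<Longrightarrow> y \<in> I \<Longrightarrow> x + y \<in> I"
    and mult: "\<And>x y. x \<in> I \<Longrightarrow> y * x \<in> I"
    and c: "of_int c \<in> I" "odd c"
  obtains g where "g \<in> I" "odd (hq_norm g)" "\<And>x. x \<in> I \<Longrightarrow> \<exists>k. of_int 2 * x = k * g"
proof -
  have ne: "of_int c \<noteq> (0 :: hq)" using c by (auto simp: hq_eq_iff)
  define m where "m = (LEAST n. \<exists>x\<in>I. x \<noteq> 0 \<and> nat (hq_norm x) = n)"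
  have "\<exists>x\<in>I. x \<noteq> 0 \<and> nat (hq_norm x) = m"
    unfolding m_def by (rule LeastI_ex) (use ne c in blast)
  then obtain g where g: "g \<in> I" "g \<noteq> 0" "nat (hq_norm g) = m" by blast
  have min: "hq_norm g \<le> hq_norm x" if "x \<in> I" "x \<noteq> 0" for x
  proof -
    have "m \<le> nat (hq_norm x)" unfolding m_def by (rule Least_le) (use that in blast)
    hence "nat (hq_norm g) \<le> nat (hq_norm x)" using g(3) by simp
    thus ?thesis by (simp add: nat_le_eq_zle)
  qed
  have uminus: "- x \<in> I" if "x \<in> I" for x using mult[OF that, of "-1"] by simp
  have diff: "x - y \<in> I" if "x \<in> I" "y \<in> I" for x y
    using add[OF that(1) uminus[OF that(2)]] by simp
  define n where "n = hq_norm g"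
  have npos: "n > 0" using g hq_norm_eq_0_iff[of g] hq_norm_nonneg[of g] unfolding n_def by linarith
  have quot: "\<exists>k. of_int 2 * x = k * g" if x: "x \<in> I" for x
  proof -
    define w where "w = x * hq_conj g"
    \<comment> \<open>The nearest integer to a / n.\<close>
    define rd where "rd = (\<lambda>a :: int. (2 * a + n) div (2 * n))"
    have rd: "\<bar>2 * (a - n * rd a)\<bar> \<le> n" for a
    proof -
      have "(2 * a + n) = 2 * n * rd a + (2 * a + n) mod (2 * n)"
        unfolding rd_def by simp
      moreover have "0 \<le> (2 * a + n) mod (2 * n)" "(2 * a + n) mod (2 * n) < 2 * n"
        using npos by simp_all
      ultimately show ?thesis by (simp add: algebra_simps)
    qed
    define k where "k = HQ (rd (hq0 w)) (rd (hq1 w)) (rd (hq2 w)) (rd (hq3 w))"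
    define r where "r = w - of_int n * k"
    have rb: "\<bar>2 * hq0 r\<bar> \<le> n" "\<bar>2 * hq1 r\<bar> \<le> n" "\<bar>2 * hq2 r\<bar> \<le> n" "\<bar>2 * hq3 r\<bar> \<le> n"
      using rd unfolding r_def k_def by simp_all
    define rho where "rho = x - k * g"
    have rhoI: "rho \<in> I" unfolding rho_def by (intro diff x mult g)
    have rr: "rho * hq_conj g = r"
      unfolding rho_def r_def w_def n_def
      by (simp add: left_diff_distrib mult.assoc hq_mult_conj of_int_hq_commute)
    have nr: "hq_norm rho * n = hq_norm r"
      using arg_cong[OF rr, of hq_norm] by (simp add: hq_norm_mult n_def)
    have sq: "(2 * hq0 r)\<^sup>2 \<le> n\<^sup>2" "(2 * hq1 r)\<^sup>2 \<le> n\<^sup>2" "(2 * hq2 r)\<^sup>2 \<le> n\<^sup>2" "(2 * hq3 r)\<^sup>2 \<le> n\<^sup>2"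
      using power_mono[OF rb(1), of 2] power_mono[OF rb(2), of 2] power_mono[OF rb(3), of 2]
        power_mono[OF rb(4), of 2] by (simp_all only: power2_abs abs_ge_zero simp_thms)
    show ?thesis
    proof (cases "rho = 0")
      case True
      hence "x = k * g" by (simp add: rho_def)
      hence "of_int 2 * x = (of_int 2 * k) * g" by (simp add: mult.assoc)
      thus ?thesis by blast
    next
      case False
      hence "n * n \<le> hq_norm r" using min[OF rhoI False] nr npos
        by (metis mult_right_mono n_def order_less_imp_le)
      hence "4 * n\<^sup>2 \<le> (2 * hq0 r)\<^sup>2 + (2 * hq1 r)\<^sup>2 + (2 * hq2 r)\<^sup>2 + (2 * hq3 r)\<^sup>2"
        by (simp add: hq_norm_def power_mult_distrib power2_eq_square)
      hence "(2 * hq0 r)\<^sup>2 = n\<^sup>2" "(2 * hq1 r)\<^sup>2 = n\<^sup>2" "(2 * hq2 r)\<^sup>2 = n\<^sup>2" "(2 * hq3 r)\<^sup>2 = n\<^sup>2"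
        using sq by linarith+
      hence "qdvd n (of_int 2 * r)"
        unfolding qdvd_def hq_of_int_mult_sel power2_eq_iff by auto
      then obtain s where s: "of_int 2 * r = of_int n * s" unfolding qdvd_iff by blast
      have "of_int n * (of_int 2 * rho) = (of_int 2 * r) * g"
        unfolding rr[symmetric] n_def
        by (simp add: mult.assoc hq_mult_conj of_int_hq_commute of_int_hq_left_commute)
      also have "\<dots> = of_int n * (s * g)" by (simp only: s mult.assoc)
      finally have "of_int 2 * rho = s * g" using npos of_int_hq_cancel[of n] by simp
      hence "of_int 2 * x = (of_int 2 * k + s) * g"
        unfolding rho_def by (simp add: algebra_simps)
      thus ?thesis by blast
    qed
  qed
  \<comment> \<open>If n were even, 2 would divide one of (1-i)g, (1-j)g, (1-k)g: the coordinates of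
    g have even sum, so they split into two pairs of equal parity. Writing that product as 2d, the
    ideal contains 2d and an odd multiple of d, hence d itself, whose norm n / 2 contradicts
    minimality.\<close>
  have "odd n"
  proof
    assume "even n"
    have half: False if v: "hq_norm v = 2" "qdvd 2 (v * g)" for v
    proof -
      obtain d where d: "v * g = of_int 2 * d" using v(2) unfolding qdvd_iff by blast
      obtain e where e: "c = 2 * e + 1" using c(2) oddE by blast
      have dI2: "of_int 2 * d \<in> I" using d mult[OF g(1), of v] by simp
      have "d = of_int c * d - of_int e * (of_int 2 * d)"
        unfolding e by (simp add: hq_eq_iff algebra_simps)
      moreover have "of_int c * d \<in> I"
        using mult[OF c(1), of d] by (simp add: of_int_hq_commute)
      ultimately have dI: "d \<in> I" using diff[OF _ mult[OF dI2, of "of_int e"]] by metis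
      have "2 * n = 4 * hq_norm d"
        using arg_cong[OF d, of hq_norm] v(1) by (simp add: hq_norm_mult n_def)
      moreover have "d \<noteq> 0" using calculation npos by (auto simp: hq_norm_def)
      ultimately show False using min[OF dI] npos n_def by linarith
    qed
    have "even (hq0 g + hq1 g + hq2 g + hq3 g)"
      using \<open>even n\<close> unfolding n_def hq_norm_def by simp
    hence "qdvd 2 (HQ 1 (-1) 0 0 * g) \<or> qdvd 2 (HQ 1 0 (-1) 0 * g) \<or> qdvd 2 (HQ 1 0 0 (-1) * g)"
      unfolding qdvd_def hq_sel_mult by (simp; presburger)
    thus False
      using half[of "HQ 1 (-1) 0 0"] half[of "HQ 1 0 (-1) 0"] half[of "HQ 1 0 0 (-1)"]
      by (auto simp: hq_norm_def)
  qed
  thus ?thesis using that g(1) quot n_def by blast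
qed

lemma right_ideal_generator:
  assumes add: "\<And>x y. x \<in> I \<Longrightarrow> y \<in> I \<Longrightarrow> x + y \<in> I"
    and mult: "\<And>x y. x \<in> I \<Longrightarrow> x * y \<in> I"
    and c: "of_int c \<in> I" "odd c"
  obtains g where "g \<in> I" "odd (hq_norm g)" "\<And>x. x \<in> I \<Longrightarrow> \<exists>k. of_int 2 * x = g * k"
proof -
  define J where "J = {x. hq_conj x \<in> I}"
  obtain g where g: "g \<in> J" "odd (hq_norm g)" "\<And>x. x \<in> J \<Longrightarrow> \<exists>k. of_int 2 * x = k * g"
    by (rule left_ideal_generator[of J c])
       (use assms in \<open>auto simp: J_def hq_conj_add hq_conj_mult\<close>)
  have "\<exists>k. of_int 2 * x = hq_conj g * k" if "x \<in> I" for x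
  proof -
    obtain k where "of_int 2 * hq_conj x = k * g"
      using g(3)[of "hq_conj x"] \<open>x \<in> I\<close> by (auto simp: J_def)
    from arg_cong[OF this, of hq_conj] show ?thesis
      by (auto simp: hq_conj_mult of_int_hq_commute simp del: of_int_numeral)
  qed
  thus ?thesis using that[of "hq_conj g"] g by (auto simp: J_def)
qed

lemma odd_dvd_4_mult:
  fixes d a :: int
  assumes "odd d" "d dvd 4 * a"
  shows "d dvd a"
proof -
  have "coprime d 2" using assms(1) by simp
  hence "coprime d (2 ^ 2)" using coprime_power_right_iff by blast
  thus ?thesis using assms(2) by (simp add: coprime_dvd_mult_right_iff)
qed

text \<open>The right ideal generated by \<open>x\<close> and \<open>p\<close> is, up to the factor
  2, generated by some \<open>g\<close> of odd norm; this norm divides p^2 and is divisible by p.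
  Norm p^2 would make \<open>g\<close> divisible by \<open>p\<close> and hence \<open>x\<close> as
  well. So the norm is \<open>p\<close>, and \<open>g\<close> splits off on the left of
  \<open>x\<close>.\<close>

lemma factor_left:
  assumes p: "prime p" "odd p" and x: "p dvd hq_norm x" "\<not> qdvd p x"
  obtains g b where "hq_norm g = p" "x = g * b"
proof -
  define I where "I = {x * u + of_int p * v | u v. True}"
  have II: "x * u + of_int p * v \<in> I" for u v unfolding I_def by blast
  obtain g where g: "g \<in> I" "odd (hq_norm g)" "\<And>x. x \<in> I \<Longrightarrow> \<exists>k. of_int 2 * x = g * k"
  proof (rule right_ideal_generator[of I p])
    show "y + z \<in> I" if yz: "y \<in> I" "z \<in> I" for y z
    proof -
      from yz obtain u v u' v' where "y = x * u + of_int p * v" "z = x * u' + of_int p * v'"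
        unfolding I_def by blast
      hence "y + z = x * (u + u') + of_int p * (v + v')" by (simp only: distrib_left ac_simps)
      thus ?thesis using II by simp
    qed
    show "y * z \<in> I" if y: "y \<in> I" for y z
    proof -
      from y obtain u v where "y = x * u + of_int p * v" unfolding I_def by blast
      hence "y * z = x * (u * z) + of_int p * (v * z)" by (simp only: distrib_right mult.assoc)
      thus ?thesis using II by simp
    qed
    show "of_int p \<in> I" using II[of 0 1] by simp
  qed (use p in auto)
  obtain u v where guv: "g = x * u + of_int p * v" using g(1) unfolding I_def by blast
  have "p dvd hq_norm g"
  proof -
    have "hq_norm g = hq_norm x * hq_norm u + p * (2 * hq0 (x * u * hq_conj v) + p * hq_norm v)"
      unfolding guv hq_norm_mult[symmetric] by (rule hq_norm_add_of_int_mult)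
    thus ?thesis using x(1) by (metis dvd_add dvd_mult2 dvd_triv_left)
  qed
  obtain k where k: "of_int 2 * of_int p = g * k" using g(3)[OF II[of 0 1]] by auto
  have nk: "4 * p\<^sup>2 = hq_norm g * hq_norm k"
    using arg_cong[OF k, of hq_norm] by (simp add: hq_norm_mult del: of_int_mult)
  hence "hq_norm g dvd p\<^sup>2" using g(2) odd_dvd_4_mult by (metis dvd_triv_left)
  then obtain i where i: "i \<le> 2" "hq_norm g = p ^ i"
    using divides_primepow[OF p(1), of "hq_norm g" 2]
    by (metis abs_of_nonneg hq_norm_nonneg normalize_int_def normalize_idem)
  have ndvd2: False if "qdvd p (of_int 2 * y)" "\<not> qdvd p y" for y
    using that p qdvd_of_int_mult[of p 2 y] by (simp add: coprime_commute)
  have "i = 1"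
  proof (rule ccontr)
    assume "i \<noteq> 1"
    moreover have "i \<noteq> 0" using i(2) \<open>p dvd hq_norm g\<close> p(1) by (metis not_prime_unit power_0)
    ultimately have i2: "i = 2" using i by simp
    have "hq_conj g * (of_int 2 * of_int p) = of_int (p\<^sup>2) * k"
      unfolding k using i i2 by (simp add: mult.assoc[symmetric] hq_mult_conj)
    moreover have "hq_conj g * (of_int 2 * of_int p) = of_int p * (of_int 2 * hq_conj g)"
      by (simp add: hq_eq_iff hq_sel_mult[of "hq_conj g"])
    moreover have "of_int (p\<^sup>2) * k = of_int p * (of_int p * k)"
      by (simp add: power2_eq_square mult.assoc)
    ultimately have "of_int p * (of_int 2 * hq_conj g) = of_int p * (of_int p * k)" by metis
    hence "of_int 2 * hq_conj g = of_int p * k" using p of_int_hq_cancel[of p] by (metis not_prime_0)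
    hence "qdvd p (of_int 2 * hq_conj g)" unfolding qdvd_iff by blast
    hence "qdvd p g" using ndvd2 by fastforce
    moreover obtain k' where "of_int 2 * x = g * k'" using g(3)[OF II[of 1 0]] by auto
    ultimately have "qdvd p (of_int 2 * x)" by (simp add: qdvd_mult_right)
    thus False using ndvd2 x by blast
  qed
  hence ng: "hq_norm g = p" using i by simp
  obtain k' where k': "of_int 2 * x = g * k'" using g(3)[OF II[of 1 0]] by auto
  have "of_int 2 * (hq_conj g * x) = hq_conj g * (of_int 2 * x)"
    by (rule of_int_hq_left_commute[symmetric])
  also have "\<dots> = of_int p * k'"
    unfolding k' using ng by (simp add: mult.assoc[symmetric] hq_mult_conj)
  finally have "qdvd p (hq_conj g * x)" using ndvd2 qdvd_iff by blast
  then obtain b where b: "hq_conj g * x = of_int p * b" unfolding qdvd_iff by blast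
  have "of_int p * x = g * (hq_conj g * x)"
    using ng by (simp add: mult.assoc[symmetric] hq_mult_conj)
  also have "\<dots> = of_int p * (g * b)" unfolding b by (simp add: of_int_hq_left_commute)
  finally have "x = g * b" using p of_int_hq_cancel[of p] by (metis not_prime_0)
  thus ?thesis using that ng by blast
qed

section \<open>Quaternions congruent to 1 modulo 2 and the generators of norm
  \<open>p\<close>\<close>

definition odd_real :: "hq \<Rightarrow> bool" where
  "odd_real x \<longleftrightarrow> odd (hq0 x) \<and> even (hq1 x) \<and> even (hq2 x) \<and> even (hq3 x)"

lemma odd_real_mult: "odd_real x \<Longrightarrow> odd_real y \<Longrightarrow> odd_real (x * y)"
  by (simp add: odd_real_def hq_sel_mult)

lemma odd_real_mult_iff: "odd_real x \<Longrightarrow> odd_real (x * y) = odd_real y"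
  by (auto simp: odd_real_def hq_sel_mult)

lemma odd_real_conj [simp]: "odd_real (hq_conj x) = odd_real x"
  by (simp add: odd_real_def)

lemma odd_real_uminus [simp]: "odd_real (- x) = odd_real x"
  by (simp add: odd_real_def)

lemma odd_real_1 [simp]: "odd_real 1"
  by (simp add: odd_real_def)

lemma odd_real_of_int_mult: "odd n \<Longrightarrow> odd_real (of_int n * x) = odd_real x"
  by (simp add: odd_real_def)

lemma odd_real_norm_1:
  assumes "odd_real x" "hq_norm x = 1"
  shows "x = 1 \<or> x = - 1"
proof -
  have "hq0 x \<noteq> 0" using assms by (auto simp: odd_real_def)
  hence "(hq0 x)\<^sup>2 \<ge> 1" by (metis int_one_le_iff_zero_less zero_less_power2)
  hence "(hq0 x)\<^sup>2 = 1 \<and> (hq1 x)\<^sup>2 = 0 \<and> (hq2 x)\<^sup>2 = 0 \<and> (hq3 x)\<^sup>2 = 0"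
    using assms(2) zero_le_power2[of "hq1 x"] zero_le_power2[of "hq2 x"] zero_le_power2[of "hq3 x"]
    unfolding hq_norm_def by linarith
  thus ?thesis by (auto simp: hq_eq_iff power2_eq_1_iff)
qed

definition prime_gens :: "int \<Rightarrow> hq set" where
  "prime_gens p = {s. hq_norm s = p \<and> hq0 s > 0 \<and> odd_real s}"

lemma prime_gens_conj: "s \<in> prime_gens p \<Longrightarrow> hq_conj s \<in> prime_gens p"
  by (simp add: prime_gens_def)

lemma finite_norm_le: "finite {x. hq_norm x \<le> n}"
proof (rule finite_subset)
  let ?I = "{-n..n}"
  show "{x. hq_norm x \<le> n} \<subseteq> (\<lambda>(a, b, c, d). HQ a b c d) ` (?I \<times> ?I \<times> ?I \<times> ?I)"
  proof
    fix x assume "x \<in> {x. hq_norm x \<le> n}"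
    hence le: "hq_norm x \<le> n" by simp
    have b: "\<bar>a\<bar> \<le> n" if "a\<^sup>2 \<le> n" for a :: int
    proof -
      have "\<bar>a\<bar> \<le> \<bar>a\<bar>\<^sup>2" using mult_left_mono[of 1 "\<bar>a\<bar>" "\<bar>a\<bar>"]
        by (cases "a = 0") (auto simp: power2_eq_square)
      thus ?thesis using that by simp
    qed
    have "(hq0 x)\<^sup>2 \<le> n" "(hq1 x)\<^sup>2 \<le> n" "(hq2 x)\<^sup>2 \<le> n" "(hq3 x)\<^sup>2 \<le> n"
      using le unfolding hq_norm_def
      by (smt (verit) zero_le_power2)+
    hence "\<bar>hq0 x\<bar> \<le> n" "\<bar>hq1 x\<bar> \<le> n" "\<bar>hq2 x\<bar> \<le> n" "\<bar>hq3 x\<bar> \<le> n" using b by blast+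
    hence "hq0 x \<in> ?I" "hq1 x \<in> ?I" "hq2 x \<in> ?I" "hq3 x \<in> ?I" by auto
    moreover have "x = (\<lambda>(a, b, c, d). HQ a b c d) (hq0 x, hq1 x, hq2 x, hq3 x)" by simp
    ultimately show "x \<in> (\<lambda>(a, b, c, d). HQ a b c d) ` (?I \<times> ?I \<times> ?I \<times> ?I)" by blast
  qed
qed auto

lemma finite_prime_gens [simp]: "finite (prime_gens p)"
  by (rule finite_subset[OF _ finite_norm_le[of p]]) (auto simp: prime_gens_def)

lemma sq_mod_4: "(a :: int)\<^sup>2 mod 4 = (if odd a then 1 else 0)"
proof (cases "even a")
  case True
  then obtain b where "a = 2 * b" by blast
  thus ?thesis by (simp add: power2_eq_square)
next
  case False
  then obtain b where "a = 2 * b + 1" using oddE by blast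
  hence "a\<^sup>2 = 1 + 4 * (b\<^sup>2 + b)" by (simp add: power2_eq_square algebra_simps)
  moreover have "(1 + 4 * k) mod 4 = 1" for k :: int by presburger
  ultimately have "a\<^sup>2 mod 4 = 1" by (simp only:)
  thus ?thesis using False by simp
qed

lemma one_odd_coordinate:
  assumes "hq_norm x mod 4 = 1"
  shows "odd (hq0 x) \<and> even (hq1 x) \<and> even (hq2 x) \<and> even (hq3 x) \<or>
         even (hq0 x) \<and> odd (hq1 x) \<and> even (hq2 x) \<and> even (hq3 x) \<or>
         even (hq0 x) \<and> even (hq1 x) \<and> odd (hq2 x) \<and> even (hq3 x) \<or>
         even (hq0 x) \<and> even (hq1 x) \<and> even (hq2 x) \<and> odd (hq3 x)"
proof -
  have "hq_norm x mod 4 = ((hq0 x)\<^sup>2 mod 4 + (hq1 x)\<^sup>2 mod 4 + (hq2 x)\<^sup>2 mod 4 + (hq3 x)\<^sup>2 mod 4) mod 4"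
    unfolding hq_norm_def by (intro mod_add_cong) simp_all
  thus ?thesis using assms unfolding sq_mod_4 by (auto split: if_splits)
qed

text \<open>A norm congruent to 1 modulo 4 forces exactly one odd coordinate. Right multiplication
  by 1, i, j or k moves it into the real place, and a sign makes it positive; the right ideal
  generated by \<open>g\<close> does not change.\<close>

lemma normalize_generator:
  assumes "hq_norm g = p" "p mod 4 = 1"
  obtains u where "hq_norm u = 1" "g * u \<in> prime_gens p"
proof -
  have *: "\<exists>u. hq_norm u = 1 \<and> g * u \<in> prime_gens p"
    if "hq_norm u = 1" "odd_real (g * u)" for u
  proof -
    have "hq0 (g * u) \<noteq> 0" using that by (auto simp: odd_real_def)
    moreover have "odd_real (g * - u)" using that odd_real_uminus[of "g * u"] by simp
    ultimately show ?thesis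
      using that assms by (intro exI[of _ "if hq0 (g * u) > 0 then u else - u"])
        (auto simp: prime_gens_def hq_norm_mult)
  qed
  have "odd_real (g * 1) \<or> odd_real (g * HQ 0 1 0 0) \<or> odd_real (g * HQ 0 0 1 0) \<or>
      odd_real (g * HQ 0 0 0 1)"
    using one_odd_coordinate[of g] assms unfolding odd_real_def hq_sel_mult by auto
  thus ?thesis using * that
    by (metis (no_types, lifting) hq_norm_1 hq_norm_def hq.sel power2_eq_square add_0 add.right_neutral
        mult_zero_left mult_1)
qed

locale quat_prime =
  fixes p :: int
  assumes prime_p: "prime p" and p_mod_4: "p mod 4 = 1"
begin

lemma odd_p: "odd p" using p_mod_4 by presburger

lemma p_gt_1: "p > 1" using prime_p prime_gt_1_int by blast

lemma p_ne_0: "p \<noteq> 0" using p_gt_1 by simp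

lemma cancel_p: "of_int p * x = of_int p * y \<Longrightarrow> x = (y :: hq)"
  using of_int_hq_cancel p_ne_0 by blast

lemma gen_norm: "s \<in> prime_gens p \<Longrightarrow> hq_norm s = p"
  by (simp add: prime_gens_def)

lemma gen_conj_mult: "s \<in> prime_gens p \<Longrightarrow> hq_conj s * s = of_int p" "s \<in> prime_gens p \<Longrightarrow> s * hq_conj s = of_int p"
  by (simp_all add: hq_mult_conj prime_gens_def)

lemma gen_cancel: "s \<in> prime_gens p \<Longrightarrow> s * x = s * y \<Longrightarrow> x = y"
  by (metis cancel_p gen_conj_mult(1) mult.assoc)

lemma gen_prefix:
  assumes x: "p dvd hq_norm x" "\<not> qdvd p x"
  obtains s b where "s \<in> prime_gens p" "x = s * b"
proof -
  obtain g b where gb: "hq_norm g = p" "x = g * b"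
    using factor_left[OF prime_p odd_p x] by blast
  obtain u where u: "hq_norm u = 1" "g * u \<in> prime_gens p"
    using normalize_generator[OF gb(1) p_mod_4] by blast
  have "x = (g * u) * (hq_conj u * b)"
    using gb u by (metis hq_mult_conj(1) mult.assoc mult.right_neutral of_int_1)
  thus ?thesis using that u by blast
qed

text \<open>\<open>hq_conj s * t\<close> has norm p^2, so its quotient by \<open>p\<close> is a
  unit; being odd in the real place, this unit is 1 or -1. The positive real parts exclude t =
  -s.\<close>

lemma gen_eqI:
  assumes s: "s \<in> prime_gens p" and t: "t \<in> prime_gens p" and st: "qdvd p (hq_conj s * t)"
  shows "s = t"
proof -
  obtain e where e: "hq_conj s * t = of_int p * e" using st unfolding qdvd_iff by blast
  have "p * p = p\<^sup>2 * hq_norm e"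
    using arg_cong[OF e, of hq_norm] s t by (simp add: hq_norm_mult gen_norm)
  hence "hq_norm e = 1" using p_ne_0 by (simp add: power2_eq_square)
  moreover have "odd_real (hq_conj s * t)"
    using s t by (auto simp: prime_gens_def intro!: odd_real_mult)
  hence "odd_real e" unfolding e by (simp add: odd_real_of_int_mult odd_p)
  ultimately have e1: "e = 1 \<or> e = -1" by (rule odd_real_norm_1[rotated])
  have "of_int p * t = s * (hq_conj s * t)"
    using s by (simp add: mult.assoc[symmetric] gen_conj_mult)
  also have "\<dots> = of_int p * (s * e)" unfolding e by (simp add: of_int_hq_left_commute)
  finally have "t = s * e" by (rule cancel_p)
  with e1 have "t = s \<or> t = - s" by auto
  thus ?thesis using s t by (auto simp: prime_gens_def)
qed

text \<open>The right ideal of \<open>s\<close> and \<open>t\<close> contains \<open>p\<close>, and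
  its generator has a norm dividing \<open>p\<close>. If that norm is 1, then
  \<open>hq_conj x\<close>, which sends both \<open>s\<close> and \<open>t\<close> to multiples of
  \<open>p\<close>, is itself a multiple of \<open>p\<close>, against primitivity; if it is
  \<open>p\<close>, then \<open>p\<close> divides \<open>hq_conj s * t\<close> and
  \<open>gen_eqI\<close> applies.\<close>

lemma gen_prefix_unique:
  assumes s: "s \<in> prime_gens p" and t: "t \<in> prime_gens p"
    and x: "x = s * b" "x = t * c" "\<not> qdvd p x"
  shows "s = t"
proof -
  define I where "I = {s * u + t * v | u v. True}"
  have II: "s * u + t * v \<in> I" for u v unfolding I_def by blast
  obtain g where g: "g \<in> I" "odd (hq_norm g)" "\<And>x. x \<in> I \<Longrightarrow> \<exists>k. of_int 2 * x = g * k"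
  proof (rule right_ideal_generator[of I p])
    show "y + z \<in> I" if yz: "y \<in> I" "z \<in> I" for y z
    proof -
      from yz obtain u v u' v' where "y = s * u + t * v" "z = s * u' + t * v'"
        unfolding I_def by blast
      hence "y + z = s * (u + u') + t * (v + v')" by (simp only: distrib_left ac_simps)
      thus ?thesis using II by simp
    qed
    show "y * z \<in> I" if y: "y \<in> I" for y z
    proof -
      from y obtain u v where "y = s * u + t * v" unfolding I_def by blast
      hence "y * z = s * (u * z) + t * (v * z)" by (simp only: distrib_right mult.assoc)
      thus ?thesis using II by simp
    qed
    show "of_int p \<in> I" using II[of "hq_conj s" 0] s by (simp add: gen_conj_mult)
  qed (use odd_p in auto)
  obtain u v where guv: "g = s * u + t * v" using g(1) unfolding I_def by blast
  obtain k1 where k1: "of_int 2 * s = g * k1" using g(3)[OF II[of 1 0]] by auto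
  obtain k2 where k2: "of_int 2 * t = g * k2" using g(3)[OF II[of 0 1]] by auto
  have "4 * p = hq_norm g * hq_norm k1"
    using arg_cong[OF k1, of hq_norm] s by (simp add: hq_norm_mult gen_norm)
  hence "hq_norm g dvd p" using g(2) odd_dvd_4_mult by (metis dvd_triv_left)
  hence "hq_norm g = 1 \<or> hq_norm g = p"
    using prime_p hq_norm_nonneg[of g] p_gt_1 by (metis prime_int_iff)
  thus ?thesis
  proof
    assume n1: "hq_norm g = 1"
    have 1: "hq_conj x * s = of_int p * hq_conj b"
      using s unfolding x(1) hq_conj_mult by (simp add: mult.assoc gen_conj_mult of_int_hq_commute)
    have 2: "hq_conj x * t = of_int p * hq_conj c"
      using t unfolding x(2) hq_conj_mult by (simp add: mult.assoc gen_conj_mult of_int_hq_commute)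
    have "hq_conj x * g = of_int p * (hq_conj b * u + hq_conj c * v)"
      unfolding guv distrib_left mult.assoc[symmetric] 1 2 ..
    hence "qdvd p (hq_conj x * g)" unfolding qdvd_iff by blast
    hence "qdvd p (hq_conj x * g * hq_conj g)" by (rule qdvd_mult_right)
    hence "qdvd p (hq_conj x)" using n1 by (simp add: mult.assoc hq_mult_conj)
    thus ?thesis using x(3) by simp
  next
    assume np: "hq_norm g = p"
    have "of_int 4 * (hq_conj s * t) = hq_conj (of_int 2 * s) * (of_int 2 * t)"
      by (simp add: hq_eq_iff hq_sel_mult algebra_simps)
    also have "\<dots> = of_int p * (hq_conj k1 * k2)"
      unfolding k1 k2 hq_conj_mult using np
      by (metis hq_mult_conj(2) mult.assoc of_int_hq_left_commute)
    finally have "qdvd p (of_int 4 * (hq_conj s * t))" unfolding qdvd_iff by blast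
    moreover have "coprime p 4"
      using odd_p coprime_power_right_iff[of p 2 2] by simp
    ultimately have "qdvd p (hq_conj s * t)" using qdvd_of_int_mult by blast
    thus ?thesis by (rule gen_eqI[OF s t])
  qed
qed

section \<open>Reduced words: the conjugate of a generator is its inverse up to the factor
  \<open>p\<close>\<close>

definition reduced :: "hq list \<Rightarrow> bool" where
  "reduced = successively (\<lambda>a b. b \<noteq> hq_conj a)"

lemma reduced_simps [simp]:
  "reduced []" "reduced [a]" "reduced (a # b # r) \<longleftrightarrow> b \<noteq> hq_conj a \<and> reduced (b # r)"
  by (simp_all add: reduced_def)

lemma reduced_ConsD: "reduced (a # r) \<Longrightarrow> reduced r"
  by (cases r) auto

definition words :: "nat \<Rightarrow> hq list set" where
  "words m = {w. set w \<subseteq> prime_gens p \<and> length w = m \<and> reduced w}"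

lemma finite_words [simp]: "finite (words m)"
  by (rule finite_subset[OF _ finite_lists_length_eq[of "prime_gens p" m]]) (auto simp: words_def)

lemma norm_prod_list: "set w \<subseteq> prime_gens p \<Longrightarrow> hq_norm (prod_list w) = p ^ length w"
  by (induction w) (auto simp: hq_norm_mult gen_norm)

lemma odd_real_prod_list: "set w \<subseteq> prime_gens p \<Longrightarrow> odd_real (prod_list w)"
  by (induction w) (auto simp: prime_gens_def intro!: odd_real_mult)

lemma conj_prod_list: "hq_conj (prod_list w) = prod_list (rev (map hq_conj w))"
  by (induction w) (auto simp: hq_conj_mult)

text \<open>If \<open>p\<close> divides \<open>a * prod_list r\<close>, then
  \<open>prod_list r\<close> can be divided on the left by \<open>hq_conj a\<close>. It can also be
  divided by the head of \<open>r\<close>, and uniqueness of prefixes identifies the two, against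
  reducedness.\<close>

lemma prod_list_primitive: "set w \<subseteq> prime_gens p \<Longrightarrow> reduced w \<Longrightarrow> \<not> qdvd p (prod_list w)"
proof (induction w)
  case Nil
  thus ?case using p_gt_1 by (simp add: qdvd_def)
next
  case (Cons a r)
  have a: "a \<in> prime_gens p" using Cons.prems by simp
  have IH: "\<not> qdvd p (prod_list r)" using Cons reduced_ConsD by simp
  show ?case
  proof
    assume "qdvd p (prod_list (a # r))"
    then obtain e where e: "a * prod_list r = of_int p * e" unfolding qdvd_iff by auto
    have "of_int p * prod_list r = hq_conj a * (a * prod_list r)"
      using a by (simp add: mult.assoc[symmetric] gen_conj_mult)
    also have "\<dots> = of_int p * (hq_conj a * e)" unfolding e by (simp add: of_int_hq_left_commute)
    finally have e': "prod_list r = hq_conj a * e" by (rule cancel_p)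
    show False
    proof (cases r)
      case Nil
      hence "hq_norm (hq_conj a * e) = 1" using e' by simp
      hence "p * hq_norm e = 1" using a by (simp add: hq_norm_mult gen_norm)
      hence "p dvd 1" by (metis dvd_triv_left)
      thus False using p_gt_1 by simp
    next
      case (Cons b r')
      have "hq_conj a = b"
      proof (rule gen_prefix_unique[OF _ _ e' _ IH])
        show "prod_list r = b * prod_list r'" using Cons by simp
      qed (use \<open>set (a # r) \<subseteq> prime_gens p\<close> Cons prime_gens_conj in auto)
      thus False using \<open>reduced (a # r)\<close> Cons by simp
    qed
  qed
qed

lemma ex_word:
  "hq_norm x = p ^ m \<Longrightarrow> odd_real x \<Longrightarrow> \<not> qdvd p x \<Longrightarrow>
   \<exists>w. set w \<subseteq> prime_gens p \<and> length w = m \<and> (x = prod_list w \<or> x = - prod_list w)"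
proof (induction m arbitrary: x)
  case 0
  thus ?case using odd_real_norm_1[of x] by auto
next
  case (Suc m)
  obtain s b where sb: "s \<in> prime_gens p" "x = s * b"
    using gen_prefix[of x] Suc.prems by auto
  have "hq_norm b = p ^ m" using Suc.prems(1) sb p_ne_0 by (simp add: hq_norm_mult gen_norm)
  moreover have "odd_real b" using Suc.prems(2) sb odd_real_mult_iff by (auto simp: prime_gens_def)
  moreover have "\<not> qdvd p b" using Suc.prems(3) sb qdvd_mult_left by blast
  ultimately obtain w where "set w \<subseteq> prime_gens p" "length w = m" "b = prod_list w \<or> b = - prod_list w"
    using Suc.IH by blast
  thus ?case using sb by (intro exI[of _ "s # w"]) auto
qed

lemma reduced_if_primitive:
  "set w \<subseteq> prime_gens p \<Longrightarrow> \<not> qdvd p (prod_list w) \<Longrightarrow> reduced w"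
proof (induction w)
  case (Cons a r)
  have r: "reduced r" using Cons qdvd_mult_left by auto
  show ?case
  proof (cases r)
    case (Cons b r')
    have "b \<noteq> hq_conj a"
    proof
      assume "b = hq_conj a"
      hence "prod_list (a # r) = of_int p * prod_list r'"
        using Cons \<open>set (a # r) \<subseteq> _\<close> by (simp add: mult.assoc[symmetric] gen_conj_mult)
      thus False using \<open>\<not> qdvd p (prod_list (a # r))\<close> unfolding qdvd_iff by blast
    qed
    thus ?thesis using r Cons by simp
  qed simp
qed simp

text \<open>Elements are only known up to sign. The sign is kept as a central factor
  \<open>e\<close> at the right end, so that the first letters can be compared and
  cancelled.\<close>

lemma word_unique:
  "set w \<subseteq> prime_gens p \<Longrightarrow> set v \<subseteq> prime_gens p \<Longrightarrow> length w = length v \<Longrightarrow>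
   \<not> qdvd p (prod_list w) \<Longrightarrow> prod_list w = prod_list v \<or> prod_list w = - prod_list v \<Longrightarrow> w = v"
proof (induction w arbitrary: v)
  case (Cons a r)
  then obtain b r' where v: "v = b # r'" by (cases v) auto
  obtain e :: hq where e: "e = 1 \<or> e = - 1" and eq: "prod_list (a # r) = prod_list v * e"
    using Cons.prems(5) by (metis mult.right_neutral mult_minus_right)
  have ab: "a \<in> prime_gens p" "b \<in> prime_gens p" using Cons.prems v by auto
  have "prod_list (a # r) = b * (prod_list r' * e)" using eq v by (simp add: mult.assoc)
  hence "a = b" using gen_prefix_unique[OF ab _ _ Cons.prems(4)] by simp
  hence "prod_list r = prod_list r' * e"
    using \<open>prod_list (a # r) = b * _\<close> gen_cancel[OF ab(1)] by simp
  hence "r = r'" using Cons e v qdvd_mult_left by (intro Cons.IH) auto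
  thus ?case using v \<open>a = b\<close> by simp
qed simp

end

lemma ex_sqrt_minus_one:
  fixes p :: int
  assumes "prime p" "p mod 4 = 1"
  shows "\<exists>i. p dvd i\<^sup>2 + 1"
proof -
  have p: "p > 2" using assms prime_gt_1_int[of p] by (smt (verit) mod_pos_pos_trivial)
  have "[Legendre (-1) (int (nat p)) = (-1) ^ ((nat p - 1) div 2)] (mod int (nat p))"
    by (rule euler_criterion) (use assms p in auto)
  moreover have "even ((nat p - 1) div 2)"
  proof -
    have k: "p = 4 * (p div 4) + 1" using assms(2) by presburger
    hence "nat p = 4 * nat (p div 4) + 1" using p by linarith
    thus ?thesis by simp
  qed
  ultimately have "[Legendre (-1) p = 1] (mod p)" using p by simp
  hence "QuadRes p (-1)"
    using p unfolding Legendre_def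
    by (auto split: if_splits simp: cong_def mod_minus_right zmod_zminus1_eq_if)
  then obtain y where "[y\<^sup>2 = -1] (mod p)" unfolding QuadRes_def by blast
  thus ?thesis by (auto simp: cong_iff_dvd_diff)
qed

context quat_prime
begin

text \<open>The right ideals of norm \<open>p\<close> correspond to points of a projective line over the field with
  \<open>p\<close> elements: fix an isotropic element \<open>\<omega>\<close>; the \<open>p + 1\<close> lines in the left
  ideal of \<open>\<omega>\<close> modulo \<open>p\<close> generate distinct right ideals.\<close>

lemma card_prime_gens_ge: "card (prime_gens p) \<ge> nat p + 1"
proof -
  obtain i where i: "p dvd i\<^sup>2 + 1" using ex_sqrt_minus_one[OF prime_p p_mod_4] by blast
  \<comment> \<open>The integer \<open>i\<close> is a root of -1 modulo \<open>p\<close>; adding the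
    quaternion unit i to it gives an element whose norm i^2 + 1 vanishes modulo \<open>p\<close>.
    \<open>X\<close> runs through the combinations of \<open>om\<close> and j * \<open>om\<close>,
    and \<open>T\<close> lists the points (0, 1) and (1, t) of the projective line.\<close>
  define om where "om = HQ i 1 0 0"
  define X where "X = (\<lambda>(a :: int, b :: int). (of_int a + of_int b * HQ 0 0 1 0) * om)"
  define T where "T = insert (0 :: int, 1 :: int) ((\<lambda>t. (1, t)) ` {0..<p})"
  have cardT: "card T = nat p + 1"
    unfolding T_def by (subst card_insert_disjoint) (auto simp: card_image inj_on_def)
  have Xs: "hq0 (X (a, b)) = a * i" "hq1 (X (a, b)) = a" "hq2 (X (a, b)) = b * i"
    "hq3 (X (a, b)) = - b" for a b
    by (simp_all add: X_def om_def hq_sel_mult)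
  have "\<exists>s b. s \<in> prime_gens p \<and> X t = s * b" if "t \<in> T" for t
  proof -
    obtain a b where t: "t = (a, b)" by (cases t)
    have "hq_norm (X t) = (a\<^sup>2 + b\<^sup>2) * (i\<^sup>2 + 1)"
      unfolding t hq_norm_def Xs by (simp add: power2_eq_square algebra_simps)
    hence "p dvd hq_norm (X t)" using i by simp
    moreover have "\<not> qdvd p (X t)"
      using \<open>t \<in> T\<close> p_gt_1 unfolding t T_def qdvd_def Xs by (auto dest: zdvd_imp_le)
    ultimately show ?thesis using gen_prefix by metis
  qed
  then obtain f where f: "\<And>t. t \<in> T \<Longrightarrow> f t \<in> prime_gens p \<and> (\<exists>b. X t = f t * b)"
    by metis
  have "inj_on f T"
  proof (rule inj_onI, rule ccontr)
    fix t t' assume tt: "t \<in> T" "t' \<in> T" "f t = f t'" "t \<noteq> t'"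
    obtain a b a' b' where t: "t = (a, b)" "t' = (a', b')" by (cases t; cases t')
    \<comment> \<open>Left multiplication by \<open>y\<close> kills both \<open>X t\<close> and
      \<open>X t'\<close> modulo \<open>p\<close>. The determinant \<open>D\<close> of the two
      points is invertible, so \<open>y\<close> kills both \<open>om\<close> and j *
      \<open>om\<close>; this forces \<open>p\<close> to divide all coordinates of \<open>y\<close>,
      which is impossible for an element of norm \<open>p\<close>.\<close>
    define y where "y = hq_conj (f t)"
    have "qdvd p (y * X t)" "qdvd p (y * X t')"
      using f[OF tt(1)] f[OF tt(2)] tt(3) unfolding y_def qdvd_iff
      by (metis gen_conj_mult(1) mult.assoc)+
    hence d: "p dvd a * (hq0 y * i - hq1 y) - b * (hq2 y * i - hq3 y)"
      "p dvd a' * (hq0 y * i - hq1 y) - b' * (hq2 y * i - hq3 y)"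
      "p dvd a * (hq1 y * i + hq0 y) - b * (hq3 y * i + hq2 y)"
      "p dvd a' * (hq1 y * i + hq0 y) - b' * (hq3 y * i + hq2 y)"
      "p dvd a * (hq2 y * i + hq3 y) + b * (hq0 y * i + hq1 y)"
      "p dvd a' * (hq2 y * i + hq3 y) + b' * (hq0 y * i + hq1 y)"
      unfolding t qdvd_def hq_sel_mult Xs by (simp_all add: algebra_simps)
    define D where "D = a * b' - a' * b"
    have "\<not> p dvd D"
    proof -
      have "\<not> p dvd v - u" if "u \<in> {0..<p}" "v \<in> {0..<p}" "u \<noteq> v" for u v
        using that dvd_imp_le_int[of "v - u" p] by auto
      moreover have "\<not> p dvd 1" "\<not> p dvd -1" using p_gt_1 by auto
      ultimately show ?thesis
        using tt t unfolding T_def D_def by (auto simp: image_iff)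
    qed
    have k: "p dvd z" if "p dvd D * z" for z
      using that \<open>\<not> p dvd D\<close> prime_p prime_dvd_mult_iff by blast
    have e: "p dvd u \<and> p dvd v" if "p dvd a * u - b * v" "p dvd a' * u - b' * v" for u v
    proof -
      have "D * u = b' * (a * u - b * v) - b * (a' * u - b' * v)"
        "D * v = a' * (a * u - b * v) - a * (a' * u - b' * v)"
        unfolding D_def by (simp_all add: algebra_simps)
      thus ?thesis using that k by (metis dvd_diff dvd_mult)
    qed
    have 1: "p dvd hq0 y * i - hq1 y" "p dvd hq2 y * i - hq3 y"
      using e[OF d(1,2)] by auto
    have 2: "p dvd hq2 y * i + hq3 y" "p dvd hq0 y * i + hq1 y"
      using e[of "hq2 y * i + hq3 y" "- (hq0 y * i + hq1 y)"] d(5,6)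
      by (simp_all only: mult_minus_right diff_minus_eq_add dvd_minus_iff)
    have h: "p dvd u" "p dvd v" if "p dvd u * i - v" "p dvd u * i + v" for u v
    proof -
      have "p dvd 2 * v" using dvd_diff[OF that(2,1)] by simp
      thus v: "p dvd v"
        using odd_p prime_p by (metis coprime_dvd_mult_right_iff coprime_right_2_iff_odd)
      have "p dvd u * i" using that(1) v by (metis dvd_add diff_add_cancel)
      hence "p dvd u * i * i" by simp
      moreover have "p dvd u * (i\<^sup>2 + 1)" using i by simp
      ultimately have "p dvd u * (i\<^sup>2 + 1) - u * i * i" by (rule dvd_diff[rotated])
      thus "p dvd u" by (simp add: power2_eq_square algebra_simps)
    qed
    have "qdvd p y" unfolding qdvd_def using h 1 2 by blast
    hence "p\<^sup>2 dvd hq_norm y" by (rule qdvd_norm)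
    hence "p * p dvd p" using f[OF tt(1)] by (simp add: y_def gen_norm power2_eq_square)
    thus False using p_gt_1 by (auto dest: zdvd_imp_le)
  qed
  hence "card T \<le> card (prime_gens p)"
    using f by (intro card_inj_on_le[of f]) auto
  thus ?thesis using cardT by simp
qed

end

text \<open>The element b + x has norm b^2 + \<open>hq_norm x\<close>, a multiple of
  \<open>l\<close>, so it factors as g * c with \<open>g\<close> of norm \<open>l\<close>.
  Exchanging the factors gives c * g, which is b plus the conjugate of \<open>x\<close> by
  \<open>g\<close>; thus the conjugate is again integral although \<open>g\<close> is not
  invertible.\<close>

lemma rotate_pure:
  assumes l: "prime l" "odd l" "\<not> l dvd hq_norm x" "l dvd b\<^sup>2 + hq_norm x" and x: "hq0 x = 0"
  obtains g y where "hq_norm g = l" "hq0 y = 0" "g * y = x * g"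
proof -
  define z where "z = of_int b + x"
  have nz: "hq_norm z = b\<^sup>2 + hq_norm x" using x by (simp add: z_def hq_norm_def)
  have "\<not> qdvd l z"
  proof
    assume "qdvd l z"
    hence "l dvd hq1 x" "l dvd hq2 x" "l dvd hq3 x" unfolding qdvd_def z_def by auto
    thus False using l(3) x unfolding hq_norm_def by (simp add: power2_eq_square)
  qed
  then obtain g c where gc: "hq_norm g = l" "z = g * c"
    using factor_left[OF l(1,2), of z] nz l(4) by metis
  define y where "y = c * g - of_int b"
  have "g * y = (z - of_int b) * g"
    unfolding gc(2) y_def
    by (simp add: right_diff_distrib left_diff_distrib mult.assoc of_int_hq_commute)
  also have "\<dots> = x * g" by (simp add: z_def)
  finally have "g * y = x * g" .
  moreover have "hq0 (c * g) = hq0 (g * c)" by (simp add: hq_sel_mult algebra_simps)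
  hence "hq0 y = hq0 z - b" unfolding y_def gc(2) by simp
  hence "hq0 y = 0" using x by (simp add: z_def)
  ultimately show ?thesis using that gc(1) by blast
qed

lemma conjugate_norm:
  assumes "g * y = x * g" "hq_norm g \<noteq> 0"
  shows "hq_norm y = hq_norm x"
  using arg_cong[OF assms(1), of hq_norm] assms(2) by (simp add: hq_norm_mult)

text \<open>Commuting with a nonzero pure \<open>x\<close> means having a vector part parallel to
  \<open>x\<close>. If g is the greatest common divisor of the coordinates of \<open>x\<close>, the
  vector part of \<open>d\<close> is an integral multiple of x / g, and a nonzero one, so the norm
  of \<open>d\<close> is at least that of x / g.\<close>

lemma commute_pure:
  assumes x: "hq0 x = 0" and comm: "d * x = x * d" and G: "\<And>e. qdvd e x \<Longrightarrow> e \<le> G"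
    and d: "hq1 d \<noteq> 0 \<or> hq2 d \<noteq> 0 \<or> hq3 d \<noteq> 0"
  shows "hq_norm x \<le> G\<^sup>2 * hq_norm d"
proof (cases "x = 0")
  case False
  define g where "g = gcd (hq1 x) (gcd (hq2 x) (hq3 x))"
  have "qdvd g x"
    unfolding qdvd_def g_def using x by (metis dvd_0_right dvd_trans gcd_dvd1 gcd_dvd2)
  have "g \<noteq> 0" using False x by (auto simp: g_def hq_eq_iff)
  hence gpos: "g > 0" by (simp add: g_def less_le)
  obtain u v where uv: "gcd (hq2 x) (hq3 x) = u * hq2 x + v * hq3 x" by (metis bezout_int)
  obtain w z where wz: "g = w * hq1 x + z * (u * hq2 x + v * hq3 x)"
    unfolding g_def uv[symmetric] by (metis bezout_int)
  have c: "hq1 d * hq2 x = hq2 d * hq1 x" "hq1 d * hq3 x = hq3 d * hq1 x"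
    "hq2 d * hq3 x = hq3 d * hq2 x"
    using comm x by (simp_all add: hq_eq_iff hq_sel_mult algebra_simps)
  \<comment> \<open>The Bezout combination that produces \<open>g\<close> from the coordinates of
    \<open>x\<close>, applied to \<open>d\<close>: it is the integer for which the vector part of
    \<open>d\<close> equals t * x / g.\<close>
  define t where "t = w * hq1 d + z * (u * hq2 d + v * hq3 d)"
  have t: "g * hq1 d = t * hq1 x" "g * hq2 d = t * hq2 x" "g * hq3 d = t * hq3 x"
  proof -
    have "g * hq1 d = w * (hq1 d * hq1 x) + z * (u * (hq1 d * hq2 x) + v * (hq1 d * hq3 x))"
      "g * hq2 d = w * (hq2 d * hq1 x) + z * (u * (hq2 d * hq2 x) + v * (hq2 d * hq3 x))"
      "g * hq3 d = w * (hq3 d * hq1 x) + z * (u * (hq3 d * hq2 x) + v * (hq3 d * hq3 x))"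
      unfolding wz by (simp_all add: algebra_simps)
    moreover have "t * hq1 x = w * (hq1 d * hq1 x) + z * (u * (hq2 d * hq1 x) + v * (hq3 d * hq1 x))"
      "t * hq2 x = w * (hq1 d * hq2 x) + z * (u * (hq2 d * hq2 x) + v * (hq3 d * hq2 x))"
      "t * hq3 x = w * (hq1 d * hq3 x) + z * (u * (hq2 d * hq3 x) + v * (hq3 d * hq3 x))"
      unfolding t_def by (simp_all add: algebra_simps)
    ultimately show "g * hq1 d = t * hq1 x" "g * hq2 d = t * hq2 x" "g * hq3 d = t * hq3 x"
      by (simp_all only: c)
  qed
  have "t \<noteq> 0" using d t gpos by auto
  hence "t\<^sup>2 \<ge> 1" by (metis int_one_le_iff_zero_less zero_less_power2)
  hence "hq_norm x \<le> t\<^sup>2 * hq_norm x" using mult_right_mono[of 1 "t\<^sup>2" "hq_norm x"] by simp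
  also have "\<dots> = (t * hq1 x)\<^sup>2 + (t * hq2 x)\<^sup>2 + (t * hq3 x)\<^sup>2"
    using x by (simp add: hq_norm_def power_mult_distrib algebra_simps)
  also have "\<dots> = g\<^sup>2 * ((hq1 d)\<^sup>2 + (hq2 d)\<^sup>2 + (hq3 d)\<^sup>2)"
    unfolding t[symmetric] by (simp only: power_mult_distrib distrib_left)
  also have "\<dots> \<le> g\<^sup>2 * hq_norm d"
    by (intro mult_left_mono) (auto simp: hq_norm_def)
  also have "\<dots> \<le> G\<^sup>2 * hq_norm d"
    using G[OF \<open>qdvd g x\<close>] gpos by (intro mult_right_mono power_mono) auto
  finally show ?thesis .
qed (simp add: hq_norm_def)

text \<open>Conjugating a pure quaternion \<open>x\<close> by elements of norm \<open>l\<^sub>1 l\<^sub>2\<close> yields distinct pure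
  quaternions of the same norm: a coincidence would put an element of small norm outside
  the integers into the commutant of \<open>x\<close>.\<close>

lemma many_pure_quaternions:
  fixes L :: "int set" and B G N :: int
  assumes L: "finite L" "\<And>l. l \<in> L \<Longrightarrow> prime l \<and> odd l \<and> \<not> l dvd N \<and> l \<le> B \<and> (\<exists>b. l dvd b\<^sup>2 + N)"
    and x: "hq0 x = 0" "hq_norm x = N" "\<And>e. qdvd e x \<Longrightarrow> e \<le> G"
    and small: "G\<^sup>2 * B ^ 4 < N"
  shows "card {(l, l'). l \<in> L \<and> l' \<in> L \<and> l < l'} \<le> card {y. hq0 y = 0 \<and> hq_norm y = N}"
proof -
  let ?P = "{(l, l'). l \<in> L \<and> l' \<in> L \<and> l < l'}"
  define Q where "Q = (\<lambda>t g y. hq_norm g = fst t * snd t \<and> hq0 y = 0 \<and> g * y = x * g)"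
  have exQ: "\<exists>g y. Q t g y" if t: "t \<in> ?P" for t
  proof -
    obtain l l' where t': "t = (l, l')" "l \<in> L" "l' \<in> L" using t by auto
    obtain b where "prime l" "odd l" "\<not> l dvd N" "l dvd b\<^sup>2 + N" using L(2)[OF t'(2)] by blast
    then obtain g y where gy: "hq_norm g = l" "hq0 y = 0" "g * y = x * g"
      using rotate_pure[of l x b] x by metis
    have ny: "hq_norm y = N" using conjugate_norm[OF gy(3)] gy(1) x \<open>prime l\<close> by auto
    obtain b' where "prime l'" "odd l'" "\<not> l' dvd N" "l' dvd b'\<^sup>2 + N" using L(2)[OF t'(3)] by blast
    then obtain g' y' where gy': "hq_norm g' = l'" "hq0 y' = 0" "g' * y' = y * g'"
      using rotate_pure[of l' y b'] gy ny by metis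
    have "(g * g') * y' = x * (g * g')" using gy(3) gy'(3) by (metis mult.assoc)
    thus ?thesis using gy gy' t' unfolding Q_def by (intro exI[of _ "g * g'"] exI[of _ y']) (simp add: hq_norm_mult)
  qed
  have "\<forall>t\<in>?P. \<exists>z. Q t (fst z) (snd z)" 
  proof
    fix t assume "t \<in> ?P"
    then obtain g y where "Q t g y" using exQ by blast
    thus "\<exists>z. Q t (fst z) (snd z)" by (intro exI[of _ "(g, y)"]) simp
  qed
  from bchoice[OF this] obtain f where f: "\<forall>t\<in>?P. Q t (fst (f t)) (snd (f t))" ..
  define g y where "g = (\<lambda>t. fst (f t))" and "y = (\<lambda>t. snd (f t))"
  have "Q t (g t) (y t)" if "t \<in> ?P" for t using f that unfolding g_def y_def by blast
  hence gy: "\<And>t. t \<in> ?P \<Longrightarrow> hq_norm (g t) = fst t * snd t \<and> hq0 (y t) = 0 \<and> g t * y t = x * g t"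
    unfolding Q_def by blast
  have conjx: "hq_conj x = - x" using x by (simp add: hq_eq_iff)
  have "inj_on y ?P"
  proof (rule inj_onI)
    fix s t assume st: "s \<in> ?P" "t \<in> ?P" "y s = y t"
    obtain a b c d where ab: "s = (a, b)" "t = (c, d)" by (cases s; cases t)
    have pr: "prime a" "prime b" "prime c" "prime d" "a < b" "c < d"
      "a \<le> B" "b \<le> B" "c \<le> B" "d \<le> B" using st ab L by auto
    have pos: "a > 0" "b > 0" "c > 0" "d > 0" using pr prime_gt_0_int by blast+
    define e where "e = g s * hq_conj (g t)"
    have "hq_conj (y t) = - y t" using gy[OF st(2)] by (simp add: hq_eq_iff)
    moreover have "hq_conj (g t * y t) = hq_conj (x * g t)" using gy[OF st(2)] by simp
    ultimately have c1: "y t * hq_conj (g t) = hq_conj (g t) * x"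
      by (simp add: hq_conj_mult conjx)
    have comm: "e * x = x * e"
      unfolding e_def using gy[OF st(1)] c1 st(3) by (metis mult.assoc)
    have ne: "hq_norm e = a * b * (c * d)"
      unfolding e_def using gy[OF st(1)] gy[OF st(2)] ab by (simp add: hq_norm_mult)
    have "a * b * (c * d) \<le> B * B * (B * B)"
      using pr pos by (intro mult_mono mult_nonneg_nonneg) auto
    hence le: "hq_norm e \<le> B ^ 4" unfolding ne by (simp add: power4_eq_xxxx mult.assoc)
    have "hq1 e = 0 \<and> hq2 e = 0 \<and> hq3 e = 0"
    proof (rule ccontr)
      assume "\<not> ?thesis"
      hence "N \<le> G\<^sup>2 * hq_norm e" using commute_pure[OF x(1) comm x(3)] x(2) by auto
      also have "\<dots> \<le> G\<^sup>2 * B ^ 4" using le by (intro mult_left_mono) auto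
      finally show False using small by simp
    qed
    \<comment> \<open>A real \<open>e\<close> makes a * b * c * d a perfect square. With a < b and c
      < d each prime must then occur once in either pair, so the pairs agree.\<close>
    hence sq: "(hq0 e)\<^sup>2 = a * b * (c * d)" using ne by (simp add: hq_norm_def)
    have ne2: "\<And>u v. prime u \<Longrightarrow> prime v \<Longrightarrow> u dvd v \<Longrightarrow> u = (v::int)"
      using primes_dvd_imp_eq by blast
    have in1: "a = c \<or> a = d"
    proof -
      have "a dvd (hq0 e)\<^sup>2" unfolding sq by simp
      hence "a dvd hq0 e" using pr(1) prime_dvd_power by blast
      hence "a * a dvd a * (b * (c * d))"
        using sq by (metis mult.assoc mult_dvd_mono power2_eq_square)
      hence "a dvd b * (c * d)" using pos by simp
      thus ?thesis using pr ne2 by (metis less_irrefl prime_dvd_mult_iff)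
    qed
    have in2: "b = c \<or> b = d"
    proof -
      have "b dvd (hq0 e)\<^sup>2" unfolding sq by simp
      hence "b dvd hq0 e" using pr(2) prime_dvd_power by blast
      hence "b * b dvd b * (a * (c * d))"
        using sq by (metis mult.assoc mult.commute mult_dvd_mono power2_eq_square)
      hence "b dvd a * (c * d)" using pos by simp
      thus ?thesis using pr ne2 by (metis less_irrefl prime_dvd_mult_iff)
    qed
    show "s = t" using in1 in2 pr ab by auto
  qed
  moreover have "y ` ?P \<subseteq> {y. hq0 y = 0 \<and> hq_norm y = N}"
  proof safe
    fix l l' assume "l \<in> L" "l' \<in> L" "l < l'"
    hence t: "(l, l') \<in> ?P" by simp
    have "hq_norm (g (l, l')) \<noteq> 0" using gy[OF t] L \<open>l \<in> L\<close> \<open>l' \<in> L\<close> by auto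
    thus "hq0 (y (l, l')) = 0" "hq_norm (y (l, l')) = N"
      using gy[OF t] conjugate_norm x by metis+
  qed
  moreover have "finite {y. hq0 y = 0 \<and> hq_norm y = N}"
    by (rule finite_subset[OF _ finite_norm_le[of N]]) auto
  ultimately show ?thesis by (rule card_inj_on_le)
qed

section \<open>The Lubotzky--Phillips--Sarnak graph\<close>

text \<open>Cauchy-Schwarz over the fibres of \<open>f\<close>. With words as \<open>A\<close> and
  vertices as \<open>B\<close>, few collisions mean many vertices.\<close>

lemma card_squared_le_card_collisions:
  assumes "finite A" "finite B" "f ` A \<subseteq> B"
  shows "(card A)\<^sup>2 \<le> card B * card {(a, a'). a \<in> A \<and> a' \<in> A \<and> f a = f a'}"
proof -
  define F where "F = (\<lambda>b. {a \<in> A. f a = b})"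
  have finF: "finite (F b)" for b using assms(1) by (simp add: F_def)
  have "A = (\<Union>b\<in>B. F b)" using assms(3) by (auto simp: F_def)
  hence "card A = card (\<Union>b\<in>B. F b)" by simp
  also have "\<dots> = (\<Sum>b\<in>B. card (F b))"
    by (intro card_UN_disjoint) (use assms finF in \<open>auto simp: F_def\<close>)
  finally have 1: "card A = (\<Sum>b\<in>B. card (F b))" .
  have "{(a, a'). a \<in> A \<and> a' \<in> A \<and> f a = f a'} = (\<Union>b\<in>B. F b \<times> F b)"
    using assms(3) by (auto simp: F_def)
  hence "card {(a, a'). a \<in> A \<and> a' \<in> A \<and> f a = f a'} = card (\<Union>b\<in>B. F b \<times> F b)" by simp
  also have "\<dots> = (\<Sum>b\<in>B. card (F b \<times> F b))"
    by (intro card_UN_disjoint) (use assms finF in \<open>auto simp: F_def\<close>)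
  finally have 2: "card {(a, a'). a \<in> A \<and> a' \<in> A \<and> f a = f a'} = (\<Sum>b\<in>B. (card (F b))\<^sup>2)"
    by (simp add: card_cartesian_product power2_eq_square)
  have "(\<Sum>b\<in>B. real (card (F b)))\<^sup>2 \<le> (\<Sum>b\<in>B. (real (card (F b)))\<^sup>2) * card B"
    by (rule sum_squared_le_sum_of_squares)
  hence "real ((card A)\<^sup>2) \<le> real (card B * (\<Sum>b\<in>B. (card (F b))\<^sup>2))"
    by (simp add: 1 mult.commute)
  thus ?thesis unfolding 2 by linarith
qed

section \<open>Classes, cosets and edges expressed through quaternions\<close>

locale lps = quat_prime +
  fixes q :: int
  assumes prime_q: "prime q" and odd_q: "odd q" and p_less_q: "p < q"
begin

lemma q_gt_1: "q > 1" using prime_q prime_gt_1_int by blast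

lemma q_not_dvd_p: "\<not> q dvd p"
  using primes_dvd_imp_eq[OF prime_q prime_p] p_less_q by auto

lemma q_not_dvd_p_power: "\<not> q dvd p ^ m"
  using q_not_dvd_p prime_q prime_dvd_power by blast

text \<open>Scalar modulo \<open>q\<close>. The factor 2 of the congruence defining
  \<open>Lambda2q\<close> is automatic on \<open>Lam\<close>, where the vector part is even.\<close>

definition sc :: "hq \<Rightarrow> bool" where
  "sc x \<longleftrightarrow> q dvd hq1 x \<and> q dvd hq2 x \<and> q dvd hq3 x"

lemma sc_of_int_mult: "\<not> q dvd c \<Longrightarrow> sc (of_int c * x) = sc x"
  using prime_q by (auto simp: sc_def prime_dvd_mult_iff)

lemma sc_p_power_mult: "sc (of_int (p ^ m) * x) = sc x"
  by (rule sc_of_int_mult[OF q_not_dvd_p_power])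

lemma sc_uminus [simp]: "sc (- x) = sc x"
  by (simp add: sc_def)

lemma sc_conj [simp]: "sc (hq_conj x) = sc x"
  by (simp add: sc_def)

lemma sc_of_int [simp]: "sc (of_int n)"
  by (simp add: sc_def)

lemma sc_mult: "sc x \<Longrightarrow> sc y \<Longrightarrow> sc (x * y)"
  by (simp add: sc_def hq_sel_mult)

text \<open>An element that is scalar modulo \<open>q\<close> is an integer plus \<open>q\<close>
  times a quaternion, and this shape survives conjugation. This is the normality of the subgroup
  that is factored out.\<close>

lemma sc_between: "sc y \<Longrightarrow> sc (x * y * hq_conj x)"
proof -
  assume "sc y"
  then obtain a b c where y: "hq1 y = q * a" "hq2 y = q * b" "hq3 y = q * c"
    unfolding sc_def by (auto elim!: dvdE)
  have "y = of_int (hq0 y) + of_int q * HQ 0 a b c" using y by (simp add: hq_eq_iff)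
  hence "x * y * hq_conj x = x * (of_int (hq0 y) + of_int q * HQ 0 a b c) * hq_conj x"
    by simp
  also have "\<dots> = x * of_int (hq0 y) * hq_conj x + x * (of_int q * HQ 0 a b c) * hq_conj x"
    by (simp only: distrib_left distrib_right)
  also have "x * of_int (hq0 y) * hq_conj x = of_int (hq0 y) * of_int (hq_norm x)"
    by (simp only: of_int_hq_commute[of x] mult.assoc hq_mult_conj)
  also have "x * (of_int q * HQ 0 a b c) * hq_conj x = of_int q * (x * HQ 0 a b c * hq_conj x)"
    by (simp only: of_int_hq_left_commute mult.assoc)
  finally show "sc (x * y * hq_conj x)"
    by (simp add: sc_def)
qed

abbreviation "Lam \<equiv> Lam2_set p"

lemma Lam_iff: "x \<in> Lam \<longleftrightarrow> odd_real x \<and> (\<exists>m. hq_norm x = p ^ m)"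
  by (simp add: Lam2_set_def odd_real_def)

lemma Lam_mult: "x \<in> Lam \<Longrightarrow> y \<in> Lam \<Longrightarrow> x * y \<in> Lam"
  unfolding Lam_iff by (metis hq_norm_mult odd_real_mult power_add)

lemma Lam_conj: "x \<in> Lam \<Longrightarrow> hq_conj x \<in> Lam"
  by (simp add: Lam_iff)

lemma Lam_1: "1 \<in> Lam"
  unfolding Lam_iff by (auto intro: exI[of _ 0])

lemma Lam_p_mult: "x \<in> Lam \<Longrightarrow> of_int (p ^ m) * x \<in> Lam"
  unfolding Lam_iff
  by (auto simp: odd_real_of_int_mult odd_p hq_norm_mult simp del: of_int_power simp flip: power_mult power_add)

lemma Lam_gen: "s \<in> prime_gens p \<Longrightarrow> s \<in> Lam"
  unfolding Lam_iff by (auto simp: prime_gens_def intro: exI[of _ 1])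

lemma Lam_prod_list: "set w \<subseteq> prime_gens p \<Longrightarrow> prod_list w \<in> Lam"
  unfolding Lam_iff using norm_prod_list odd_real_prod_list by blast

lemma Lam_norm: "x \<in> Lam \<Longrightarrow> \<exists>m. hq_norm x = p ^ m"
  by (simp add: Lam_iff)

lemma lam_rel_iff: "(x, y) \<in> lam_rel p \<longleftrightarrow> x \<in> Lam \<and> y \<in> Lam \<and>
    (\<exists>a b e. (e = 1 \<or> e = -1) \<and> of_int (p ^ a) * x = of_int (e * p ^ b) * y)"
  unfolding lam_rel_def hq_scale_eq by simp

lemma lam_rel_sym: "(x, y) \<in> lam_rel p \<Longrightarrow> (y, x) \<in> lam_rel p"
proof -
  assume "(x, y) \<in> lam_rel p"
  then obtain a b e where l: "x \<in> Lam" "y \<in> Lam" and e: "e = 1 \<or> e = -1"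
    and eq: "of_int (p ^ a) * x = of_int (e * p ^ b) * y" unfolding lam_rel_iff by blast
  have "of_int (e * p ^ a) * x = of_int e * (of_int (p ^ a) * x)" by (simp add: mult.assoc)
  also have "\<dots> = of_int (p ^ b) * y" unfolding eq using e by auto
  finally show ?thesis unfolding lam_rel_iff using l e by metis
qed

lemma lam_rel_trans:
  assumes "(x, y) \<in> lam_rel p" "(y, z) \<in> lam_rel p"
  shows "(x, z) \<in> lam_rel p"
proof -
  obtain a b e where 1: "x \<in> Lam" "y \<in> Lam" "e = 1 \<or> e = -1"
    "of_int (p ^ a) * x = of_int (e * p ^ b) * y" using assms(1) unfolding lam_rel_iff by blast
  obtain c d f where 2: "z \<in> Lam" "f = 1 \<or> f = -1"
    "of_int (p ^ c) * y = of_int (f * p ^ d) * z" using assms(2) unfolding lam_rel_iff by blast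
  have "of_int (p ^ (c + a)) * x = of_int (p ^ c) * (of_int (p ^ a) * x)"
    by (simp add: power_add mult.assoc)
  also have "\<dots> = of_int (e * p ^ b) * (of_int (p ^ c) * y)"
    unfolding 1(4) by (rule of_int_hq_left_commute)
  also have "\<dots> = of_int (e * f * p ^ (b + d)) * z"
    unfolding 2(3) by (simp add: hq_eq_iff power_add del: of_int_mult of_int_power)
  finally show ?thesis unfolding lam_rel_iff using 1(1,3) 2(1,2)
    by (metis minus_mult_minus mult.right_neutral mult_1)
qed

lemma lam_relI:
  assumes "x \<in> Lam" "y \<in> Lam" "x = of_int (p ^ m) * y"
  shows "(x, y) \<in> lam_rel p"
proof -
  have "of_int (p ^ 0) * x = of_int (1 * p ^ m) * y" using assms(3) by simp
  thus ?thesis unfolding lam_rel_iff using assms(1,2) by blast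
qed

lemma lam_rel_refl: "x \<in> Lam \<Longrightarrow> (x, x) \<in> lam_rel p"
  by (rule lam_relI[of _ _ 0]) auto

definition cl :: "hq \<Rightarrow> hq set" where "cl x = lam_rel p `` {x}"

lemma mem_cl: "y \<in> cl x \<longleftrightarrow> (x, y) \<in> lam_rel p"
  by (simp add: cl_def)

lemma cl_self: "x \<in> Lam \<Longrightarrow> x \<in> cl x"
  by (simp add: mem_cl lam_rel_refl)

lemma cl_Lam: "y \<in> cl x \<Longrightarrow> y \<in> Lam"
  by (auto simp: mem_cl lam_rel_iff)

lemma cl_eqI: "(x, y) \<in> lam_rel p \<Longrightarrow> cl x = cl y"
  unfolding cl_def using lam_rel_trans lam_rel_sym by blast

lemma cl_eq_iff: "y \<in> Lam \<Longrightarrow> cl x = cl y \<longleftrightarrow> (x, y) \<in> lam_rel p"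
  using cl_eqI cl_self mem_cl by metis

lemma Lambda2_eq: "Lambda2 p = cl ` Lam"
  unfolding Lambda2_def quotient_def cl_def by auto

lemma lam_rel_mult:
  assumes "(x, x') \<in> lam_rel p" "(y, y') \<in> lam_rel p"
  shows "(x * y, x' * y') \<in> lam_rel p"
proof -
  obtain a b e where 1: "x \<in> Lam" "x' \<in> Lam" "e = 1 \<or> e = -1"
    "of_int (p ^ a) * x = of_int (e * p ^ b) * x'" using assms(1) unfolding lam_rel_iff by blast
  obtain c d f where 2: "y \<in> Lam" "y' \<in> Lam" "f = 1 \<or> f = -1"
    "of_int (p ^ c) * y = of_int (f * p ^ d) * y'" using assms(2) unfolding lam_rel_iff by blast
  have "of_int (p ^ (a + c)) * (x * y) = (of_int (p ^ a) * x) * (of_int (p ^ c) * y)"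
    by (simp only: power_add of_int_mult mult.assoc of_int_hq_left_commute[of x])
  also have "\<dots> = (of_int (e * p ^ b) * x') * (of_int (f * p ^ d) * y')" by (simp only: 1 2)
  also have "\<dots> = of_int ((e * p ^ b) * (f * p ^ d)) * (x' * y')"
    by (simp only: of_int_mult[of "e * p ^ b"] mult.assoc[of _ x'] mult.assoc[of "of_int (e * p ^ b)"]
        of_int_hq_left_commute[of x'])
  also have "(e * p ^ b) * (f * p ^ d) = (e * f) * p ^ (b + d)" by (simp add: power_add)
  finally have "of_int (p ^ (a + c)) * (x * y) = of_int (e * f * p ^ (b + d)) * (x' * y')" .
  moreover have "e * f = 1 \<or> e * f = -1" using 1(3) 2(3) by auto
  ultimately show ?thesis unfolding lam_rel_iff using 1(1,2) 2(1,2) Lam_mult by blast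
qed

lemma cmult_cl:
  assumes "x \<in> Lam" "y \<in> Lam"
  shows "cmult p (cl x) (cl y) = cl (x * y)"
proof -
  have "cmult p (cl x) (cl y) = lam_rel p `` {a * b | a b. a \<in> cl x \<and> b \<in> cl y}"
    unfolding cmult_def times_hq_def ..
  also have "\<dots> = cl (x * y)"
  proof
    show "lam_rel p `` {a * b | a b. a \<in> cl x \<and> b \<in> cl y} \<subseteq> cl (x * y)"
    proof
      fix z assume "z \<in> lam_rel p `` {a * b | a b. a \<in> cl x \<and> b \<in> cl y}"
      then obtain a b where "(x, a) \<in> lam_rel p" "(y, b) \<in> lam_rel p" "(a * b, z) \<in> lam_rel p"
        by (auto simp: mem_cl)
      thus "z \<in> cl (x * y)" using lam_rel_trans[OF lam_rel_mult] mem_cl by blast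
    qed
    show "cl (x * y) \<subseteq> lam_rel p `` {a * b | a b. a \<in> cl x \<and> b \<in> cl y}"
      using cl_self assms unfolding cl_def[of "x * y"] by blast
  qed
  finally show ?thesis .
qed

lemma sc_lam_rel:
  assumes "(y, y') \<in> lam_rel p"
  shows "sc (x * y) = sc (x * y')"
proof -
  obtain a b e where 1: "e = 1 \<or> e = -1"
    "of_int (p ^ a) * y = of_int (e * p ^ b) * y'" using assms(1) unfolding lam_rel_iff by blast
  have "sc (x * y) = sc (of_int (p ^ a) * (x * y))" by (simp only: sc_p_power_mult)
  also have "of_int (p ^ a) * (x * y) = of_int e * (of_int (p ^ b) * (x * y'))"
  proof -
    have "of_int (p ^ a) * (x * y) = x * (of_int (p ^ a) * y)"
      by (rule of_int_hq_left_commute[symmetric])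
    also have "\<dots> = of_int (e * p ^ b) * (x * y')" unfolding 1(2) by (rule of_int_hq_left_commute)
    finally show ?thesis by (simp only: of_int_mult mult.assoc)
  qed
  also have "sc \<dots> = sc (of_int (p ^ b) * (x * y'))" using 1(1) by auto
  also have "\<dots> = sc (x * y')" by (simp only: sc_p_power_mult)
  finally show ?thesis .
qed

lemma Lam_sc_iff: "x \<in> Lam \<Longrightarrow> (2 * q dvd hq1 x \<and> 2 * q dvd hq2 x \<and> 2 * q dvd hq3 x) \<longleftrightarrow> sc x"
proof -
  assume "x \<in> Lam"
  hence "even (hq1 x)" "even (hq2 x)" "even (hq3 x)" by (auto simp: Lam_iff odd_real_def)
  moreover have "2 * q dvd z \<longleftrightarrow> q dvd z" if "even z" for z
    using that odd_q by (metis coprime_left_2_iff_odd divides_mult dvd_mult_right)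
  ultimately show ?thesis unfolding sc_def by blast
qed

lemma Lambda2q_eq: "Lambda2q p q = cl ` {z \<in> Lam. sc z}"
proof
  show "Lambda2q p q \<subseteq> cl ` {z \<in> Lam. sc z}"
  proof
    fix c assume c: "c \<in> Lambda2q p q"
    then obtain x y where x: "x \<in> Lam" "c = cl x" and y: "y \<in> c"
      "2 * q dvd hq1 y" "2 * q dvd hq2 y" "2 * q dvd hq3 y"
      unfolding Lambda2q_def Lambda2_eq by auto
    have "y \<in> Lam" using y x cl_Lam by blast
    moreover have "c = cl y" using x y cl_eqI mem_cl by auto
    ultimately show "c \<in> cl ` {z \<in> Lam. sc z}" using y Lam_sc_iff by blast
  qed
  show "cl ` {z \<in> Lam. sc z} \<subseteq> Lambda2q p q"
    unfolding Lambda2q_def Lambda2_eq using cl_self Lam_sc_iff by blast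
qed

text \<open>The coset of the class of \<open>x\<close>: \<open>hq_conj x\<close> represents the
  inverse class, because x * hq_conj x is a power of \<open>p\<close>.\<close>

definition Vx :: "hq \<Rightarrow> hq set set" where
  "Vx x = {cl w | w. w \<in> Lam \<and> sc (hq_conj x * w)}"

lemma cl_mem_Vx: "w \<in> Lam \<Longrightarrow> cl w \<in> Vx x \<longleftrightarrow> sc (hq_conj x * w)"
proof
  assume w: "w \<in> Lam" and "cl w \<in> Vx x"
  then obtain v where "v \<in> Lam" "sc (hq_conj x * v)" "cl w = cl v" unfolding Vx_def by blast
  thus "sc (hq_conj x * w)" using cl_eq_iff sc_lam_rel by blast
qed (auto simp: Vx_def)

lemma coset_eq_Vx:
  assumes x: "x \<in> Lam"
  shows "(\<lambda>h. cmult p (cl x) h) ` Lambda2q p q = Vx x"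
proof
  show "(\<lambda>h. cmult p (cl x) h) ` Lambda2q p q \<subseteq> Vx x"
  proof
    fix c assume "c \<in> (\<lambda>h. cmult p (cl x) h) ` Lambda2q p q"
    then obtain z where z: "z \<in> Lam" "sc z" "c = cl (x * z)"
      unfolding Lambda2q_eq using cmult_cl[OF x] by auto
    have "sc (hq_conj x * (x * z))"
      using z(2) by (simp add: mult.assoc[symmetric] hq_mult_conj sc_mult)
    thus "c \<in> Vx x" using z Lam_mult[OF x] unfolding Vx_def by blast
  qed
  show "Vx x \<subseteq> (\<lambda>h. cmult p (cl x) h) ` Lambda2q p q"
  proof
    fix c assume "c \<in> Vx x"
    then obtain w where w: "w \<in> Lam" "sc (hq_conj x * w)" "c = cl w" unfolding Vx_def by blast
    obtain m where m: "hq_norm x = p ^ m" using Lam_norm[OF x] by blast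
    define z where "z = hq_conj x * w"
    have zL: "z \<in> Lam" unfolding z_def by (intro Lam_mult Lam_conj x w)
    have "x * z = of_int (p ^ m) * w"
      unfolding z_def mult.assoc[symmetric] hq_mult_conj m ..
    hence "(x * z, w) \<in> lam_rel p"
      using Lam_mult[OF x zL] w(1) by (intro lam_relI)
    hence "c = cmult p (cl x) (cl z)" using cl_eqI cmult_cl[OF x zL] w(3) by metis
    thus "c \<in> (\<lambda>h. cmult p (cl x) h) ` Lambda2q p q"
      unfolding Lambda2q_eq using zL w(2) z_def by blast
  qed
qed

abbreviation "Vs \<equiv> LPS_vertices p q"
abbreviation "Ed \<equiv> LPS_adj p q"

lemma Vs_eq: "Vs = Vx ` Lam"
  unfolding LPS_vertices_def Lambda2_eq using coset_eq_Vx by auto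

text \<open>Transitivity is the point: (conj a * b) * (conj b * w) is the norm of b times conj a *
  w, and this norm, a power of \<open>p\<close>, can be cancelled modulo \<open>q\<close>.\<close>

lemma Vx_eq_iff:
  assumes x: "x \<in> Lam" and y: "y \<in> Lam"
  shows "Vx x = Vx y \<longleftrightarrow> sc (hq_conj x * y)"
proof
  assume "Vx x = Vx y"
  moreover have "cl y \<in> Vx y" using y cl_mem_Vx by (simp add: hq_mult_conj)
  ultimately show "sc (hq_conj x * y)" using cl_mem_Vx y by blast
next
  assume s: "sc (hq_conj x * y)"
  have tr: "sc (hq_conj a * w)" if "sc (hq_conj a * b)" "sc (hq_conj b * w)" "b \<in> Lam" for a b w
  proof -
    obtain m where m: "hq_norm b = p ^ m" using Lam_norm[OF \<open>b \<in> Lam\<close>] by blast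
    have "(hq_conj a * b) * (hq_conj b * w) = hq_conj a * ((b * hq_conj b) * w)"
      by (simp only: mult.assoc)
    also have "\<dots> = of_int (p ^ m) * (hq_conj a * w)"
      unfolding hq_mult_conj m by (rule of_int_hq_left_commute)
    finally have "sc (of_int (p ^ m) * (hq_conj a * w))" using sc_mult[OF that(1,2)] by simp
    thus ?thesis by (simp only: sc_p_power_mult)
  qed
  have s': "sc (hq_conj y * x)"
    using s sc_conj[of "hq_conj x * y"] by (simp add: hq_conj_mult)
  show "Vx x = Vx y" unfolding Vx_def using tr[OF s' _ x] tr[OF s _ y] by blast
qed

lemma Vx_mult_right:
  assumes "x \<in> Lam" "y \<in> Lam" "z \<in> Lam" "Vx x = Vx y"
  shows "Vx (x * z) = Vx (y * z)"
proof -
  have "sc (hq_conj z * (hq_conj x * y) * hq_conj (hq_conj z))"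
    by (rule sc_between) (use assms Vx_eq_iff in blast)
  thus ?thesis
    by (subst Vx_eq_iff) (use assms Lam_mult in \<open>simp_all add: hq_conj_mult mult.assoc\<close>)
qed

lemma Vx_p_mult:
  assumes "x \<in> Lam"
  shows "Vx (of_int (p ^ m) * x) = Vx x"
proof -
  have "hq_conj (of_int (p ^ m) * x) * x = of_int (hq_norm x) * of_int (p ^ m)"
    unfolding hq_conj_mult hq_conj_of_int of_int_hq_commute[of "hq_conj x"] mult.assoc hq_mult_conj
    by (rule of_int_hq_commute)
  hence "sc (hq_conj (of_int (p ^ m) * x) * x)" by (simp only: of_int_mult[symmetric] sc_of_int)
  thus ?thesis using Vx_eq_iff Lam_p_mult assms by blast
qed

lemma LPS_S_eq: "LPS_S p = cl ` prime_gens p"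
proof
  show "LPS_S p \<subseteq> cl ` prime_gens p"
  proof
    fix c assume "c \<in> LPS_S p"
    then obtain x y where xy: "x \<in> Lam" "c = cl x" "y \<in> c" "hq_norm y = p" "hq0 y > 0"
      unfolding LPS_S_def Lambda2_eq by auto
    hence "y \<in> prime_gens p" using cl_Lam by (auto simp: prime_gens_def Lam_iff)
    moreover have "c = cl y" using xy cl_eqI mem_cl by auto
    ultimately show "c \<in> cl ` prime_gens p" by blast
  qed
  show "cl ` prime_gens p \<subseteq> LPS_S p"
    unfolding LPS_S_def Lambda2_eq
  proof safe
    fix s assume s: "s \<in> prime_gens p"
    show "cl s \<in> cl ` Lam" using Lam_gen[OF s] by blast
    show "\<exists>x\<in>cl s. hq_norm x = p \<and> 0 < hq0 x \<and> odd (hq0 x)"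
      using s cl_self[OF Lam_gen[OF s]] by (auto simp: prime_gens_def odd_real_def)
  qed
qed

text \<open>Right multiplication by \<open>s\<close> has to be moved past the subgroup, which is
  where normality enters, through \<open>sc_between\<close>. In the converse direction
  \<open>hq_conj s\<close> inverts \<open>s\<close> up to the scalar \<open>p\<close>.\<close>

lemma Vx_image_cmult:
  assumes x: "x \<in> Lam" and s: "s \<in> prime_gens p"
  shows "(\<lambda>u. cmult p u (cl s)) ` Vx x = Vx (x * s)"
proof
  note sL = Lam_gen[OF s]
  show "(\<lambda>u. cmult p u (cl s)) ` Vx x \<subseteq> Vx (x * s)"
  proof
    fix c assume "c \<in> (\<lambda>u. cmult p u (cl s)) ` Vx x"
    then obtain w where w: "w \<in> Lam" "sc (hq_conj x * w)" "c = cl (w * s)"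
      unfolding Vx_def using cmult_cl[OF _ sL] by auto
    have "sc (hq_conj s * (hq_conj x * w) * hq_conj (hq_conj s))" by (rule sc_between[OF w(2)])
    hence "sc (hq_conj (x * s) * (w * s))" by (simp add: hq_conj_mult mult.assoc)
    thus "c \<in> Vx (x * s)" unfolding Vx_def using w Lam_mult sL by blast
  qed
  show "Vx (x * s) \<subseteq> (\<lambda>u. cmult p u (cl s)) ` Vx x"
  proof
    fix c assume "c \<in> Vx (x * s)"
    then obtain v where v: "v \<in> Lam" "sc (hq_conj (x * s) * v)" "c = cl v" unfolding Vx_def by blast
    define w where "w = v * hq_conj s"
    have wL: "w \<in> Lam" unfolding w_def by (intro Lam_mult v Lam_conj sL)
    have ws: "w * s = of_int p * v"
      unfolding w_def mult.assoc gen_conj_mult(1)[OF s] by (rule of_int_hq_commute)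
    have "sc (s * (hq_conj (x * s) * v) * hq_conj s)" by (rule sc_between[OF v(2)])
    moreover have "s * (hq_conj (x * s) * v) * hq_conj s = (s * hq_conj s) * (hq_conj x * w)"
      by (simp add: hq_conj_mult w_def mult.assoc)
    ultimately have "sc (of_int (p ^ 1) * (hq_conj x * w))" using gen_conj_mult(2)[OF s] by simp
    hence "sc (hq_conj x * w)" by (simp only: sc_p_power_mult)
    moreover have "(w * s, v) \<in> lam_rel p"
      using v(1) Lam_mult[OF wL sL] ws by (intro lam_relI[of _ _ 1]) auto
    hence "c = cmult p (cl w) (cl s)" using cl_eqI cmult_cl[OF wL sL] v(3) by metis
    ultimately show "c \<in> (\<lambda>u. cmult p u (cl s)) ` Vx x" unfolding Vx_def using wL by blast
  qed
qed

lemma Ed_iff: "x \<in> Lam \<Longrightarrow> Ed (Vx x) U \<longleftrightarrow> (\<exists>s\<in>prime_gens p. U = Vx (x * s))"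
  unfolding LPS_adj_def LPS_S_eq using Vx_image_cmult by auto

end

section \<open>Closed walks and reduced words with product scalar modulo \<open>q\<close>\<close>

context lps
begin

lemma reduced_append:
  "reduced (v @ w) \<longleftrightarrow> reduced v \<and> reduced w \<and> (v = [] \<or> w = [] \<or> hd w \<noteq> hq_conj (last v))"
  by (simp add: reduced_def successively_append_iff) 

lemma reduced_rev_conj: "reduced (rev (map hq_conj w)) = reduced w"
  unfolding reduced_def successively_rev successively_map hq_conj_conj
  by (intro successively_cong refl) auto

lemma words_eqI:
  assumes "v \<in> words m" "w \<in> words m" "prod_list v = prod_list w"
  shows "v = w"
proof -
  have "set v \<subseteq> prime_gens p" "reduced v" "set w \<subseteq> prime_gens p" "length v = length w"
    using assms by (simp_all add: words_def)
  thus ?thesis using word_unique prod_list_primitive assms(3) by blast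
qed

text \<open>The possible products of generators along a closed walk of length \<open>m\<close>, up
  to sign.\<close>

definition Ker :: "nat \<Rightarrow> hq set" where
  "Ker m = {k. odd_real k \<and> hq_norm k = p ^ m \<and> sc k}"

lemma finite_Ker [simp]: "finite (Ker m)"
  by (rule finite_subset[OF _ finite_norm_le[of "p ^ m"]]) (auto simp: Ker_def)

lemma finite_Vs: "finite Vs"
proof -
  define f where "f = (\<lambda>x. (hq0 x mod q, hq1 x mod q, hq2 x mod q, hq3 x mod q))"
  have "Vx x = Vx y" if "x \<in> Lam" "y \<in> Lam" "f x = f y" for x y
  proof -
    have "qdvd q (y - x)" using that(3)[symmetric] by (auto simp: f_def qdvd_def mod_eq_dvd_iff)
    then obtain z where "y = x + of_int q * z" unfolding qdvd_iff by (metis add.commute diff_add_cancel)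
    hence "hq_conj x * y = of_int (hq_norm x) + of_int q * (hq_conj x * z)"
      by (simp only: distrib_left hq_mult_conj of_int_hq_left_commute)
    hence "sc (hq_conj x * y)" by (simp add: sc_def)
    thus ?thesis using Vx_eq_iff that by blast
  qed
  note f_cong = this
  define g where "g = (\<lambda>t. Vx (SOME x. x \<in> Lam \<and> f x = t))"
  have img: "Vx ` Lam = g ` f ` Lam"
    unfolding image_image g_def
  proof (rule image_cong[OF refl])
    fix x assume x: "x \<in> Lam"
    have "(SOME y. y \<in> Lam \<and> f y = f x) \<in> Lam \<and> f (SOME y. y \<in> Lam \<and> f y = f x) = f x"
      by (rule someI[of _ x]) (use x in auto)
    thus "Vx x = Vx (SOME y. y \<in> Lam \<and> f y = f x)" using f_cong[OF x] by simp
  qed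
  have "finite (f ` Lam)"
    by (rule finite_subset[of _ "{0..<q} \<times> {0..<q} \<times> {0..<q} \<times> {0..<q}"])
       (use q_gt_1 in \<open>auto simp: f_def\<close>)
  thus ?thesis unfolding Vs_eq img by simp
qed

text \<open>The product has norm p^2 < q^2, so coordinates divisible by \<open>q\<close> vanish and
  the product is p or -p. Hence two steps lead back to the starting vertex only if the second letter
  undoes the first, and non-backtracking of walks becomes reducedness of words.\<close>

lemma gens_sc_mult:
  assumes s: "s \<in> prime_gens p" and t: "t \<in> prime_gens p" and st: "sc (s * t)"
  shows "t = hq_conj s"
proof -
  have n: "hq_norm (s * t) = p\<^sup>2" using s t by (simp add: hq_norm_mult gen_norm power2_eq_square)
  have z: "v = 0" if "q dvd v" "v\<^sup>2 \<le> hq_norm (s * t)" for v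
  proof (rule ccontr)
    assume "v \<noteq> 0"
    hence "q \<le> \<bar>v\<bar>" using dvd_imp_le_int[OF _ that(1)] q_gt_1 by simp
    hence "p < \<bar>v\<bar>" using p_less_q by simp
    hence "p\<^sup>2 < \<bar>v\<bar>\<^sup>2" using p_gt_1 by (intro power_strict_mono) auto
    thus False using that(2) n by simp
  qed
  have "hq1 (s * t) = 0" "hq2 (s * t) = 0" "hq3 (s * t) = 0"
    using st z unfolding sc_def hq_norm_def by simp_all
  moreover from this have "(hq0 (s * t))\<^sup>2 = p\<^sup>2" using n by (simp add: hq_norm_def)
  ultimately have "qdvd p (s * t)" by (auto simp: qdvd_def power2_eq_iff)
  hence "qdvd p (hq_conj (hq_conj s) * t)" by simp
  hence "hq_conj s = t" by (rule gen_eqI[OF prime_gens_conj[OF s] t])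
  thus ?thesis by simp
qed

text \<open>Letters are chosen one edge at a time. Choosing the conjugate of the preceding letter
  would lead back to the vertex two steps earlier, since it only multiplies an earlier product by
  \<open>p\<close>; the walk forbids that. Indices are taken modulo the length so that
  \<open>k = length xs\<close> records the closing of the walk.\<close>

lemma walk_word_upto:
  assumes walk: "nb_closed_walk Vs Ed xs" and x: "x \<in> Lam" "xs ! 0 = Vx x"
  shows "k \<le> length xs \<Longrightarrow> \<exists>w. set w \<subseteq> prime_gens p \<and> length w = k \<and> reduced w \<and>
           (\<forall>i\<le>k. xs ! (i mod length xs) = Vx (x * prod_list (take i w)))"
proof (induction k)
  case 0
  show ?case using x by (intro exI[of _ "[]"]) auto
next
  case (Suc k)
  let ?n = "length xs"
  obtain w where w: "set w \<subseteq> prime_gens p" "length w = k" "reduced w"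
    "\<And>i. i \<le> k \<Longrightarrow> xs ! (i mod ?n) = Vx (x * prod_list (take i w))"
    using Suc by auto
  have k: "k < ?n" using Suc.prems by simp
  have y: "x * prod_list w \<in> Lam" by (intro Lam_mult x Lam_prod_list w)
  have "Ed (xs ! k) (xs ! ((k + 1) mod ?n))"
    using walk k unfolding nb_closed_walk_def by blast
  moreover have xk: "xs ! k = Vx (x * prod_list w)" using w(4)[of k] w(2) k by simp
  ultimately obtain s where s: "s \<in> prime_gens p" "xs ! ((k + 1) mod ?n) = Vx (x * prod_list w * s)"
    using Ed_iff[OF y] by auto
  have red: "reduced (w @ [s])"
  proof (cases "w = []")
    case False
    have "s \<noteq> hq_conj (last w)"
    proof
      assume sl: "s = hq_conj (last w)"
      define j where "j = k - 1"
      have j: "k = Suc j" using False w(2) by (cases k) (auto simp: j_def)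
      have wj: "w = take j w @ [last w]"
        using False w(2) j by (metis append_butlast_last_id butlast_conv_take diff_Suc_1)
      have lw: "last w \<in> prime_gens p" using w(1) False by auto
      have "x * prod_list w * s = x * (prod_list (take j w) * (last w * s))"
        by (subst wj) (simp add: mult.assoc)
      also have "last w * s = of_int (p ^ 1)" unfolding sl using gen_conj_mult(2)[OF lw] by simp
      also have "x * (prod_list (take j w) * of_int (p ^ 1)) = of_int (p ^ 1) * (x * prod_list (take j w))"
        by (simp only: of_int_hq_commute[of "prod_list (take j w)"] of_int_hq_left_commute)
      finally have "Vx (x * prod_list w * s) = Vx (x * prod_list (take j w))"
        using Vx_p_mult[of "x * prod_list (take j w)" 1] Lam_mult[OF x(1) Lam_prod_list[of "take j w"]] w(1)
        by (metis set_take_subset subset_trans)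
      also have "\<dots> = xs ! j" using w(4)[of j] j k by simp
      finally have "xs ! ((j + 2) mod ?n) = xs ! j" using s(2) j by simp
      thus False using walk k j unfolding nb_closed_walk_def by simp
    qed
    thus ?thesis using w(3) reduced_append by simp
  qed simp
  show ?case
  proof (intro exI[of _ "w @ [s]"] conjI allI impI)
    fix i assume "i \<le> Suc k"
    then consider "i \<le> k" | "i = Suc k" by linarith
    thus "xs ! (i mod ?n) = Vx (x * prod_list (take i (w @ [s])))"
      by cases (use w s in \<open>auto simp: mult.assoc\<close>)
  qed (use w s red in auto)
qed

lemma walk_word:
  assumes walk: "nb_closed_walk Vs Ed xs" and x: "x \<in> Lam" "xs ! 0 = Vx x"
  obtains w where "w \<in> words (length xs)" "prod_list w \<in> Ker (length xs)"
    "\<And>i. i < length xs \<Longrightarrow> xs ! i = Vx (x * prod_list (take i w))"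
proof -
  obtain w where w: "set w \<subseteq> prime_gens p" "length w = length xs" "reduced w"
    "\<And>i. i \<le> length xs \<Longrightarrow> xs ! (i mod length xs) = Vx (x * prod_list (take i w))"
    using walk_word_upto[OF assms order_refl] by blast
  obtain m where m: "hq_norm x = p ^ m" using Lam_norm[OF x(1)] by blast
  have "Vx x = Vx (x * prod_list w)" using w(4)[of "length xs"] w(2) x(2) by simp
  hence "sc (hq_conj x * (x * prod_list w))"
    using Vx_eq_iff x Lam_mult Lam_prod_list w(1) by blast
  hence "sc (of_int (p ^ m) * prod_list w)" by (simp only: mult.assoc[symmetric] hq_mult_conj m)
  hence "sc (prod_list w)" by (simp only: sc_p_power_mult)
  hence "prod_list w \<in> Ker (length xs)"
    using norm_prod_list[OF w(1)] odd_real_prod_list[OF w(1)] w(2) by (simp add: Ker_def)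
  moreover have "w \<in> words (length xs)" using w by (simp add: words_def)
  moreover have "xs ! i = Vx (x * prod_list (take i w))" if "i < length xs" for i
    using w(4)[of i] that by simp
  ultimately show ?thesis using that by blast
qed

definition nonreal :: "hq \<Rightarrow> bool" where
  "nonreal x \<longleftrightarrow> hq1 x \<noteq> 0 \<or> hq2 x \<noteq> 0 \<or> hq3 x \<noteq> 0"

lemma not_nonrealD: "\<not> nonreal x \<Longrightarrow> x = of_int (hq0 x)"
  by (simp add: nonreal_def hq_eq_iff)

lemma primitive_nonreal:
  assumes "\<not> qdvd p x" "hq_norm x = p ^ m" "m > 0"
  shows "nonreal x"
proof (rule ccontr)
  assume "\<not> nonreal x"
  hence x: "x = of_int (hq0 x)" by (rule not_nonrealD)
  hence "(hq0 x)\<^sup>2 = p ^ m" using assms(2) hq_norm_of_int by metis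
  hence "p dvd (hq0 x)\<^sup>2" using assms(3) by (simp add: dvd_power)
  hence "p dvd hq0 x" using prime_p prime_dvd_power by blast
  hence "qdvd p x" by (subst x) (simp add: qdvd_def)
  thus False using assms(1) by simp
qed

definition closed_walks :: "nat \<Rightarrow> hq set set list set" where
  "closed_walks m = {xs. nb_closed_walk Vs Ed xs \<and> length xs = m}"

lemma finite_closed_walks [simp]: "finite (closed_walks m)"
  by (rule finite_subset[OF _ finite_lists_length_eq[OF finite_Vs, of m]])
     (auto simp: closed_walks_def nb_closed_walk_def)

text \<open>A closed walk is determined by its starting vertex and its word, and the word by its
  product, by unique factorization.\<close>

lemma card_closed_walks_le: "card (closed_walks m) \<le> card Vs * card (Ker m)"
proof -
  define r where "r = (\<lambda>v. SOME x. x \<in> Lam \<and> Vx x = v)"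
  have r: "r v \<in> Lam \<and> Vx (r v) = v" if "v \<in> Vs" for v
    unfolding r_def by (rule someI_ex) (use that Vs_eq in auto)
  define R where "R = (\<lambda>xs w. w \<in> words m \<and> prod_list w \<in> Ker m \<and>
    (\<forall>i<m. xs ! i = Vx (r (xs ! 0) * prod_list (take i w))))"
  have "\<exists>w. R xs w" if "xs \<in> closed_walks m" for xs
  proof -
    have w: "nb_closed_walk Vs Ed xs" "length xs = m" using that by (auto simp: closed_walks_def)
    hence "xs ! 0 \<in> Vs" by (auto simp: nb_closed_walk_def)
    thus ?thesis using walk_word[OF w(1), of "r (xs ! 0)"] r w(2) unfolding R_def by metis
  qed
  then obtain f where f: "\<And>xs. xs \<in> closed_walks m \<Longrightarrow> R xs (f xs)" by metis
  have "card (closed_walks m) \<le> card (Vs \<times> Ker m)"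
  proof (rule card_inj_on_le)
    show "inj_on (\<lambda>xs. (xs ! 0, prod_list (f xs))) (closed_walks m)"
    proof (rule inj_onI)
      fix xs ys assume a: "xs \<in> closed_walks m" "ys \<in> closed_walks m"
        "(xs ! 0, prod_list (f xs)) = (ys ! 0, prod_list (f ys))"
      have ff: "f xs = f ys"
      proof (rule words_eqI)
        show "f xs \<in> words m" "f ys \<in> words m" using f a unfolding R_def by blast+
        show "prod_list (f xs) = prod_list (f ys)" using a(3) by blast
      qed
      have "xs ! i = ys ! i" if "i < m" for i
      proof -
        have "xs ! i = Vx (r (xs ! 0) * prod_list (take i (f xs)))"
          "ys ! i = Vx (r (ys ! 0) * prod_list (take i (f ys)))"
          using f a that unfolding R_def by blast+
        moreover have "xs ! 0 = ys ! 0" using a(3) by blast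
        ultimately show ?thesis using ff by metis
      qed
      thus "xs = ys" using a by (intro nth_equalityI) (auto simp: closed_walks_def)
    qed
    show "(\<lambda>xs. (xs ! 0, prod_list (f xs))) ` closed_walks m \<subseteq> Vs \<times> Ker m"
    proof
      fix z assume "z \<in> (\<lambda>xs. (xs ! 0, prod_list (f xs))) ` closed_walks m"
      then obtain xs where xs: "xs \<in> closed_walks m" "z = (xs ! 0, prod_list (f xs))" by blast
      have "prod_list (f xs) \<in> Ker m" using f[OF xs(1)] unfolding R_def by blast
      moreover have "xs ! 0 \<in> Vs" using xs(1) by (auto simp: closed_walks_def nb_closed_walk_def)
      ultimately show "z \<in> Vs \<times> Ker m" using xs(2) by simp
    qed
  qed (simp add: finite_Vs)
  thus ?thesis by (simp add: card_cartesian_product)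
qed

lemma closed_walk_nonreal:
  assumes "xs \<in> closed_walks m"
  shows "\<exists>k\<in>Ker m. nonreal k"
proof -
  have w: "nb_closed_walk Vs Ed xs" "length xs = m" using assms by (auto simp: closed_walks_def)
  hence "xs ! 0 \<in> Vs" "m > 0" by (auto simp: nb_closed_walk_def)
  then obtain x where "x \<in> Lam" "xs ! 0 = Vx x" using Vs_eq by auto
  then obtain w where w: "w \<in> words m" "prod_list w \<in> Ker m" using walk_word[OF w(1)] w(2) by metis
  have "nonreal (prod_list w)"
    by (rule primitive_nonreal[OF prod_list_primitive norm_prod_list])
       (use w \<open>m > 0\<close> in \<open>auto simp: words_def\<close>)
  thus ?thesis using w by blast
qed

text \<open>The girth measured by kernel elements instead of walks; \<open>girth_Sys\<close>
  identifies the two.\<close>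

definition Sys :: "nat \<Rightarrow> bool" where
  "Sys m \<longleftrightarrow> m \<ge> 3 \<and> (\<exists>k\<in>Ker m. nonreal k) \<and> (\<forall>j<m. \<forall>k\<in>Ker j. \<not> nonreal k)"

text \<open>Minimality does both jobs. Were \<open>k\<close> divisible by \<open>p\<close>, the
  quotient would be a nonreal kernel element of smaller length. Were the word to end with the
  inverse of its first letter, conjugation would remove both letters; the shorter product would lie
  in the kernel and so be real, making the whole product divisible by \<open>p\<close>.\<close>

lemma Sys_word:
  assumes sys: "Sys m" and k: "k \<in> Ker m" "nonreal k"
  obtains w where "w \<in> words m" "k = prod_list w \<or> k = - prod_list w"
    "hd w \<noteq> hq_conj (last w)"
proof -
  have prim: "\<not> qdvd p k"
  proof
    assume "qdvd p k"
    then obtain k' where k': "k = of_int p * k'" unfolding qdvd_iff by blast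
    obtain j where j: "m = j + 2" using sys unfolding Sys_def by (metis add.commute le_Suc_ex add_leD1 numeral_3_eq_3 Suc_leD numeral_2_eq_2)
    have "p\<^sup>2 * hq_norm k' = p\<^sup>2 * p ^ j"
      using k(1) unfolding k' Ker_def j by (simp add: hq_norm_mult power_add power2_eq_square)
    hence "hq_norm k' = p ^ j" using p_ne_0 by simp
    moreover have "odd_real k'" using k(1) odd_p by (simp add: k' Ker_def odd_real_of_int_mult)
    moreover have "sc k'" using k(1) sc_p_power_mult[of 1 k'] by (simp add: k' Ker_def)
    ultimately have "k' \<in> Ker j" by (simp add: Ker_def)
    moreover have "nonreal k'" using k(2) by (auto simp: k' nonreal_def)
    moreover have "j < m" using j by simp
    ultimately show False using sys unfolding Sys_def by blast
  qed
  obtain w where w: "set w \<subseteq> prime_gens p" "length w = m" "k = prod_list w \<or> k = - prod_list w"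
    using ex_word[of k m] k(1) prim by (auto simp: Ker_def)
  have primw: "\<not> qdvd p (prod_list w)" using prim w(3) by auto
  have red: "reduced w" by (rule reduced_if_primitive[OF w(1) primw])
  have "hd w \<noteq> hq_conj (last w)"
  proof
    assume eq: "hd w = hq_conj (last w)"
    obtain s v t where svt: "w = s # v @ [t]"
    proof -
      obtain s w' where sw: "w = s # w'" using w(2) sys by (cases w) (auto simp: Sys_def)
      moreover have "w' \<noteq> []" using sw w(2) sys by (auto simp: Sys_def)
      ultimately show ?thesis using that append_butlast_last_id by metis
    qed
    hence st: "s = hq_conj t" using eq by simp
    hence ts: "t = hq_conj s" by simp
    have sg: "s \<in> prime_gens p" and vg: "set v \<subseteq> prime_gens p" using w(1) svt by auto
    have scw: "sc (prod_list w)" using k(1) w(3) by (auto simp: Ker_def)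
    have "sc (hq_conj s * prod_list w * hq_conj (hq_conj s))" by (rule sc_between[OF scw])
    also have "hq_conj s * prod_list w * hq_conj (hq_conj s) = (hq_conj s * s) * prod_list v * (hq_conj s * s)"
      unfolding svt ts by (simp add: mult.assoc)
    also have "\<dots> = of_int (p ^ 2) * prod_list v"
      unfolding gen_conj_mult[OF sg] by (simp add: of_int_hq_commute[of "prod_list v"] power2_eq_square mult.assoc of_int_hq_left_commute[of "prod_list v"])
    finally have "sc (prod_list v)" by (simp only: sc_p_power_mult)
    hence "prod_list v \<in> Ker (length v)"
      using norm_prod_list[OF vg] odd_real_prod_list[OF vg] by (simp add: Ker_def)
    moreover have "length v < m" using w(2) svt by simp
    ultimately have "\<not> nonreal (prod_list v)" using sys unfolding Sys_def by blast
    hence vr: "prod_list v = of_int (hq0 (prod_list v))" by (rule not_nonrealD)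
    have "prod_list w = s * of_int (hq0 (prod_list v)) * hq_conj s"
      unfolding svt ts using vr by (simp add: mult.assoc)
    also have "\<dots> = of_int (hq0 (prod_list v)) * (s * hq_conj s)"
      by (simp only: of_int_hq_commute[of s] mult.assoc)
    finally have "qdvd p (prod_list w)" using gen_conj_mult(2)[OF sg] by (simp add: qdvd_def)
    thus False using primw by simp
  qed
  thus ?thesis using that w red by (auto simp: words_def)
qed

text \<open>Converse of \<open>walk_word\<close>. The condition on \<open>hd w\<close> and
  \<open>last w\<close> is reducedness across the seam; together with \<open>gens_sc_mult\<close> it
  excludes a return after two steps everywhere on the closed walk.\<close>

lemma word_closed_walk:
  assumes w: "w \<in> words m" "sc (prod_list w)" "hd w \<noteq> hq_conj (last w)" "m \<ge> 3" and x: "x \<in> Lam"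
  shows "map (\<lambda>i. Vx (x * prod_list (take i w))) [0..<m] \<in> closed_walks m"
proof -
  define y where "y = (\<lambda>i. x * prod_list (take i w))"
  define xs where "xs = map (\<lambda>i. Vx (y i)) [0..<m]"
  have wg: "set w \<subseteq> prime_gens p" "length w = m" "reduced w" using w(1) by (auto simp: words_def)
  have yL: "y i \<in> Lam" for i
    unfolding y_def by (intro Lam_mult x Lam_prod_list) (use wg in \<open>meson set_take_subset subset_trans\<close>)
  have gen: "w ! i \<in> prime_gens p" if "i < m" for i using wg that by auto
  have nx: "xs ! i = Vx (y i)" if "i < m" for i using that by (simp add: xs_def)
  have ySuc: "y (Suc i) = y i * w ! i" if "i < m" for i
    using that wg by (simp add: y_def take_Suc_conv_app_nth mult.assoc)
  have ym: "Vx (y m) = Vx (y 0)"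
  proof -
    obtain j where j: "hq_norm x = p ^ j" using Lam_norm[OF x] by blast
    have "hq_conj (y 0) * y m = of_int (hq_norm x) * prod_list w"
      using wg by (simp add: y_def mult.assoc[symmetric] hq_mult_conj)
    hence "sc (hq_conj (y 0) * y m)" using w(2) sc_mult[OF sc_of_int] by simp
    thus ?thesis using Vx_eq_iff yL by metis
  qed
  have nxt: "xs ! (Suc i mod m) = Vx (y (Suc i))" if "i < m" for i
    using that nx ym w(4) by (cases "Suc i = m") auto
  have adj: "Ed (xs ! i) (xs ! (Suc i mod m))" if "i < m" for i
    unfolding nx[OF that] nxt[OF that] ySuc[OF that] using Ed_iff[OF yL] gen[OF that] by blast
  have turn: "w ! (Suc i mod m) \<noteq> hq_conj (w ! i)" if "i < m" for i
  proof (cases "Suc i = m")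
    case True
    hence "w ! i = last w" using wg w(4) by (metis Suc_diff_1 diff_Suc_1 last_conv_nth length_0_conv nat.distinct(1))
    moreover have "w ! 0 = hd w" using wg w(4) by (cases w) auto
    ultimately show ?thesis using w(3) True by simp
  next
    case False
    hence i: "Suc i < m" using that by simp
    have "w = take i w @ w ! i # w ! Suc i # drop (Suc (Suc i)) w"
      using i wg by (simp add: Cons_nth_drop_Suc id_take_nth_drop[symmetric])
    hence "reduced (take i w @ w ! i # w ! Suc i # drop (Suc (Suc i)) w)" using wg by simp
    thus ?thesis using reduced_append i by simp
  qed
  have nb: "xs ! (Suc (Suc i) mod m) \<noteq> xs ! i" if i: "i < m" for i
  proof
    let ?j = "Suc i mod m"
    assume eq: "xs ! (Suc (Suc i) mod m) = xs ! i"
    have jm: "?j < m" using w(4) by simp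
    have "xs ! (Suc (Suc i) mod m) = xs ! (Suc ?j mod m)" by (simp add: mod_Suc_eq)
    also have "\<dots> = Vx (y ?j * w ! ?j)" using nxt[OF jm] ySuc[OF jm] by simp
    also have "\<dots> = Vx (y i * w ! i * w ! ?j)"
      by (rule Vx_mult_right) (use yL gen i jm Lam_gen Lam_mult nx nxt ySuc in \<open>auto\<close>)
    finally have "Vx (y i) = Vx (y i * (w ! i * w ! ?j))" using eq nx[OF i] by (simp add: mult.assoc)
    hence "sc (hq_conj (y i) * (y i * (w ! i * w ! ?j)))"
      using Vx_eq_iff yL Lam_mult Lam_gen gen i jm by metis
    hence "sc (of_int (hq_norm (y i)) * (w ! i * w ! ?j))"
      by (simp add: mult.assoc[symmetric] hq_mult_conj)
    moreover obtain j where "hq_norm (y i) = p ^ j" using Lam_norm yL by blast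
    ultimately have "sc (w ! i * w ! ?j)" by (metis sc_p_power_mult)
    thus False using gens_sc_mult gen i jm turn[OF i] by blast
  qed
  have "nb_closed_walk Vs Ed xs"
    unfolding nb_closed_walk_def
  proof (intro conjI allI impI)
    show "xs \<noteq> []" using w(4) by (auto simp: xs_def)
    show "set xs \<subseteq> Vs" using yL unfolding Vs_eq xs_def by auto
  qed (use adj nb in \<open>auto simp: xs_def\<close>)
  thus ?thesis unfolding closed_walks_def xs_def y_def by simp
qed

text \<open>Two letters s and t leading from one vertex to the same neighbour make
  \<open>hq_conj s * t\<close> scalar modulo \<open>q\<close>, so they coincide by
  \<open>gens_sc_mult\<close>. The vertex with index \<open>m\<close> is missing from the
  hypothesis, but for both words it is the starting vertex.\<close>

lemma word_of_walk_unique: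
  assumes v: "v \<in> words m" and w: "w \<in> words m" and x: "x \<in> Lam" and sv: "sc (prod_list v)" "sc (prod_list w)"
    and eq: "\<And>i. i < m \<Longrightarrow> Vx (x * prod_list (take i v)) = Vx (x * prod_list (take i w))"
  shows "v = w"
proof -
  have g: "set v \<subseteq> prime_gens p" "length v = m" "set w \<subseteq> prime_gens p" "length w = m"
    using v w by (auto simp: words_def)
  have eq': "Vx (x * prod_list (take i v)) = Vx (x * prod_list (take i w))" if "i \<le> m" for i
  proof (cases "i = m")
    case True
    have "Vx (x * prod_list u) = Vx x" if "sc (prod_list u)" "set u \<subseteq> prime_gens p" for u
    proof -
      have "sc (hq_conj x * (x * prod_list u))"
        using that sc_mult[OF sc_of_int] by (simp add: mult.assoc[symmetric] hq_mult_conj)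
      thus ?thesis using Vx_eq_iff x Lam_mult Lam_prod_list that(2) by metis
    qed
    thus ?thesis using True sv g by simp
  qed (use that eq in simp)
  have "take i v = take i w" if "i \<le> m" for i
    using that
  proof (induction i)
    case (Suc i)
    define z where "z = x * prod_list (take i v)"
    have zL: "z \<in> Lam"
      unfolding z_def by (intro Lam_mult x Lam_prod_list) (use g in \<open>meson set_take_subset subset_trans\<close>)
    have s: "v ! i \<in> prime_gens p" "w ! i \<in> prime_gens p" using g Suc.prems by auto
    have "Vx (z * v ! i) = Vx (z * w ! i)"
      using eq'[OF Suc.prems] Suc g by (simp add: take_Suc_conv_app_nth z_def mult.assoc)
    hence "sc (hq_conj (z * v ! i) * (z * w ! i))" using Vx_eq_iff zL s Lam_gen Lam_mult by blast
    moreover have "hq_conj (z * v ! i) * (z * w ! i) = hq_conj (v ! i) * ((hq_conj z * z) * w ! i)"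
      by (simp only: hq_conj_mult mult.assoc)
    ultimately have "sc (of_int (hq_norm z) * (hq_conj (v ! i) * w ! i))"
      by (simp only: hq_mult_conj of_int_hq_left_commute)
    moreover obtain j where "hq_norm z = p ^ j" using Lam_norm zL by blast
    ultimately have "sc (hq_conj (v ! i) * w ! i)" by (metis sc_p_power_mult)
    hence "w ! i = hq_conj (hq_conj (v ! i))" using gens_sc_mult prime_gens_conj s by blast
    thus ?case using Suc g by (simp add: take_Suc_conv_app_nth)
  qed simp
  from this[of m] show ?thesis using g by simp
qed

text \<open>An element and its negative come from the same word, so only those with positive real
  part are counted. Starting vertex and word can be read off the walk, so nothing else is
  identified.\<close>

lemma card_closed_walks_ge:
  assumes sys: "Sys m"
  shows "card Vs * card {k \<in> Ker m. nonreal k \<and> hq0 k > 0} \<le> card (closed_walks m)"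
proof -
  let ?K = "{k \<in> Ker m. nonreal k \<and> hq0 k > 0}"
  define r where "r = (\<lambda>v. SOME x. x \<in> Lam \<and> Vx x = v)"
  have r: "r v \<in> Lam \<and> Vx (r v) = v" if "v \<in> Vs" for v
    unfolding r_def by (rule someI_ex) (use that Vs_eq in auto)
  have m3: "m \<ge> 3" using sys by (simp add: Sys_def)
  define R where "R = (\<lambda>k w. w \<in> words m \<and> (k = prod_list w \<or> k = - prod_list w) \<and> hd w \<noteq> hq_conj (last w))"
  have "\<exists>w. R k w" if "k \<in> ?K" for k
    using Sys_word[OF sys, of k] that unfolding R_def by blast
  then obtain f where f: "\<And>k. k \<in> ?K \<Longrightarrow> R k (f k)" by metis
  have scf: "sc (prod_list (f k))" if "k \<in> ?K" for k
    using f[OF that] that unfolding R_def Ker_def by (metis (mono_tags, lifting) mem_Collect_eq sc_uminus)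
  define F where "F = (\<lambda>(v, k). map (\<lambda>i. Vx (r v * prod_list (take i (f k)))) [0..<m])"
  have "card (Vs \<times> ?K) \<le> card (closed_walks m)"
  proof (rule card_inj_on_le[of F])
    show "inj_on F (Vs \<times> ?K)"
    proof (rule inj_onI)
      fix a b assume ab: "a \<in> Vs \<times> ?K" "b \<in> Vs \<times> ?K" "F a = F b"
      obtain v k v' k' where vk: "a = (v, k)" "b = (v', k')" by (cases a; cases b)
      have mem: "v \<in> Vs" "v' \<in> Vs" "k \<in> ?K" "k' \<in> ?K" using ab vk by auto
      have e: "Vx (r v * prod_list (take i (f k))) = Vx (r v' * prod_list (take i (f k')))" if "i < m" for i
        using arg_cong[OF ab(3), of "\<lambda>l. l ! i"] that vk by (simp add: F_def)
      have vv: "v = v'" using e[of 0] m3 r mem by simp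
      have "f k = f k'"
        by (rule word_of_walk_unique[of _ m _ "r v"])
           (use f scf mem r e vv in \<open>auto simp: R_def\<close>)
      hence "k = k' \<or> k = - k'" using f[OF mem(3)] f[OF mem(4)] unfolding R_def by (metis minus_minus)
      hence "k = k'" using mem by auto
      thus "a = b" using vk vv by simp
    qed
    show "F ` (Vs \<times> ?K) \<subseteq> closed_walks m"
    proof
      fix z assume "z \<in> F ` (Vs \<times> ?K)"
      then obtain v k where vk: "v \<in> Vs" "k \<in> ?K" "z = F (v, k)" by auto
      have "r v \<in> Lam" using r vk by blast
      thus "z \<in> closed_walks m"
        unfolding vk(3) F_def prod.case using f[OF vk(2)] scf[OF vk(2)] m3
        by (intro word_closed_walk) (auto simp: R_def)
    qed
  qed simp
  thus ?thesis by (simp add: card_cartesian_product)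
qed

lemma girth_Sys:
  assumes "Sys m"
  shows "girth Vs Ed = m"
proof -
  have ne: "closed_walks m \<noteq> {}"
  proof -
    obtain k where k: "k \<in> Ker m" "nonreal k" using assms unfolding Sys_def by blast
    obtain w where "w \<in> words m" "k = prod_list w \<or> k = - prod_list w" "hd w \<noteq> hq_conj (last w)"
      using Sys_word[OF assms k] by blast
    moreover from this have "sc (prod_list w)" using k by (auto simp: Ker_def)
    ultimately show ?thesis using word_closed_walk[OF _ _ _ _ Lam_1] assms unfolding Sys_def by blast
  qed
  show ?thesis
    unfolding girth_def
  proof (rule Least_equality)
    show "\<exists>xs. nb_closed_walk Vs Ed xs \<and> length xs = m" using ne by (auto simp: closed_walks_def)
    fix j assume "\<exists>xs. nb_closed_walk Vs Ed xs \<and> length xs = j"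
    hence "\<exists>k\<in>Ker j. nonreal k" using closed_walk_nonreal by (auto simp: closed_walks_def)
    thus "m \<le> j" using assms unfolding Sys_def by (metis not_less)
  qed
qed

text \<open>An oriented cycle is a rotation class of closed walks, consisting of at least one and at
  most \<open>m\<close> of them; this is the source of the factor \<open>m\<close>.\<close>

theorem kiss_bounds:
  assumes "Sys m"
  shows "kiss Vs Ed \<le> card Vs * card (Ker m)"
    and "card Vs * card {k \<in> Ker m. nonreal k \<and> hq0 k > 0} \<le> m * kiss Vs Ed"
proof -
  define C where "C = (\<lambda>xs :: hq set set list. {rotate k xs | k. True})"
  have cyc: "shortest_oriented_cycles Vs Ed = C ` closed_walks m"
    unfolding shortest_oriented_cycles_def girth_Sys[OF assms] closed_walks_def C_def by auto
  have "kiss Vs Ed \<le> card (closed_walks m)"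
    unfolding kiss_def cyc by (rule card_image_le) simp
  thus "kiss Vs Ed \<le> card Vs * card (Ker m)" using card_closed_walks_le order_trans by blast
  have cardC: "finite (C xs) \<and> card (C xs) \<le> m" if "xs \<in> closed_walks m" for xs
  proof -
    have "C xs = (\<lambda>k. rotate k xs) ` {..<m}"
    proof -
      have l: "length xs = m" "m > 0" using that assms by (auto simp: closed_walks_def Sys_def)
      have "rotate k xs \<in> (\<lambda>k. rotate k xs) ` {..<m}" for k
        using l rotate_conv_mod[of k xs] by (intro image_eqI[of _ _ "k mod m"]) auto
      thus ?thesis by (auto simp: C_def)
    qed
    thus ?thesis using card_image_le[of "{..<m}" "\<lambda>k. rotate k xs"] by simp
  qed
  have "xs \<in> C xs" for xs unfolding C_def by (auto intro: exI[of _ 0])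
  hence "closed_walks m \<subseteq> \<Union> (C ` closed_walks m)" by blast
  hence "card (closed_walks m) \<le> card (\<Union> (C ` closed_walks m))"
    using cardC by (intro card_mono) auto
  also have "\<dots> \<le> (\<Sum>c\<in>C ` closed_walks m. card c)"
    using cardC by (intro card_Union_le_sum_card_weak) auto
  also have "\<dots> \<le> (\<Sum>c\<in>C ` closed_walks m. m)" using cardC by (intro sum_mono) auto
  also have "\<dots> = m * kiss Vs Ed" unfolding kiss_def cyc by simp
  finally show "card Vs * card {k \<in> Ker m. nonreal k \<and> hq0 k > 0} \<le> m * kiss Vs Ed"
    using card_closed_walks_ge[OF assms] by linarith
qed

end

section \<open>The number of vertices\<close>

context lps
begin

text \<open>A reduced word can be extended at the front by every generator except the conjugate of
  its head, and there are at least p + 1 generators.\<close>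

lemma words_growth: "nat p * card (words m) \<le> card (words (Suc m))"
proof -
  define A where "A = (\<lambda>w. prime_gens p - (if w = [] then {} else {hq_conj (hd w)}))"
  have cA: "nat p \<le> card (A w)" for w
    using card_prime_gens_ge card_Diff_singleton_if[of "prime_gens p" "hq_conj (hd w)"]
    by (auto simp: A_def)
  have "nat p * card (words m) = (\<Sum>w\<in>words m. nat p)" by simp
  also have "\<dots> \<le> (\<Sum>w\<in>words m. card (A w))" by (intro sum_mono cA)
  also have "\<dots> = card (SIGMA w : words m. A w)"
    by (intro card_SigmaI[symmetric]) (auto simp: A_def)
  also have "\<dots> \<le> card (words (Suc m))"
  proof (rule card_inj_on_le[of "\<lambda>(w, s). s # w"])
    show "(\<lambda>(w, s). s # w) ` (SIGMA w : words m. A w) \<subseteq> words (Suc m)"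
    proof safe
      fix w s assume "w \<in> words m" "s \<in> A w"
      thus "s # w \<in> words (Suc m)"
        by (cases w) (auto simp: words_def A_def)
    qed
  qed (auto simp: inj_on_def)
  finally show ?thesis .
qed

lemma words_growth_power: "nat p ^ u * card (words m) \<le> card (words (m + u))"
proof (induction u)
  case (Suc u)
  have "nat p ^ Suc u * card (words m) \<le> nat p * card (words (m + u))" using Suc by simp
  also have "\<dots> \<le> card (words (m + Suc u))" using words_growth[of "m + u"] by simp
  finally show ?case .
qed simp

lemma card_words_ge: "nat p ^ t \<le> card (words t)"
proof -
  have "words 0 = {[]}" by (auto simp: words_def)
  thus ?thesis using words_growth_power[of t 0] by simp
qed

text \<open>Two reduced words ending at the same vertex differ, after their common prefix, by a reduced
  word in the kernel.\<close>

lemma collisions_le: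
  "card {(v, w). v \<in> words t \<and> w \<in> words t \<and> Vx (prod_list v) = Vx (prod_list w)}
     \<le> (\<Sum>u\<le>t. card (words (t - u)) * card (Ker (2 * u)))" (is "card ?P \<le> _")
proof -
  define R where "R = (\<lambda>(v, w) (u, c, k). \<exists>v' w'. v = c @ v' \<and> w = c @ w' \<and> u \<le> t \<and>
      length v' = u \<and> length w' = u \<and> c \<in> words (t - u) \<and>
      rev (map hq_conj v') @ w' \<in> words (2 * u) \<and> k = prod_list (rev (map hq_conj v') @ w') \<and> sc k)"
  have ex: "\<exists>y. R x y" if x: "x \<in> ?P" for x
  proof -
    obtain v w where vw: "x = (v, w)" "v \<in> words t" "w \<in> words t" "Vx (prod_list v) = Vx (prod_list w)"
      using x by auto
    \<comment> \<open>After removal of the longest common prefix the next letters differ, so the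
      inverse of one remainder followed by the other is again reduced.\<close>
    define c where "c = longest_common_prefix v w"
    obtain v' w' where v': "v = c @ v'" and w': "w = c @ w'"
      unfolding c_def by (metis longest_common_prefix_prefix1 longest_common_prefix_prefix2 prefixE)
    have hd: "hd v' \<noteq> hd w'" if "v' \<noteq> []" "w' \<noteq> []"
    proof
      assume "hd v' = hd w'"
      hence "prefix (c @ [hd v']) v" "prefix (c @ [hd v']) w"
        unfolding v' w' using that by (metis list.collapse Cons_prefix_Cons Nil_prefix same_prefix_prefix)+
      hence "prefix (c @ [hd v']) c" unfolding c_def by (rule longest_common_prefix_max_prefix)
      thus False using prefix_length_le by fastforce
    qed
    define u where "u = length v'"
    have len: "length v = t" "length w = t" using vw by (auto simp: words_def)
    hence u: "u \<le> t" "length w' = u" "length c = t - u" unfolding u_def v' w' by auto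
    have gens: "set c \<subseteq> prime_gens p" "set v' \<subseteq> prime_gens p" "set w' \<subseteq> prime_gens p"
      using vw unfolding words_def v' w' by auto
    have red: "reduced c" "reduced v'" "reduced w'"
      using vw unfolding words_def v' w' by (auto simp: reduced_append)
    have "reduced (rev (map hq_conj v') @ w')"
    proof -
      have "hd w' \<noteq> hq_conj (last (rev (map hq_conj v')))" if "v' \<noteq> []" "w' \<noteq> []"
        using hd[OF that] that by (simp add: last_rev hd_map)
      thus ?thesis unfolding reduced_append reduced_rev_conj using red by auto
    qed
    hence wd: "rev (map hq_conj v') @ w' \<in> words (2 * u)"
      using gens u by (auto simp: words_def u_def intro: prime_gens_conj)
    have "sc (hq_conj (prod_list v) * prod_list w)"
      using vw Vx_eq_iff Lam_prod_list unfolding words_def by blast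
    also have "hq_conj (prod_list v) * prod_list w =
        hq_conj (prod_list v') * ((hq_conj (prod_list c) * prod_list c) * prod_list w')"
      unfolding v' w' by (simp add: hq_conj_mult mult.assoc)
    also have "\<dots> = of_int (p ^ (t - u)) * (hq_conj (prod_list v') * prod_list w')"
      unfolding hq_mult_conj norm_prod_list[OF gens(1)] u(3) by (rule of_int_hq_left_commute)
    finally have "sc (hq_conj (prod_list v') * prod_list w')" by (simp only: sc_p_power_mult)
    hence "sc (prod_list (rev (map hq_conj v') @ w'))" by (simp add: conj_prod_list)
    moreover have "c \<in> words (t - u)" using gens red u by (simp add: words_def)
    ultimately have "R x (u, c, prod_list (rev (map hq_conj v') @ w'))"
      unfolding R_def vw(1) prod.case
      by (intro exI[of _ v'] exI[of _ w'] conjI v' w' u wd refl) (simp_all add: u_def)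
    thus ?thesis by blast
  qed
  define f where "f = (\<lambda>x. SOME y. R x y)"
  have f: "R x (f x)" if "x \<in> ?P" for x
    unfolding f_def using someI_ex[OF ex[OF that]] .
  \<comment> \<open>The triple determines the pair: \<open>k\<close> has only one reduced word, and
    this word is cut at position \<open>u\<close>.\<close>
  have inj: "x = y" if "R x z" "R y z" for x y z
  proof -
    obtain v w v2 w2 u c k where xyz: "x = (v, w)" "y = (v2, w2)" "z = (u, c, k)"
      by (cases x; cases y; cases z)
    obtain v' w' where 1: "v = c @ v'" "w = c @ w'" "length v' = u" "length w' = u"
      "rev (map hq_conj v') @ w' \<in> words (2 * u)" "k = prod_list (rev (map hq_conj v') @ w')"
      using \<open>R x z\<close> unfolding xyz R_def by auto
    obtain v2' w2' where 2: "v2 = c @ v2'" "w2 = c @ w2'" "length v2' = u" "length w2' = u"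
      "rev (map hq_conj v2') @ w2' \<in> words (2 * u)" "k = prod_list (rev (map hq_conj v2') @ w2')"
      using \<open>R y z\<close> unfolding xyz R_def by auto
    have "rev (map hq_conj v') @ w' = rev (map hq_conj v2') @ w2'"
      by (rule words_eqI[OF 1(5) 2(5)]) (use 1(6) 2(6) in simp)
    hence "rev (map hq_conj v') = rev (map hq_conj v2')" "w' = w2'"
      using 1 2 by (simp_all add: append_eq_append_conv)
    moreover have "inj hq_conj" by (metis hq_conj_conj injI)
    ultimately show ?thesis using 1 2 xyz by (simp add: inj_map_eq_map)
  qed
  have "card ?P \<le> card (SIGMA u : {..t}. words (t - u) \<times> Ker (2 * u))"
  proof (rule card_inj_on_le[of f])
    show "inj_on f ?P" using inj f by (metis (no_types, lifting) inj_onI)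
    show "f ` ?P \<subseteq> (SIGMA u : {..t}. words (t - u) \<times> Ker (2 * u))"
    proof
      fix z assume "z \<in> f ` ?P"
      then obtain x where x: "x \<in> ?P" "z = f x" by blast
      obtain v w u c k where xz: "x = (v, w)" "z = (u, c, k)" by (cases x; cases z)
      have "R (v, w) (u, c, k)" using f[OF x(1)] x(2) xz by simp
      then obtain w0 where w0: "u \<le> t" "c \<in> words (t - u)" "w0 \<in> words (2 * u)" "k = prod_list w0" "sc k"
        unfolding R_def by auto
      hence "k \<in> Ker (2 * u)"
        using norm_prod_list[of w0] odd_real_prod_list[of w0] by (auto simp: words_def Ker_def)
      thus "z \<in> (SIGMA u : {..t}. words (t - u) \<times> Ker (2 * u))" using w0 xz by simp
    qed
  qed auto
  also have "\<dots> = (\<Sum>u\<le>t. card (words (t - u) \<times> Ker (2 * u)))" by (rule card_SigmaI) auto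
  finally show ?thesis by (simp add: card_cartesian_product)
qed

text \<open>Cauchy-Schwarz for the endpoints of all reduced words of length \<open>t\<close>. The
  factor \<open>card (words (t - u))\<close> in the collision count is at most
  \<open>card (words t)\<close> divided by p^u, and one factor \<open>card (words t)\<close> then
  cancels.\<close>

lemma card_Vs_ge:
  "real_of_int p ^ t \<le> card Vs * (\<Sum>u\<le>t. card (Ker (2 * u)) / real_of_int p ^ u)"
proof -
  let ?P = "{(v, w). v \<in> words t \<and> w \<in> words t \<and> Vx (prod_list v) = Vx (prod_list w)}"
  define W where "W = real (card (words t))"
  have p0: "real_of_int p > 0" using p_gt_1 by simp
  have Wge: "W \<ge> real_of_int p ^ t"
  proof -
    have "real (nat p ^ t) \<le> W" unfolding W_def using card_words_ge[of t] by linarith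
    thus ?thesis using p_gt_1 by simp
  qed
  hence Wpos: "W > 0" using p0 by (meson less_le_trans zero_less_power)
  have "(card (words t))\<^sup>2 \<le> card Vs * card ?P"
  proof (rule card_squared_le_card_collisions)
    show "(\<lambda>w. Vx (prod_list w)) ` words t \<subseteq> Vs"
      using Lam_prod_list by (auto simp: Vs_eq words_def)
  qed (simp_all add: finite_Vs)
  also have "\<dots> \<le> card Vs * (\<Sum>u\<le>t. card (words (t - u)) * card (Ker (2 * u)))"
    using collisions_le by (rule mult_left_mono) simp
  finally have "real ((card (words t))\<^sup>2) \<le> real (card Vs * (\<Sum>u\<le>t. card (words (t - u)) * card (Ker (2 * u))))"
    by (rule of_nat_mono)
  hence "W * W \<le> card Vs * (\<Sum>u\<le>t. real (card (words (t - u))) * card (Ker (2 * u)))"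
    by (simp add: W_def power2_eq_square)
  also have "\<dots> \<le> card Vs * (\<Sum>u\<le>t. W * (card (Ker (2 * u)) / real_of_int p ^ u))"
  proof (intro mult_left_mono sum_mono)
    fix u assume "u \<in> {..t}"
    hence "nat p ^ u * card (words (t - u)) \<le> card (words t)" using words_growth_power[of u "t - u"] by simp
    hence "real (nat p ^ u * card (words (t - u))) \<le> W" unfolding W_def by (rule of_nat_mono)
    hence "real (card (words (t - u))) \<le> W / real_of_int p ^ u"
      using p0 p_gt_1 by (simp add: field_simps)
    hence "real (card (words (t - u))) * card (Ker (2 * u)) \<le> W / real_of_int p ^ u * card (Ker (2 * u))"
      by (intro mult_right_mono) auto
    thus "real (card (words (t - u))) * card (Ker (2 * u)) \<le> W * (card (Ker (2 * u)) / real_of_int p ^ u)"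
      by simp
  qed auto
  also have "\<dots> = W * (card Vs * (\<Sum>u\<le>t. card (Ker (2 * u)) / real_of_int p ^ u))"
    by (simp add: sum_distrib_left mult.left_commute)
  finally show ?thesis using Wge Wpos by simp
qed

text \<open>A vertex accounts for the \<open>q - 1\<close> distinct scalar multiples of a residue class modulo \<open>q\<close>.\<close>

lemma card_Vs_le: "card Vs * nat (q - 1) \<le> nat q ^ 4"
proof -
  define r where "r = (\<lambda>v. SOME x. x \<in> Lam \<and> Vx x = v)"
  have r: "r v \<in> Lam \<and> Vx (r v) = v" if "v \<in> Vs" for v
    unfolding r_def by (rule someI_ex) (use that Vs_eq in auto)
  define F where "F = (\<lambda>(v, c :: int). (c * hq0 (r v) mod q, c * hq1 (r v) mod q, c * hq2 (r v) mod q, c * hq3 (r v) mod q))"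
  have nq: "\<not> q dvd hq_norm (r v)" if "v \<in> Vs" for v
    using r[OF that] Lam_norm q_not_dvd_p_power by metis
  have "card (Vs \<times> {1..<q}) \<le> card ({0..<q} \<times> {0..<q} \<times> {0..<q} \<times> {0..<q})"
  proof (rule card_inj_on_le[of F])
    show "inj_on F (Vs \<times> {1..<q})"
    proof (rule inj_onI)
      fix a b assume ab: "a \<in> Vs \<times> {1..<q}" "b \<in> Vs \<times> {1..<q}" "F a = F b"
      obtain v c w d where vc: "a = (v, c)" "b = (w, d)" by (cases a; cases b)
      define x y where "x = r v" and "y = r w"
      have xy: "x \<in> Lam" "y \<in> Lam" "Vx x = v" "Vx y = w"
        unfolding x_def y_def using r ab vc by auto
      have "qdvd q (of_int d * y - of_int c * x)"
        using ab(3)[symmetric] unfolding vc F_def x_def y_def by (simp add: qdvd_def mod_eq_dvd_iff)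
      then obtain z where z: "of_int d * y = of_int c * x + of_int q * z"
        unfolding qdvd_iff by (metis add.commute diff_add_cancel)
      have nd: "\<not> q dvd e" if "e \<in> {1..<q}" for e using that zdvd_not_zless by auto
      have "of_int d * (hq_conj x * y) = hq_conj x * (of_int d * y)"
        by (rule of_int_hq_left_commute[symmetric])
      also have "\<dots> = of_int c * of_int (hq_norm x) + of_int q * (hq_conj x * z)"
        unfolding z by (simp only: distrib_left of_int_hq_left_commute hq_mult_conj)
      finally have e: "of_int d * (hq_conj x * y) = of_int (c * hq_norm x) + of_int q * (hq_conj x * z)"
        by simp
      have "sc (of_int d * (hq_conj x * y))" unfolding e by (simp add: sc_def del: of_int_mult)
      hence "sc (hq_conj x * y)" using sc_of_int_mult nd ab vc by auto
      hence vw: "v = w" using Vx_eq_iff xy by metis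
      hence "x = y" by (simp add: x_def y_def)
      hence "q dvd hq0 (of_int d * (hq_conj x * x) - of_int (c * hq_norm x))"
        using e by (simp add: del: of_int_mult)
      hence "q dvd (d - c) * hq_norm x"
        unfolding hq_mult_conj by (simp add: algebra_simps)
      hence "q dvd d - c"
        using nq[of v] ab vc prime_q prime_dvd_mult_iff unfolding x_def by blast
      have "d - c = 0"
      proof (rule ccontr)
        assume "d - c \<noteq> 0"
        hence "q \<le> \<bar>d - c\<bar>" using dvd_imp_le_int[OF _ \<open>q dvd d - c\<close>] q_gt_1 by simp
        moreover have "1 \<le> c" "c < q" "1 \<le> d" "d < q" using ab vc by auto
        ultimately show False by linarith
      qed
      hence "c = d" by simp
      thus "a = b" using vc vw by simp
    qed
    show "F ` (Vs \<times> {1..<q}) \<subseteq> {0..<q} \<times> {0..<q} \<times> {0..<q} \<times> {0..<q}"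
      using q_gt_1 by (auto simp: F_def)
  qed simp
  thus ?thesis by (simp add: card_cartesian_product numeral_eq_Suc mult.assoc)
qed

end

section \<open>Upper bounds for representation numbers\<close>

definition ndiv :: "int \<Rightarrow> nat" where
  "ndiv n = card {d. 0 < d \<and> d dvd n}"

lemma finite_pos_divisors: "n > 0 \<Longrightarrow> finite {d :: int. 0 < d \<and> d dvd n}"
  by (rule finite_subset[of _ "{0..n}"]) (auto dest: zdvd_imp_le)

lemma ndiv_mono:
  assumes "n > 0" "m dvd n"
  shows "ndiv m \<le> ndiv n"
  unfolding ndiv_def by (rule card_mono) (use assms finite_pos_divisors dvd_trans in auto)

lemma card_le_fibers:
  assumes "finite B" "\<And>a. a \<in> A \<Longrightarrow> f a \<in> B" "finite A"
    "\<And>b. b \<in> B \<Longrightarrow> card {a \<in> A. f a = b} \<le> k"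
  shows "card A \<le> card B * k"
proof -
  have "A = (\<Union>b\<in>B. {a \<in> A. f a = b})" using assms(2) by auto
  hence "card A = card (\<Union>b\<in>B. {a \<in> A. f a = b})" by (rule arg_cong)
  also have "\<dots> \<le> (\<Sum>b\<in>B. card {a \<in> A. f a = b})" by (rule card_UN_le[OF assms(1)])
  also have "\<dots> \<le> (\<Sum>b\<in>B. k)" using assms(4) by (intro sum_mono) auto
  finally show ?thesis by simp
qed

text \<open>A root \<open>x\<close> is determined up to \<open>n / 2\<close> by its greatest common divisor with \<open>n\<close>
  after subtracting a fixed root.\<close>

lemma card_sqrt_mod:
  fixes n c :: int
  assumes n: "n > 0" and c: "coprime c n"
  shows "card {x \<in> {0..<n}. n dvd x\<^sup>2 - c} \<le> 3 * ndiv n"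
proof (cases "{x \<in> {0..<n}. n dvd x\<^sup>2 - c} = {}")
  case False
  let ?A = "{x \<in> {0..<n}. n dvd x\<^sup>2 - c}"
  obtain x0 where x0: "n dvd x0\<^sup>2 - c" using False by blast
  have cop: "coprime x0 n"
  proof (rule coprimeI)
    fix d assume "d dvd x0" "d dvd n"
    hence "d dvd x0\<^sup>2" "d dvd x0\<^sup>2 - c" using x0 by (auto simp: power2_eq_square intro: dvd_trans)
    hence "d dvd c" by (metis dvd_diff_right_iff)
    thus "is_unit d" using c \<open>d dvd n\<close> by (meson coprime_common_divisor)
  qed
  have "card ?A \<le> card {d. 0 < d \<and> d dvd n} * 3"
  proof (rule card_le_fibers[where f = "\<lambda>x. gcd (x - x0) n"])
    show "gcd (x - x0) n \<in> {d. 0 < d \<and> d dvd n}" for x using n by auto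
    fix d assume "d \<in> {d. 0 < d \<and> d dvd n}"
    hence d: "d > 0" "d dvd n" by auto
    then obtain e where e: "n = d * e" by auto
    have epos: "e > 0" using n d e by (simp add: zero_less_mult_iff)
    let ?F = "{x \<in> ?A. gcd (x - x0) n = d}"
    \<comment> \<open>With n = d * e and d the gcd of x - x0 with n, the cofactor e divides x + x0.
      A common divisor of d and e divides 2 * x0 and hence 2. Two roots with the same d are
      congruent modulo d and modulo e, so twice their difference is divisible by n.\<close>
    have key: "n dvd 2 * (x - y)" if "x \<in> ?F" "y \<in> ?F" for x y
    proof -
      have de: "d dvd x - x0 \<and> e dvd x + x0" if "x \<in> ?F" for x
      proof
        show dx: "d dvd x - x0" using that by auto
        then obtain k where k: "x - x0 = d * k" by auto
        have "d * gcd k e = gcd (d * k) (d * e)" using d by (simp add: gcd_mult_left abs_mult)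
        also have "\<dots> = d" using that k e by auto
        finally have ke: "coprime k e" using d by (simp add: coprime_iff_gcd_eq_1)
        have "n dvd (x\<^sup>2 - c) - (x0\<^sup>2 - c)" by (rule dvd_diff) (use that x0 in auto)
        hence "d * e dvd d * (k * (x + x0))"
          using k e by (simp add: power2_eq_square algebra_simps)
        hence "e dvd k * (x + x0)" using d by simp
        thus "e dvd x + x0" using ke by (simp add: coprime_commute coprime_dvd_mult_right_iff)
      qed
      have "gcd d e dvd (x + x0) - (x - x0)"
        using de[OF that(1)] by (meson dvd_diff dvd_trans gcd_dvd1 gcd_dvd2)
      hence "gcd d e dvd 2 * x0" by simp
      moreover have "coprime (gcd d e) x0"
        using cop d(2) by (meson coprime_commute coprime_divisors dvd_refl dvd_trans gcd_dvd1)
      ultimately have "gcd d e dvd 2" by (simp add: coprime_dvd_mult_left_iff)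
      then obtain m where m: "2 = gcd d e * m" by (elim dvdE)
      obtain u v where "u * d + v * e = gcd d e" by (metis bezout_int)
      hence two: "2 = m * (u * d + v * e)" using m by (simp add: mult.commute)
      have dd: "d dvd x - y" using de[OF that(1)] de[OF that(2)] dvd_diff[of d "x - x0" "y - x0"] by auto
      have ee: "e dvd x - y" using de[OF that(1)] de[OF that(2)] dvd_diff[of e "x + x0" "y + x0"] by auto
      have "2 * (x - y) = m * u * (d * (x - y)) + m * v * (e * (x - y))"
        by (subst two) (simp add: algebra_simps)
      moreover have "n dvd d * (x - y)" "n dvd e * (x - y)"
        using dd ee e by (auto simp: mult.commute[of d e] mult_dvd_mono)
      ultimately show ?thesis by simp
    qed
    show "card ?F \<le> 3"
    proof (cases "?F = {}")
      case False
      then obtain y where y: "y \<in> ?F" by blast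
      have "?F \<subseteq> {y, y + n div 2, y - n div 2}"
      proof
        fix x assume x: "x \<in> ?F"
        obtain k where k: "2 * (x - y) = n * k" using key[OF x y] by auto
        have b: "0 \<le> x" "x < n" "0 \<le> y" "y < n" using x y by auto
        have "\<bar>n * k\<bar> < n * 2" unfolding k[symmetric] using b by auto
        hence "\<bar>k\<bar> < 2" using n by (simp add: abs_mult)
        hence "k = 0 \<or> k = 1 \<or> k = -1" by auto
        thus "x \<in> {y, y + n div 2, y - n div 2}" using k by auto
      qed
      hence "card ?F \<le> card {y, y + n div 2, y - n div 2}" by (intro card_mono) auto
      also have "\<dots> \<le> 3" by (rule card_insert_le_m1; simp add: card_insert_if)
      finally show ?thesis .
    qed (metis (no_types, lifting) card.empty le0)
  next
    show "finite ?A" by (rule finite_subset[of _ "{0..<n}"]) auto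
  qed (use finite_pos_divisors[OF n] in auto)
  thus ?thesis by (simp add: ndiv_def mult.commute)
qed (metis (no_types, lifting) card.empty le0)

lemma card_sqrt_interval:
  fixes n c X :: int
  assumes n: "n > 0" and c: "coprime c n" and X: "X \<ge> 0"
  shows "card {x \<in> {0..X}. n dvd x\<^sup>2 - c} \<le> 3 * ndiv n * nat (X div n + 1)"
proof -
  let ?A = "{x \<in> {0..<n}. n dvd x\<^sup>2 - c}"
  have finA: "finite ?A" by (rule finite_subset[of _ "{0..<n}"]) auto
  have "card {x \<in> {0..X}. n dvd x\<^sup>2 - c} \<le> card (?A \<times> {0..X div n})"
  proof (rule card_inj_on_le[of "\<lambda>x. (x mod n, x div n)"])
    show "inj_on (\<lambda>x. (x mod n, x div n)) {x \<in> {0..X}. n dvd x\<^sup>2 - c}"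
      by (rule inj_onI) (metis Pair_inject mult_div_mod_eq)
    show "(\<lambda>x. (x mod n, x div n)) ` {x \<in> {0..X}. n dvd x\<^sup>2 - c} \<subseteq> ?A \<times> {0..X div n}"
    proof safe
      fix x assume x: "x \<in> {0..X}" "n dvd x\<^sup>2 - c"
      show "x mod n \<in> {0..<n}" using n by simp
      show "x div n \<in> {0..X div n}" using x n by (simp add: zdiv_mono1 pos_imp_zdiv_nonneg_iff)
      have "((x mod n)\<^sup>2 - c) mod n = (x\<^sup>2 - c) mod n" by (metis mod_diff_left_eq power_mod)
      thus "n dvd (x mod n)\<^sup>2 - c" using x(2) by (simp only: dvd_eq_mod_eq_0)
    qed
  qed (use finA in simp)
  also have "\<dots> = card ?A * nat (X div n + 1)" by (simp add: card_cartesian_product)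
  also have "\<dots> \<le> 3 * ndiv n * nat (X div n + 1)" by (intro mult_right_mono card_sqrt_mod n c) simp
  finally show ?thesis .
qed

lemma ndiv_mult_le:
  assumes "a > 0" "b > 0"
  shows "ndiv (a * b) \<le> ndiv a * ndiv b"
proof -
  let ?D = "\<lambda>n :: int. {d. 0 < d \<and> d dvd n}"
  have "?D (a * b) \<subseteq> (\<lambda>(x, y). x * y) ` (?D a \<times> ?D b)"
  proof
    fix d assume d: "d \<in> ?D (a * b)"
    then obtain x y where xy: "d = x * y" "x dvd a" "y dvd b"
      using division_decomp[of d a b] by auto
    hence "(\<bar>x\<bar>, \<bar>y\<bar>) \<in> ?D a \<times> ?D b" using d by auto
    moreover have "d = \<bar>x\<bar> * \<bar>y\<bar>" using d xy by (simp flip: abs_mult)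
    ultimately show "d \<in> (\<lambda>(x, y). x * y) ` (?D a \<times> ?D b)" by (metis (mono_tags, lifting) case_prod_conv image_eqI)
  qed
  hence "card (?D (a * b)) \<le> card ((\<lambda>(x, y). x * y) ` (?D a \<times> ?D b))"
    using finite_pos_divisors assms by (intro card_mono) auto
  also have "\<dots> \<le> card (?D a \<times> ?D b)" using finite_pos_divisors assms by (intro card_image_le) auto
  finally show ?thesis by (simp add: ndiv_def card_cartesian_product)
qed

lemma ndiv_prime_power:
  assumes "prime p"
  shows "ndiv (p ^ k) \<le> k + 1"
proof -
  have "{d. 0 < d \<and> d dvd p ^ k} \<subseteq> (\<lambda>i. p ^ i) ` {..k}"
    using divides_primepow[OF assms] by force
  hence "ndiv (p ^ k) \<le> card ((\<lambda>i. p ^ i) ` {..k})" unfolding ndiv_def by (intro card_mono) auto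
  also have "\<dots> \<le> card {..k}" by (rule card_image_le) simp
  finally show ?thesis by simp
qed

text \<open>One prime power p^k is removed at a time. For p \<ge> 2^(1/\<epsilon>) the factor k + 1
  is at most 2^k and so at most p^(k\<epsilon>), at no cost. Each of the boundedly many smaller
  primes costs a factor \<open>K\<close>.\<close>

lemma divisor_bound:
  assumes eps: "\<epsilon> > (0 :: real)"
  obtains C where "C \<ge> 1" "\<And>n. n > 0 \<Longrightarrow> real (ndiv n) \<le> C * real_of_int n powr \<epsilon>"
proof -
  \<comment> \<open>Chosen so that k + 1 \<le> K * 2^(\<epsilon> k) for all k, which follows from 1
    + t \<le> exp t.\<close>
  define K where "K = 1 + 1 / (\<epsilon> * ln 2)"
  have K1: "K \<ge> 1" using eps by (simp add: K_def)
  have K: "real k + 1 \<le> K * 2 powr (\<epsilon> * k)" for k :: nat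
  proof -
    have "1 + \<epsilon> * real k * ln 2 \<le> exp (\<epsilon> * real k * ln 2)" by (rule exp_ge_add_one_self)
    also have "\<dots> = 2 powr (\<epsilon> * k)" by (simp add: powr_def mult.commute mult.left_commute)
    finally have le: "1 + \<epsilon> * real k * ln 2 \<le> 2 powr (\<epsilon> * k)" .
    have "real k + 1 \<le> 1 + real k + (\<epsilon> * real k * ln 2 + 1 / (\<epsilon> * ln 2))"
      using eps by simp
    also have "\<dots> = K * (1 + \<epsilon> * real k * ln 2)"
      using eps by (simp add: K_def field_simps)
    also have "\<dots> \<le> K * 2 powr (\<epsilon> * k)" using le K1 by (intro mult_left_mono) auto
    finally show ?thesis .
  qed
  define B where "B = nat \<lceil>2 powr (1 / \<epsilon>)\<rceil>"
  have B: "real_of_int p powr \<epsilon> \<ge> 2" if "p \<ge> int B" for p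
  proof -
    have "2 powr (1 / \<epsilon>) \<le> real B" unfolding B_def by (rule real_nat_ceiling_ge)
    also have "\<dots> \<le> real_of_int p" using that by linarith
    finally have "(2 powr (1 / \<epsilon>)) powr \<epsilon> \<le> real_of_int p powr \<epsilon>" using eps by (intro powr_mono2) auto
    thus ?thesis using eps by (simp add: powr_powr)
  qed
  define S where "S = (\<lambda>n :: int. {p. prime p \<and> p dvd n \<and> p < int B})"
  have finS: "finite (S n)" for n
    by (rule finite_subset[of _ "{0..int B}"]) (auto simp: S_def dest: prime_ge_0_int)
  have main: "real (ndiv n) \<le> K ^ card (S n) * real_of_int n powr \<epsilon>" if "n > 0" for n
    using that
  proof (induction "nat n" arbitrary: n rule: less_induct)
    case less
    show ?case
    proof (cases "n = 1")
      case True
      have "{d :: int. 0 < d \<and> d dvd 1} = {1}" by auto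
      thus ?thesis using True K1 by (simp add: ndiv_def)
    next
      case False
      then obtain p where p: "prime p" "p dvd n" using less.prems prime_divisor_exists[of n] by auto
      define k where "k = multiplicity p n"
      obtain m where m: "n = p ^ k * m" "\<not> p dvd m"
      proof -
        have "n \<noteq> 0" "\<not> is_unit p" using less.prems p(1) not_prime_unit by auto
        thus ?thesis using multiplicity_decompose'[of n p] that unfolding k_def by blast
      qed
      have pg: "p > 1" using p prime_gt_1_int by blast
      have mpos: "m > 0" using less.prems m pg by (metis zero_less_mult_pos zero_less_power less_trans zero_less_one)
      have "k > 0" using m p(2) by (cases k) auto
      hence "p ^ k > 1" using pg by (simp add: one_less_power)
      hence "m < n" using m mpos by simp
      hence IH: "real (ndiv m) \<le> K ^ card (S m) * real_of_int m powr \<epsilon>"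
        using less.hyps[of m] mpos by simp
      have pw: "real_of_int n powr \<epsilon> = (real_of_int p powr \<epsilon>) ^ k * real_of_int m powr \<epsilon>"
        using m pg mpos by (simp add: powr_mult powr_powr[symmetric] flip: powr_realpow powr_power)
           (simp add: powr_powr mult.commute)
      have "ndiv n \<le> (k + 1) * ndiv m"
        using ndiv_mult_le[of "p ^ k" m] ndiv_prime_power[OF p(1), of k] m mpos pg
        by (metis (no_types, lifting) mult_le_mono1 order_trans zero_less_power less_trans zero_less_one)
      hence "real (ndiv n) \<le> real ((k + 1) * ndiv m)" by (rule of_nat_mono)
      also have "\<dots> = (real k + 1) * real (ndiv m)" by (simp add: algebra_simps)
      also have "\<dots> \<le> (real k + 1) * (K ^ card (S m) * real_of_int m powr \<epsilon>)"
        using IH by (intro mult_left_mono) auto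
      finally have le: "real (ndiv n) \<le> (real k + 1) * K ^ card (S m) * real_of_int m powr \<epsilon>"
        by (simp add: mult.assoc)
      have sub: "S m \<subseteq> S n" using m by (auto simp: S_def)
      show ?thesis
      proof (cases "p < int B")
        case True
        have "insert p (S m) \<subseteq> S n" using sub True p by (auto simp: S_def)
        hence "card (insert p (S m)) \<le> card (S n)" using finS by (intro card_mono) auto
        moreover have "p \<notin> S m" using m by (auto simp: S_def)
        ultimately have cd: "Suc (card (S m)) \<le> card (S n)" using finS by simp
        have "2 powr (\<epsilon> * k) = (2 powr \<epsilon>) ^ k" by (simp add: powr_powr[symmetric] powr_realpow)
        also have "\<dots> \<le> (real_of_int p powr \<epsilon>) ^ k"
          using pg eps by (intro power_mono powr_mono2) auto
        finally have "real k + 1 \<le> K * (real_of_int p powr \<epsilon>) ^ k"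
          using K[of k] K1 by (meson mult_left_mono order_trans zero_le_one)
        hence "(real k + 1) * K ^ card (S m) * real_of_int m powr \<epsilon>
            \<le> (K * (real_of_int p powr \<epsilon>) ^ k) * K ^ card (S m) * real_of_int m powr \<epsilon>"
          using K1 by (intro mult_right_mono) auto
        also have "\<dots> = K ^ Suc (card (S m)) * real_of_int n powr \<epsilon>" unfolding pw by simp
        also have "\<dots> \<le> K ^ card (S n) * real_of_int n powr \<epsilon>"
          using K1 cd by (intro mult_right_mono power_increasing) auto
        finally show ?thesis using le by linarith
      next
        case False
        have "k + 1 \<le> 2 ^ k" by (induction k) auto
        hence "real (k + 1) \<le> real (2 ^ k)" by (rule of_nat_mono)
        also have "\<dots> \<le> (real_of_int p powr \<epsilon>) ^ k"
          using B[of p] False by (simp add: power_mono)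
        finally have "(real k + 1) * K ^ card (S m) * real_of_int m powr \<epsilon>
            \<le> (real_of_int p powr \<epsilon>) ^ k * K ^ card (S m) * real_of_int m powr \<epsilon>"
          using K1 by (intro mult_right_mono) auto
        also have "\<dots> = K ^ card (S m) * real_of_int n powr \<epsilon>" unfolding pw by simp
        also have "\<dots> \<le> K ^ card (S n) * real_of_int n powr \<epsilon>"
          using K1 card_mono[OF finS sub] by (intro mult_right_mono power_increasing) auto
        finally show ?thesis using le by linarith
      qed
    qed
  qed
  have "card (S n) \<le> B" for n
  proof -
    have "card (S n) \<le> card {0..<int B}"
      by (intro card_mono) (auto simp: S_def dest: prime_ge_0_int)
    thus ?thesis by simp
  qed
  hence "K ^ card (S n) \<le> K ^ B" for n using K1 by (intro power_increasing) auto
  hence "real (ndiv n) \<le> K ^ B * real_of_int n powr \<epsilon>" if "n > 0" for n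
    using main[OF that] by (meson mult_right_mono order_trans powr_ge_zero)
  moreover have "K ^ B \<ge> 1" using K1 by (rule one_le_power)
  ultimately show ?thesis using that by blast
qed

section \<open>Upper bounds for sums of two and three squares\<close>

lemma int_sum_squares_eq_sq:
  fixes a b n :: int
  assumes "n > 0" "n dvd a" "n dvd b" "a\<^sup>2 + b\<^sup>2 = n\<^sup>2"
  shows "(a, b) \<in> {(n, 0), (-n, 0), (0, n), (0, -n)}"
proof -
  obtain u v where uv: "a = n * u" "b = n * v" using assms(2,3) by (auto elim!: dvdE)
  hence "n\<^sup>2 * (u\<^sup>2 + v\<^sup>2) = n\<^sup>2 * 1" using assms(4) by (simp add: power_mult_distrib distrib_left)
  hence e: "u\<^sup>2 + v\<^sup>2 = 1" using assms(1) by simp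
  have "u\<^sup>2 \<ge> 0" "v\<^sup>2 \<ge> 0" by auto
  hence "u\<^sup>2 = 0 \<and> v\<^sup>2 = 1 \<or> u\<^sup>2 = 1 \<and> v\<^sup>2 = 0" using e by linarith
  thus ?thesis using uv by (auto simp: power2_eq_1_iff)
qed

lemma finite_two_squares: "finite {(x, y :: int). x\<^sup>2 + y\<^sup>2 = n}"
proof (rule finite_subset)
  show "{(x, y). x\<^sup>2 + y\<^sup>2 = n} \<subseteq> {-n..n} \<times> {-n..n}"
  proof safe
    fix x y :: int assume "n = x\<^sup>2 + y\<^sup>2"
    have b: "\<bar>a\<bar> \<le> a\<^sup>2" for a :: int
      using mult_left_mono[of 1 "\<bar>a\<bar>" "\<bar>a\<bar>"] by (cases "a = 0") (auto simp: power2_eq_square)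
    show "x \<in> {- (x\<^sup>2 + y\<^sup>2)..x\<^sup>2 + y\<^sup>2}" "y \<in> {- (x\<^sup>2 + y\<^sup>2)..x\<^sup>2 + y\<^sup>2}"
      using b[of x] b[of y] by auto
  qed
qed simp

text \<open>A primitive representation defines a root r = x / y of -1 modulo \<open>n\<close>, and
  there are at most 3 * \<open>ndiv n\<close> roots. Representations with the same root differ by
  one of the four Gaussian units.\<close>

lemma card_primitive_two_squares:
  fixes n :: int
  assumes n: "n > 0"
  shows "card {(x, y). x\<^sup>2 + y\<^sup>2 = n \<and> coprime x y} \<le> 12 * ndiv n"
proof -
  let ?A = "{(x, y). x\<^sup>2 + y\<^sup>2 = n \<and> coprime x y}"
  let ?R = "{r \<in> {0..<n}. n dvd r\<^sup>2 - (-1)}"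
  have finA: "finite ?A" by (rule finite_subset[OF _ finite_two_squares[of n]]) auto
  define Q where "Q = (\<lambda>(x, y) r. r \<in> ?R \<and> n dvd x - r * y)"
  have exQ: "\<exists>r. Q a r" if aA: "a \<in> ?A" for a
  proof -
    obtain x y where xy: "a = (x, y)" "x\<^sup>2 + y\<^sup>2 = n" "coprime x y" using aA by auto
    have "coprime y n"
    proof (rule coprimeI)
      fix d assume d: "d dvd y" "d dvd n"
      hence "d dvd n - y\<^sup>2" by (simp add: power2_eq_square)
      moreover have "n - y\<^sup>2 = x\<^sup>2" using xy(2) by simp
      ultimately have "d dvd x\<^sup>2" by simp
      moreover have "coprime (x\<^sup>2) y" using xy(3) by simp
      ultimately show "is_unit d" using d(1) by (meson coprime_common_divisor)
    qed
    then obtain z where z: "[y * z = 1] (mod n)" using cong_solve_coprime_int by blast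
    define r where "r = (x * z) mod n"
    have "[r * y = x * z * y] (mod n)" unfolding r_def cong_def by (simp add: mod_mult_left_eq)
    also have "[x * z * y = x * 1] (mod n)"
      using cong_mult[OF cong_refl[of x] z] by (simp add: mult_ac)
    finally have ry: "[r * y = x] (mod n)" by simp
    have "[r\<^sup>2 * y\<^sup>2 = x\<^sup>2] (mod n)" using cong_pow[OF ry, of 2] by (simp add: power_mult_distrib)
    hence "n dvd r\<^sup>2 * y\<^sup>2 - x\<^sup>2" by (simp add: cong_iff_dvd_diff)
    hence "n dvd r\<^sup>2 * y\<^sup>2 - x\<^sup>2 + n" by simp
    hence "n dvd y * (y * (r\<^sup>2 + 1))" unfolding xy(2)[symmetric] by (simp add: power2_eq_square algebra_simps)
    hence "n dvd r\<^sup>2 + 1" using \<open>coprime y n\<close> by (simp add: coprime_commute coprime_dvd_mult_right_iff)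
    moreover have "r \<in> {0..<n}" using n by (simp add: r_def)
    moreover have "n dvd x - r * y" using ry by (metis cong_iff_dvd_diff cong_sym)
    ultimately show ?thesis unfolding Q_def xy(1) by auto
  qed
  define f where "f = (\<lambda>a. SOME r. Q a r)"
  have f: "Q a (f a)" if "a \<in> ?A" for a
    unfolding f_def by (rule someI_ex[OF exQ[OF that]])
  have "card ?A \<le> card ?R * 4"
  proof (rule card_le_fibers[where f = f])
    show "f a \<in> ?R" if "a \<in> ?A" for a using f[OF that] unfolding Q_def by (auto split: prod.splits)
    fix r
    let ?F = "{a \<in> ?A. f a = r}"
    show "card ?F \<le> 4"
    proof (cases "?F = {}")
      case False
      then obtain x y where xy: "(x, y) \<in> ?F" by auto
      \<comment> \<open>Real and imaginary part of (x - iy)(u + iv). Both are divisible by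
        \<open>n\<close> when the roots agree, and their squares add up to n^2, which leaves four
        values.\<close>
      define T where "T = (\<lambda>(u, v). (x * u + y * v, x * v - u * y))"
      have "card ?F \<le> card {(n, 0), (-n, 0), (0, n), (0, -n)}"
      proof (rule card_inj_on_le[of T])
        show "inj_on T ?F"
        proof (rule inj_onI)
          fix a b assume ab: "a \<in> ?F" "b \<in> ?F" "T a = T b"
          obtain u v s t where uv: "a = (u, v)" "b = (s, t)" by (cases a; cases b)
          have e: "x * u + y * v = x * s + y * t" "x * v - u * y = x * t - s * y"
            using ab(3) uv by (auto simp: T_def)
          have nn: "x\<^sup>2 + y\<^sup>2 = n" using xy by auto
          have "n * u = x * (x * u + y * v) - y * (x * v - u * y)"
            "n * s = x * (x * s + y * t) - y * (x * t - s * y)"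
            "n * v = y * (x * u + y * v) + x * (x * v - u * y)"
            "n * t = y * (x * s + y * t) + x * (x * t - s * y)"
            unfolding nn[symmetric] by (simp_all add: power2_eq_square algebra_simps)
          hence "n * u = n * s" "n * v = n * t" using e by auto
          thus "a = b" using n uv by simp
        qed
        show "T ` ?F \<subseteq> {(n, 0), (-n, 0), (0, n), (0, -n)}"
        proof
          fix z assume "z \<in> T ` ?F"
          then obtain u v where uv: "(u, v) \<in> ?F" "z = T (u, v)" by auto
          have 1: "n dvd x - r * y" "n dvd r\<^sup>2 + 1" "x\<^sup>2 + y\<^sup>2 = n" using f[of "(x, y)"] xy unfolding Q_def by auto
          have 2: "n dvd u - r * v" "u\<^sup>2 + v\<^sup>2 = n" using f[of "(u, v)"] uv unfolding Q_def by auto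
          have "x * u + y * v = u * (x - r * y) + r * y * (u - r * v) + y * v * (r\<^sup>2 + 1)"
            by (simp add: power2_eq_square algebra_simps)
          moreover have "n dvd \<dots>"
            by (rule dvd_add[OF dvd_add[OF dvd_mult[OF 1(1)] dvd_mult[OF 2(1)]] dvd_mult[OF 1(2)]])
          ultimately have d1: "n dvd x * u + y * v" by (simp only:)
          have "x * v - u * y = v * (x - r * y) - y * (u - r * v)" by (simp add: algebra_simps)
          moreover have "n dvd \<dots>" by (rule dvd_diff[OF dvd_mult[OF 1(1)] dvd_mult[OF 2(1)]])
          ultimately have d2: "n dvd x * v - u * y" by (simp only:)
          have "(x * u + y * v)\<^sup>2 + (x * v - u * y)\<^sup>2 = (x\<^sup>2 + y\<^sup>2) * (u\<^sup>2 + v\<^sup>2)"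
            by (simp add: power2_eq_square algebra_simps)
          also have "\<dots> = n\<^sup>2" using 1 2 by (simp add: power2_eq_square)
          finally show "z \<in> {(n, 0), (-n, 0), (0, n), (0, -n)}"
            using int_sum_squares_eq_sq[OF n d1 d2] uv(2) by (simp add: T_def)
        qed
      qed simp
      also have "\<dots> \<le> 4" by (simp add: card_insert_if)
      finally show ?thesis .
    qed (metis (no_types, lifting) card.empty le0)
  next
    show "finite ?R" by (rule finite_subset[of _ "{0..<n}"]) auto
  qed (rule finA)
  also have "\<dots> \<le> 3 * ndiv n * 4" using card_sqrt_mod[OF n, of "-1"] by simp
  finally show ?thesis by simp
qed

text \<open>The fibres of the gcd are primitive representations of n / g^2, which has no more
  divisors than \<open>n\<close>.\<close>

lemma card_two_squares_le:
  fixes n :: int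
  assumes n: "n > 0"
  shows "card {(x, y). x\<^sup>2 + y\<^sup>2 = n} \<le> 12 * (ndiv n)\<^sup>2"
proof -
  let ?A = "{(x, y). x\<^sup>2 + y\<^sup>2 = n}"
  have gn: "(gcd x y)\<^sup>2 dvd n \<and> gcd x y > 0" if "x\<^sup>2 + y\<^sup>2 = n" for x y
  proof
    have "(gcd x y)\<^sup>2 dvd x\<^sup>2" "(gcd x y)\<^sup>2 dvd y\<^sup>2" by (simp_all)
    thus "(gcd x y)\<^sup>2 dvd n" unfolding that[symmetric] by (rule dvd_add)
    show "gcd x y > 0" using that n by (auto simp: less_le)
  qed
  have "card ?A \<le> card {d. 0 < d \<and> d dvd n} * (12 * ndiv n)"
  proof (rule card_le_fibers[where f = "\<lambda>(x, y). gcd x y"])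
    show "(\<lambda>(x, y). gcd x y) a \<in> {d. 0 < d \<and> d dvd n}" if "a \<in> ?A" for a
      using that gn by (cases a) (auto simp: power2_eq_square dest: dvd_mult_left)
    fix g assume "g \<in> {d. 0 < d \<and> d dvd n}"
    hence g: "g > 0" by auto
    let ?F = "{a \<in> ?A. (\<lambda>(x, y). gcd x y) a = g}"
    show "card ?F \<le> 12 * ndiv n"
    proof (cases "?F = {}")
      case False
      then obtain x y where "x\<^sup>2 + y\<^sup>2 = n" "gcd x y = g" by auto
      hence "g\<^sup>2 dvd n" using gn by blast
      then obtain m where m: "n = g\<^sup>2 * m" by auto
      have mpos: "m > 0" using n m g by (simp add: zero_less_mult_iff)
      have "card ?F \<le> card {(x, y). x\<^sup>2 + y\<^sup>2 = m \<and> coprime x y}"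
      proof (rule card_inj_on_le[of "\<lambda>(x, y). (x div g, y div g)"])
        show "inj_on (\<lambda>(x, y). (x div g, y div g)) ?F"
        proof (rule inj_onI)
          fix a b assume ab: "a \<in> ?F" "b \<in> ?F" "(\<lambda>(x, y). (x div g, y div g)) a = (\<lambda>(x, y). (x div g, y div g)) b"
          obtain u v s t where uv: "a = (u, v)" "b = (s, t)" by (cases a; cases b)
          have "gcd u v = g" "gcd s t = g" using ab(1,2) uv by simp_all
          hence "g dvd u" "g dvd v" "g dvd s" "g dvd t" by (metis gcd_dvd1 gcd_dvd2)+
          thus "a = b" using ab(3) uv g by (auto elim!: dvdE)
        qed
        show "(\<lambda>(x, y). (x div g, y div g)) ` ?F \<subseteq> {(x, y). x\<^sup>2 + y\<^sup>2 = m \<and> coprime x y}"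
        proof safe
          fix x y assume xy: "n = x\<^sup>2 + y\<^sup>2" "g = gcd x y"
          obtain u v where uv: "x = g * u" "y = g * v" by (metis xy(2) gcd_dvd1 gcd_dvd2 dvdE)
          have "g\<^sup>2 * (u\<^sup>2 + v\<^sup>2) = g\<^sup>2 * m" using xy(1) m uv by (simp add: power_mult_distrib distrib_left)
          hence "u\<^sup>2 + v\<^sup>2 = m" using g by simp
          moreover have "x div g = u" "y div g = v" using uv g by simp_all
          ultimately show "(x div gcd x y)\<^sup>2 + (y div gcd x y)\<^sup>2 = m"
            unfolding xy(2)[symmetric] by simp
          show "coprime (x div gcd x y) (y div gcd x y)" using g xy(2) by (intro div_gcd_coprime) auto
        qed
        show "finite {(x, y). x\<^sup>2 + y\<^sup>2 = m \<and> coprime x y}"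
          by (rule finite_subset[OF _ finite_two_squares[of m]]) auto
      qed
      also have "\<dots> \<le> 12 * ndiv m" by (rule card_primitive_two_squares[OF mpos])
      also have "\<dots> \<le> 12 * ndiv n" using ndiv_mono[OF n, of m] m by simp
      finally show ?thesis .
    qed (metis (no_types, lifting) card.empty le0)
  qed (use finite_pos_divisors[OF n] finite_two_squares in auto)
  thus ?thesis by (simp add: ndiv_def[symmetric] power2_eq_square)
qed

text \<open>The representations of \<open>n\<close> as a sum of three squares, kept as pure
  quaternions so that conjugation can act on them.\<close>

definition pure_reps :: "int \<Rightarrow> hq set" where
  "pure_reps n = {y. hq0 y = 0 \<and> hq_norm y = n}"

lemma finite_pure_reps [simp]: "finite (pure_reps n)"
proof (rule finite_subset)
  have b: "\<bar>a\<bar> \<le> a\<^sup>2" for a :: int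
    using mult_left_mono[of 1 "\<bar>a\<bar>" "\<bar>a\<bar>"] by (cases "a = 0") (auto simp: power2_eq_square)
  show "pure_reps n \<subseteq> (\<lambda>(b, c, d). HQ 0 b c d) ` ({-n..n} \<times> {-n..n} \<times> {-n..n})"
  proof
    fix y assume y: "y \<in> pure_reps n"
    have "\<bar>hq1 y\<bar> \<le> n" "\<bar>hq2 y\<bar> \<le> n" "\<bar>hq3 y\<bar> \<le> n"
      using y b[of "hq1 y"] b[of "hq2 y"] b[of "hq3 y"]
        zero_le_power2[of "hq1 y"] zero_le_power2[of "hq2 y"] zero_le_power2[of "hq3 y"]
      unfolding pure_reps_def hq_norm_def by auto
    moreover have "y = (\<lambda>(b, c, d). HQ 0 b c d) (hq1 y, hq2 y, hq3 y)"
      using y by (simp add: hq_eq_iff pure_reps_def)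
    ultimately show "y \<in> (\<lambda>(b, c, d). HQ 0 b c d) ` ({-n..n} \<times> {-n..n} \<times> {-n..n})"
      by (intro image_eqI[where x = "(hq1 y, hq2 y, hq3 y)"]) auto
  qed
qed simp

text \<open>One coordinate takes O(n^(1/2)) values; for each of them the other two solve a
  two-squares equation, with O(n^\<epsilon>) solutions.\<close>

lemma pure_reps_bound:
  assumes eps: "\<epsilon> > (0 :: real)"
  obtains C where "C \<ge> 1" "\<And>n. n > 0 \<Longrightarrow> real (card (pure_reps n)) \<le> C * real_of_int n powr (1 / 2 + \<epsilon>)"
proof -
  obtain D where D: "D \<ge> 1" "\<And>n. n > 0 \<Longrightarrow> real (ndiv n) \<le> D * real_of_int n powr (\<epsilon> / 2)"
    using divisor_bound[of "\<epsilon> / 2"] eps by auto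
  have main: "real (card (pure_reps n)) \<le> 36 * D\<^sup>2 * real_of_int n powr (1 / 2 + \<epsilon>)" if n: "n > 0" for n
  proof -
    define s where "s = \<lfloor>sqrt n\<rfloor>"
    have s: "real_of_int s \<le> sqrt n" "s \<ge> 1" unfolding s_def using n by auto
    define k where "k = nat \<lfloor>12 * D\<^sup>2 * real_of_int n powr \<epsilon>\<rfloor>"
    have n1: "real_of_int n powr \<epsilon> \<ge> 1" using n eps by (simp add: ge_one_powr_ge_zero)
    have D2: "D\<^sup>2 \<ge> 1" using D(1) by simp
    have one: "1 \<le> 12 * D\<^sup>2 * real_of_int n powr \<epsilon>" using mult_mono[of 1 "12 * D\<^sup>2" 1 "real_of_int n powr \<epsilon>"] n1 D2 by simp
    have "card (pure_reps n) \<le> card {-s..s} * k"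
    proof (rule card_le_fibers[where f = hq1])
      fix y assume y: "y \<in> pure_reps n"
      have "(hq1 y)\<^sup>2 \<le> n"
        using y zero_le_power2[of "hq2 y"] zero_le_power2[of "hq3 y"] unfolding pure_reps_def hq_norm_def by auto
      hence "(real_of_int (hq1 y))\<^sup>2 \<le> real_of_int n" by (metis of_int_le_iff of_int_power)
      hence "\<bar>real_of_int (hq1 y)\<bar> \<le> sqrt n" by (simp add: real_le_rsqrt)
      hence "\<bar>hq1 y\<bar> \<le> s" unfolding s_def by (simp add: le_floor_iff)
      thus "hq1 y \<in> {-s..s}" by auto
    next
      fix b assume "b \<in> {-s..s}"
      let ?F = "{y \<in> pure_reps n. hq1 y = b}"
      define m where "m = n - b\<^sup>2"
      have "card ?F \<le> card {(c, d). c\<^sup>2 + d\<^sup>2 = m}"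
        by (rule card_inj_on_le[of "\<lambda>y. (hq2 y, hq3 y)"])
           (auto simp: inj_on_def hq_eq_iff pure_reps_def hq_norm_def m_def finite_two_squares)
      also have "real \<dots> \<le> 12 * D\<^sup>2 * real_of_int n powr \<epsilon>"
      proof (cases "m > 0")
        case True
        have "real (card {(c, d). c\<^sup>2 + d\<^sup>2 = m}) \<le> 12 * (real (ndiv m))\<^sup>2"
          using of_nat_mono[OF card_two_squares_le[OF True], where 'a = real] by simp
        also have "\<dots> \<le> 12 * (D * real_of_int m powr (\<epsilon> / 2))\<^sup>2"
          using D(2)[OF True] by (intro mult_left_mono power_mono) auto
        also have "\<dots> = 12 * D\<^sup>2 * real_of_int m powr \<epsilon>"
          using True by (simp add: power_mult_distrib powr_power)
        also have "\<dots> \<le> 12 * D\<^sup>2 * real_of_int n powr \<epsilon>"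
          using True eps by (intro mult_left_mono powr_mono2) (auto simp: m_def)
        finally show ?thesis .
      next
        case False
        have "{(c, d :: int). c\<^sup>2 + d\<^sup>2 = m} \<subseteq> {(0, 0)}"
        proof safe
          fix c d :: int assume "m = c\<^sup>2 + d\<^sup>2"
          hence "c\<^sup>2 + d\<^sup>2 = 0" using False zero_le_power2[of c] zero_le_power2[of d] by linarith
          thus "c = 0" "d = 0" by (simp_all add: sum_power2_eq_zero_iff)
        qed
        hence "card {(c, d :: int). c\<^sup>2 + d\<^sup>2 = m} \<le> card {(0 :: int, 0 :: int)}" by (intro card_mono) auto
        thus ?thesis using one by simp
      qed
      finally show "card ?F \<le> k" unfolding k_def by (simp add: le_nat_floor)
    qed auto
    hence "real (card (pure_reps n)) \<le> real (card {-s..s}) * real k" by (metis of_nat_mono of_nat_mult)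
    also have "\<dots> \<le> (3 * sqrt n) * (12 * D\<^sup>2 * real_of_int n powr \<epsilon>)"
    proof (intro mult_mono)
      show "real k \<le> 12 * D\<^sup>2 * real_of_int n powr \<epsilon>" unfolding k_def using one by simp
      have "card {-s..s} = nat (2 * s + 1)" by simp
      hence "real (card {-s..s}) = 2 * real_of_int s + 1" using s(2) by simp
      thus "real (card {-s..s}) \<le> 3 * sqrt n" using s by linarith
    qed (use s n in auto)
    also have "\<dots> = 36 * D\<^sup>2 * (real_of_int n powr (1 / 2) * real_of_int n powr \<epsilon>)"
      using n by (simp add: powr_half_sqrt)
    also have "\<dots> = 36 * D\<^sup>2 * real_of_int n powr (1 / 2 + \<epsilon>)" by (simp add: powr_add)
    finally show ?thesis .
  qed
  have "36 * D\<^sup>2 \<ge> 1" using D(1) one_le_power[of D 2] by linarith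
  thus ?thesis using that main by blast
qed

section \<open>The kernel when \<open>p\<close> is a nonresidue modulo \<open>q\<close>\<close>

locale lps_nr = lps +
  assumes nonres: "\<not> q dvd z\<^sup>2 - p"
begin

text \<open>The norm form makes p^(2j+1) congruent to the square of the real part modulo
  \<open>q\<close>. Dividing by p^(2j) would exhibit \<open>p\<close> as a square; in the proof
  \<open>v\<close> is the inverse of p^j.\<close>

lemma Ker_odd_empty:
  assumes "odd m"
  shows "Ker m = {}"
proof (rule ccontr)
  assume "Ker m \<noteq> {}"
  then obtain k where k: "hq_norm k = p ^ m" "sc k" by (auto simp: Ker_def)
  obtain j where j: "m = 2 * j + 1" using assms oddE by blast
  have "coprime (p ^ j) q" using prime_imp_coprime[OF prime_q q_not_dvd_p_power[of j]] by (simp add: coprime_commute)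
  then obtain v where "[p ^ j * v = 1] (mod q)" using cong_solve_coprime_int by blast
  hence v: "q dvd p ^ j * v - 1" by (simp add: cong_iff_dvd_diff)
  have "q dvd (hq1 k)\<^sup>2 + (hq2 k)\<^sup>2 + (hq3 k)\<^sup>2"
    using k(2) unfolding sc_def by (simp add: power2_eq_square)
  hence "q dvd p ^ m - (hq0 k)\<^sup>2" unfolding k(1)[symmetric] hq_norm_def by (simp add: algebra_simps)
  hence "q dvd (p ^ j * v - 1) * ((p ^ j * v + 1) * p) - v\<^sup>2 * (p ^ m - (hq0 k)\<^sup>2)"
    by (intro dvd_diff[OF dvd_mult2[OF v] dvd_mult])
  also have "\<dots> = (v * hq0 k)\<^sup>2 - p"
    unfolding j by (simp add: power_add power_mult power2_eq_square algebra_simps power_mult_distrib)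
  finally show False using nonres by blast
qed

text \<open>With P = p^h, q^2 divides P^2 - x0^2 = (P - x0)(P + x0), where x0 is the real part.
  Since \<open>q\<close> cannot divide both factors, q^2 divides one of them, and the sign
  \<open>e\<close> records which. Both factors are even, which supplies the 2; the norm equation
  then fixes the length of \<open>y\<close>.\<close>

lemma Ker_param:
  assumes k: "k \<in> Ker (2 * h)"
  obtains e m y where "e = 1 \<or> e = -1" "m \<ge> 0" "m * q\<^sup>2 \<le> p ^ h"
    "k = of_int (e * (p ^ h - 2 * m * q\<^sup>2)) + of_int (2 * q) * y"
    "y \<in> pure_reps (m * (p ^ h - m * q\<^sup>2))"
proof -
  define P where "P = p ^ h"
  have Ppos: "P > 0" unfolding P_def using p_gt_1 by simp
  have Podd: "odd P" unfolding P_def using odd_p by simp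
  have kL: "k \<in> Lam" using k by (auto simp: Ker_def Lam_iff)
  have "2 * q dvd hq1 k" "2 * q dvd hq2 k" "2 * q dvd hq3 k"
    using Lam_sc_iff[OF kL] k by (auto simp: Ker_def)
  then obtain a b c where abc: "hq1 k = 2 * q * a" "hq2 k = 2 * q * b" "hq3 k = 2 * q * c"
    by (auto elim!: dvdE)
  define y where "y = HQ 0 a b c"
  have nk: "(hq0 k)\<^sup>2 + 4 * q\<^sup>2 * hq_norm y = P\<^sup>2"
  proof -
    have "hq_norm k = P\<^sup>2" using k by (simp add: Ker_def P_def power_mult[symmetric] mult.commute)
    thus ?thesis unfolding hq_norm_def abc y_def by (simp add: power_mult_distrib algebra_simps)
  qed
  have "q\<^sup>2 dvd (P - hq0 k) * (P + hq0 k)"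
  proof -
    have "(P - hq0 k) * (P + hq0 k) = q\<^sup>2 * (4 * hq_norm y)"
      using nk by (simp add: power2_eq_square algebra_simps)
    thus ?thesis by simp
  qed
  moreover have "\<not> (q dvd P - hq0 k \<and> q dvd P + hq0 k)"
  proof
    assume "q dvd P - hq0 k \<and> q dvd P + hq0 k"
    hence "q dvd (P - hq0 k) + (P + hq0 k)" by (metis dvd_add)
    hence "q dvd 2 * P" by simp
    hence "q dvd P" using odd_q coprime_dvd_mult_right_iff[of q 2 P] by simp
    thus False using q_not_dvd_p_power P_def by blast
  qed
  ultimately have "q\<^sup>2 dvd P - hq0 k \<or> q\<^sup>2 dvd P + hq0 k"
    using prime_q by (metis coprime_dvd_mult_left_iff coprime_dvd_mult_right_iff coprime_power_left_iff prime_imp_coprime)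
  then obtain e where e: "e = 1 \<or> e = -1" "q\<^sup>2 dvd P - e * hq0 k"
    by (metis add_uminus_conv_diff mult_1 mult_minus1 diff_minus_eq_add)
  have oddk: "odd (hq0 k)" using k by (auto simp: Ker_def odd_real_def)
  hence "even (P - e * hq0 k)" using Podd e(1) by auto
  moreover have "coprime 2 (q\<^sup>2)" using odd_q by simp
  ultimately have "2 * q\<^sup>2 dvd P - e * hq0 k" using e(2) by (intro divides_mult)
  then obtain m where "P - e * hq0 k = 2 * q\<^sup>2 * m" by (elim dvdE)
  hence m: "e * hq0 k = P - 2 * m * q\<^sup>2" by (simp add: algebra_simps)
  have k0: "hq0 k = e * (P - 2 * m * q\<^sup>2)" unfolding m[symmetric] using e(1) by auto
  have "(hq0 k)\<^sup>2 \<le> P\<^sup>2" using nk by (smt (verit) hq_norm_nonneg mult_nonneg_nonneg zero_le_power2)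
  hence "\<bar>hq0 k\<bar> \<le> P" using Ppos abs_le_square_iff[of "hq0 k" P] by simp
  hence b: "- P \<le> P - 2 * m * q\<^sup>2" "P - 2 * m * q\<^sup>2 \<le> P" using k0 e(1) by auto
  have q2: "q\<^sup>2 > 0" using q_gt_1 by simp
  have "0 \<le> m * q\<^sup>2" using b(2) by simp
  hence m0: "m \<ge> 0" using q2 by (simp add: zero_le_mult_iff)
  have "(hq0 k)\<^sup>2 = (P - 2 * m * q\<^sup>2)\<^sup>2" unfolding k0 using e(1) power2_commute[of "2 * m * q\<^sup>2" P] by auto
  hence "4 * q\<^sup>2 * hq_norm y = 4 * q\<^sup>2 * (m * (P - m * q\<^sup>2))"
    using nk by (simp add: power2_eq_square algebra_simps)
  hence "hq_norm y = m * (P - m * q\<^sup>2)" using q2 by simp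
  hence "y \<in> pure_reps (m * (P - m * q\<^sup>2))" by (simp add: pure_reps_def y_def)
  moreover have "k = of_int (e * (P - 2 * m * q\<^sup>2)) + of_int (2 * q) * y"
    using abc k0 by (simp add: hq_eq_iff y_def del: of_int_mult)
  ultimately show ?thesis using that[of e m y] e(1) m0 b(1) unfolding P_def by simp
qed

lemma Ker_of_rep:
  assumes y: "y \<in> pure_reps (m * (p ^ h - m * q\<^sup>2))" and e: "e = 1 \<or> e = -1"
  shows "of_int (e * (p ^ h - 2 * m * q\<^sup>2)) + of_int (2 * q) * y \<in> Ker (2 * h)"
proof -
  let ?k = "of_int (e * (p ^ h - 2 * m * q\<^sup>2)) + of_int (2 * q) * y"
  have y0: "hq0 y = 0" "hq_norm y = m * (p ^ h - m * q\<^sup>2)" using y by (auto simp: pure_reps_def)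
  have "hq_norm ?k = (p ^ h - 2 * m * q\<^sup>2)\<^sup>2 + 4 * q\<^sup>2 * hq_norm y"
    using e y0(1) power2_commute[of "m * (2 * q\<^sup>2)" "p ^ h"]
    by (auto simp: hq_norm_def power_mult_distrib algebra_simps simp del: of_int_mult)
  also have "\<dots> = p ^ (2 * h)"
    unfolding y0(2) by (simp add: power2_eq_square power_mult[symmetric] algebra_simps flip: power_add mult_2)
  finally have "hq_norm ?k = p ^ (2 * h)" .
  moreover have "odd_real ?k" using e y0 odd_p by (auto simp: odd_real_def simp del: of_int_mult)
  moreover have "sc ?k" by (simp add: sc_def del: of_int_mult)
  ultimately show ?thesis by (simp add: Ker_def)
qed

text \<open>Equivalent to the existence of a nonreal element in \<open>Ker (2 * h)\<close>:
  \<open>m = 0\<close> gives a real element, and equality of m * q^2 with p^h is impossible by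
  divisibility by \<open>q\<close>.\<close>

definition rep :: "nat \<Rightarrow> bool" where
  "rep h \<longleftrightarrow> (\<exists>m\<ge>1. m * q\<^sup>2 < p ^ h \<and> pure_reps (m * (p ^ h - m * q\<^sup>2)) \<noteq> {})"

lemma q_not_dvd_sub: "m * q\<^sup>2 \<noteq> p ^ h"
proof
  assume "m * q\<^sup>2 = p ^ h"
  hence "q dvd p ^ h" by (metis dvd_mult dvd_triv_left power2_eq_square)
  thus False using q_not_dvd_p_power by blast
qed

lemma nonreal_rep:
  assumes "k \<in> Ker j" "nonreal k"
  shows "\<exists>h. j = 2 * h \<and> rep h"
proof -
  have "even j" using Ker_odd_empty assms(1) by auto
  then obtain h where j: "j = 2 * h" by blast
  obtain e m y where emy: "e = 1 \<or> e = -1" "m \<ge> 0" "m * q\<^sup>2 \<le> p ^ h"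
    "k = of_int (e * (p ^ h - 2 * m * q\<^sup>2)) + of_int (2 * q) * y"
    "y \<in> pure_reps (m * (p ^ h - m * q\<^sup>2))" using Ker_param assms(1) j by metis
  have "m \<noteq> 0"
  proof
    assume "m = 0"
    hence "y = 0" using emy(5) by (simp add: pure_reps_def hq_norm_eq_0_iff)
    thus False using emy(4) assms(2) by (simp add: nonreal_def del: of_int_mult)
  qed
  hence "m \<ge> 1" using emy(2) by simp
  moreover have "m * q\<^sup>2 < p ^ h" using emy(3) q_not_dvd_sub[of m h] by simp
  ultimately show ?thesis using j emy(5) unfolding rep_def by blast
qed

lemma rep_nonreal_card:
  assumes m: "m \<ge> 1" "m * q\<^sup>2 < p ^ h"
  shows "card (pure_reps (m * (p ^ h - m * q\<^sup>2))) \<le> card {k \<in> Ker (2 * h). nonreal k \<and> hq0 k > 0}"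
proof -
  define A where "A = p ^ h - 2 * m * q\<^sup>2"
  \<comment> \<open>The sign that makes the real part positive; the real part is odd and therefore
    not zero.\<close>
  define e :: int where "e = (if A > 0 then 1 else -1)"
  have "odd A" unfolding A_def using odd_p by simp
  hence "A \<noteq> 0" by auto
  hence eA: "e * A > 0" unfolding e_def by auto
  have e: "e = 1 \<or> e = -1" by (simp add: e_def)
  have npos: "m * (p ^ h - m * q\<^sup>2) > 0" using m by simp
  define F where "F = (\<lambda>y. of_int (e * A) + of_int (2 * q) * (y :: hq))"
  show ?thesis
  proof (rule card_inj_on_le[of F])
    show "inj_on F (pure_reps (m * (p ^ h - m * q\<^sup>2)))"
      using q_gt_1 by (auto simp: inj_on_def F_def hq_eq_iff simp del: of_int_mult)
    show "F ` pure_reps (m * (p ^ h - m * q\<^sup>2)) \<subseteq> {k \<in> Ker (2 * h). nonreal k \<and> 0 < hq0 k}"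
    proof safe
      fix y assume y: "y \<in> pure_reps (m * (p ^ h - m * q\<^sup>2))"
      show "F y \<in> Ker (2 * h)" using Ker_of_rep[OF y e] by (simp add: F_def A_def)
      have "y \<noteq> 0" "hq0 y = 0" using y npos by (auto simp: pure_reps_def hq_norm_def)
      thus "nonreal (F y)" using q_gt_1 by (auto simp: nonreal_def F_def hq_eq_iff simp del: of_int_mult)
      show "0 < hq0 (F y)" using eA \<open>hq0 y = 0\<close> by (simp add: F_def del: of_int_mult)
    qed
  qed simp
qed

lemma Sys_rep:
  assumes "rep h" "\<And>j. j < h \<Longrightarrow> \<not> rep j"
  shows "Sys (2 * h)"
proof -
  obtain m where m: "m \<ge> 1" "m * q\<^sup>2 < p ^ h" "pure_reps (m * (p ^ h - m * q\<^sup>2)) \<noteq> {}"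
    using assms(1) unfolding rep_def by blast
  have "card (pure_reps (m * (p ^ h - m * q\<^sup>2))) > 0" using m(3) by (simp add: card_gt_0_iff)
  hence "card {k \<in> Ker (2 * h). nonreal k \<and> hq0 k > 0} > 0" using rep_nonreal_card[OF m(1,2)] by linarith
  hence "\<exists>k\<in>Ker (2 * h). nonreal k" by (auto simp: card_gt_0_iff)
  moreover have "2 * h \<ge> 3"
  proof -
    have "p\<^sup>2 < q\<^sup>2" using p_less_q p_gt_1 by (intro power_strict_mono) auto
    also have "q\<^sup>2 \<le> m * q\<^sup>2" using m(1) mult_right_mono[of 1 m "q\<^sup>2"] by simp
    also have "\<dots> < p ^ h" by (rule m(2))
    finally have "2 < h" using p_gt_1 power_less_imp_less_exp by blast
    thus ?thesis by simp
  qed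
  moreover have "\<not> nonreal k" if "j < 2 * h" "k \<in> Ker j" for j k
    using nonreal_rep[OF that(2)] assms(2) that(1) by auto
  ultimately show ?thesis unfolding Sys_def by blast
qed

text \<open>Let h0 be the least exponent with q^2 < p^h0; shorter lengths admit no \<open>m\<close>.
  If 2 * q^2 < p^h0, then \<open>m = 2\<close> works, since 2 * (p^h - 2 * q^2) is 6 modulo 8.
  Otherwise \<open>m = 1\<close> is the only candidate at h0; if it fails, \<open>m = 2\<close>
  works at h0 + 1. In every case p^h \<le> p^2 * q^2.\<close>

lemma girth_choice:
  assumes three: "\<And>n :: int. n > 0 \<Longrightarrow> n mod 8 = 6 \<Longrightarrow> pure_reps n \<noteq> {}"
  obtains h m where "m = 1 \<or> m = 2" "Sys (2 * h)" "m * q\<^sup>2 < p ^ h" "p ^ h \<le> p\<^sup>2 * q\<^sup>2"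
    "pure_reps (m * (p ^ h - m * q\<^sup>2)) \<noteq> {}"
proof -
  define h0 where "h0 = (LEAST h. q\<^sup>2 < p ^ h)"
  have ex: "\<exists>h. q\<^sup>2 < p ^ h"
  proof -
    have "q\<^sup>2 < 2 ^ nat (q\<^sup>2)" using less_exp[of "nat (q\<^sup>2)"] 
      by (metis nat_less_numeral_power_cancel_iff nat_0_le zero_le_power2 of_nat_less_numeral_power_cancel_iff)
    also have "\<dots> \<le> p ^ nat (q\<^sup>2)" using p_gt_1 by (intro power_mono) auto
    finally show ?thesis by blast
  qed
  have h0: "q\<^sup>2 < p ^ h0" unfolding h0_def by (rule LeastI_ex[OF ex])
  have min: "p ^ j \<le> q\<^sup>2" if "j < h0" for j
    using not_less_Least[of j "\<lambda>h. q\<^sup>2 < p ^ h"] that unfolding h0_def by simp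
  have "h0 \<noteq> 0" using h0 q_gt_1 by (cases h0) (auto simp: not_less power2_eq_square intro: ccontr dest: mult_strict_mono)
  then obtain i where i: "h0 = Suc i" by (cases h0) auto
  have up: "p ^ h0 \<le> p * q\<^sup>2" using min[of i] i p_gt_1 by simp
  have norep: "\<not> rep j" if "j < h0" for j
  proof
    assume "rep j"
    then obtain m where "m \<ge> 1" "m * q\<^sup>2 < p ^ j" unfolding rep_def by blast
    moreover from this have "q\<^sup>2 \<le> m * q\<^sup>2" using mult_right_mono[of 1 m "q\<^sup>2"] by simp
    ultimately show False using min[OF that] by linarith
  qed
  have p2: "p * q\<^sup>2 \<le> p\<^sup>2 * q\<^sup>2" using p_gt_1 by (intro mult_right_mono) (auto simp: power2_eq_square)
  have two: "pure_reps (2 * (p ^ h - 2 * q\<^sup>2)) \<noteq> {}" if "2 * q\<^sup>2 < p ^ h" for h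
  proof (rule three)
    show "2 * (p ^ h - 2 * q\<^sup>2) > 0" using that by simp
    have "p ^ h mod 4 = 1" using p_mod_4 power_mod[of p 4 h] by simp
    moreover have "q\<^sup>2 mod 4 = 1" using sq_mod_4[of q] odd_q by simp
    ultimately show "2 * (p ^ h - 2 * q\<^sup>2) mod 8 = 6" by presburger
  qed
  show ?thesis
  proof (cases "2 * q\<^sup>2 < p ^ h0")
    case True
    have "rep h0" unfolding rep_def using True two[OF True] by (intro exI[of _ 2]) auto
    hence "Sys (2 * h0)" using norep Sys_rep by blast
    thus ?thesis using that[of 2 h0] True two[OF True] up p2 by auto
  next
    case False
    hence lt: "p ^ h0 < 2 * q\<^sup>2" using q_not_dvd_sub[of 2 h0] by simp
    show ?thesis
    proof (cases "pure_reps (1 * (p ^ h0 - 1 * q\<^sup>2)) = {}")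
      case False
      have "rep h0" unfolding rep_def using False h0 by (intro exI[of _ 1]) auto
      hence "Sys (2 * h0)" using norep Sys_rep by blast
      thus ?thesis using that[of 1 h0] False h0 up p2 by auto
    next
      case True
      have "\<not> rep h0"
      proof
        assume "rep h0"
        then obtain m where m: "m \<ge> 1" "m * q\<^sup>2 < p ^ h0" "pure_reps (m * (p ^ h0 - m * q\<^sup>2)) \<noteq> {}"
          unfolding rep_def by blast
        have "m * q\<^sup>2 < 2 * q\<^sup>2" using m(2) lt by simp
        hence "m < 2" using q_gt_1 by (simp add: mult_less_cancel_right)
        hence "m = 1" using m(1) by simp
        thus False using m(3) True by simp
      qed
      have l2: "2 * q\<^sup>2 < p ^ Suc h0"
      proof -
        have "2 * q\<^sup>2 < 2 * p ^ h0" using h0 by simp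
        also have "\<dots> \<le> p ^ Suc h0" using p_gt_1 by simp
        finally show ?thesis .
      qed
      have "rep (Suc h0)" unfolding rep_def using l2 two[OF l2] by (intro exI[of _ 2]) auto
      moreover have "\<not> rep j" if "j < Suc h0" for j using norep \<open>\<not> rep h0\<close> that less_Suc_eq by blast
      ultimately have "Sys (2 * Suc h0)" using Sys_rep by blast
      moreover have "p ^ Suc h0 \<le> p\<^sup>2 * q\<^sup>2"
        using mult_left_mono[OF up, of p] p_gt_1 by (simp add: power2_eq_square mult.assoc)
      ultimately show ?thesis using that[of 2 "Suc h0"] l2 two[OF l2] by simp
    qed
  qed
qed

text \<open>There are two signs and at most p^h / q^2 values \<open>m\<close> \<ge> 1, and the
  represented number n satisfies n * q^2 = (m q^2)(p^h - m q^2) \<le> p^(2h). The summand 2 accounts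
  for \<open>m = 0\<close>, that is, for the real elements p^h and -p^h.\<close>

lemma card_Ker_le:
  assumes C: "C \<ge> 1" "\<And>n. n > 0 \<Longrightarrow> real (card (pure_reps n)) \<le> C * real_of_int n powr (1 / 2 + \<epsilon>)"
    and eps: "\<epsilon> > 0"
  shows "real (card (Ker (2 * h))) \<le>
    2 + 2 * C * (real_of_int p ^ h / real_of_int q ^ 2) * (real_of_int p ^ h / real_of_int q) powr (1 + 2 * \<epsilon>)"
proof -
  define P where "P = p ^ h"
  define M where "M = P div q\<^sup>2"
  have Ppos: "P > 0" unfolding P_def using p_gt_1 by simp
  have q2: "q\<^sup>2 > 0" using q_gt_1 by simp
  define R where "R = (\<lambda>k (e, m, y). k = of_int (e * (P - 2 * m * q\<^sup>2)) + of_int (2 * q) * y \<and>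
    (e, m, y) \<in> {1, -1} \<times> (SIGMA m : {0..M}. pure_reps (m * (P - m * q\<^sup>2))))"
  have "\<exists>z. R k z" if k: "k \<in> Ker (2 * h)" for k
  proof -
    obtain e m y where emy: "e = 1 \<or> e = -1" "m \<ge> 0" "m * q\<^sup>2 \<le> P"
      "k = of_int (e * (P - 2 * m * q\<^sup>2)) + of_int (2 * q) * y"
      "y \<in> pure_reps (m * (P - m * q\<^sup>2))" using Ker_param[OF k] unfolding P_def by metis
    have "m \<le> M" unfolding M_def using zdiv_mono1[OF emy(3) q2] q2 by simp
    thus ?thesis using emy by (intro exI[of _ "(e, m, y)"]) (auto simp: R_def)
  qed
  then obtain f where f: "\<And>k. k \<in> Ker (2 * h) \<Longrightarrow> R k (f k)" by metis
  have "card (Ker (2 * h)) \<le> card ({1, -1 :: int} \<times> (SIGMA m : {0..M}. pure_reps (m * (P - m * q\<^sup>2))))"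
  proof (rule card_inj_on_le[of f])
    show "inj_on f (Ker (2 * h))"
    proof (rule inj_onI)
      fix a b assume "a \<in> Ker (2 * h)" "b \<in> Ker (2 * h)" "f a = f b"
      thus "a = b" using f[of a] f[of b] unfolding R_def by (auto split: prod.splits)
    qed
    show "f ` Ker (2 * h) \<subseteq> {1, -1} \<times> (SIGMA m : {0..M}. pure_reps (m * (P - m * q\<^sup>2)))"
    proof
      fix z assume "z \<in> f ` Ker (2 * h)"
      then obtain k where k: "k \<in> Ker (2 * h)" "z = f k" by blast
      show "z \<in> {1, -1} \<times> (SIGMA m : {0..M}. pure_reps (m * (P - m * q\<^sup>2)))"
        using f[OF k(1)] unfolding k(2)[symmetric] R_def by (cases z) simp
    qed
  qed auto
  also have "\<dots> = 2 * (\<Sum>m\<in>{0..M}. card (pure_reps (m * (P - m * q\<^sup>2))))"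
    by (subst card_cartesian_product) (simp add: card_SigmaI)
  finally have "real (card (Ker (2 * h))) \<le> 2 * (\<Sum>m\<in>{0..M}. real (card (pure_reps (m * (P - m * q\<^sup>2)))))"
    by (simp flip: of_nat_sum)
  also have "(\<Sum>m\<in>{0..M}. real (card (pure_reps (m * (P - m * q\<^sup>2)))))
      \<le> 1 + (\<Sum>m\<in>{1..M}. C * (real_of_int P / real_of_int q) powr (1 + 2 * \<epsilon>))"
  proof -
    have M0: "M \<ge> 0" unfolding M_def using Ppos q2 by (simp add: pos_imp_zdiv_nonneg_iff)
    have split: "{0..M} = insert 0 {1..M}" using M0 by auto
    have "pure_reps 0 = {0}" by (auto simp: pure_reps_def hq_norm_eq_0_iff)
    hence "(\<Sum>m\<in>{0..M}. real (card (pure_reps (m * (P - m * q\<^sup>2)))))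
        = 1 + (\<Sum>m\<in>{1..M}. real (card (pure_reps (m * (P - m * q\<^sup>2)))))"
      unfolding split by simp
    also have "\<dots> \<le> 1 + (\<Sum>m\<in>{1..M}. C * (real_of_int P / real_of_int q) powr (1 + 2 * \<epsilon>))"
    proof (intro add_left_mono sum_mono)
      fix m assume m: "m \<in> {1..M}"
      have "m * q\<^sup>2 \<le> M * q\<^sup>2" using m q2 by (intro mult_right_mono) auto
      also have "M * q\<^sup>2 \<le> P" unfolding M_def using q2 by (simp add: minus_mod_eq_div_mult[symmetric])
      finally have "m * q\<^sup>2 \<le> P" .
      hence mP: "m * q\<^sup>2 < P" using q_not_dvd_sub[of m h] by (simp add: P_def)
      define n where "n = m * (P - m * q\<^sup>2)"
      have n: "n > 0" unfolding n_def using m mP by simp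
      have "n * q\<^sup>2 = (m * q\<^sup>2) * (P - m * q\<^sup>2)" by (simp add: n_def)
      also have "\<dots> \<le> P * P" using mP m q2 Ppos by (intro mult_mono) auto
      finally have "real_of_int (n * q\<^sup>2) \<le> real_of_int (P * P)" by (simp only: of_int_le_iff)
      hence "real_of_int n \<le> (real_of_int P / real_of_int q)\<^sup>2"
        using q_gt_1 by (simp add: field_simps power2_eq_square)
      hence "real_of_int n powr (1 / 2 + \<epsilon>) \<le> ((real_of_int P / real_of_int q)\<^sup>2) powr (1 / 2 + \<epsilon>)"
        using n eps by (intro powr_mono2) auto
      also have "\<dots> = (real_of_int P / real_of_int q) powr (1 + 2 * \<epsilon>)"
        using Ppos q_gt_1 by (simp add: powr_powr distrib_left flip: powr_numeral)
      finally have "C * real_of_int n powr (1 / 2 + \<epsilon>) \<le> C * (real_of_int P / real_of_int q) powr (1 + 2 * \<epsilon>)"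
        using C(1) by (intro mult_left_mono) auto
      thus "real (card (pure_reps (m * (P - m * q\<^sup>2)))) \<le> C * (real_of_int P / real_of_int q) powr (1 + 2 * \<epsilon>)"
        using C(2)[OF n] unfolding n_def by linarith
    qed
    finally show ?thesis .
  qed
  also have "(\<Sum>m\<in>{1..M}. C * (real_of_int P / real_of_int q) powr (1 + 2 * \<epsilon>))
      \<le> (real_of_int P / real_of_int q ^ 2) * (C * (real_of_int P / real_of_int q) powr (1 + 2 * \<epsilon>))"
  proof -
    have "real (card {1..M}) \<le> real_of_int P / real_of_int q ^ 2"
    proof -
      have "M * q\<^sup>2 \<le> P" unfolding M_def using q2 by (simp add: minus_mod_eq_div_mult[symmetric])
      hence "real_of_int (M * q\<^sup>2) \<le> real_of_int P" by (simp only: of_int_le_iff)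
      hence "real_of_int M \<le> real_of_int P / real_of_int q ^ 2" using q_gt_1 by (simp add: field_simps)
      moreover have "0 \<le> real_of_int P / real_of_int q ^ 2" using Ppos by simp
      moreover have "real (card {1..M}) = max 0 (real_of_int M)" by simp
      ultimately show ?thesis by simp
    qed
    hence "real (card {1..M}) * (C * (real_of_int P / real_of_int q) powr (1 + 2 * \<epsilon>))
        \<le> real_of_int P / real_of_int q ^ 2 * (C * (real_of_int P / real_of_int q) powr (1 + 2 * \<epsilon>))"
      by (rule mult_right_mono) (use C(1) in simp)
    thus ?thesis by (simp only: sum_constant)
  qed
  finally show ?thesis unfolding P_def by (simp add: mult_ac)
qed

end

section \<open>Primes with prescribed quadratic characters\<close>

lemma sum_divisors_swap:
  fixes F :: "nat \<Rightarrow> nat \<Rightarrow> real"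
  shows "(\<Sum>n=1..x. \<Sum>d | d dvd n. F d (n div d)) = (\<Sum>d=1..x. \<Sum>e=1..x div d. F d e)"
proof -
  have "(\<Sum>n=1..x. \<Sum>d | d dvd n. F d (n div d)) =
      (\<Sum>(n, d)\<in>(SIGMA n:{1..x}. {d. d dvd n}). F d (n div d))"
    by (intro sum.Sigma) auto
  also have "\<dots> = (\<Sum>(d, e)\<in>(SIGMA d:{1..x}. {1..x div d}). F d e)"
  proof (rule sum.reindex_bij_witness[where i = "\<lambda>(d, e). (d * e, d)" and j = "\<lambda>(n, d). (d, n div d)"])
    fix a assume "a \<in> (SIGMA n:{1..x}. {d. d dvd n})"
    then obtain n d where a: "a = (n, d)" "n \<ge> 1" "n \<le> x" "d dvd n" by auto
    then obtain e where e: "n = d * e" by auto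
    have pos: "d \<ge> 1" "e \<ge> 1" using a e by (auto simp: Suc_le_eq)
    show "(case (case a of (n, d) \<Rightarrow> (d, n div d)) of (d, e) \<Rightarrow> (d * e, d)) = a"
      using a e pos by simp
    have "d \<le> x" using dvd_imp_le[OF a(4)] a(2,3) by simp
    moreover have "e \<le> x div d" using a e pos by (simp add: less_eq_div_iff_mult_less_eq mult.commute)
    ultimately show "(case a of (n, d) \<Rightarrow> (d, n div d)) \<in> (SIGMA d:{1..x}. {1..x div d})"
      using a e pos by simp
    show "(case (case a of (n, d) \<Rightarrow> (d, n div d)) of (d, e) \<Rightarrow> F d e) = (case a of (n, d) \<Rightarrow> F d (n div d))"
      using a by simp
  next
    fix b assume "b \<in> (SIGMA d:{1..x}. {1..x div d})"
    then obtain d e where b: "b = (d, e)" "d \<ge> 1" "d \<le> x" "e \<ge> 1" "e \<le> x div d" by auto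
    show "(case (case b of (d, e) \<Rightarrow> (d * e, d)) of (n, d) \<Rightarrow> (d, n div d)) = b" using b by simp
    have "d * e \<le> x" using b by (simp add: less_eq_div_iff_mult_less_eq mult.commute)
    moreover have "1 \<le> d * e" using b by (metis One_nat_def Suc_le_eq nat_0_less_mult_iff)
    ultimately show "(case b of (d, e) \<Rightarrow> (d * e, d)) \<in> (SIGMA n:{1..x}. {d. d dvd n})" using b by simp
  qed
  also have "\<dots> = (\<Sum>d=1..x. \<Sum>e=1..x div d. F d e)" by (rule sum.Sigma[symmetric]) auto
  finally show ?thesis .
qed

lemma ln_fact_mangoldt: "ln (fact n) = (\<Sum>d=1..n. mangoldt d * real (n div d))"
proof -
  have "ln (fact n :: real) = (\<Sum>k=1..n. ln (real k))" by (subst ln_prod[symmetric]) (auto simp: fact_prod)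
  also have "\<dots> = (\<Sum>k=1..n. \<Sum>d | d dvd k. mangoldt d)"
    by (intro sum.cong refl) (simp add: mangoldt_sum)
  also have "\<dots> = (\<Sum>d=1..n. \<Sum>e=1..n div d. mangoldt d)"
    by (rule sum_divisors_swap[where F = "\<lambda>d e. mangoldt d"])
  also have "\<dots> = (\<Sum>d=1..n. mangoldt d * real (n div d))" by (simp add: mult.commute)
  finally show ?thesis .
qed

definition psi :: "nat \<Rightarrow> real" where "psi n = (\<Sum>d=1..n. mangoldt d)"

text \<open>Chebyshev's comparison with the central binomial coefficient: in its logarithm every d
  in (n, 2n] has coefficient 1, no coefficient is negative, and the binomial coefficient is at most
  2^(2n).\<close>

lemma psi_double: "psi (2 * n) - psi n \<le> 2 * real n * ln 2"
proof -
  have "psi (2 * n) - psi n = (\<Sum>d\<in>{n+1..2*n}. mangoldt d)"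
  proof -
    have "{1..2*n} = {1..n} \<union> {n+1..2*n}" by auto
    hence "psi (2 * n) = psi n + (\<Sum>d\<in>{n+1..2*n}. mangoldt d)"
      unfolding psi_def by (simp add: sum.union_disjoint)
    thus ?thesis by simp
  qed
  also have "\<dots> = (\<Sum>d\<in>{n+1..2*n}. mangoldt d * (real (2 * n div d) - 2 * real (n div d)))"
  proof (intro sum.cong refl)
    fix d assume d: "d \<in> {n+1..2*n}"
    hence "n div d = 0" "2 * n div d = 1" by (auto intro: div_nat_eqI)
    thus "mangoldt d = mangoldt d * (real (2 * n div d) - 2 * real (n div d))" by simp
  qed
  also have "\<dots> \<le> (\<Sum>d\<in>{1..2*n}. mangoldt d * (real (2 * n div d) - 2 * real (n div d)))"
  proof (rule sum_mono2)
    fix d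
    have "2 * (n div d) \<le> 2 * n div d"
      using div_times_less_eq_dividend[of n d]
      by (cases "d = 0") (simp_all add: less_eq_div_iff_mult_less_eq)
    hence "real (2 * (n div d)) \<le> real (2 * n div d)" by (rule of_nat_mono)
    thus "0 \<le> mangoldt d * (real (2 * n div d) - 2 * real (n div d))"
      by (intro mult_nonneg_nonneg mangoldt_nonneg) simp
  qed auto
  also have "\<dots> = ln (fact (2 * n)) - 2 * (\<Sum>d\<in>{1..2*n}. mangoldt d * real (n div d))"
    by (simp add: ln_fact_mangoldt algebra_simps sum_subtractf sum_distrib_left)
  also have "(\<Sum>d\<in>{1..2*n}. mangoldt d * real (n div d)) = ln (fact n)"
    unfolding ln_fact_mangoldt by (rule sum.mono_neutral_right) auto
  also have "ln (fact (2 * n)) - 2 * ln (fact n :: real) = ln (real (2 * n choose n))"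
    using binomial_fact[of n "2 * n", where 'a = real]
    by (simp add: ln_div ln_mult)
  also have "\<dots> \<le> ln (real (2 ^ (2 * n)))"
  proof -
    have "real (2 * n choose n) \<le> real (2 ^ (2 * n))" by (rule of_nat_mono[OF binomial_le_pow2])
    moreover have "real (2 * n choose n) > 0" by simp
    ultimately show ?thesis by simp
  qed
  also have "\<dots> = 2 * real n * ln 2" by (simp add: ln_realpow)
  finally show ?thesis .
qed

lemma psi_mono: "m \<le> n \<Longrightarrow> psi m \<le> psi n"
  unfolding psi_def by (intro sum_mono2) (auto simp: mangoldt_nonneg)

text \<open>Halving would allow 2 * ln 2 for even n. The constant 4 * ln 2 leaves room for rounding
  odd n up, where 6k + 6 \<le> 8k + 4 is what is needed.\<close>

lemma psi_le: "psi n \<le> 4 * ln 2 * real n"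
proof (induction n rule: less_induct)
  case (less n)
  show ?case
  proof (cases "n \<le> 1")
    case True
    hence "n = 0 \<or> n = 1" by auto
    thus ?thesis by (auto simp: psi_def)
  next
    case False
    define k where "k = n div 2"
    have k: "k \<ge> 1" using False by (simp add: k_def)
    show ?thesis
    proof (cases "even n")
      case True
      hence n: "n = 2 * k" by (simp add: k_def)
      have "psi k \<le> 4 * ln 2 * real k" using less.IH[of k] k n by simp
      hence "psi n \<le> 4 * ln 2 * real k + 2 * real k * ln 2"
        using psi_double[of k] unfolding n by linarith
      also have "\<dots> \<le> 4 * ln 2 * real n" by (simp add: n)
      finally show ?thesis .
    next
      case False
      hence n: "n = 2 * k + 1" by (simp add: k_def)
      have "psi n \<le> psi (2 * (k + 1))" using psi_mono[of n "2 * (k + 1)"] n by simp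
      also have "\<dots> \<le> 4 * ln 2 * real (k + 1) + 2 * real (k + 1) * ln 2"
        using psi_double[of "k + 1"] less.IH[of "k + 1"] k n by simp
      also have "\<dots> = ln 2 * (6 * real k + 6)" by (simp add: algebra_simps)
      also have "\<dots> \<le> ln 2 * (8 * real k + 4)" using k by (intro mult_left_mono) auto
      also have "\<dots> = 4 * ln 2 * real n" by (simp add: n algebra_simps)
      finally show ?thesis .
    qed
  qed
qed

lemma psi_le_4: "psi n \<le> 4 * real n"
proof -
  have "4 * ln 2 * real n \<le> 4 * 1 * real n"
    using ln_2_less_1 by (intro mult_right_mono mult_left_mono) auto
  thus ?thesis using psi_le[of n] by simp
qed

lemma ln_Suc_diff_le:
  assumes "n > 0"
  shows "real n * (ln (real (Suc n)) - ln (real n)) \<le> 1"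
proof -
  have "ln (1 + 1 / real n) \<le> 1 / real n" by (rule ln_add_one_self_le_self) simp
  moreover have "1 + 1 / real n = real (Suc n) / real n" using assms by (simp add: field_simps)
  ultimately have "ln (real (Suc n)) - ln (real n) \<le> 1 / real n" using assms by (simp add: ln_div del: of_nat_Suc)
  thus ?thesis using assms by (simp add: field_simps)
qed

lemma ln_fact_bounds:
  assumes "n \<ge> 1"
  shows "ln (fact n) \<le> real n * ln (real n)" "real n * ln (real n) - real n \<le> ln (fact n)"
proof -
  have "fact n \<le> real n ^ n" using fact_le_power[of n, where 'a = real] by simp
  hence "ln (fact n :: real) \<le> ln (real n ^ n)" using assms by (subst ln_le_cancel_iff) auto
  thus "ln (fact n) \<le> real n * ln (real n)" using assms by (simp add: ln_realpow)
  show "real n * ln (real n) - real n \<le> ln (fact n)"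
    using assms
  proof (induction n rule: dec_induct)
    case (step n)
    have "real n * (ln (real (Suc n)) - ln (real n)) \<le> 1" using ln_Suc_diff_le step by simp
    moreover have "ln (fact (Suc n) :: real) = ln (real (Suc n)) + ln (fact n)"
      by (simp add: ln_mult del: of_nat_Suc)
    ultimately show ?case using step.IH by (simp add: algebra_simps)
  qed simp
qed

lemma real_div_le_Suc: "real n / real d \<le> real (n div d) + 1"
proof (cases "d = 0")
  case False
  hence "n < d * (n div d) + d" using dividend_less_times_div[of d n] by simp
  hence "real n \<le> real (d * (n div d) + d)" by (intro of_nat_mono) simp
  thus ?thesis using False by (simp add: field_simps)
qed simp

text \<open>n times the sum differs from ln(n!) only by the fractional parts of n / d, which
  contribute at most \<open>psi n\<close>.\<close>

lemma mertens_first: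
  assumes "n \<ge> 1"
  shows "\<bar>(\<Sum>d=1..n. mangoldt d / real d) - ln (real n)\<bar> \<le> 4"
proof -
  define S where "S = (\<Sum>d=1..n. mangoldt d / real d)"
  have n0: "real n > 0" using assms by simp
  have "real n * S = (\<Sum>d=1..n. mangoldt d * (real n / real d))"
    unfolding S_def sum_distrib_left by (intro sum.cong) auto
  also have "\<dots> \<ge> ln (fact n)"
    unfolding ln_fact_mangoldt by (intro sum_mono mult_left_mono of_nat_div_le_of_nat mangoldt_nonneg)
  finally have 1: "ln (fact n) \<le> real n * S" .
  have "real n * S = (\<Sum>d=1..n. mangoldt d * (real n / real d))"
    unfolding S_def sum_distrib_left by (intro sum.cong) auto
  also have "\<dots> \<le> (\<Sum>d=1..n. mangoldt d * (real (n div d) + 1))"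
    by (intro sum_mono mult_left_mono mangoldt_nonneg real_div_le_Suc)
  also have "\<dots> = ln (fact n) + psi n"
    unfolding ln_fact_mangoldt psi_def by (simp add: distrib_left sum.distrib)
  finally have 2: "real n * S \<le> ln (fact n) + 4 * real n" using psi_le_4[of n] by linarith
  have "real n * S \<le> real n * (ln (real n) + 4)" using 2 ln_fact_bounds(1)[OF assms] by (simp add: algebra_simps)
  moreover have "real n * (ln (real n) - 1) \<le> real n * S" using 1 ln_fact_bounds(2)[OF assms] by (simp add: algebra_simps)
  ultimately have "S \<le> ln (real n) + 4" "ln (real n) - 1 \<le> S" using n0 by simp_all
  thus ?thesis unfolding S_def[symmetric] by linarith
qed

text \<open>Comparison with 2 * sqrt at n and at n + 1 gives a decreasing sequence \<open>u\<close>
  above an increasing sequence \<open>v\<close>. The constant between them is the value of the zeta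
  function at 1/2; only its existence matters.\<close>

lemma inverse_sqrt_sum:
  obtains c where "\<And>z. z \<ge> 1 \<Longrightarrow> \<bar>(\<Sum>e=1..nat \<lfloor>z\<rfloor>. 1 / sqrt (real e)) - 2 * sqrt z - c\<bar> \<le> 2 / sqrt z"
proof -
  define H where "H = (\<lambda>n. \<Sum>e=1..n. 1 / sqrt (real e))"
  define u where "u = (\<lambda>n. H (Suc n) - 2 * sqrt (real (Suc n)))"
  define v where "v = (\<lambda>n. H (Suc n) - 2 * sqrt (real (Suc n) + 1))"
  have HS: "H (Suc n) = H n + 1 / sqrt (real (Suc n))" for n by (simp add: H_def)
  have dif: "sqrt (x + 1) - sqrt x = 1 / (sqrt (x + 1) + sqrt x)" if "x > 0" for x :: real
  proof -
    have "(sqrt (x + 1) - sqrt x) * (sqrt (x + 1) + sqrt x) = 1"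
      using that by (simp add: algebra_simps flip: power2_eq_square)
    moreover have "sqrt (x + 1) + sqrt x > 0" using that by (simp add: add_pos_pos)
    ultimately show ?thesis by (simp add: field_simps)
  qed
  have lo: "1 / (2 * sqrt (x + 1)) \<le> sqrt (x + 1) - sqrt x" if "x > 0" for x :: real
  proof -
    have "sqrt (x + 1) + sqrt x \<le> 2 * sqrt (x + 1)" by simp
    thus ?thesis unfolding dif[OF that] using that by (intro divide_left_mono) (auto simp: add_pos_pos)
  qed
  have hi: "sqrt (x + 1) - sqrt x \<le> 1 / (2 * sqrt x)" if "x > 0" for x :: real
  proof -
    have "2 * sqrt x \<le> sqrt (x + 1) + sqrt x" by simp
    thus ?thesis unfolding dif[OF that] using that by (intro divide_left_mono) (auto simp: add_pos_pos)
  qed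
  have u_dec: "u (Suc n) \<le> u n" for n
    unfolding u_def HS[of "Suc n"] using lo[of "real (Suc n)"] by (simp add: add.commute)
  have v_inc: "v n \<le> v (Suc n)" for n
    unfolding v_def HS[of "Suc n"] using hi[of "real (Suc n) + 1"] by (simp add: add.commute)
  have vu: "v m \<le> u n" for m n
  proof -
    have "v m \<le> v (max m n)" by (rule lift_Suc_mono_le[of v, OF v_inc]) simp
    also have "\<dots> \<le> u (max m n)" by (simp add: u_def v_def)
    also have "\<dots> \<le> u n" by (rule lift_Suc_antimono_le[of u, OF u_dec]) simp
    finally show ?thesis .
  qed
  define c where "c = (SUP n. v n)"
  have bdd: "bdd_above (range v)" using vu by (auto simp: bdd_above_def)
  have cv: "v n \<le> c" for n unfolding c_def by (intro cSUP_upper bdd) auto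
  have cu: "c \<le> u n" for n unfolding c_def by (intro cSUP_least) (auto simp: vu)
  have "\<bar>H (nat \<lfloor>z\<rfloor>) - 2 * sqrt z - c\<bar> \<le> 2 / sqrt z" if z: "z \<ge> 1" for z
  proof -
    obtain n where n: "nat \<lfloor>z\<rfloor> = Suc n"
      using z by (metis One_nat_def Suc_le_D le_nat_floor of_nat_1)
    have zn: "real (Suc n) \<le> z" "z \<le> real (Suc n) + 1" using z n by linarith+
    have "sqrt (real (Suc n)) \<le> sqrt z" "sqrt z \<le> sqrt (real (Suc n) + 1)"
      using zn by simp_all
    hence "v n \<le> H (Suc n) - 2 * sqrt z" "H (Suc n) - 2 * sqrt z \<le> u n"
      unfolding u_def v_def by simp_all
    hence "\<bar>H (Suc n) - 2 * sqrt z - c\<bar> \<le> u n - v n" using cv[of n] cu[of n] by linarith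
    also have "\<dots> = 2 * (sqrt (real (Suc n) + 1) - sqrt (real (Suc n)))" by (simp add: u_def v_def)
    also have "\<dots> \<le> 1 / sqrt (real (Suc n))" using hi[of "real (Suc n)"] by simp
    also have "\<dots> \<le> 2 / sqrt z"
    proof -
      have "z \<le> 4 * real (Suc n)" using zn by simp
      hence "sqrt z \<le> sqrt (4 * real (Suc n))" by (rule real_sqrt_le_mono)
      hence "sqrt z \<le> 2 * sqrt (real (Suc n))" by (simp add: real_sqrt_mult del: of_nat_Suc)
      thus ?thesis using z by (simp add: divide_simps)
    qed
    finally show ?thesis unfolding n .
  qed
  thus ?thesis using that[of c] unfolding H_def by blast
qed

section \<open>Real characters: nonvanishing at 1 and the weighted sum over prime powers\<close>

locale real_char =
  fixes chi :: "nat \<Rightarrow> real" and B :: real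
  assumes chi_mult: "chi (m * n) = chi m * chi n"
    and chi_vals: "chi n \<in> {-1, 0, 1}" and chi_1: "chi 1 = 1"
    and chi_sum: "\<bar>\<Sum>n=1..x. chi n\<bar> \<le> B"
begin

lemma B_nonneg: "B \<ge> 0" using chi_sum[of 0] by simp

lemma chi_abs: "\<bar>chi n\<bar> \<le> 1" using chi_vals[of n] by auto

text \<open>Partial summation. Sums starting at \<open>a\<close> are differences of two initial
  sums, hence bounded by 2 * B, and the decrements of \<open>f\<close> telescope.\<close>

lemma abel_bound:
  assumes a: "a \<ge> 1" and f: "\<And>n. n \<ge> a \<Longrightarrow> 0 \<le> f n \<and> f (Suc n) \<le> f n"
  shows "\<bar>\<Sum>n=a..b. chi n * f n\<bar> \<le> 2 * B * f a"
proof (cases "b \<ge> a")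
  case False
  thus ?thesis using f[of a] B_nonneg by simp
next
  case True
  define S where "S = (\<lambda>k. \<Sum>n=a..k. chi n)"
  have Sb: "\<bar>S k\<bar> \<le> 2 * B" if "k \<ge> a" for k
  proof -
    have "{1..k} = {1..a-1} \<union> {a..k}" using a that by auto
    hence "(\<Sum>n=1..k. chi n) = (\<Sum>n=1..a-1. chi n) + S k"
      unfolding S_def using a by (simp add: sum.union_disjoint)
    thus ?thesis using chi_sum[of k] chi_sum[of "a - 1"] by linarith
  qed
  have eq: "(\<Sum>n=a..b. chi n * f n) = S b * f b + (\<Sum>n=a..<b. S n * (f n - f (Suc n)))"
    using True
  proof (induction b rule: dec_induct)
    case base
    show ?case by (simp add: S_def)
  next
    case (step n)
    have "S (Suc n) = S n + chi (Suc n)" using step by (simp add: S_def)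
    thus ?case using step by (simp add: algebra_simps)
  qed
  have tel: "f b + (\<Sum>n=a..<b. f n - f (Suc n)) = f a"
    using True by (induction b rule: dec_induct) auto
  have "\<bar>\<Sum>n=a..b. chi n * f n\<bar> \<le> \<bar>S b * f b\<bar> + (\<Sum>n=a..<b. \<bar>S n * (f n - f (Suc n))\<bar>)"
    unfolding eq by (intro order_trans[OF abs_triangle_ineq] add_left_mono sum_abs)
  also have "\<dots> \<le> 2 * B * f b + (\<Sum>n=a..<b. 2 * B * (f n - f (Suc n)))"
    using Sb f True B_nonneg by (intro add_mono sum_mono) (auto simp: abs_mult intro!: mult_mono)
  also have "\<dots> = 2 * B * (f b + (\<Sum>n=a..<b. f n - f (Suc n)))"
    by (simp only: distrib_left sum_distrib_left)
  finally show ?thesis unfolding tel .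
qed

definition T :: "nat \<Rightarrow> real" where "T x = (\<Sum>n=1..x. chi n * (1 / real n))"

lemma T_diff: "x \<le> y \<Longrightarrow> \<bar>T y - T x\<bar> \<le> 2 * B / real (Suc x)"
proof -
  assume "x \<le> y"
  hence "{1..y} = {1..x} \<union> {Suc x..y}" by auto
  hence "T y - T x = (\<Sum>n=Suc x..y. chi n * (1 / real n))"
    unfolding T_def by (simp add: sum.union_disjoint)
  also have "\<bar>\<dots>\<bar> \<le> 2 * B * (1 / real (Suc x))" by (rule abel_bound) (auto simp: divide_simps)
  finally show ?thesis by simp
qed

text \<open>The value at 1 of the Dirichlet series of \<open>chi\<close>.\<close>

definition L :: real where "L = lim T"

lemma T_tendsto: "T \<longlonglongrightarrow> L"
proof -
  have "Cauchy T"
  proof (rule CauchyI')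
    fix e :: real assume e: "e > 0"
    obtain N where N: "2 * B / e < real N" using reals_Archimedean2 by blast
    have "dist (T m) (T n) < e" if "m \<ge> N" "n > m" for m n
    proof -
      have "2 * B < e * real N" using N e by (simp add: field_simps)
      also have "\<dots> \<le> e * real (Suc m)" using that e by (intro mult_left_mono) auto
      finally have "2 * B / real (Suc m) < e" by (simp add: field_simps)
      thus ?thesis using T_diff[of m n] that by (simp add: dist_real_def abs_minus_commute)
    qed
    thus "\<exists>M. \<forall>m\<ge>M. \<forall>n>m. dist (T m) (T n) < e" by blast
  qed
  thus ?thesis unfolding L_def by (simp add: Cauchy_convergent_iff convergent_LIMSEQ_iff)
qed

lemma T_L: "\<bar>L - T x\<bar> \<le> 2 * B / real (Suc x)"
proof (rule LIMSEQ_le_const2)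
  show "(\<lambda>y. \<bar>T y - T x\<bar>) \<longlonglongrightarrow> \<bar>L - T x\<bar>" by (intro tendsto_intros T_tendsto)
  show "\<exists>N. \<forall>n\<ge>N. \<bar>T n - T x\<bar> \<le> 2 * B / real (Suc x)" using T_diff by blast
qed

text \<open>The Dirichlet convolution of \<open>chi\<close> with the constant 1. That it is
  nonnegative, and at least 1 on squares, is what rules out \<open>L = 0\<close>.\<close>

definition g :: "nat \<Rightarrow> real" where "g n = (\<Sum>d | d dvd n. chi d)"

lemma chi_power: "chi (n ^ k) = chi n ^ k"
  by (induction k) (use chi_1 chi_mult in auto)

lemma g_prime_power_mult:
  assumes p: "prime p" and m: "\<not> p dvd m"
  shows "g (p ^ k * m) = (\<Sum>i\<le>k. chi p ^ i) * g m"
proof -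
  have m0: "m > 0" using m by (cases m) auto
  have p0: "p > 0" using p prime_gt_0_nat by blast
  have fin: "finite {d. d dvd m}" using m0 by simp
  have "(\<Sum>i\<le>k. chi p ^ i) * g m = (\<Sum>(i, d)\<in>{..k} \<times> {d. d dvd m}. chi (p ^ i * d))"
    unfolding g_def by (simp add: sum_product sum.cartesian_product chi_mult chi_power)
  also have "\<dots> = (\<Sum>d | d dvd p ^ k * m. chi d)"
  proof -
    have bij: "bij_betw (\<lambda>(i, d). p ^ i * d) ({..k} \<times> {d. d dvd m}) {d. d dvd p ^ k * m}"
      unfolding bij_betw_def
    proof
      show "inj_on (\<lambda>(i, d). p ^ i * d) ({..k} \<times> {d. d dvd m})"
      proof (rule inj_onI)
        fix a b assume ab: "a \<in> {..k} \<times> {d. d dvd m}" "b \<in> {..k} \<times> {d. d dvd m}"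
          "(\<lambda>(i, d). p ^ i * d) a = (\<lambda>(i, d). p ^ i * d) b"
        obtain i d j e where ie: "a = (i, d)" "b = (j, e)" by (cases a; cases b)
        have nd: "\<not> p dvd d" "\<not> p dvd e" using ab ie m dvd_trans by auto
        have eq: "p ^ i * d = p ^ j * e" using ab(3) ie by simp
        have "i = j"
        proof (rule ccontr)
          assume "i \<noteq> j"
          moreover have False if "i < j" "p ^ i * d = p ^ j * e" "\<not> p dvd d" for i j d e
          proof -
            have "p ^ j = p ^ i * (p * p ^ (j - i - 1))"
              using that(1) by (metis Suc_diff_Suc diff_Suc_eq_diff_pred le_add_diff_inverse less_imp_le_nat power_Suc power_add diff_commute diff_diff_left One_nat_def plus_1_eq_Suc)
            hence "d = p * p ^ (j - i - 1) * e" using that(2) p0 by simp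
            thus False using that(3) by simp
          qed
          ultimately show False using eq nd by (metis nat_neq_iff)
        qed
        thus "a = b" using eq ie p0 by simp
      qed
      show "(\<lambda>(i, d). p ^ i * d) ` ({..k} \<times> {d. d dvd m}) = {d. d dvd p ^ k * m}"
      proof
        show "(\<lambda>(i, d). p ^ i * d) ` ({..k} \<times> {d. d dvd m}) \<subseteq> {d. d dvd p ^ k * m}"
          by (auto intro: mult_dvd_mono le_imp_power_dvd)
        show "{d. d dvd p ^ k * m} \<subseteq> (\<lambda>(i, d). p ^ i * d) ` ({..k} \<times> {d. d dvd m})"
        proof
          fix x assume "x \<in> {d. d dvd p ^ k * m}"
          then obtain b c where bc: "x = b * c" "b dvd p ^ k" "c dvd m"
            using division_decomp[of x "p ^ k" m] by auto
          then obtain i where "i \<le> k" "b = p ^ i" using divides_primepow_nat[OF p] by blast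
          thus "x \<in> (\<lambda>(i, d). p ^ i * d) ` ({..k} \<times> {d. d dvd m})" using bc by force
        qed
      qed
    qed
    show ?thesis using sum.reindex_bij_betw[OF bij, of chi] by (simp add: case_prod_unfold)
  qed
  finally show ?thesis by (simp add: g_def)
qed

lemma power_sum_nonneg:
  assumes "t \<in> {-1, 0, 1 :: real}"
  shows "(\<Sum>i\<le>k. t ^ i) \<ge> 0" "even k \<Longrightarrow> (\<Sum>i\<le>k. t ^ i) \<ge> 1"
proof -
  have 1: "(\<Sum>i\<le>k. (1 :: real) ^ i) = real k + 1" by simp
  have 2: "(\<Sum>i\<le>k. (0 :: real) ^ i) = 1" by (induction k) auto
  have 3: "(\<Sum>i\<le>k. (-1 :: real) ^ i) = (if even k then 1 else 0)" by (induction k) auto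
  show "(\<Sum>i\<le>k. t ^ i) \<ge> 0" "even k \<Longrightarrow> (\<Sum>i\<le>k. t ^ i) \<ge> 1"
    using assms 1 2 3 by auto
qed

lemma nat_prime_split:
  assumes "n > (1 :: nat)"
  obtains p k m where "prime p" "n = p ^ k * m" "\<not> p dvd m" "m < n" "m > 0"
proof -
  obtain p where p: "prime p" "p dvd n" using assms prime_factor_nat[of n] by auto
  obtain m where m: "n = p ^ multiplicity p n * m" "\<not> p dvd m"
  proof -
    have "n \<noteq> 0" "\<not> is_unit p" using assms p(1) not_prime_unit by auto
    thus ?thesis using multiplicity_decompose'[of n p] that by blast
  qed
  have "multiplicity p n \<noteq> 0" using m p(2) by (metis mult_1 power_0)
  hence "p ^ multiplicity p n > 1" using prime_gt_1_nat[OF p(1)] by (intro one_less_power) auto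
  moreover have "m > 0" using m assms by (cases m) auto
  ultimately have "1 * m < p ^ multiplicity p n * m" by (intro mult_strict_right_mono)
  hence "m < n" using m(1) by simp
  thus ?thesis using that p m \<open>m > 0\<close> by blast
qed

lemma g_nonneg: "n > 0 \<Longrightarrow> g n \<ge> 0"
proof (induction n rule: less_induct)
  case (less n)
  show ?case
  proof (cases "n = 1")
    case True
    thus ?thesis using chi_1 by (simp add: g_def)
  next
    case False
    then obtain p k m where pkm: "prime p" "n = p ^ k * m" "\<not> p dvd m" "m < n" "m > 0"
      using nat_prime_split[of n] less.prems by auto
    thus ?thesis
      using less.IH[of m] power_sum_nonneg(1)[OF chi_vals] by (simp add: g_prime_power_mult)
  qed
qed

lemma g_square: "n > 0 \<Longrightarrow> g (n\<^sup>2) \<ge> 1"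
proof (induction n rule: less_induct)
  case (less n)
  show ?case
  proof (cases "n = 1")
    case True
    thus ?thesis using chi_1 by (simp add: g_def)
  next
    case False
    then obtain p k m where pkm: "prime p" "n = p ^ k * m" "\<not> p dvd m" "m < n" "m > 0"
      using nat_prime_split[of n] less.prems by auto
    have "n\<^sup>2 = p ^ (2 * k) * m\<^sup>2" using pkm by (simp add: power_mult_distrib power_mult[symmetric] mult.commute)
    moreover have "\<not> p dvd m\<^sup>2" using pkm prime_dvd_power by blast
    ultimately have "g (n\<^sup>2) = (\<Sum>i\<le>2*k. chi p ^ i) * g (m\<^sup>2)" using g_prime_power_mult pkm by simp
    moreover have "1 * 1 \<le> (\<Sum>i\<le>2*k. chi p ^ i) * g (m\<^sup>2)"
      using less.IH[of m] pkm power_sum_nonneg(2)[OF chi_vals, of "2 * k" p] by (intro mult_mono) auto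
    ultimately show ?thesis by simp
  qed
qed

lemma inverse_sqrt_sum_le: "(\<Sum>e=1..n. 1 / sqrt (real e)) \<le> 2 * sqrt (real n)"
proof (induction n)
  case (Suc n)
  have "1 / sqrt (real (Suc n)) \<le> 2 * (sqrt (real (Suc n)) - sqrt (real n))"
  proof -
    define s t where "s = sqrt (real (Suc n))" and "t = sqrt (real n)"
    have st: "0 \<le> t" "t \<le> s" "s > 0" "s * s = t * t + 1" by (simp_all add: s_def t_def)
    have "(s - t) * (s + t) \<le> (s - t) * (2 * s)" using st by (intro mult_left_mono) auto
    hence "1 \<le> 2 * (s - t) * s" using st(4) by (simp add: algebra_simps)
    hence "1 / s \<le> 2 * (s - t)" using st(3) by (simp add: divide_le_eq)
    thus ?thesis by (simp add: s_def t_def)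
  qed
  thus ?case using Suc by simp
qed simp

lemma sum_g_lower: "ln (real Y + 1) \<le> (\<Sum>n=1..Y\<^sup>2. g n / sqrt (real n))"
proof -
  have "ln (real Y + 1) \<le> (\<Sum>k=1..Y. 1 / real k)"
    using ln_le_harm[of Y] by (simp add: harm_def divide_inverse)
  also have "\<dots> \<le> (\<Sum>k=1..Y. g (k\<^sup>2) / sqrt (real (k\<^sup>2)))"
    by (intro sum_mono) (auto intro!: divide_right_mono g_square)
  also have "\<dots> = (\<Sum>n\<in>(\<lambda>k. k\<^sup>2) ` {1..Y}. g n / sqrt (real n))"
    by (subst sum.reindex) (auto simp: inj_on_def)
  also have "\<dots> \<le> (\<Sum>n=1..Y\<^sup>2. g n / sqrt (real n))"
    by (intro sum_mono2) (auto simp: power2_eq_square intro!: mult_mono divide_nonneg_nonneg g_nonneg)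
  finally show ?thesis .
qed

text \<open>The sum of g(n) / sqrt n up to Y^2 is at least the harmonic sum, already from the
  squares. The hyperbola method gives it as 2 * Y * T(Y) plus a bounded quantity. If
  \<open>L = 0\<close>, then T(Y) is O(1 / Y) and the whole sum stays bounded, a
  contradiction.\<close>

lemma L_nonzero: "L \<noteq> 0"
proof
  assume L0: "L = 0"
  obtain c where c: "\<And>z. z \<ge> 1 \<Longrightarrow> \<bar>(\<Sum>e=1..nat \<lfloor>z\<rfloor>. 1 / sqrt (real e)) - 2 * sqrt z - c\<bar> \<le> 2 / sqrt z"
    using inverse_sqrt_sum by blast
  \<comment> \<open>The three summands bound the main term 2 * Y * T(Y), the constant
    \<open>c\<close> with the error terms of \<open>inverse_sqrt_sum\<close>, and the part of the
    hyperbola with d > Y.\<close>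
  define K where "K = 4 * B + (2 * B * \<bar>c\<bar> + 2) + 4 * B"
  have bound: "(\<Sum>n=1..Y\<^sup>2. g n / sqrt (real n)) \<le> K" if Y: "Y \<ge> 1" for Y
  proof -
    define X where "X = Y\<^sup>2"
    define F where "F = (\<lambda>d e. chi d / sqrt (real d) * (1 / sqrt (real e)))"
    have YX: "Y \<le> X" using Y by (simp add: X_def power2_eq_square)
    have "(\<Sum>n=1..X. g n / sqrt (real n)) = (\<Sum>n=1..X. \<Sum>d | d dvd n. F d (n div d))"
    proof (intro sum.cong refl)
      fix n assume n: "n \<in> {1..X}"
      show "g n / sqrt (real n) = (\<Sum>d | d dvd n. F d (n div d))"
        unfolding g_def sum_divide_distrib
      proof (intro sum.cong refl)
        fix d assume "d \<in> {d. d dvd n}"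
        hence "n = d * (n div d)" by simp
        hence "sqrt (real n) = sqrt (real d) * sqrt (real (n div d))"
          by (metis of_nat_mult real_sqrt_mult)
        thus "chi d / sqrt (real n) = F d (n div d)" by (simp add: F_def)
      qed
    qed
    also have "\<dots> = (\<Sum>d=1..X. \<Sum>e=1..X div d. F d e)" by (rule sum_divisors_swap)
    \<comment> \<open>Cut at d = Y, the square root of X. Beyond the cut e is at most Y, so there
      the order of summation is exchanged and the cancellation of \<open>chi\<close> is used in the
      inner sum over d.\<close>
    also have "\<dots> = (\<Sum>d=1..Y. \<Sum>e=1..X div d. F d e) + (\<Sum>d=Suc Y..X. \<Sum>e=1..X div d. F d e)"
    proof -
      have "{1..X} = {1..Y} \<union> {Suc Y..X}" using YX by auto
      thus ?thesis by (simp add: sum.union_disjoint)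
    qed
    also have "(\<Sum>d=Suc Y..X. \<Sum>e=1..X div d. F d e) = (\<Sum>e=1..Y. \<Sum>d=Suc Y..X div e. F d e)"
    proof -
      have "(\<Sum>d=Suc Y..X. \<Sum>e=1..X div d. F d e) = (\<Sum>(d, e)\<in>(SIGMA d:{Suc Y..X}. {1..X div d}). F d e)"
        by (intro sum.Sigma) auto
      also have "\<dots> = (\<Sum>(e, d)\<in>(SIGMA e:{1..Y}. {Suc Y..X div e}). F d e)"
      proof (rule sum.reindex_bij_witness[where i = "\<lambda>(e, d). (d, e)" and j = "\<lambda>(d, e). (e, d)"])
        fix a assume "a \<in> (SIGMA d:{Suc Y..X}. {1..X div d})"
        then obtain d e where a: "a = (d, e)" "Suc Y \<le> d" "d \<le> X" "1 \<le> e" "e \<le> X div d" by auto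
        have de: "d * e \<le> X" using a by (simp add: less_eq_div_iff_mult_less_eq mult.commute)
        have "e \<le> Y"
        proof (rule ccontr)
          assume "\<not> e \<le> Y"
          hence "Y * Y < d * e" using a by (intro mult_strict_mono) auto
          thus False using de by (simp add: X_def power2_eq_square)
        qed
        moreover have "d \<le> X div e" using de a by (simp add: less_eq_div_iff_mult_less_eq)
        ultimately show "(case a of (d, e) \<Rightarrow> (e, d)) \<in> (SIGMA e:{1..Y}. {Suc Y..X div e})" using a by simp
      next
        fix b assume "b \<in> (SIGMA e:{1..Y}. {Suc Y..X div e})"
        then obtain e d where b: "b = (e, d)" "1 \<le> e" "e \<le> Y" "Suc Y \<le> d" "d \<le> X div e" by auto
        have de: "d * e \<le> X" using b by (simp add: less_eq_div_iff_mult_less_eq)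
        hence "e \<le> X div d" using b by (simp add: less_eq_div_iff_mult_less_eq mult.commute)
        moreover have "d \<le> d * e" using b by simp
        hence "d \<le> X" using de by linarith
        ultimately show "(case b of (e, d) \<Rightarrow> (d, e)) \<in> (SIGMA d:{Suc Y..X}. {1..X div d})" using b de by simp
      qed auto
      also have "\<dots> = (\<Sum>e=1..Y. \<Sum>d=Suc Y..X div e. F d e)" by (rule sum.Sigma[symmetric]) auto
      finally show ?thesis .
    qed
    finally have eq: "(\<Sum>n=1..X. g n / sqrt (real n)) =
      (\<Sum>d=1..Y. \<Sum>e=1..X div d. F d e) + (\<Sum>e=1..Y. \<Sum>d=Suc Y..X div e. F d e)" .
    have sqX: "sqrt (real X) = real Y" by (simp add: X_def)
    have sY: "sqrt (real Y) \<ge> 1" using Y by simp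
    have first: "(\<Sum>d=1..Y. \<Sum>e=1..X div d. F d e) \<le> 4 * B + (2 * B * \<bar>c\<bar> + 2)"
    proof -
      define th where "th = (\<lambda>d. (\<Sum>e=1..X div d. 1 / sqrt (real e)) - 2 * sqrt (real X / real d) - c)"
      have th: "\<bar>chi d / sqrt (real d) * th d\<bar> \<le> 2 / real Y" if d: "d \<in> {1..Y}" for d
      proof -
        have "real d \<le> real X" using d YX by simp
        hence z1: "real X / real d \<ge> 1" using d by simp
        have fl: "nat \<lfloor>real X / real d\<rfloor> = X div d" by (simp add: floor_divide_of_nat_eq)
        have "\<bar>th d\<bar> \<le> 2 / sqrt (real X / real d)" using c[OF z1] unfolding th_def fl .
        also have "\<dots> = 2 * sqrt (real d) / real Y" using sqX by (simp add: real_sqrt_divide)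
        finally have "\<bar>th d\<bar> \<le> 2 * sqrt (real d) / real Y" .
        hence "\<bar>chi d\<bar> / sqrt (real d) * \<bar>th d\<bar> \<le> 1 / sqrt (real d) * (2 * sqrt (real d) / real Y)"
          using chi_abs by (intro mult_mono divide_right_mono) auto
        also have "\<dots> = 2 / real Y" using d by simp
        finally show ?thesis by (simp add: abs_mult)
      qed
      have "(\<Sum>d=1..Y. \<Sum>e=1..X div d. F d e) =
          (\<Sum>d=1..Y. 2 * real Y * (chi d * (1 / real d)) + c * (chi d * (1 / sqrt (real d))) + chi d / sqrt (real d) * th d)"
      proof (intro sum.cong refl)
        fix d assume d: "d \<in> {1..Y}"
        have "(\<Sum>e=1..X div d. F d e) = chi d / sqrt (real d) * (\<Sum>e=1..X div d. 1 / sqrt (real e))"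
          by (simp add: F_def sum_distrib_left)
        also have "(\<Sum>e=1..X div d. 1 / sqrt (real e)) = 2 * sqrt (real X / real d) + c + th d"
          by (simp add: th_def)
        also have "sqrt (real X / real d) = real Y / sqrt (real d)" using sqX by (simp add: real_sqrt_divide)
        also have "chi d / sqrt (real d) * (2 * (real Y / sqrt (real d)) + c + th d) =
           2 * real Y * (chi d * (1 / (sqrt (real d) * sqrt (real d)))) + c * (chi d * (1 / sqrt (real d))) + chi d / sqrt (real d) * th d"
          by (simp add: algebra_simps)
        finally show "(\<Sum>e=1..X div d. F d e) = 2 * real Y * (chi d * (1 / real d)) + c * (chi d * (1 / sqrt (real d))) + chi d / sqrt (real d) * th d"
          by simp
      qed
      also have "\<dots> = 2 * real Y * T Y + c * (\<Sum>d=1..Y. chi d * (1 / sqrt (real d))) + (\<Sum>d=1..Y. chi d / sqrt (real d) * th d)"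
        by (simp only: T_def sum.distrib sum_distrib_left)
      also have "\<dots> \<le> 4 * B + 2 * B * \<bar>c\<bar> + 2"
      proof (intro add_mono)
        have "\<bar>T Y\<bar> \<le> 2 * B / real (Suc Y)" using T_L[of Y] L0 by simp
        also have "\<dots> \<le> 2 * B / real Y" using Y B_nonneg by (intro divide_left_mono) auto
        finally have "T Y \<le> 2 * B / real Y" by simp
        hence "2 * real Y * T Y \<le> 2 * real Y * (2 * B / real Y)" using Y by (intro mult_left_mono) auto
        thus "2 * real Y * T Y \<le> 4 * B" using Y by simp
        have "\<bar>\<Sum>d=1..Y. chi d * (1 / sqrt (real d))\<bar> \<le> 2 * B * (1 / sqrt (real 1))"
          by (rule abel_bound) (auto simp: divide_simps)
        hence "\<bar>c\<bar> * \<bar>\<Sum>d=1..Y. chi d * (1 / sqrt (real d))\<bar> \<le> \<bar>c\<bar> * (2 * B)" by (intro mult_left_mono) auto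
        thus "c * (\<Sum>d=1..Y. chi d * (1 / sqrt (real d))) \<le> 2 * B * \<bar>c\<bar>"
          by (simp add: mult.commute abs_mult[symmetric] abs_le_iff)
        have "(\<Sum>d=1..Y. chi d / sqrt (real d) * th d) \<le> (\<Sum>d=1..Y. 2 / real Y)"
          using th by (intro sum_mono) (meson abs_le_D1)
        thus "(\<Sum>d=1..Y. chi d / sqrt (real d) * th d) \<le> 2" using Y by simp
      qed
      finally show ?thesis by simp
    qed
    have second: "(\<Sum>e=1..Y. \<Sum>d=Suc Y..X div e. F d e) \<le> 4 * B"
    proof -
      have "(\<Sum>e=1..Y. \<Sum>d=Suc Y..X div e. F d e) \<le> (\<Sum>e=1..Y. 1 / sqrt (real e) * (2 * B * (1 / sqrt (real Y))))"
      proof (intro sum_mono)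
        fix e assume "e \<in> {1..Y}"
        have "(\<Sum>d=Suc Y..X div e. F d e) = 1 / sqrt (real e) * (\<Sum>d=Suc Y..X div e. chi d * (1 / sqrt (real d)))"
          by (simp add: F_def sum_distrib_left sum_divide_distrib mult.commute)
        also have "(\<Sum>d=Suc Y..X div e. chi d * (1 / sqrt (real d))) \<le> 2 * B * (1 / sqrt (real (Suc Y)))"
        proof -
          have "\<bar>\<Sum>d=Suc Y..X div e. chi d * (1 / sqrt (real d))\<bar> \<le> 2 * B * (1 / sqrt (real (Suc Y)))"
            by (rule abel_bound) (auto simp: divide_simps)
          thus ?thesis by linarith
        qed
        hence "1 / sqrt (real e) * (\<Sum>d=Suc Y..X div e. chi d * (1 / sqrt (real d))) \<le> 1 / sqrt (real e) * (2 * B * (1 / sqrt (real (Suc Y))))"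
          by (intro mult_left_mono) auto
        also have "\<dots> \<le> 1 / sqrt (real e) * (2 * B * (1 / sqrt (real Y)))"
          using Y B_nonneg by (intro mult_left_mono divide_left_mono) auto
        finally show "(\<Sum>d=Suc Y..X div e. F d e) \<le> 1 / sqrt (real e) * (2 * B * (1 / sqrt (real Y)))"
          using \<open>(\<Sum>d=Suc Y..X div e. F d e) = _\<close> by linarith
      qed
      also have "\<dots> = (\<Sum>e=1..Y. 1 / sqrt (real e)) * (2 * B * (1 / sqrt (real Y)))"
        by (simp only: sum_distrib_right)
      also have "\<dots> \<le> (2 * sqrt (real Y)) * (2 * B * (1 / sqrt (real Y)))"
        using B_nonneg by (intro mult_right_mono inverse_sqrt_sum_le) auto
      also have "\<dots> = 4 * B" using sY by simp
      finally show ?thesis .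
    qed
    show ?thesis using eq first second unfolding K_def X_def by linarith
  qed
  obtain Y :: nat where Y: "exp K < real Y" using reals_Archimedean2 by blast
  hence "Y \<ge> 1" using exp_gt_zero[of K] by (cases Y) auto
  have "K = ln (exp K)" by simp
  also have "\<dots> < ln (real Y + 1)" using Y exp_gt_zero[of K] by (subst ln_less_cancel_iff) auto
  also have "\<dots> \<le> K" using sum_g_lower[of Y] bound[OF \<open>Y \<ge> 1\<close>] by linarith
  finally show False by simp
qed

text \<open>Since ln is the divisor sum of the von Mangoldt function, the convergent sum of chi(n)
  ln n / n equals the sum of chi(d) mangoldt(d) / d * T(x / d). Replacing T by \<open>L\<close>
  costs O(psi x / x), which is bounded, and \<open>L\<close> can be divided out.\<close>

lemma mertens_char:
  obtains C where "\<And>x. \<bar>\<Sum>d=1..x. chi d * mangoldt d / real d\<bar> \<le> C"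
proof -
  define f where "f = (\<lambda>n :: nat. ln (real n) / real n)"
  \<comment> \<open>ln n / n decreases only from n = 3 > exp 1 on; the terms n \<le> 2 are treated
    separately.\<close>
  have fdec: "0 \<le> f n \<and> f (Suc n) \<le> f n" if n: "n \<ge> 3" for n
  proof
    show "0 \<le> f n" using n by (simp add: f_def)
    have "exp 1 \<le> real n" using exp_le n by simp
    hence "ln (exp 1) \<le> ln (real n)" using n by (subst ln_le_cancel_iff) auto
    hence l1: "1 \<le> ln (real n)" by simp
    have "real n * (ln (real (Suc n)) - ln (real n)) \<le> 1" using ln_Suc_diff_le n by simp
    hence "real n * ln (real (Suc n)) \<le> real (Suc n) * ln (real n)" using l1 by (simp add: algebra_simps)
    thus "f (Suc n) \<le> f n" using n by (simp add: f_def field_simps)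
  qed
  define A where "A = (\<lambda>x. \<Sum>n=1..x. chi n * f n)"
  have Ab: "\<bar>A x\<bar> \<le> 2 * B * f 3 + 1" for x
  proof -
    have "A x = (\<Sum>n\<in>{1..min x 2}. chi n * f n) + (\<Sum>n=3..x. chi n * f n)"
    proof -
      have "{1..x} = {1..min x 2} \<union> {3..x}" by auto
      moreover have "{1..min x 2} \<inter> {3..x} = {}" by auto
      ultimately show ?thesis unfolding A_def by (simp add: sum.union_disjoint)
    qed
    moreover have "\<bar>\<Sum>n\<in>{1..min x 2}. chi n * f n\<bar> \<le> 1"
    proof -
      have "\<bar>\<Sum>n\<in>{1..min x 2}. chi n * f n\<bar> \<le> (\<Sum>n\<in>{1..min x 2}. \<bar>chi n * f n\<bar>)" by (rule sum_abs)
      also have "\<dots> \<le> (\<Sum>n\<in>{1..2}. \<bar>chi n * f n\<bar>)" by (intro sum_mono2) auto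
      also have "\<dots> = \<bar>chi 2\<bar> * (ln 2 / 2)" by (simp add: f_def numeral_2_eq_2 abs_mult)
      also have "\<dots> \<le> 1 * 1" using chi_abs ln_2_less_1 by (intro mult_mono) auto
      finally show ?thesis by simp
    qed
    moreover have "\<bar>\<Sum>n=3..x. chi n * f n\<bar> \<le> 2 * B * f 3" by (rule abel_bound) (use fdec in auto)
    ultimately show ?thesis by linarith
  qed
  define C where "C = (2 * B * f 3 + 1 + 8 * B) / \<bar>L\<bar>"
  have "\<bar>\<Sum>d=1..x. chi d * mangoldt d / real d\<bar> \<le> C" for x
  proof (cases "x = 0")
    case True
    have "2 * B * f 3 + 1 + 8 * B \<ge> 0" using B_nonneg fdec[of 3] by simp
    thus ?thesis using True by (simp add: C_def)
  next
    case False
    define S where "S = (\<Sum>d=1..x. chi d * mangoldt d / real d)"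
    have "A x = (\<Sum>n=1..x. \<Sum>d | d dvd n. (chi d * mangoldt d / real d) * (chi (n div d) * (1 / real (n div d))))"
      unfolding A_def
    proof (intro sum.cong refl)
      fix n assume n: "n \<in> {1..x}"
      hence "ln (real n) = (\<Sum>d | d dvd n. mangoldt d)" by (simp add: mangoldt_sum)
      hence "chi n * f n = (\<Sum>d | d dvd n. chi n * mangoldt d / real n)"
        by (simp add: f_def sum_divide_distrib sum_distrib_left)
      also have "\<dots> = (\<Sum>d | d dvd n. (chi d * mangoldt d / real d) * (chi (n div d) * (1 / real (n div d))))"
      proof (intro sum.cong refl)
        fix d assume "d \<in> {d. d dvd n}"
        hence e: "n = d * (n div d)" by simp
        have "chi n = chi d * chi (n div d)" using e chi_mult by metis
        moreover have "real n = real d * real (n div d)" using e of_nat_mult by metis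
        ultimately show "chi n * mangoldt d / real n = (chi d * mangoldt d / real d) * (chi (n div d) * (1 / real (n div d)))"
          by simp
      qed
      finally show "chi n * f n = \<dots>" .
    qed
    also have "\<dots> = (\<Sum>d=1..x. \<Sum>e=1..x div d. (chi d * mangoldt d / real d) * (chi e * (1 / real e)))"
      by (rule sum_divisors_swap)
    also have "\<dots> = (\<Sum>d=1..x. (chi d * mangoldt d / real d) * T (x div d))"
      by (simp only: T_def sum_distrib_left)
    finally have AT: "A x = (\<Sum>d=1..x. (chi d * mangoldt d / real d) * T (x div d))" .
    have "L * S - A x = (\<Sum>d=1..x. (chi d * mangoldt d / real d) * (L - T (x div d)))"
      unfolding AT S_def sum_distrib_left sum_subtractf[symmetric]
      by (intro sum.cong refl) (simp add: algebra_simps diff_divide_distrib)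
    hence "\<bar>L * S - A x\<bar> = \<bar>\<Sum>d=1..x. (chi d * mangoldt d / real d) * (L - T (x div d))\<bar>" by simp
    also have "\<dots> \<le> (\<Sum>d=1..x. \<bar>(chi d * mangoldt d / real d) * (L - T (x div d))\<bar>)" by (rule sum_abs)
    also have "\<dots> \<le> (\<Sum>d=1..x. mangoldt d * (2 * B / real x))"
    proof (intro sum_mono)
      fix d assume d: "d \<in> {1..x}"
      have "real x / real d \<le> real (Suc (x div d))"
        using real_div_le_Suc[of x d] by simp
      moreover have "real x / real d > 0" using d by simp
      ultimately have "2 * B / real (Suc (x div d)) \<le> 2 * B / (real x / real d)"
        using B_nonneg by (intro divide_left_mono mult_pos_pos) auto
      hence LT: "\<bar>L - T (x div d)\<bar> \<le> 2 * B * real d / real x" using T_L[of "x div d"] by simp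
      have "\<bar>(chi d * mangoldt d / real d) * (L - T (x div d))\<bar> = \<bar>chi d\<bar> * (mangoldt d / real d) * \<bar>L - T (x div d)\<bar>"
        by (simp add: abs_mult mangoldt_nonneg)
      also have "\<dots> \<le> 1 * (mangoldt d / real d) * (2 * B * real d / real x)"
        using chi_abs LT by (intro mult_mono) (auto simp: mangoldt_nonneg)
      also have "\<dots> = mangoldt d * (2 * B / real x)" using d by simp
      finally show "\<bar>(chi d * mangoldt d / real d) * (L - T (x div d))\<bar> \<le> mangoldt d * (2 * B / real x)" .
    qed
    also have "\<dots> = psi x * (2 * B / real x)" unfolding psi_def by (rule sum_distrib_right[symmetric])
    also have "\<dots> \<le> (4 * real x) * (2 * B / real x)"
      using B_nonneg by (intro mult_right_mono psi_le_4) auto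
    also have "\<dots> = 8 * B" using False by simp
    finally have "\<bar>L * S\<bar> \<le> 2 * B * f 3 + 1 + 8 * B" using Ab[of x] by linarith
    thus ?thesis unfolding C_def S_def[symmetric] using L_nonzero
      by (simp add: abs_mult field_simps)
  qed
  thus ?thesis using that by blast
qed

end

section \<open>Legendre symbols and the characters built from them\<close>

lemma Legendre_vals: "Legendre a p \<in> {-1, 0, 1}"
  by (simp add: Legendre_def)

lemma Legendre_cong:
  assumes "[a = b] (mod p)"
  shows "Legendre a p = Legendre b p"
proof -
  have "[a = 0] (mod p) \<longleftrightarrow> [b = 0] (mod p)" using assms by (metis cong_sym cong_trans)
  moreover have "QuadRes p a \<longleftrightarrow> QuadRes p b"
    unfolding QuadRes_def using assms by (metis cong_sym cong_trans)
  ultimately show ?thesis by (simp add: Legendre_def)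
qed

lemma Legendre_eq_0_iff: "Legendre a p = 0 \<longleftrightarrow> p dvd a"
  by (simp add: Legendre_def cong_0_iff)

lemma Legendre_mult:
  assumes "prime p" "p > (2 :: int)"
  shows "Legendre (a * b) p = Legendre a p * Legendre b p"
proof -
  have E: "[Legendre a p = a ^ ((nat p - 1) div 2)] (mod p)" for a
    using euler_criterion[of "nat p" a] assms by simp
  have "[Legendre (a * b) p = Legendre a p * Legendre b p] (mod p)"
    using cong_trans[OF E[of "a * b"] cong_sym[OF cong_mult[OF E[of a] E[of b], folded power_mult_distrib]]] .
  hence "p dvd Legendre (a * b) p - Legendre a p * Legendre b p" by (simp add: cong_iff_dvd_diff)
  moreover have "\<bar>Legendre (a * b) p - Legendre a p * Legendre b p\<bar> \<le> 2"
    using Legendre_vals[of "a * b" p] Legendre_vals[of a p] Legendre_vals[of b p] by auto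
  ultimately show ?thesis
    using assms(2) dvd_imp_le_int[of "Legendre (a * b) p - Legendre a p * Legendre b p" p] by auto
qed

lemma Legendre_square: "\<not> p dvd a \<Longrightarrow> Legendre (a\<^sup>2) p = 1" if "prime p"
  using that unfolding Legendre_def
  by (auto simp: QuadRes_def cong_0_iff prime_dvd_power_iff intro!: exI[of _ a])

lemma Legendre_1: "prime p \<Longrightarrow> Legendre 1 p = 1"
  using Legendre_square[of p 1] not_prime_unit[of p] by auto

text \<open>If every nonzero residue were a square, squaring would be surjective and hence injective
  on them, but 1 and p - 1 have the same square.\<close>

lemma ex_nonresidue:
  fixes p :: int
  assumes "prime p" "p > 2"
  shows "\<exists>a. Legendre a p = -1"
proof (rule ccontr)
  assume no: "\<not> ?thesis"
  let ?A = "{1..p - 1}"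
  define f where "f = (\<lambda>x :: int. x\<^sup>2 mod p)"
  have "?A \<subseteq> f ` ?A"
  proof
    fix a assume a: "a \<in> ?A"
    hence nd: "\<not> p dvd a" by (auto dest: zdvd_imp_le)
    have "Legendre a p = 1" using no Legendre_vals[of a p] Legendre_eq_0_iff[of a p] nd by auto
    hence "QuadRes p a" unfolding Legendre_def by (auto split: if_splits)
    then obtain y where y: "[y\<^sup>2 = a] (mod p)" unfolding QuadRes_def by blast
    have "f (y mod p) = a" using y a assms by (simp add: f_def cong_def power_mod)
    moreover have "y mod p \<noteq> 0"
    proof
      assume "y mod p = 0"
      hence "p dvd a" using \<open>f (y mod p) = a\<close> by (auto simp: f_def)
      thus False using nd by simp
    qed
    moreover have "0 \<le> y mod p" "y mod p < p" using assms by auto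
    hence "y mod p \<in> ?A" using \<open>y mod p \<noteq> 0\<close> by auto
    ultimately show "a \<in> f ` ?A" by blast
  qed
  hence "card ?A \<le> card (f ` ?A)" by (intro card_mono) auto
  hence "card (f ` ?A) = card ?A" using card_image_le[of ?A f] by simp
  hence "inj_on f ?A" by (simp add: eq_card_imp_inj_on)
  moreover have "f 1 = f (p - 1)"
  proof -
    have "(p - 1)\<^sup>2 = 1 + p * (p - 2)" by (simp add: power2_eq_square algebra_simps)
    thus ?thesis by (simp add: f_def)
  qed
  moreover have "1 \<in> ?A" "p - 1 \<in> ?A" using assms by auto
  ultimately have "1 = p - 1" by (rule inj_onD)
  thus False using assms by simp
qed

text \<open>Multiplication by \<open>u\<close> permutes the residues and changes the sign of
  \<open>chi\<close>, so a full period sums to 0. The additional 1 comes from the summand at 0,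
  which the sum from 1 omits.\<close>

lemma periodic_char_sum:
  fixes chi :: "nat \<Rightarrow> real"
  assumes mult: "\<And>m n. chi (m * n) = chi m * chi n" and vals: "\<And>n. \<bar>chi n\<bar> \<le> 1"
    and per: "\<And>n. chi (n mod M) = chi n" and M: "M > 0" and u: "coprime u M" "chi u = -1"
  shows "\<bar>\<Sum>n=1..x. chi n\<bar> \<le> real M + 1"
proof -
  define S where "S = (\<lambda>k. \<Sum>n<k. chi n)"
  have bij: "bij_betw (\<lambda>n. u * n mod M) {..<M} {..<M}"
  proof -
    have "inj_on (\<lambda>n. u * n mod M) {..<M}"
    proof (rule inj_onI)
      fix a b assume ab: "a \<in> {..<M}" "b \<in> {..<M}" "u * a mod M = u * b mod M"
      hence "[u * a = u * b] (mod M)" by (simp add: cong_def)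
      hence "[a = b] (mod M)" using u(1) cong_mult_lcancel_nat coprime_commute by blast
      thus "a = b" using ab by (simp add: cong_def)
    qed
    moreover have "(\<lambda>n. u * n mod M) ` {..<M} \<subseteq> {..<M}" using M by auto
    ultimately show ?thesis unfolding bij_betw_def
      by (metis card_image card_subset_eq finite_lessThan)
  qed
  have "S M = (\<Sum>n<M. chi (u * n mod M))"
    unfolding S_def by (rule sum.reindex_bij_betw[OF bij, symmetric])
  also have "\<dots> = - S M" by (simp add: per mult u(2) S_def sum_negf)
  finally have SM: "S M = 0" by simp
  have Sb: "\<bar>S k\<bar> \<le> real M" for k
  proof (induction k rule: less_induct)
    case (less k)
    show ?case
    proof (cases "k < M")
      case True
      have "\<bar>S k\<bar> \<le> (\<Sum>n<k. \<bar>chi n\<bar>)" unfolding S_def by (rule sum_abs)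
      also have "\<dots> \<le> (\<Sum>n<k. 1)" by (intro sum_mono vals)
      finally show ?thesis using True by simp
    next
      case False
      have "S k = S M + (\<Sum>n=M..<k. chi n)"
        unfolding S_def using False by (simp add: lessThan_atLeast0 sum.atLeastLessThan_concat)
      also have "(\<Sum>n=M..<k. chi n) = (\<Sum>n=0..<k - M. chi (n + M))"
        using sum.shift_bounds_nat_ivl[of chi 0 M "k - M"] False by simp
      also have "\<dots> = S (k - M)"
        unfolding S_def lessThan_atLeast0 by (intro sum.cong refl) (metis per mod_add_self2)
      finally show ?thesis using less.IH[of "k - M"] SM M False by simp
    qed
  qed
  have "S (Suc x) = chi 0 + (\<Sum>n=1..x. chi n)"
  proof -
    have "{..<Suc x} = insert 0 {1..x}" by auto
    thus ?thesis unfolding S_def by simp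
  qed
  thus ?thesis using Sb[of "Suc x"] vals[of 0] by linarith
qed

text \<open>The characters modulo 4 and 8 and the Legendre symbols, indexed by \<open>-1\<close>, \<open>-2\<close> and the
  odd primes.\<close>

definition qchi :: "int \<Rightarrow> nat \<Rightarrow> real" where
  "qchi i n = (if i = -1 then (if n mod 4 = 1 then 1 else if n mod 4 = 3 then -1 else 0)
     else if i = -2 then (if n mod 8 = 1 \<or> n mod 8 = 7 then 1 else if n mod 8 = 3 \<or> n mod 8 = 5 then -1 else 0)
     else real_of_int (Legendre (int n) i))"

lemma qchi_vals: "qchi i n \<in> {-1, 0, 1}"
  using Legendre_vals[of "int n" i] by (auto simp: qchi_def)

lemma qchi_mult:
  assumes "i = -1 \<or> i = -2 \<or> prime i \<and> i > 2"
  shows "qchi i (m * n) = qchi i m * qchi i n"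
proof -
  consider "i = -1" | "i = -2" | "prime i" "i > 2" using assms by blast
  thus ?thesis
  proof cases
    case 1
    have "m mod 4 \<in> {0, 1, 2, 3}" "n mod 4 \<in> {0, 1, 2, 3}" by auto
    moreover have "(m * n) mod 4 = ((m mod 4) * (n mod 4)) mod 4" by (simp add: mod_mult_eq)
    ultimately show ?thesis using 1 by (elim insertE) (simp_all add: qchi_def)
  next
    case 2
    have "m mod 8 \<in> {0, 1, 2, 3, 4, 5, 6, 7}" "n mod 8 \<in> {0, 1, 2, 3, 4, 5, 6, 7}" by auto
    moreover have "(m * n) mod 8 = ((m mod 8) * (n mod 8)) mod 8" by (simp add: mod_mult_eq)
    ultimately show ?thesis using 2 by (elim insertE) (simp_all add: qchi_def)
  next
    case 3
    thus ?thesis by (simp add: qchi_def Legendre_mult)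
  qed
qed

lemma qchi_1: "i = -1 \<or> i = -2 \<or> prime i \<Longrightarrow> qchi i 1 = 1"
  by (auto simp: qchi_def Legendre_1)

lemma qchi_periodic:
  assumes "i = -1 \<or> i = -2 \<or> prime i" "8 dvd M" "i > 0 \<Longrightarrow> i dvd int M"
  shows "qchi i (n mod M) = qchi i n"
proof -
  have "4 dvd M" using assms(2) dvd_trans[of 4 8 M] by simp
  hence "n mod M mod 4 = n mod 4" "n mod M mod 8 = n mod 8" using assms(2) by (simp_all add: mod_mod_cancel)
  moreover have "Legendre (int (n mod M)) i = Legendre (int n) i" if "prime i"
  proof (rule Legendre_cong)
    have "i dvd int M" using assms(3) that prime_gt_0_int by blast
    thus "[int (n mod M) = int n] (mod i)"
      by (simp add: cong_def zmod_int mod_mod_cancel)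
  qed
  ultimately show ?thesis using assms(1) by (auto simp: qchi_def)
qed

lemma coprime_8_odd: "odd (r :: int) \<Longrightarrow> coprime 8 r"
  using coprime_power_left_iff[of 2 3 r] by simp

text \<open>By the Chinese remainder theorem: 7 modulo 8 changes only the character modulo 4, 5
  modulo 8 only the one modulo 8, and a nonresidue modulo j only that of j. It makes every product
  of distinct characters nontrivial.\<close>

lemma ex_separating_residue:
  fixes R :: "int set"
  assumes R: "finite R" "\<And>r. r \<in> R \<Longrightarrow> prime r \<and> r > 2" and j: "j \<in> {-1, -2} \<union> R"
  shows "\<exists>u. qchi j u = -1 \<and> (\<forall>i\<in>{-1, -2} \<union> R - {j}. qchi i u = 1)"
proof -
  have lift: "\<exists>u :: nat. [int u = a] (mod m) \<and> [int u = b] (mod n)" if mn: "coprime m n" "m > 0" "n > 0" for a b m n :: int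
  proof -
    obtain x where x: "[x = a] (mod m)" "[x = b] (mod n)" using binary_chinese_remainder_int[OF mn(1)] by blast
    have "[x mod (m * n) = x] (mod m)" "[x mod (m * n) = x] (mod n)"
      by (simp_all add: cong_def mod_mod_cancel)
    hence "[x mod (m * n) = a] (mod m)" "[x mod (m * n) = b] (mod n)" using x cong_trans by blast+
    moreover have "x mod (m * n) \<ge> 0" using mn by simp
    ultimately show ?thesis by (intro exI[of _ "nat (x mod (m * n))"]) simp
  qed
  have cop8: "coprime 8 (\<Prod>S)" if "S \<subseteq> R" for S
  proof (rule prod_coprime_right)
    fix r assume "r \<in> S"
    hence "odd r" using R(2) that prime_odd_int by blast
    thus "coprime 8 r" by (rule coprime_8_odd)
  qed
  have pos: "\<Prod>S > 0" if "S \<subseteq> R" for S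
    by (rule prod_pos) (use R(2) that in force)
  have one: "qchi r u = 1" if "r \<in> S" "S \<subseteq> R" "[int u = 1] (mod \<Prod>S)" for r u S
  proof -
    have "finite S" using that(2) R(1) finite_subset by blast
    hence "r dvd \<Prod>S" using that(1) by (rule dvd_prodI)
    hence "[int u = 1] (mod r)" using that(3) cong_dvd_modulus by blast
    hence "Legendre (int u) r = 1" using Legendre_cong Legendre_1 R(2) that by (metis subsetD)
    moreover have "r > 2" using R(2) that by blast
    ultimately show ?thesis by (simp add: qchi_def)
  qed
  have m8: "u mod 8 = nat (a mod 8)" if "[int u = a] (mod 8)" for u a
    using that by (simp add: cong_def) (metis nat_int of_nat_mod of_nat_numeral)
  have m4: "u mod 4 = u mod 8 mod 4" for u :: nat by (simp add: mod_mod_cancel)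
  consider "j = -1" | "j = -2" | "j \<in> R" using j by auto
  thus ?thesis
  proof cases
    case 1
    obtain u where u: "[int u = 7] (mod 8)" "[int u = 1] (mod \<Prod>R)"
      using lift[OF cop8[OF subset_refl] _ pos[OF subset_refl], of 7 1] by auto
    have "qchi (-1) u = -1" "qchi (-2) u = 1" using m8[OF u(1)] m4[of u] by (simp_all add: qchi_def)
    thus ?thesis using 1 one[OF _ subset_refl u(2)] by auto
  next
    case 2
    obtain u where u: "[int u = 5] (mod 8)" "[int u = 1] (mod \<Prod>R)"
      using lift[OF cop8[OF subset_refl] _ pos[OF subset_refl], of 5 1] by auto
    have "qchi (-2) u = -1" "qchi (-1) u = 1" using m8[OF u(1)] m4[of u] by (simp_all add: qchi_def)
    thus ?thesis using 2 one[OF _ subset_refl u(2)] by auto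
  next
    case 3
    let ?S = "R - {j}"
    obtain a where a: "Legendre a j = -1" using ex_nonresidue R(2)[OF 3] by blast
    have cj: "coprime (8 * \<Prod>?S) j"
    proof -
      have "coprime (\<Prod>?S) j"
      proof (rule prod_coprime_left)
        fix r assume "r \<in> ?S"
        thus "coprime r j" using R(2) 3 primes_coprime by (metis DiffD1 DiffD2 insertI1)
      qed
      moreover have "coprime 8 j" using cop8[of "{j}"] 3 by simp
      ultimately show ?thesis by simp
    qed
    obtain u where u: "[int u = 1] (mod (8 * \<Prod>?S))" "[int u = a] (mod j)"
      using lift[OF cj, of 1 a] pos[of ?S] pos[of "{j}"] 3 by auto
    have u8: "[int u = 1] (mod 8)" and uS: "[int u = 1] (mod \<Prod>?S)"
      using u(1) cong_dvd_modulus by (metis dvd_triv_left, metis dvd_triv_right)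
    have "j > 2" using R(2) 3 by blast
    hence "qchi j u = -1" using Legendre_cong[OF u(2)] a by (simp add: qchi_def)
    moreover have "qchi (-1) u = 1" "qchi (-2) u = 1" using m8[OF u8] m4[of u] by (simp_all add: qchi_def)
    ultimately show ?thesis using one[OF _ Diff_subset uS] by (intro exI[of _ u]) auto
  qed
qed

section \<open>Primes in a prescribed class\<close>

lemma primepow_not_prime_count:
  assumes "x \<ge> (2 :: nat)"
  shows "real (card {n \<in> {1..x}. primepow n \<and> \<not> prime n}) \<le> sqrt (real x) * log 2 (real x)"
proof -
  let ?N = "{n \<in> {1..x}. primepow n \<and> \<not> prime n}"
  define a b where "a = nat \<lfloor>sqrt (real x)\<rfloor>" and "b = nat \<lfloor>log 2 (real x)\<rfloor>"
  have "?N \<subseteq> (\<lambda>(c, j). c ^ j) ` ({1..a} \<times> {1..b})"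
  proof
    fix n assume n: "n \<in> ?N"
    then obtain c j where cj: "prime c" "j > 0" "n = c ^ j" by (auto simp: primepow_def)
    have "j \<noteq> 1" using n cj by auto
    hence j2: "j \<ge> 2" using cj by simp
    have c2: "c \<ge> 2" using cj prime_ge_2_nat by blast
    have "c\<^sup>2 \<le> c ^ j" using c2 j2 by (intro power_increasing) auto
    hence "real (c\<^sup>2) \<le> real x" using n cj by (intro of_nat_mono) auto
    hence "real c \<le> sqrt (real x)" by (intro real_le_rsqrt) simp
    hence "c \<le> a" unfolding a_def by (simp add: le_nat_floor)
    have "2 ^ j \<le> c ^ j" using c2 by (intro power_mono) auto
    also have "\<dots> \<le> x" using n cj by simp
    finally have "real (2 ^ j) \<le> real x" by (rule of_nat_mono)
    hence "2 powr real j \<le> real x" by (simp add: powr_realpow)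
    hence "real j \<le> log 2 (real x)" using assms by (subst le_log_iff) auto
    hence "j \<le> b" unfolding b_def by (simp add: le_nat_floor)
    thus "n \<in> (\<lambda>(c, j). c ^ j) ` ({1..a} \<times> {1..b})"
      using cj c2 \<open>c \<le> a\<close> by (intro image_eqI[of _ _ "(c, j)"]) auto
  qed
  hence "card ?N \<le> card ((\<lambda>(c, j). c ^ j) ` ({1..a} \<times> {1..b}))" by (intro card_mono) auto
  also have "\<dots> \<le> card ({1..a} \<times> {1..b})" by (rule card_image_le) simp
  also have "\<dots> = a * b" by simp
  finally have "real (card ?N) \<le> real a * real b" by (metis of_nat_mono of_nat_mult)
  also have "\<dots> \<le> sqrt (real x) * log 2 (real x)"
    using assms by (intro mult_mono) (auto simp: a_def b_def)
  finally show ?thesis .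
qed

text \<open>Modulo a prime that is 5 modulo 8, -1 is a residue and 2 is not. The three squares
  theorem uses both, and reciprocity with such a prime has no sign.\<close>

definition class_primes :: "int set \<Rightarrow> (int \<Rightarrow> int) \<Rightarrow> nat set" where
  "class_primes R eps = {l. prime l \<and> l mod 8 = 5 \<and> (\<forall>r\<in>R. Legendre (int l) r = eps r)}"

text \<open>The class is detected by a product of factors 1 + s * chi. In its expansion only the
  empty product contributes ln x to the sum with weights mangoldt(d) / d; all others are bounded.
  Hence the interval from x / N0 to x carries weight at least 1. A single term is O(ln x / x), and
  higher prime powers are too few to matter.\<close>

theorem class_primes_dense:
  fixes R :: "int set"
  assumes R: "finite R" "\<And>r. r \<in> R \<Longrightarrow> prime r \<and> r > 2" and eps: "\<And>r. r \<in> R \<Longrightarrow> eps r = 1 \<or> eps r = -1"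
  obtains N0 :: nat and c :: real where "N0 \<ge> 1" "c > 0"
    "eventually (\<lambda>x :: nat. c * real x / ln (real x) \<le> real (card (class_primes R eps \<inter> {x div N0 <.. x}))) at_top"
proof -
  define I where "I = {-1, -2} \<union> R"
  have finI: "finite I" using R by (simp add: I_def)
  have I: "i = -1 \<or> i = -2 \<or> prime i \<and> i > 2" if "i \<in> I" for i using that R by (auto simp: I_def)
  define M where "M = nat (8 * \<Prod>R)"
  have PR: "\<Prod>R > 0" by (rule prod_pos) (use R(2) in force)
  have Mpos: "M > 0" using PR by (simp add: M_def)
  have M8: "8 dvd M" unfolding M_def using PR by (simp add: nat_mult_distrib)
  have Mr: "r dvd int M" if "r \<in> R" for r
    unfolding M_def using PR dvd_prodI[OF R(1) that, of "\<lambda>x. x"] by simp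
  have per: "qchi i (n mod M) = qchi i n" if "i \<in> I" for i n
  proof (rule qchi_periodic)
    show "i = -1 \<or> i = -2 \<or> prime i" using I[OF that] by auto
    show "i dvd int M" if "i > 0" using Mr \<open>i \<in> I\<close> that by (auto simp: I_def)
  qed (rule M8)
  \<comment> \<open>Value 1 of the character modulo 4 and -1 of the character modulo 8 single out
    the class 5 modulo 8.\<close>
  define s :: "int \<Rightarrow> real" where "s = (\<lambda>i. if i = -1 then 1 else if i = -2 then -1 else real_of_int (eps i))"
  have s1: "s i = 1 \<or> s i = -1" if "i \<in> I" for i using that eps[of i] by (auto simp: s_def I_def)
  define X where "X = (\<lambda>J n. \<Prod>i\<in>J. qchi i n)"
  \<comment> \<open>Vanishes as soon as one character takes the opposite of the wanted value;
    expanding the product leads to the characters \<open>X J\<close>.\<close>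
  define w where "w = (\<lambda>n. \<Prod>i\<in>I. s i * qchi i n + 1)"
  define W :: real where "W = 2 ^ card I"
  have wexp: "w n = (\<Sum>J\<in>Pow I. (\<Prod>i\<in>J. s i) * X J n)" for n
    unfolding w_def prod_add[OF finI] X_def by (simp add: prod.distrib)
  have bnd: "\<exists>C. \<forall>x. x \<ge> 1 \<longrightarrow> \<bar>(\<Sum>d=1..x. X J d * mangoldt d / real d) - (if J = {} then ln (real x) else 0)\<bar> \<le> C"
    if J: "J \<in> Pow I" for J
  proof (cases "J = {}")
    case True
    thus ?thesis using mertens_first by (intro exI[of _ 4]) (simp add: X_def)
  next
    case False
    then obtain j where j: "j \<in> J" by blast
    have finJ: "finite J" using J finI finite_subset by auto
    obtain u where u: "qchi j u = -1" "\<forall>i\<in>I - {j}. qchi i u = 1"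
      using ex_separating_residue[OF R, of j] j J unfolding I_def by auto
    have vals: "X J n \<in> {-1, 0, 1}" for n
      unfolding X_def using finJ
    proof (induction J)
      case (insert i J)
      thus ?case using qchi_vals[of i n] by auto
    qed simp
    have Xmult: "X J (m * n) = X J m * X J n" for m n
      unfolding X_def prod.distrib[symmetric] by (intro prod.cong refl qchi_mult I) (use J in auto)
    have "X J u = (\<Prod>i\<in>insert j (J - {j}). qchi i u)" unfolding X_def using j by (intro prod.cong) auto
    also have "\<dots> = qchi j u * (\<Prod>i\<in>J - {j}. qchi i u)" using finJ by (subst prod.insert) auto
    also have "(\<Prod>i\<in>J - {j}. qchi i u) = 1" using u(2) J by (intro prod.neutral) auto
    finally have Xu: "X J u = -1" using u(1) by simp
    have nz: "qchi i u \<noteq> 0" if "i \<in> I" for i using u that by (cases "i = j") auto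
    have copu: "coprime u M"
    proof -
      have "odd u"
      proof
        assume "even u"
        hence "qchi (-1) u = 0" unfolding qchi_def by simp presburger
        thus False using nz[of "-1"] by (simp add: I_def)
      qed
      hence "coprime (int u) 8" using coprime_8_odd[of "int u"] by (simp add: coprime_commute)
      moreover have "coprime (int u) (\<Prod>R)"
      proof (rule prod_coprime_right)
        fix r assume r: "r \<in> R"
        hence "r > 2" "prime r" using R by auto
        moreover have "qchi r u \<noteq> 0" using nz r by (simp add: I_def)
        ultimately have "\<not> r dvd int u" by (auto simp: qchi_def Legendre_eq_0_iff)
        thus "coprime (int u) r" using \<open>prime r\<close> prime_imp_coprime coprime_commute by blast
      qed
      ultimately have "coprime (int u) (int M)" using PR by (simp add: M_def)
      thus ?thesis by simp
    qed
    \<comment> \<open>For nonempty J the product is nontrivial: it is -1 at \<open>u\<close>, so its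
      partial sums are bounded.\<close>
    interpret real_char "X J" "real M + 1"
    proof
      show "\<bar>\<Sum>n=1..x. X J n\<bar> \<le> real M + 1" for x
      proof (rule periodic_char_sum[OF Xmult _ _ Mpos copu Xu])
        show "\<bar>X J n\<bar> \<le> 1" for n using vals[of n] by auto
        show "X J (n mod M) = X J n" for n
          unfolding X_def by (intro prod.cong refl per) (use J in auto)
      qed
      show "X J 1 = 1" unfolding X_def by (intro prod.neutral ballI qchi_1) (use I J in auto)
    qed (use Xmult vals in auto)
    obtain C where "\<And>x. \<bar>\<Sum>d=1..x. X J d * mangoldt d / real d\<bar> \<le> C" using mertens_char by blast
    thus ?thesis using False by (intro exI[of _ C]) simp
  qed
  then obtain C where C: "\<And>J x. J \<in> Pow I \<Longrightarrow> x \<ge> 1 \<Longrightarrow>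
      \<bar>(\<Sum>d=1..x. X J d * mangoldt d / real d) - (if J = {} then ln (real x) else 0)\<bar> \<le> C J"
    by metis
  define K where "K = (\<Sum>J\<in>Pow I. C J)"
  define F where "F = (\<lambda>x. \<Sum>d=1..x. w d * mangoldt d / real d)"
  have Fb: "\<bar>F x - ln (real x)\<bar> \<le> K" if x: "x \<ge> 1" for x
  proof -
    have "F x = (\<Sum>d=1..x. \<Sum>J\<in>Pow I. (\<Prod>i\<in>J. s i) * (X J d * mangoldt d / real d))"
      unfolding F_def wexp by (simp add: sum_distrib_right sum_divide_distrib mult.assoc)
    also have "\<dots> = (\<Sum>J\<in>Pow I. (\<Prod>i\<in>J. s i) * (\<Sum>d=1..x. X J d * mangoldt d / real d))"
      unfolding sum_distrib_left by (rule sum.swap)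
    finally have Feq: "F x = (\<Sum>J\<in>Pow I. (\<Prod>i\<in>J. s i) * (\<Sum>d=1..x. X J d * mangoldt d / real d))" .
    have "ln (real x) = (\<Sum>J\<in>Pow I. if J = {} then ln (real x) else 0)"
      using finI by (simp add: sum.delta)
    also have "\<dots> = (\<Sum>J\<in>Pow I. (\<Prod>i\<in>J. s i) * (if J = {} then ln (real x) else 0))"
      by (intro sum.cong) auto
    finally have "F x - ln (real x) = (\<Sum>J\<in>Pow I. (\<Prod>i\<in>J. s i) *
        ((\<Sum>d=1..x. X J d * mangoldt d / real d) - (if J = {} then ln (real x) else 0)))"
      unfolding Feq right_diff_distrib sum_subtractf by linarith
    also have "\<bar>\<dots>\<bar> \<le> (\<Sum>J\<in>Pow I. \<bar>(\<Prod>i\<in>J. s i) *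
        ((\<Sum>d=1..x. X J d * mangoldt d / real d) - (if J = {} then ln (real x) else 0))\<bar>)"
      by (rule sum_abs)
    also have "\<dots> \<le> K" unfolding K_def
    proof (intro sum_mono)
      fix J assume J: "J \<in> Pow I"
      have "\<bar>\<Prod>i\<in>J. s i\<bar> = (\<Prod>i\<in>J. \<bar>s i\<bar>)" by (rule abs_prod)
      also have "\<dots> = 1"
      proof (intro prod.neutral ballI)
        fix i assume "i \<in> J"
        hence "i \<in> I" using J by blast
        thus "\<bar>s i\<bar> = 1" using s1[of i] by auto
      qed
      finally show "\<bar>(\<Prod>i\<in>J. s i) * ((\<Sum>d=1..x. X J d * mangoldt d / real d) - (if J = {} then ln (real x) else 0))\<bar> \<le> C J"
        using C[OF J x] by (simp only: abs_mult mult_1)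
    qed
    finally show ?thesis .
  qed
  have w0: "0 \<le> w n" and wW: "w n \<le> W" for n
  proof -
    have f: "0 \<le> s i * qchi i n + 1 \<and> s i * qchi i n + 1 \<le> 2" if "i \<in> I" for i
      using s1[OF that] qchi_vals[of i n] by auto
    show "0 \<le> w n" unfolding w_def by (intro prod_nonneg) (use f in auto)
    have "w n \<le> (\<Prod>i\<in>I. 2)" unfolding w_def by (intro prod_mono) (use f in auto)
    thus "w n \<le> W" by (simp add: W_def)
  qed
  have wclass: "n \<in> class_primes R eps" if n: "prime n" "n > M" "w n \<noteq> 0" for n
  proof -
    have nz: "s i * qchi i n + 1 \<noteq> 0" if "i \<in> I" for i using n(3) finI that by (auto simp: w_def)
    have "M \<ge> 8" using M8 Mpos by (auto dest: dvd_imp_le)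
    hence "odd n" using n(1,2) prime_odd_nat by simp
    hence "n mod 8 = 1 \<or> n mod 8 = 3 \<or> n mod 8 = 5 \<or> n mod 8 = 7" by presburger
    moreover have "n mod 4 = n mod 8 mod 4" by (simp add: mod_mod_cancel)
    ultimately have "n mod 8 = 5" using nz[of "-1"] nz[of "-2"] by (auto simp: I_def s_def qchi_def)
    moreover have "Legendre (int n) r = eps r" if r: "r \<in> R" for r
    proof -
      have r2: "r > 2" "prime r" using R r by auto
      have "\<not> r dvd int n"
      proof
        assume "r dvd int n"
        hence "r = int n" using r2(2) n(1) primes_dvd_imp_eq[of r "int n"] by simp
        moreover have "r \<le> int M" using Mr[OF r] Mpos by (intro zdvd_imp_le) auto
        ultimately show False using n(2) by simp
      qed
      hence "Legendre (int n) r \<noteq> 0" by (simp add: Legendre_eq_0_iff)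
      moreover have "real_of_int (eps r) * real_of_int (Legendre (int n) r) + 1 \<noteq> 0"
        using nz[of r] r r2 by (simp add: I_def s_def qchi_def)
      ultimately show ?thesis using eps[OF r] Legendre_vals[of "int n" r] by auto
    qed
    ultimately show ?thesis using n(1) by (simp add: class_primes_def)
  qed
  have K0: "K \<ge> 0" using Fb[of 1] by (simp add: F_def)
  \<comment> \<open>Makes ln N0 - 2 * K at least 1, which is the lower bound for the weight of the
    interval.\<close>
  define N0 where "N0 = nat \<lceil>exp (2 * K + 1)\<rceil>"
  have N0: "real N0 \<ge> exp (2 * K + 1)" unfolding N0_def by (rule real_nat_ceiling_ge)
  have N01: "N0 \<ge> 1" using N0 exp_gt_zero[of "2 * K + 1"] by (cases N0) auto
  have W0: "W > 0" by (simp add: W_def)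
  define c where "c = 1 / (2 * W * real N0)"
  have c0: "c > 0" using W0 N01 by (simp add: c_def)
  have main: "1 \<le> (real (card (class_primes R eps \<inter> {x div N0 <.. x})) + sqrt (real x) * log 2 (real x)) * (W * real N0 * ln (real x) / real x)"
    if x: "x \<ge> N0 * (M + 2)" for x
  proof -
    define y where "y = x div N0"
    have yM: "y \<ge> M + 2" unfolding y_def using x N01 by (simp add: less_eq_div_iff_mult_less_eq mult.commute)
    have yx: "y \<le> x" by (simp add: y_def)
    have x2: "x \<ge> 2" using yM yx by simp
    let ?Q = "class_primes R eps \<inter> {y<..x}" and ?N = "{n \<in> {1..x}. primepow n \<and> \<not> prime n}"
    have "real y \<le> real x / real N0" unfolding y_def by (rule of_nat_div_le_of_nat)
    hence "ln (real y) \<le> ln (real x / real N0)" using yM N01 x2 by (subst ln_le_cancel_iff) auto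
    also have "\<dots> = ln (real x) - ln (real N0)" using N01 x2 by (simp add: ln_div)
    finally have "ln (real y) \<le> ln (real x) - ln (real N0)" .
    moreover have "2 * K + 1 \<le> ln (real N0)" using N0 N01 by (subst ln_ge_iff) auto
    ultimately have "1 \<le> F x - F y" using Fb[of x] Fb[of y] yM x2 by simp
    also have "F x - F y = (\<Sum>d\<in>{y<..x}. w d * mangoldt d / real d)"
    proof -
      have "{1..x} = {1..y} \<union> {y<..x}" using yx by auto
      hence "F x = (\<Sum>d\<in>{1..y} \<union> {y<..x}. w d * mangoldt d / real d)" by (simp only: F_def)
      also have "\<dots> = F y + (\<Sum>d\<in>{y<..x}. w d * mangoldt d / real d)"
        unfolding F_def by (rule sum.union_disjoint) auto
      finally show ?thesis by simp
    qed
    also have "\<dots> = (\<Sum>d\<in>?Q \<union> (?N \<inter> {y<..x}). w d * mangoldt d / real d)"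
    proof (rule sum.mono_neutral_right)
      show "\<forall>i\<in>{y<..x} - (?Q \<union> (?N \<inter> {y<..x})). w i * mangoldt i / real i = 0"
      proof
        fix i assume i: "i \<in> {y<..x} - (?Q \<union> (?N \<inter> {y<..x}))"
        show "w i * mangoldt i / real i = 0"
        proof (cases "prime i")
          case True
          thus ?thesis using wclass[of i] i yM by auto
        next
          case False
          hence "\<not> primepow i" using i by auto
          thus ?thesis by (simp add: mangoldt_def)
        qed
      qed
    qed auto
    also have "\<dots> \<le> (\<Sum>d\<in>?Q \<union> (?N \<inter> {y<..x}). W * real N0 * ln (real x) / real x)"
    proof (intro sum_mono)
      fix d assume "d \<in> ?Q \<union> (?N \<inter> {y<..x})"
      hence d: "y < d" "d \<le> x" by auto
      have "x < N0 * (y + 1)" unfolding y_def using dividend_less_times_div[of N0 x] N01 by simp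
      also have "\<dots> \<le> N0 * d" using d by (intro mult_left_mono) auto
      finally have "real x \<le> real (N0 * d)" by (intro of_nat_mono) simp
      hence inv: "1 / real d \<le> real N0 / real x" using d x2 by (simp add: field_simps)
      have "mangoldt d \<le> ln (real d)" using d by (intro mangoldt_le) auto
      also have "\<dots> \<le> ln (real x)" using d by (subst ln_le_cancel_iff) auto
      finally have "w d * mangoldt d * (1 / real d) \<le> W * ln (real x) * (real N0 / real x)"
        using wW[of d] w0[of d] inv x2 W0 by (intro mult_mono) (auto simp: mangoldt_nonneg)
      thus "w d * mangoldt d / real d \<le> W * real N0 * ln (real x) / real x" by (simp add: mult_ac)
    qed
    also have "\<dots> = real (card (?Q \<union> (?N \<inter> {y<..x}))) * (W * real N0 * ln (real x) / real x)" by simp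
    also have "\<dots> \<le> (real (card ?Q) + sqrt (real x) * log 2 (real x)) * (W * real N0 * ln (real x) / real x)"
    proof (intro mult_right_mono)
      have "card (?Q \<union> (?N \<inter> {y<..x})) \<le> card ?Q + card (?N \<inter> {y<..x})" by (rule card_Un_le)
      also have "card (?N \<inter> {y<..x}) \<le> card ?N" by (intro card_mono) auto
      finally have "real (card (?Q \<union> (?N \<inter> {y<..x}))) \<le> real (card ?Q) + real (card ?N)" by linarith
      thus "real (card (?Q \<union> (?N \<inter> {y<..x}))) \<le> real (card ?Q) + sqrt (real x) * log 2 (real x)"
        using primepow_not_prime_count[OF x2] by linarith
      show "0 \<le> W * real N0 * ln (real x) / real x" using W0 x2 by (intro divide_nonneg_nonneg mult_nonneg_nonneg) auto
    qed
    finally show ?thesis by (simp add: y_def)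
  qed
  have lim: "((\<lambda>x :: nat. sqrt (real x) * log 2 (real x) * ln (real x) / real x) \<longlongrightarrow> 0) at_top"
    by real_asymp
  have ev1: "eventually (\<lambda>x :: nat. sqrt (real x) * log 2 (real x) * ln (real x) / real x < c) at_top"
    using order_tendstoD(2)[OF lim c0] .
  have "eventually (\<lambda>x :: nat. c * real x / ln (real x) \<le> real (card (class_primes R eps \<inter> {x div N0 <.. x}))) at_top"
    using ev1 eventually_ge_at_top[of "N0 * (M + 2)"] eventually_ge_at_top[of 2]
  proof eventually_elim
    case (elim x)
    have l: "ln (real x) > 0" "real x > 0" using elim(3) by auto
    have WN: "W * real N0 = 1 / (2 * c)" using W0 N01 by (simp add: c_def)
    define Q where "Q = real (card (class_primes R eps \<inter> {x div N0 <.. x}))"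
    have "1 \<le> (Q + sqrt (real x) * log 2 (real x)) * (1 / (2 * c) * ln (real x) / real x)"
      using main[OF elim(2)] unfolding Q_def WN by simp
    hence "2 * c * real x / ln (real x) \<le> Q + sqrt (real x) * log 2 (real x)"
      using l c0 by (simp add: field_simps)
    moreover have "sqrt (real x) * log 2 (real x) \<le> c * real x / ln (real x)"
      using elim(1) l by (simp add: field_simps)
    ultimately show ?case unfolding Q_def by simp
  qed
  thus ?thesis using that[OF N01 c0] by blast
qed

section \<open>Sums of three squares\<close>

lemma int_sqrt_floor:
  fixes n :: int
  assumes "n \<ge> 0"
  obtains a where "a \<ge> 0" "a\<^sup>2 \<le> n" "n < (a + 1)\<^sup>2"
proof -
  define a where "a = \<lfloor>sqrt (real_of_int n)\<rfloor>"
  have a0: "a \<ge> 0" using assms by (simp add: a_def)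
  have "real_of_int a \<le> sqrt n" "sqrt n < real_of_int a + 1" unfolding a_def by linarith+
  hence "(real_of_int a)\<^sup>2 \<le> (sqrt n)\<^sup>2" "(sqrt n)\<^sup>2 < (real_of_int a + 1)\<^sup>2"
    using a0 assms power_mono[of "real_of_int a" "sqrt n" 2]
      power_strict_mono[of "sqrt n" "real_of_int a + 1" 2] by simp_all
  hence "real_of_int (a\<^sup>2) \<le> real_of_int n" "real_of_int n < real_of_int ((a + 1)\<^sup>2)"
    using assms by simp_all
  hence "a\<^sup>2 \<le> n" "n < (a + 1)\<^sup>2" by linarith+
  thus ?thesis using that a0 by blast
qed

lemma prime_not_square: "prime p \<Longrightarrow> p \<noteq> (a :: int)\<^sup>2"
  using prime_power_iff[of a 2] by auto

text \<open>Thue's argument: two pairs from the box of side sqrt l agree under u - i * v modulo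
  \<open>l\<close>, with i a root of -1. The differences have a sum of squares divisible by
  \<open>l\<close>, positive and less than 2 * l.\<close>

lemma prime_two_squares:
  fixes l :: int
  assumes l: "prime l" "l mod 4 = 1"
  shows "\<exists>a b. l = a\<^sup>2 + b\<^sup>2"
proof -
  obtain i where i: "l dvd i\<^sup>2 + 1" using ex_sqrt_minus_one[OF l] by blast
  have l0: "l > 0" using l prime_gt_0_int by blast
  obtain s where s: "s \<ge> 0" "s\<^sup>2 \<le> l" "l < (s + 1)\<^sup>2" using int_sqrt_floor[of l] l0 by auto
  define f where "f = (\<lambda>(u, v). (u - i * v) mod l)"
  let ?A = "{0..s} \<times> {0..s}"
  have "f ` ?A \<subseteq> {0..<l}" using l0 by (auto simp: f_def)
  hence "card (f ` ?A) \<le> card {0..<l}" by (intro card_mono) auto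
  also have "card {0..<l} < card ?A"
  proof -
    have "nat l < nat ((s + 1)\<^sup>2)" using s l0 by simp
    also have "\<dots> = nat (s + 1) * nat (s + 1)" using s(1) by (simp add: power2_eq_square nat_mult_distrib)
    finally show ?thesis by (simp add: card_cartesian_product)
  qed
  finally have "\<not> inj_on f ?A" by (rule pigeonhole)
  then obtain u v u' v' where uv: "(u, v) \<in> ?A" "(u', v') \<in> ?A" "(u, v) \<noteq> (u', v')" "f (u, v) = f (u', v')"
    unfolding inj_on_def by auto
  define x y where "x = u - u'" and "y = v - v'"
  have xy0: "x \<noteq> 0 \<or> y \<noteq> 0" using uv(3) by (auto simp: x_def y_def)
  have "\<bar>x\<bar> \<le> s" "\<bar>y\<bar> \<le> s" using uv by (auto simp: x_def y_def)
  hence "x\<^sup>2 \<le> s\<^sup>2" "y\<^sup>2 \<le> s\<^sup>2"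
    using abs_le_square_iff[of x s] abs_le_square_iff[of y s] s(1) by simp_all
  moreover have "s\<^sup>2 < l" using s(2) prime_not_square[OF l(1), of s] by simp
  ultimately have lt: "x\<^sup>2 + y\<^sup>2 < 2 * l" by simp
  have "l dvd (u - i * v) - (u' - i * v')" using uv(4) by (simp add: f_def mod_eq_dvd_iff)
  hence d: "l dvd x - i * y" by (simp add: x_def y_def algebra_simps)
  have "x\<^sup>2 + y\<^sup>2 = (x - i * y) * (x + i * y) + (i\<^sup>2 + 1) * y\<^sup>2" by (simp add: power2_eq_square algebra_simps)
  hence "l dvd x\<^sup>2 + y\<^sup>2" using d i by (metis dvd_add dvd_mult2)
  then obtain k where k: "x\<^sup>2 + y\<^sup>2 = l * k" by (elim dvdE)
  have "x\<^sup>2 + y\<^sup>2 > 0" using xy0 by (simp add: sum_power2_gt_zero_iff)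
  hence "k > 0" "k < 2" using k lt l0 by (simp_all add: zero_less_mult_iff)
  hence "l = x\<^sup>2 + y\<^sup>2" using k by simp
  thus ?thesis by blast
qed

text \<open>Aubry's descent: the line through a rational point of the sphere and a nearest integer point
  meets the sphere in a second rational point of smaller denominator.\<close>

lemma aubry_descent:
  fixes N t x y z :: int
  assumes "t > 0" "x\<^sup>2 + y\<^sup>2 + z\<^sup>2 = N * t\<^sup>2"
  shows "\<exists>a b c. a\<^sup>2 + b\<^sup>2 + c\<^sup>2 = N"
  using assms
proof (induction "nat t" arbitrary: t x y z rule: less_induct)
  case less
  define rd where "rd = (\<lambda>a :: int. (2 * a + t) div (2 * t))"
  have rd: "(2 * (a - t * rd a))\<^sup>2 \<le> t\<^sup>2" for a
  proof -
    have "(2 * a + t) = 2 * t * rd a + (2 * a + t) mod (2 * t)" unfolding rd_def by simp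
    moreover have "0 \<le> (2 * a + t) mod (2 * t)" "(2 * a + t) mod (2 * t) < 2 * t" using less.prems by simp_all
    ultimately have "\<bar>2 * (a - t * rd a)\<bar> \<le> t" by (simp add: algebra_simps)
    hence "\<bar>2 * (a - t * rd a)\<bar>\<^sup>2 \<le> t\<^sup>2" by (intro power_mono) auto
    thus ?thesis by simp
  qed
  define a b c where "a = rd x" and "b = rd y" and "c = rd z"
  define r where "r = (x - t * a)\<^sup>2 + (y - t * b)\<^sup>2 + (z - t * c)\<^sup>2"
  have r34: "4 * r \<le> 3 * t\<^sup>2" using rd[of x] rd[of y] rd[of z]
    unfolding r_def a_def b_def c_def power_mult_distrib by simp
  show ?case
  proof (cases "r = 0")
    case True
    have "(x - t * a)\<^sup>2 = 0 \<and> (y - t * b)\<^sup>2 = 0 \<and> (z - t * c)\<^sup>2 = 0"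
      using True zero_le_power2[of "x - t * a"] zero_le_power2[of "y - t * b"] zero_le_power2[of "z - t * c"]
      unfolding r_def by linarith
    hence "x = t * a" "y = t * b" "z = t * c" by auto
    hence "t\<^sup>2 * (a\<^sup>2 + b\<^sup>2 + c\<^sup>2) = t\<^sup>2 * N" using less.prems(2) by (simp add: power_mult_distrib algebra_simps)
    thus ?thesis using less.prems(1) by auto
  next
    case False
    have rpos: "r > 0" using False unfolding r_def by (smt (verit) zero_le_power2)
    \<comment> \<open>The coefficients of the second intersection point of the line. Its denominator
      t' satisfies t * t' = r \<le> 3 * t^2 / 4, so it is smaller than t.\<close>
    define A where "A = a\<^sup>2 + b\<^sup>2 + c\<^sup>2 - N"
    define D where "D = 2 * (N * t - (x * a + y * b + z * c))"
    define t' where "t' = A * t + D"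
    have tt: "t * t' = r"
    proof -
      have "r = (x\<^sup>2 + y\<^sup>2 + z\<^sup>2) - 2 * t * (x * a + y * b + z * c) + t\<^sup>2 * (a\<^sup>2 + b\<^sup>2 + c\<^sup>2)"
        unfolding r_def by (simp add: power2_eq_square algebra_simps)
      thus ?thesis unfolding less.prems(2) t'_def A_def D_def by (simp add: power2_eq_square algebra_simps)
    qed
    have t'pos: "t' > 0" using tt rpos less.prems(1) by (metis zero_less_mult_pos)
    have "t * t' < t * t" using tt r34 less.prems(1) rpos by (simp add: power2_eq_square)
    hence t'lt: "t' < t" using less.prems(1) by simp
    have "(A * x + D * a)\<^sup>2 + (A * y + D * b)\<^sup>2 + (A * z + D * c)\<^sup>2
        = A\<^sup>2 * (x\<^sup>2 + y\<^sup>2 + z\<^sup>2) + 2 * A * D * (x * a + y * b + z * c) + D\<^sup>2 * (a\<^sup>2 + b\<^sup>2 + c\<^sup>2)"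
      by (simp add: power2_eq_square algebra_simps)
    also have "\<dots> = A\<^sup>2 * (N * t\<^sup>2) + A * D * (2 * N * t - D) + D\<^sup>2 * (A + N)"
      unfolding less.prems(2) by (simp add: A_def D_def algebra_simps)
    also have "\<dots> = N * t'\<^sup>2" unfolding t'_def by (simp add: power2_eq_square algebra_simps)
    finally show ?thesis using less.hyps[of t'] t'pos t'lt by simp
  qed
qed

text \<open>A box with sides sqrt(N * l), sqrt N, sqrt l has more than N * l points. A difference of
  two points that agree under \<open>f\<close> makes x^2 + l v^2 - N w^2 a multiple of N * l lying
  strictly between -N l and 2 N l, so it is 0 or N * l. The second value is turned into a zero of
  the form by composition.\<close>

lemma legendre_pigeonhole:
  fixes N l s t :: int
  assumes N: "N > 0" "\<And>a. N \<noteq> a\<^sup>2" and l: "prime l" "coprime N l"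
    and s: "N dvd s\<^sup>2 + l" and t: "l dvd t\<^sup>2 - N"
  shows "\<exists>T X Y. T > 0 \<and> X\<^sup>2 + l * Y\<^sup>2 = N * T\<^sup>2"
proof -
  have l0: "l > 0" using l prime_gt_0_int by blast
  have Nl0: "N * l > 0" using N l0 by simp
  obtain a where a: "a \<ge> 0" "a\<^sup>2 \<le> N * l" "N * l < (a + 1)\<^sup>2" using int_sqrt_floor[of "N * l"] Nl0 by auto
  obtain b where b: "b \<ge> 0" "b\<^sup>2 \<le> N" "N < (b + 1)\<^sup>2" using int_sqrt_floor[of N] N by auto
  obtain c where c: "c \<ge> 0" "c\<^sup>2 \<le> l" "l < (c + 1)\<^sup>2" using int_sqrt_floor[of l] l0 by auto
  define f where "f = (\<lambda>(x, v, w). ((x - s * v) mod N, (x - t * w) mod l))"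
  let ?A = "{0..a} \<times> {0..b} \<times> {0..c}"
  have "f ` ?A \<subseteq> {0..<N} \<times> {0..<l}" using l0 N by (auto simp: f_def)
  hence "card (f ` ?A) \<le> card ({0..<N} \<times> {0..<l})" by (intro card_mono) auto
  also have "\<dots> < card ?A"
  proof -
    have "(N * l) * (N * l) < (a + 1)\<^sup>2 * ((b + 1)\<^sup>2 * (c + 1)\<^sup>2)"
      using a(1,3) b(1,3) c(1,3) N l0 Nl0 by (intro mult_strict_mono) auto
    hence "(N * l)\<^sup>2 < ((a + 1) * ((b + 1) * (c + 1)))\<^sup>2" by (simp add: power2_eq_square mult_ac)
    hence lt: "N * l < (a + 1) * ((b + 1) * (c + 1))"
      using a b c by (auto intro: power_less_imp_less_base)
    have "int (card ({0..<N} \<times> {0..<l})) = N * l" using N l0 by (simp add: card_cartesian_product)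
    moreover have "int (card ?A) = (a + 1) * ((b + 1) * (c + 1))" using a b c by (simp add: card_cartesian_product)
    ultimately show ?thesis using lt by linarith
  qed
  finally have "\<not> inj_on f ?A" by (rule pigeonhole)
  then obtain x1 v1 w1 x2 v2 w2 where d: "(x1, v1, w1) \<in> ?A" "(x2, v2, w2) \<in> ?A"
    "(x1, v1, w1) \<noteq> (x2, v2, w2)" "f (x1, v1, w1) = f (x2, v2, w2)"
    unfolding inj_on_def by auto
  define x v w where "x = x1 - x2" and "v = v1 - v2" and "w = w1 - w2"
  have nz: "x \<noteq> 0 \<or> v \<noteq> 0 \<or> w \<noteq> 0" using d(3) by (auto simp: x_def v_def w_def)
  have "\<bar>x\<bar> \<le> a" "\<bar>v\<bar> \<le> b" "\<bar>w\<bar> \<le> c" using d(1,2) by (auto simp: x_def v_def w_def)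
  hence "x\<^sup>2 \<le> a\<^sup>2" "v\<^sup>2 \<le> b\<^sup>2" "w\<^sup>2 \<le> c\<^sup>2"
    using abs_le_square_iff[of x a] abs_le_square_iff[of v b] abs_le_square_iff[of w c] a(1) b(1) c(1)
    by simp_all
  moreover have "b\<^sup>2 < N" using b(2) N(2)[of b] by simp
  moreover have "c\<^sup>2 < l" using c(2) prime_not_square[OF l(1), of c] by simp
  ultimately have bx: "x\<^sup>2 \<le> N * l" "v\<^sup>2 < N" "w\<^sup>2 < l" using a(2) by auto
  have "N dvd (x1 - s * v1) - (x2 - s * v2)" "l dvd (x1 - t * w1) - (x2 - t * w2)"
    using d(4) by (simp_all add: f_def mod_eq_dvd_iff)
  hence dN: "N dvd x - s * v" and dl: "l dvd x - t * w" by (simp_all add: x_def v_def w_def algebra_simps)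
  define Q where "Q = x\<^sup>2 + l * v\<^sup>2 - N * w\<^sup>2"
  have "Q = (x - s * v) * (x + s * v) + (s\<^sup>2 + l) * v\<^sup>2 - N * w\<^sup>2"
    unfolding Q_def by (simp add: power2_eq_square algebra_simps)
  hence "N dvd Q" using dN s by (metis dvd_add dvd_diff dvd_mult2 dvd_triv_left)
  moreover have "Q = (x - t * w) * (x + t * w) + (t\<^sup>2 - N) * w\<^sup>2 + l * v\<^sup>2"
    unfolding Q_def by (simp add: power2_eq_square algebra_simps)
  hence "l dvd Q" using dl t by (metis dvd_add dvd_mult2 dvd_triv_left)
  ultimately have "N * l dvd Q" using l(2) by (intro divides_mult)
  then obtain k where k: "Q = N * l * k" by (elim dvdE)
  have "l * v\<^sup>2 < N * l" "N * w\<^sup>2 < N * l" using bx l0 N by (simp_all add: mult.commute[of N l])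
  moreover have "0 \<le> l * v\<^sup>2" "0 \<le> N * w\<^sup>2" "0 \<le> x\<^sup>2" using l0 N(1) by simp_all
  ultimately have "- (N * l) < Q" "Q < 2 * (N * l)"
    using bx(1) unfolding Q_def by linarith+
  hence "N * l * (-1) < N * l * k" "N * l * k < N * l * 2" unfolding k by simp_all
  hence "-1 < k" "k < 2" using Nl0 by (simp_all only: mult_less_cancel_left_pos)
  hence "k = 0 \<or> k = 1" by auto
  thus ?thesis
  proof
    assume "k = 0"
    hence eq: "x\<^sup>2 + l * v\<^sup>2 = N * w\<^sup>2" using k by (simp add: Q_def)
    have "w \<noteq> 0"
    proof
      assume "w = 0"
      hence "x\<^sup>2 + l * v\<^sup>2 = 0" using eq by simp
      moreover have "l * v\<^sup>2 \<ge> 0" using l0 by simp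
      ultimately have "x\<^sup>2 = 0" "l * v\<^sup>2 = 0" using zero_le_power2[of x] by linarith+
      thus False using nz \<open>w = 0\<close> l0 by simp
    qed
    thus ?thesis using eq by (intro exI[of _ "\<bar>w\<bar>"] exI[of _ x] exI[of _ v]) simp
  next
    assume "k = 1"
    hence eq: "x\<^sup>2 + l * v\<^sup>2 = N * (w\<^sup>2 + l)" using k by (simp add: Q_def algebra_simps)
    \<comment> \<open>Here the form x^2 + l v^2 takes the value N * (w^2 + l). Composing with w^2 +
      l, itself a value of the same form, gives N times a square.\<close>
    have "(x * w - l * v)\<^sup>2 + l * (x + v * w)\<^sup>2 = (x\<^sup>2 + l * v\<^sup>2) * (w\<^sup>2 + l)"
      by (simp add: power2_eq_square algebra_simps)
    also have "\<dots> = N * (w\<^sup>2 + l)\<^sup>2" unfolding eq by (simp add: power2_eq_square)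
    finally show ?thesis using l0
      by (intro exI[of _ "w\<^sup>2 + l"] exI[of _ "x * w - l * v"] exI[of _ "x + v * w"]) (simp add: add_nonneg_pos)
  qed
qed

lemma Legendre_minus_one:
  assumes "prime r" "r > (2 :: int)"
  shows "Legendre (-1) r = (if r mod 4 = 1 then 1 else -1)"
proof -
  have "odd r" using assms prime_odd_int by blast
  have "[Legendre (-1) r = (-1) ^ ((nat r - 1) div 2)] (mod r)"
    using euler_criterion[of "nat r" "-1"] assms by simp
  moreover have "(-1 :: int) ^ ((nat r - 1) div 2) = (if r mod 4 = 1 then 1 else -1)"
  proof (cases "r mod 4 = 1")
    case True
    hence "r = 4 * (r div 4) + 1" by presburger
    hence "nat r = 4 * nat (r div 4) + 1" using assms by linarith
    hence "even ((nat r - 1) div 2)" by simp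
    thus ?thesis using True by simp
  next
    case False
    hence "r = 4 * (r div 4) + 3" using \<open>odd r\<close> by presburger
    hence "nat r = 4 * nat (r div 4) + 3" using assms by linarith
    hence "odd ((nat r - 1) div 2)" by simp
    thus ?thesis using False by simp
  qed
  ultimately have "r dvd Legendre (-1) r - (if r mod 4 = 1 then 1 else -1)" by (simp add: cong_iff_dvd_diff)
  moreover have "\<bar>Legendre (-1) r - (if r mod 4 = 1 then 1 else -1)\<bar> \<le> 2"
    using Legendre_vals[of "-1" r] by auto
  ultimately show ?thesis
    using assms(2) dvd_imp_le_int[of "Legendre (-1) r - (if r mod 4 = 1 then 1 else -1)" r] by fastforce
qed

text \<open>If i^2 = -1 modulo \<open>l\<close>, then (1 + i)^2 = 2 * i, so 2 and i have the same
  symbol. By Euler's criterion i is a nonresidue, because (l - 1) / 2 is twice an odd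
  number.\<close>

lemma Legendre_two:
  assumes "prime l" "l mod 8 = (5 :: int)"
  shows "Legendre 2 l = -1"
proof -
  have l2: "l > 2" using assms prime_gt_1_int[of l] by (smt (verit) mod_pos_pos_trivial)
  have l4: "l mod 4 = 1" using assms(2) by presburger
  obtain i where i: "l dvd i\<^sup>2 + 1" using ex_sqrt_minus_one[OF assms(1) l4] by blast
  have ndi: "\<not> l dvd 1 + i"
  proof
    assume "l dvd 1 + i"
    hence "l dvd (i\<^sup>2 + 1) - (1 + i) * (i - 1)" using i by (intro dvd_diff dvd_mult2)
    hence "l dvd 2" by (simp add: power2_eq_square algebra_simps)
    thus False using l2 by (auto dest: zdvd_imp_le)
  qed
  have "l dvd (1 + i)\<^sup>2 - 2 * i" using i by (simp add: power2_eq_square algebra_simps)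
  hence "Legendre (2 * i) l = Legendre ((1 + i)\<^sup>2) l"
    by (intro Legendre_cong) (simp add: cong_iff_dvd_diff dvd_diff_commute)
  also have "\<dots> = 1" using Legendre_square[OF assms(1) ndi] .
  finally have p1: "Legendre 2 l * Legendre i l = 1" using Legendre_mult[OF assms(1) l2] by simp
  have "[i\<^sup>2 = -1] (mod l)" using i by (simp add: cong_iff_dvd_diff)
  have "l = 8 * (l div 8) + 5" using assms(2) by presburger
  hence k: "nat l = 8 * nat (l div 8) + 5" using l2 by linarith
  have "[Legendre i l = i ^ ((nat l - 1) div 2)] (mod l)"
    using euler_criterion[of "nat l" i] assms(1) l2 by simp
  also have "(nat l - 1) div 2 = 2 * (2 * nat (l div 8) + 1)" using k by simp
  also have "i ^ (2 * (2 * nat (l div 8) + 1)) = (i\<^sup>2) ^ (2 * nat (l div 8) + 1)" by (rule power_mult)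
  also have "[(i\<^sup>2) ^ (2 * nat (l div 8) + 1) = (-1) ^ (2 * nat (l div 8) + 1)] (mod l)"
    by (rule cong_pow) fact
  finally have "[Legendre i l = -1] (mod l)" by simp
  hence "l dvd Legendre i l + 1" by (simp add: cong_iff_dvd_diff)
  moreover have "\<bar>Legendre i l + 1\<bar> \<le> 2" using Legendre_vals[of i l] by auto
  ultimately have "Legendre i l = -1" using l2 dvd_imp_le_int[of "Legendre i l + 1" l] by fastforce
  thus ?thesis using p1 by simp
qed

lemma Legendre_reciprocity:
  assumes "prime r" "r > (2 :: int)" "prime l" "l mod 4 = 1" "r \<noteq> l"
  shows "Legendre r l = Legendre l r"
proof -
  have l2: "l > 2" using assms(3,4) prime_gt_1_int[of l] by (smt (verit) mod_pos_pos_trivial)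
  have "Legendre r l * Legendre l r = (-1) ^ (nat ((r - 1) div 2 * ((l - 1) div 2)))"
    by (rule Quadratic_Reciprocity_int) (use assms l2 in auto)
  moreover have "even (nat ((r - 1) div 2 * ((l - 1) div 2)))"
  proof -
    have "even ((l - 1) div 2)" using assms(4) by presburger
    moreover have "0 \<le> (r - 1) div 2 * ((l - 1) div 2)" using assms(2) l2 by simp
    ultimately show ?thesis by (simp add: even_nat_iff)
  qed
  ultimately have "Legendre r l * Legendre l r = 1" by simp
  thus ?thesis using Legendre_vals[of r l] Legendre_vals[of l r] by auto
qed

text \<open>By reciprocity and the hypothesis each prime factor r satisfies (r / l) = (l / r) = (-1
  / r), the value at r of the character modulo 4. Both sides are multiplicative in
  \<open>n\<close>.\<close>

lemma Legendre_squarefree: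
  fixes n l :: int
  assumes l: "prime l" "l mod 4 = 1"
  shows "n > 0 \<Longrightarrow> odd n \<Longrightarrow> \<not> l dvd n \<Longrightarrow> (\<And>r. prime r \<Longrightarrow> r dvd n \<Longrightarrow> Legendre l r = Legendre (-1) r) \<Longrightarrow>
    Legendre n l = (if n mod 4 = 1 then 1 else -1)"
proof (induction "nat n" arbitrary: n rule: less_induct)
  case less
  show ?case
  proof (cases "n = 1")
    case True
    thus ?thesis using Legendre_1[OF l(1)] by simp
  next
    case False
    then obtain r where r: "prime r" "r dvd n" using less.prems prime_divisor_exists[of n] by auto
    then obtain n' where n: "n = r * n'" by (elim dvdE)
    have ro: "odd r" "odd n'" using less.prems(2) n by auto
    have r2: "r > 2" using ro(1) r(1) prime_ge_2_int[of r] by (cases "r = 2") auto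
    have n'0: "n' > 0" using less.prems(1) n r2 by (simp add: zero_less_mult_iff)
    have "n' < n" using n n'0 r2 by simp
    have IH: "Legendre n' l = (if n' mod 4 = 1 then 1 else -1)"
    proof (rule less.hyps)
      show "\<not> l dvd n'" using less.prems(3) n by auto
      show "Legendre l s = Legendre (-1) s" if "prime s" "s dvd n'" for s
        using less.prems(4)[of s] that n by simp
    qed (use \<open>n' < n\<close> n'0 ro in auto)
    have l2: "l > 2" using l prime_gt_1_int[of l] by (smt (verit) mod_pos_pos_trivial)
    have "r \<noteq> l" using less.prems(3) r by auto
    hence "Legendre r l = Legendre l r" using Legendre_reciprocity r r2 l by blast
    also have "\<dots> = (if r mod 4 = 1 then 1 else -1)"
      using less.prems(4)[OF r] Legendre_minus_one[OF r(1) r2] by simp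
    finally have "Legendre n l = (if r mod 4 = 1 then 1 else -1) * (if n' mod 4 = 1 then 1 else -1)"
      using Legendre_mult[OF l(1) l2] n IH by simp
    moreover have "r mod 4 = 1 \<or> r mod 4 = 3" "n' mod 4 = 1 \<or> n' mod 4 = 3" using ro by presburger+
    moreover have "n mod 4 = ((r mod 4) * (n' mod 4)) mod 4" by (simp add: n mod_mult_eq)
    ultimately show ?thesis by auto
  qed
qed

lemma squarefree_root:
  fixes N l :: int
  shows "N > 0 \<Longrightarrow> squarefree N \<Longrightarrow> (\<And>r. prime r \<Longrightarrow> r dvd N \<Longrightarrow> \<exists>s. r dvd s\<^sup>2 + l) \<Longrightarrow> \<exists>s. N dvd s\<^sup>2 + l"
proof (induction "nat N" arbitrary: N rule: less_induct)
  case less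
  show ?case
  proof (cases "N = 1")
    case False
    then obtain r where r: "prime r" "r dvd N" using less.prems prime_divisor_exists[of N] by auto
    then obtain n where n: "N = r * n" by (elim dvdE)
    have r2: "r > 1" using r prime_gt_1_int by blast
    have n0: "n > 0" using less.prems(1) n r2 by (simp add: zero_less_mult_iff)
    have "\<not> r dvd n"
    proof
      assume "r dvd n"
      hence "r\<^sup>2 dvd N" using n by (auto simp: power2_eq_square)
      hence "r dvd 1" using less.prems(2) unfolding squarefree_def by blast
      thus False using r(1) not_prime_unit by blast
    qed
    hence cop: "coprime r n" using r(1) prime_imp_coprime by blast
    have "squarefree n" using less.prems(2) n squarefree_multD by blast
    moreover have "n < N" using n n0 r2 by simp
    ultimately obtain s where s: "n dvd s\<^sup>2 + l" using less.hyps[of n] less.prems n n0 by auto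
    obtain t where t: "r dvd t\<^sup>2 + l" using less.prems(3)[OF r] by blast
    obtain u where u: "[u = t] (mod r)" "[u = s] (mod n)" using binary_chinese_remainder_int[OF cop] by blast
    have "[u\<^sup>2 + l = t\<^sup>2 + l] (mod r)" "[u\<^sup>2 + l = s\<^sup>2 + l] (mod n)"
      using u by (auto intro!: cong_add cong_pow)
    hence "r dvd u\<^sup>2 + l" "n dvd u\<^sup>2 + l" using s t cong_dvd_iff by blast+
    hence "N dvd u\<^sup>2 + l" unfolding n using cop by (intro divides_mult)
    thus ?thesis by blast
  qed simp
qed

lemma QuadRes_Legendre: "Legendre a r = 1 \<Longrightarrow> \<exists>s. r dvd s\<^sup>2 - a"
  by (auto simp: Legendre_def QuadRes_def cong_iff_dvd_diff split: if_splits)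

text \<open>Write N = 2 * n and choose a prime l, 5 modulo 8, with (l / r) = (-1 / r) for all primes
  r dividing n. Then -l is a square modulo N, and N is a square modulo l because (2 / l) and (n / l)
  are both -1. This gives X^2 + l Y^2 = N T^2; since l is a sum of two squares, N is a sum of three
  rational squares, and the descent makes them integral.\<close>

lemma three_squares_squarefree:
  fixes N :: int
  assumes N: "N > 0" "N mod 8 = 6" and sf: "squarefree N"
  shows "\<exists>a b c. a\<^sup>2 + b\<^sup>2 + c\<^sup>2 = N"
proof -
  define n where "n = N div 2"
  have n: "N = 2 * n" "n mod 4 = 3" "n > 0" using N unfolding n_def by presburger+
  define R where "R = {r. prime r \<and> r dvd n}"
  have finR: "finite R" unfolding R_def
    by (rule finite_subset[of _ "{0..n}"]) (use n(3) in \<open>auto dest: zdvd_imp_le prime_ge_0_int\<close>)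
  have odd_n: "odd n" using n(2) by presburger
  have R: "prime r \<and> r > 2" if "r \<in> R" for r
  proof -
    have "prime r" "odd r" using that odd_n unfolding R_def by auto
    thus ?thesis using prime_ge_2_int[of r] by (cases "r = 2") auto
  qed
  define eps where "eps = (\<lambda>r. Legendre (-1) r)"
  have eps: "eps r = 1 \<or> eps r = -1" if "r \<in> R" for r
    unfolding eps_def using Legendre_minus_one R[OF that] by auto
  obtain N0 :: nat and c :: real where N0: "c > 0"
    "eventually (\<lambda>x :: nat. c * real x / ln (real x) \<le> real (card (class_primes R eps \<inter> {x div N0 <.. x}))) at_top"
    using class_primes_dense[of R eps, OF finR R eps] by blast
  have "eventually (\<lambda>x :: nat. c * real x / ln (real x) \<le> real (card (class_primes R eps \<inter> {x div N0 <.. x})) \<and> x \<ge> 3) at_top"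
    using N0(2) eventually_ge_at_top[of 3] by eventually_elim auto
  then obtain x :: nat where x: "c * real x / ln (real x) \<le> real (card (class_primes R eps \<inter> {x div N0 <.. x}))" "x \<ge> 3"
    by (metis (mono_tags, lifting) eventually_happens trivial_limit_sequentially)
  have "c * real x / ln (real x) > 0" using N0(1) x(2) by simp
  hence "real (card (class_primes R eps \<inter> {x div N0 <.. x})) > 0" using x(1) by linarith
  then obtain l' where "l' \<in> class_primes R eps" by (auto simp: card_gt_0_iff)
  hence l': "prime l'" "l' mod 8 = 5" "\<And>r. r \<in> R \<Longrightarrow> Legendre (int l') r = eps r" by (auto simp: class_primes_def)
  define l where "l = int l'"
  have l: "prime l" "l mod 8 = 5" using l'(1,2) zmod_int[of l' 8] by (simp_all add: l_def)
  have l4: "l mod 4 = 1" using l(2) by presburger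
  have l2: "l > 2" using l prime_gt_1_int[of l] by (smt (verit) mod_pos_pos_trivial)
  have Ll: "Legendre l r = Legendre (-1) r" if "prime r" "r dvd n" for r
    using l'(3)[of r] that by (simp add: l_def R_def eps_def)
  have ln: "\<not> l dvd n"
  proof
    assume "l dvd n"
    hence "l \<in> R" using l(1) by (simp add: R_def)
    hence "Legendre l l = eps l" using l'(3) by (simp add: l_def)
    moreover have "Legendre l l = 0" by (simp add: Legendre_eq_0_iff)
    ultimately show False using eps[OF \<open>l \<in> R\<close>] by auto
  qed
  have "Legendre N l = Legendre 2 l * Legendre n l" using Legendre_mult[OF l(1) l2] n(1) by simp
  also have "\<dots> = 1" using Legendre_two[OF l] Legendre_squarefree[OF l(1) l4 n(3) odd_n ln Ll] n(2) by simp
  finally obtain t where t: "l dvd t\<^sup>2 - N" using QuadRes_Legendre by blast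
  have "\<exists>s. r dvd s\<^sup>2 + l" if r: "prime r" "r dvd N" for r
  proof (cases "r = 2")
    case True
    have "odd l" using l4 by presburger
    thus ?thesis using True by (intro exI[of _ 1]) simp
  next
    case False
    hence "r dvd n" using r n(1) by (metis prime_dvd_mult_iff primes_dvd_imp_eq two_is_prime_nat prime_int_numeral_eq)
    hence rR: "r \<in> R" using r by (simp add: R_def)
    have "Legendre (- l) r = Legendre (-1) r * Legendre l r"
      using Legendre_mult[of r "-1" l] R[OF rR] by simp
    also have "\<dots> = 1" using Ll[OF r(1) \<open>r dvd n\<close>] eps[OF rR] by (auto simp: eps_def)
    finally show ?thesis using QuadRes_Legendre by fastforce
  qed
  then obtain s where s: "N dvd s\<^sup>2 + l" using squarefree_root[OF N(1) sf] by blast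
  have nsq: "N \<noteq> a\<^sup>2" for a
  proof
    assume "N = a\<^sup>2"
    hence "a\<^sup>2 mod 4 = 2" using N(2) by presburger
    thus False using sq_mod_4[of a] by (auto split: if_splits)
  qed
  have "coprime N l"
  proof -
    have "\<not> l dvd 2" using l2 by (auto dest: zdvd_imp_le)
    hence "\<not> l dvd N" using ln l(1) n(1) prime_dvd_mult_iff by blast
    thus ?thesis using l(1) prime_imp_coprime coprime_commute by blast
  qed
  then obtain T X Y where T: "T > 0" "X\<^sup>2 + l * Y\<^sup>2 = N * T\<^sup>2"
    using legendre_pigeonhole[OF N(1) nsq l(1) _ s t] by blast
  obtain c d where "l = c\<^sup>2 + d\<^sup>2" using prime_two_squares[OF l(1) l4] by blast
  hence "X\<^sup>2 + (c * Y)\<^sup>2 + (d * Y)\<^sup>2 = N * T\<^sup>2" using T(2) by (simp add: power_mult_distrib algebra_simps)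
  thus ?thesis by (rule aubry_descent[OF T(1)])
qed

text \<open>Square factors of N are odd, hence 1 modulo 8, and can be removed without leaving the
  residue class.\<close>

lemma three_squares_6_mod_8:
  fixes N :: int
  shows "N > 0 \<Longrightarrow> N mod 8 = 6 \<Longrightarrow> \<exists>a b c. a\<^sup>2 + b\<^sup>2 + c\<^sup>2 = N"
proof (induction "nat N" arbitrary: N rule: less_induct)
  case less
  show ?case
  proof (cases "squarefree N")
    case True
    thus ?thesis using three_squares_squarefree less.prems by blast
  next
    case False
    then obtain s where s: "s\<^sup>2 dvd N" "\<not> is_unit s" unfolding squarefree_def by blast
    then obtain n where n: "N = s\<^sup>2 * n" by (elim dvdE)
    have "s \<noteq> 0" using n less.prems by auto
    hence s2: "s\<^sup>2 > 1" using s(2) by (metis abs_square_eq_1 int_one_le_iff_zero_less less_le zdvd1_eq zero_less_power2 abs_power2 power2_abs power2_eq_1_iff abs_1 abs_minus)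
    have n0: "n > 0" using less.prems(1) n s2 by (simp add: zero_less_mult_iff)
    have nN: "n < N" using n n0 s2 by simp
    have "odd s"
    proof
      assume "even s"
      hence "4 dvd N" using n by (auto simp: power2_eq_square)
      thus False using less.prems(2) by presburger
    qed
    then obtain k where k: "s = 2 * k + 1" using oddE by blast
    have "s\<^sup>2 = 4 * (k * (k + 1)) + 1" by (simp add: k power2_eq_square algebra_simps)
    moreover obtain j where "k * (k + 1) = 2 * j" by (metis even_mult_iff even_plus_one_iff dvdE)
    ultimately have "s\<^sup>2 = 8 * j + 1" by simp
    hence "N = n + 8 * (j * n)" using n by (simp add: algebra_simps)
    hence "n mod 8 = 6" using less.prems(2) by simp
    then obtain a b c where "a\<^sup>2 + b\<^sup>2 + c\<^sup>2 = n" using less.hyps[of n] n0 nN by auto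
    hence "(s * a)\<^sup>2 + (s * b)\<^sup>2 + (s * c)\<^sup>2 = N"
      unfolding n by (auto simp: power_mult_distrib algebra_simps)
    thus ?thesis by blast
  qed
qed

lemma pure_reps_6_mod_8:
  assumes "N > 0" "N mod 8 = 6"
  shows "pure_reps N \<noteq> {}"
proof -
  obtain a b c where "a\<^sup>2 + b\<^sup>2 + c\<^sup>2 = N" using three_squares_6_mod_8 assms by blast
  hence "HQ 0 a b c \<in> pure_reps N" by (simp add: pure_reps_def hq_norm_def)
  thus ?thesis by blast
qed

section \<open>Exceptional sets\<close>

lemma card_linear_congruence:
  fixes A B l :: int
  assumes "l > 0" "coprime A l"
  shows "card {a \<in> {0..<l}. l dvd A * a + B} = 1"
proof -
  obtain z where z: "[A * z = 1] (mod l)" using cong_solve_coprime_int[OF assms(2)] by blast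
  define a0 where "a0 = (- B * z) mod l"
  have "[A * a0 = A * (- B * z)] (mod l)" unfolding a0_def cong_def by (simp add: mod_mult_right_eq)
  also have "[A * (- B * z) = - B * 1] (mod l)"
    using cong_mult[OF cong_refl[of "- B"] z] by (simp add: mult_ac)
  finally have "[A * a0 = - B] (mod l)" by simp
  hence d0: "l dvd A * a0 + B" by (simp add: cong_iff_dvd_diff)
  have "{a \<in> {0..<l}. l dvd A * a + B} = {a0}"
  proof safe
    fix a assume a: "a \<in> {0..<l}" "l dvd A * a + B"
    have "l dvd (A * a + B) - (A * a0 + B)" using a(2) d0 by (rule dvd_diff)
    hence "l dvd A * (a - a0)" by (simp add: algebra_simps)
    hence "l dvd a - a0" using assms(2) by (simp add: coprime_commute coprime_dvd_mult_right_iff)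
    hence "a mod l = a0 mod l" by (simp add: mod_eq_dvd_iff)
    thus "a = a0" using a(1) assms(1) by (simp add: a0_def)
  qed (use d0 assms(1) in \<open>auto simp: a0_def\<close>)
  thus ?thesis by simp
qed

lemma card_shift_mod:
  fixes l k :: int
  assumes "l > 0" "\<And>y. P (y mod l) = P y"
  shows "card {y \<in> {0..<l}. P y} = card {u \<in> {0..<l}. P (u + k)}"
proof (rule bij_betw_same_card[of "\<lambda>y. (y - k) mod l"])
  show "bij_betw (\<lambda>y. (y - k) mod l) {y \<in> {0..<l}. P y} {u \<in> {0..<l}. P (u + k)}"
  proof (rule bij_betw_byWitness[where f' = "\<lambda>u. (u + k) mod l"])
    show "\<forall>a\<in>{y \<in> {0..<l}. P y}. ((a - k) mod l + k) mod l = a" by (auto simp: mod_add_left_eq)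
    show "\<forall>a'\<in>{u \<in> {0..<l}. P (u + k)}. ((a' + k) mod l - k) mod l = a'" by (auto simp: mod_diff_left_eq)
    show "(\<lambda>y. (y - k) mod l) ` {y \<in> {0..<l}. P y} \<subseteq> {u \<in> {0..<l}. P (u + k)}"
    proof safe
      fix y assume y: "y \<in> {0..<l}" "P y"
      have "((y - k) mod l + k) mod l = y mod l" by (simp add: mod_add_left_eq)
      thus "P ((y - k) mod l + k)" using assms(2) y(2) by metis
    qed (use assms in auto)
    show "(\<lambda>u. (u + k) mod l) ` {u \<in> {0..<l}. P (u + k)} \<subseteq> {y \<in> {0..<l}. P y}"
      using assms by auto
  qed
qed

lemma card_roots_Legendre:
  fixes l d :: int
  assumes l: "prime l" "l > 2"
  shows "int (card {y \<in> {0..<l}. l dvd y\<^sup>2 - d}) = 1 + Legendre d l"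
proof -
  have odd_l: "odd l" using l prime_odd_int by blast
  consider "Legendre d l = 0" | "Legendre d l = 1" | "Legendre d l = -1" using Legendre_vals by blast
  thus ?thesis
  proof cases
    case 1
    hence d: "l dvd d" by (simp add: Legendre_eq_0_iff)
    have "{y \<in> {0..<l}. l dvd y\<^sup>2 - d} = {0}"
    proof safe
      fix y assume y: "y \<in> {0..<l}" "l dvd y\<^sup>2 - d"
      hence "l dvd y\<^sup>2" using d by (metis dvd_add diff_add_cancel)
      hence "l dvd y" using l prime_dvd_power by blast
      thus "y = 0" using y(1) by (auto dest: zdvd_imp_le)
    qed (use d l in auto)
    thus ?thesis using 1 by simp
  next
    case 2
    then obtain s where s: "l dvd s\<^sup>2 - d" using QuadRes_Legendre by blast
    define y0 where "y0 = s mod l"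
    have y0: "y0 \<in> {0..<l}" using l by (simp add: y0_def)
    have "(y0\<^sup>2 - d) mod l = (s\<^sup>2 - d) mod l" unfolding y0_def by (metis mod_diff_left_eq power_mod)
    hence dy0: "l dvd y0\<^sup>2 - d" using s by (simp add: dvd_eq_mod_eq_0)
    have "\<not> l dvd d" using 2 Legendre_eq_0_iff[of d l] by auto
    hence y0n: "y0 \<noteq> 0" using dy0 by auto
    have "{y \<in> {0..<l}. l dvd y\<^sup>2 - d} = {y0, l - y0}"
    proof (intro subset_antisym subsetI)
      fix y assume "y \<in> {y \<in> {0..<l}. l dvd y\<^sup>2 - d}"
      hence y: "y \<in> {0..<l}" "l dvd y\<^sup>2 - d" by auto
      have "l dvd (y\<^sup>2 - d) - (y0\<^sup>2 - d)" using y(2) dy0 by (rule dvd_diff)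
      hence "l dvd (y - y0) * (y + y0)" by (simp add: power2_eq_square algebra_simps)
      hence "l dvd y - y0 \<or> l dvd y + y0" using l(1) prime_dvd_mult_iff by blast
      thus "y \<in> {y0, l - y0}"
      proof
        assume "l dvd y - y0"
        hence "y mod l = y0 mod l" by (simp add: mod_eq_dvd_iff)
        thus ?thesis using y(1) y0 by simp
      next
        assume "l dvd y + y0"
        then obtain k where k: "y + y0 = l * k" by (elim dvdE)
        have "0 < l * k" "l * k < l * 2" unfolding k[symmetric] using y(1) y0 y0n by auto
        hence "k = 1" using l(2) by (simp add: zero_less_mult_iff)
        thus ?thesis using k by simp
      qed
    next
      fix y assume y: "y \<in> {y0, l - y0}"
      have e: "(l - y0)\<^sup>2 - d = l * (l - 2 * y0) + (y0\<^sup>2 - d)"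
        by (simp add: power2_eq_square algebra_simps)
      have "l dvd (l - y0)\<^sup>2 - d" unfolding e by (rule dvd_add[OF dvd_triv_left dy0])
      thus "y \<in> {y \<in> {0..<l}. l dvd y\<^sup>2 - d}" using y y0 y0n dy0 by auto
    qed
    moreover have "y0 \<noteq> l - y0" using odd_l by presburger
    ultimately show ?thesis using 2 by simp
  next
    case 3
    have "{y \<in> {0..<l}. l dvd y\<^sup>2 - d} = {}"
    proof safe
      fix y assume "l dvd y\<^sup>2 - d"
      hence "QuadRes l d" unfolding QuadRes_def by (auto simp: cong_iff_dvd_diff)
      thus "y \<in> {}" using 3 by (auto simp: Legendre_def split: if_splits)
    qed
    thus ?thesis using 3 by (simp only: card.empty)
  qed
qed

lemma card_filter_sum: "finite A \<Longrightarrow> int (card {x \<in> A. P x}) = (\<Sum>x\<in>A. if P x then 1 else 0)"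
  by (simp add: sum.If_cases Int_def)

text \<open>The sum counts the points of y^2 = m^2 a^2 - c modulo \<open>l\<close>. With y = u + m a
  the equation becomes linear in a: no solution for u = 0 and exactly one for each other u, so there
  are l - 1 points.\<close>

lemma Legendre_quadratic_sum:
  fixes l m c :: int
  assumes l: "prime l" "l > 2" and m: "\<not> l dvd m" and c: "\<not> l dvd c"
  shows "(\<Sum>a\<in>{0..<l}. Legendre (m\<^sup>2 * a\<^sup>2 - c) l) = -1"
proof -
  have fin: "finite {0..<l}" by simp
  have "(\<Sum>a\<in>{0..<l}. 1 + Legendre (m\<^sup>2 * a\<^sup>2 - c) l) =
      (\<Sum>a\<in>{0..<l}. int (card {y \<in> {0..<l}. l dvd y\<^sup>2 - (m\<^sup>2 * a\<^sup>2 - c)}))"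
    by (simp only: card_roots_Legendre[OF l])
  also have "\<dots> = (\<Sum>a\<in>{0..<l}. int (card {u \<in> {0..<l}. l dvd u\<^sup>2 + 2 * m * a * u + c}))"
  proof (intro sum.cong refl arg_cong[where f = int])
    fix a
    have "card {y \<in> {0..<l}. l dvd y\<^sup>2 - (m\<^sup>2 * a\<^sup>2 - c)} =
        card {u \<in> {0..<l}. l dvd (u + m * a)\<^sup>2 - (m\<^sup>2 * a\<^sup>2 - c)}"
    proof (rule card_shift_mod)
      show "l dvd (y mod l)\<^sup>2 - (m\<^sup>2 * a\<^sup>2 - c) \<longleftrightarrow> l dvd y\<^sup>2 - (m\<^sup>2 * a\<^sup>2 - c)" for y
      proof -
        have "((y mod l)\<^sup>2 - e) mod l = (y\<^sup>2 - e) mod l" for e by (metis mod_diff_left_eq power_mod)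
        thus ?thesis by (simp only: dvd_eq_mod_eq_0)
      qed
    qed (use l in simp)
    moreover have "(u + m * a)\<^sup>2 - (m\<^sup>2 * a\<^sup>2 - c) = u\<^sup>2 + 2 * m * a * u + c" for u
      by (simp add: power2_eq_square algebra_simps)
    ultimately show "card {y \<in> {0..<l}. l dvd y\<^sup>2 - (m\<^sup>2 * a\<^sup>2 - c)} = card {u \<in> {0..<l}. l dvd u\<^sup>2 + 2 * m * a * u + c}"
      by (simp only:)
  qed
  also have "\<dots> = (\<Sum>a\<in>{0..<l}. \<Sum>u\<in>{0..<l}. if l dvd u\<^sup>2 + 2 * m * a * u + c then 1 else 0)"
    by (simp only: card_filter_sum[OF fin])
  also have "\<dots> = (\<Sum>u\<in>{0..<l}. \<Sum>a\<in>{0..<l}. if l dvd u\<^sup>2 + 2 * m * a * u + c then 1 else 0)"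
    by (rule sum.swap)
  also have "\<dots> = (\<Sum>u\<in>{0..<l}. int (card {a \<in> {0..<l}. l dvd u\<^sup>2 + 2 * m * a * u + c}))"
    by (simp only: card_filter_sum[OF fin])
  also have "\<dots> = (\<Sum>u\<in>{0..<l}. if u = 0 then 0 else 1)"
  proof (intro sum.cong refl)
    fix u assume u: "u \<in> {0..<l}"
    show "int (card {a \<in> {0..<l}. l dvd u\<^sup>2 + 2 * m * a * u + c}) = (if u = 0 then 0 else 1)"
    proof (cases "u = 0")
      case True
      have "{a \<in> {0..<l}. l dvd u\<^sup>2 + 2 * m * a * u + c} = {}" using True c by auto
      thus ?thesis using True by (simp only: card.empty) simp
    next
      case False
      have "\<not> l dvd u" using u False by (auto dest: zdvd_imp_le)
      moreover have "\<not> l dvd 2" using l by (auto dest: zdvd_imp_le)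
      ultimately have "\<not> l dvd 2 * m * u" using m l(1) prime_dvd_mult_iff by blast
      hence "coprime (2 * m * u) l" using l(1) prime_imp_coprime coprime_commute by blast
      hence "card {a \<in> {0..<l}. l dvd (2 * m * u) * a + (u\<^sup>2 + c)} = 1"
        using l by (intro card_linear_congruence) auto
      moreover have "(2 * m * u) * a + (u\<^sup>2 + c) = u\<^sup>2 + 2 * m * a * u + c" for a by simp
      ultimately show ?thesis using False by simp
    qed
  qed
  also have "\<dots> = l - 1"
  proof -
    have "{0..<l} = insert 0 {1..<l}" using l by auto
    thus ?thesis using l by simp
  qed
  finally show ?thesis using l by (simp add: sum.distrib)
qed

lemma sum_mod_product:
  fixes a b :: int and u v :: "int \<Rightarrow> int"
  assumes "coprime a b" "a > 0" "b > 0"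
  shows "(\<Sum>x\<in>{0..<a * b}. u (x mod a) * v (x mod b)) = (\<Sum>x\<in>{0..<a}. u x) * (\<Sum>y\<in>{0..<b}. v y)"
proof -
  define f where "f = (\<lambda>x. (x mod a, x mod b))"
  have inj: "inj_on f {0..<a * b}"
  proof (rule inj_onI)
    fix x y assume xy: "x \<in> {0..<a * b}" "y \<in> {0..<a * b}" "f x = f y"
    hence "a dvd x - y" "b dvd x - y" by (simp_all add: f_def mod_eq_dvd_iff)
    hence "a * b dvd x - y" using assms(1) by (intro divides_mult)
    hence "x mod (a * b) = y mod (a * b)" by (simp add: mod_eq_dvd_iff)
    thus "x = y" using xy by simp
  qed
  have sub: "f ` {0..<a * b} \<subseteq> {0..<a} \<times> {0..<b}" using assms by (auto simp: f_def)
  have "card ({0..<a} \<times> {0..<b}) = card (f ` {0..<a * b})"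
    using assms by (simp add: card_image[OF inj] card_cartesian_product nat_mult_distrib)
  hence img: "f ` {0..<a * b} = {0..<a} \<times> {0..<b}" using sub by (intro card_subset_eq) auto
  have "(\<Sum>x\<in>{0..<a}. u x) * (\<Sum>y\<in>{0..<b}. v y) = (\<Sum>(x, y)\<in>{0..<a} \<times> {0..<b}. u x * v y)"
    by (simp add: sum_product sum.cartesian_product)
  also have "\<dots> = (\<Sum>x\<in>{0..<a * b}. (\<lambda>(x, y). u x * v y) (f x))"
    unfolding img[symmetric] by (rule sum.reindex[OF inj, unfolded o_def])
  finally show ?thesis by (simp add: f_def)
qed

text \<open>Every full period contributes at most 1 and the incomplete one at most
  \<open>M\<close>.\<close>

lemma periodic_sum_bound:
  fixes g :: "int \<Rightarrow> int" and M :: int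
  assumes M: "M > 0" and per: "\<And>x. g (x mod M) = g x" and bd: "\<And>x. \<bar>g x\<bar> \<le> 1"
    and S: "\<bar>\<Sum>x\<in>{0..<M}. g x\<bar> \<le> 1"
  shows "\<bar>\<Sum>x\<in>{0..<int k}. g x\<bar> \<le> int k div M + M"
proof (induction k rule: less_induct)
  case (less k)
  show ?case
  proof (cases "int k < M")
    case True
    have "\<bar>\<Sum>x\<in>{0..<int k}. g x\<bar> \<le> (\<Sum>x\<in>{0..<int k}. \<bar>g x\<bar>)" by (rule sum_abs)
    also have "\<dots> \<le> (\<Sum>x\<in>{0..<int k}. 1)" by (intro sum_mono bd)
    also have "\<dots> \<le> int k div M + M" using True M by simp
    finally show ?thesis .
  next
    case False
    define j where "j = k - nat M"
    have j: "int k = int j + M" "j < k" using False M by (auto simp: j_def)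
    have "{0..<int k} = {0..<M} \<union> {M..<int k}" using False M by auto
    hence "(\<Sum>x\<in>{0..<int k}. g x) = (\<Sum>x\<in>{0..<M}. g x) + (\<Sum>x\<in>{M..<int k}. g x)"
      by (simp add: sum.union_disjoint)
    also have "(\<Sum>x\<in>{M..<int k}. g x) = (\<Sum>x\<in>{0..<int j}. g x)"
    proof (rule sum.reindex_bij_witness[of _ "\<lambda>x. x + M" "\<lambda>x. x - M"])
      show "g (a - M) = g a" for a using per[of a] per[of "a - M"] by simp
    qed (use j in auto)
    finally have "\<bar>\<Sum>x\<in>{0..<int k}. g x\<bar> \<le> 1 + (int j div M + M)"
      using S less.IH[OF j(2)] by linarith
    also have "1 + int j div M = int k div M" using M by (simp add: j(1))
    hence "1 + (int j div M + M) = int k div M + M" by simp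
    finally show ?thesis .
  qed
qed

lemma few_prime_divisors:
  fixes N :: int
  assumes "finite S" "\<And>l. l \<in> S \<Longrightarrow> prime l \<and> l dvd N" "N \<noteq> 0"
  shows "2 ^ card S \<le> \<bar>N\<bar>"
proof -
  have "\<Prod>S dvd N"
    using assms(1,2)
  proof (induction S)
    case (insert l S)
    have "coprime l (\<Prod>S)"
    proof (rule prod_coprime_right)
      fix r assume "r \<in> S"
      thus "coprime l r" using insert by (intro primes_coprime) auto
    qed
    thus ?case using insert by (simp add: divides_mult)
  qed simp
  hence "\<bar>\<Prod>S\<bar> \<le> \<bar>N\<bar>" by (rule dvd_imp_le_int[OF assms(3)])
  hence "\<Prod>S \<le> \<bar>N\<bar>" by simp
  moreover have "(\<Prod>l\<in>S. 2) \<le> \<Prod>S"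
    by (rule prod_mono) (use assms(2) prime_ge_2_int in force)
  ultimately show ?thesis by simp
qed

text \<open>After expanding the square, the diagonal gives \<open>card L\<close> times X. Off the
  diagonal a period of length l * l' sums to (-1)(-1) = 1, leaving at most X / y0^2 + B^2. The
  assumption \<open>card L\<close> \<le> y0^2 bounds the first of these, summed over all pairs, by
  the diagonal.\<close>

lemma split_primes_moment:
  fixes L :: "int set" and m c B y0 :: int and X :: nat
  assumes L: "finite L" "\<And>l. l \<in> L \<Longrightarrow> prime l \<and> l > 2 \<and> \<not> l dvd m \<and> \<not> l dvd c \<and> l \<le> B \<and> y0 \<le> l"
    and y0: "y0 > 0" "int (card L) \<le> y0\<^sup>2"
  defines "F \<equiv> \<lambda>a. \<Sum>l\<in>L. Legendre (m\<^sup>2 * a\<^sup>2 - c) l"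
  shows "(\<Sum>a\<in>{0..<int X}. (F a)\<^sup>2) \<le> 2 * int (card L) * int X + (int (card L))\<^sup>2 * B\<^sup>2"
proof -
  let ?f = "\<lambda>a. m\<^sup>2 * a\<^sup>2 - c"
  have per: "Legendre (?f (a mod M)) l = Legendre (?f a) l" if "l dvd M" for a M l
  proof (rule Legendre_cong)
    have "[a mod M = a] (mod l)" using that by (simp add: cong_def mod_mod_cancel)
    thus "[?f (a mod M) = ?f a] (mod l)" by (intro cong_diff cong_mult cong_pow) auto
  qed
  have pair: "(\<Sum>a\<in>{0..<int X}. Legendre (?f a) l * Legendre (?f a) l')
      \<le> (if l = l' then int X else 0) + int X div y0\<^sup>2 + B\<^sup>2" if ll: "l \<in> L" "l' \<in> L" for l l'
  proof (cases "l = l'")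
    case True
    have "(\<Sum>a\<in>{0..<int X}. Legendre (?f a) l * Legendre (?f a) l') \<le> (\<Sum>a\<in>{0..<int X}. 1)"
      by (intro sum_mono) (use Legendre_vals True in \<open>force simp: Legendre_def\<close>)
    also have "\<dots> = int X" by simp
    finally have "(\<Sum>a\<in>{0..<int X}. Legendre (?f a) l * Legendre (?f a) l') \<le> int X" .
    moreover have "int X div y0\<^sup>2 \<ge> 0" using y0(1) by (simp add: pos_imp_zdiv_nonneg_iff)
    moreover have "(if l = l' then int X else 0) = int X" using True by simp
    ultimately show ?thesis using zero_le_power2[of B] by linarith
  next
    case False
    have l: "prime l" "l > 2" "\<not> l dvd m" "\<not> l dvd c" "l \<le> B" "y0 \<le> l" using L(2)[OF ll(1)] by auto
    have l': "prime l'" "l' > 2" "\<not> l' dvd m" "\<not> l' dvd c" "l' \<le> B" "y0 \<le> l'" using L(2)[OF ll(2)] by auto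
    have cop: "coprime l l'" using l l' False primes_coprime by blast
    have "(\<Sum>a\<in>{0..<l * l'}. Legendre (?f a) l * Legendre (?f a) l')
        = (\<Sum>a\<in>{0..<l * l'}. Legendre (?f (a mod l)) l * Legendre (?f (a mod l')) l')"
      by (simp add: per)
    also have "\<dots> = (\<Sum>a\<in>{0..<l}. Legendre (?f a) l) * (\<Sum>a\<in>{0..<l'}. Legendre (?f a) l')"
      by (rule sum_mod_product) (use cop l l' in auto)
    also have "\<dots> = 1" using Legendre_quadratic_sum l l' by simp
    finally have one: "(\<Sum>a\<in>{0..<l * l'}. Legendre (?f a) l * Legendre (?f a) l') = 1" .
    have "\<bar>\<Sum>a\<in>{0..<int X}. Legendre (?f a) l * Legendre (?f a) l'\<bar> \<le> int X div (l * l') + l * l'"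
    proof (rule periodic_sum_bound)
      show "l * l' > 0" using l l' by simp
      show "Legendre (?f (x mod (l * l'))) l * Legendre (?f (x mod (l * l'))) l' = Legendre (?f x) l * Legendre (?f x) l'" for x
        using per[of l "l * l'"] per[of l' "l * l'"] by simp
      show "\<bar>Legendre (?f x) l * Legendre (?f x) l'\<bar> \<le> 1" for x by (simp add: Legendre_def)
    qed (use one in simp)
    moreover have "int X div (l * l') \<le> int X div y0\<^sup>2"
    proof (rule zdiv_mono2)
      show "y0\<^sup>2 \<le> l * l'" unfolding power2_eq_square using l l' y0 by (intro mult_mono) auto
    qed (use y0 in auto)
    moreover have "l * l' \<le> B\<^sup>2" unfolding power2_eq_square using l l' by (intro mult_mono) auto
    moreover have "(if l = l' then int X else 0) = 0" using False by simp
    ultimately show ?thesis by linarith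
  qed
  have "(\<Sum>a\<in>{0..<int X}. (F a)\<^sup>2) = (\<Sum>a\<in>{0..<int X}. \<Sum>l\<in>L. \<Sum>l'\<in>L. Legendre (?f a) l * Legendre (?f a) l')"
    unfolding F_def power2_eq_square[of "sum _ _"] by (simp only: sum_product)
  also have "\<dots> = (\<Sum>l\<in>L. \<Sum>a\<in>{0..<int X}. \<Sum>l'\<in>L. Legendre (?f a) l * Legendre (?f a) l')"
    by (rule sum.swap)
  also have "\<dots> = (\<Sum>l\<in>L. \<Sum>l'\<in>L. \<Sum>a\<in>{0..<int X}. Legendre (?f a) l * Legendre (?f a) l')"
    by (intro sum.cong refl sum.swap)
  also have "\<dots> \<le> (\<Sum>l\<in>L. \<Sum>l'\<in>L. (if l = l' then int X else 0) + int X div y0\<^sup>2 + B\<^sup>2)"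
    by (intro sum_mono pair)
  also have "\<dots> = int (card L) * int X + int (card L) * int (card L) * (int X div y0\<^sup>2) + int (card L) * int (card L) * B\<^sup>2"
    using L(1) by (simp add: sum.distrib sum.delta distrib_left)
  also have "int (card L) * int (card L) * (int X div y0\<^sup>2) \<le> int (card L) * int X"
  proof -
    have nn: "int X div y0\<^sup>2 \<ge> 0" using y0(1) by (simp add: pos_imp_zdiv_nonneg_iff)
    have "int (card L) * (int X div y0\<^sup>2) \<le> y0\<^sup>2 * (int X div y0\<^sup>2)" using y0(2) nn by (intro mult_right_mono)
    also have "\<dots> \<le> int X" using y0(1) by (simp add: minus_mod_eq_mult_div[symmetric])
    finally show ?thesis by (simp add: mult.assoc mult_left_mono)
  qed
  finally show ?thesis by (simp add: power2_eq_square mult_ac)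
qed

text \<open>By \<open>big\<close> at most a quarter of the primes divide the value at a. If less
  than a quarter split, at least half are inert, and the sum of symbols is at most -K / 4 for K =
  \<open>card L\<close>. Chebyshev's inequality with the second moment gives the count; 32 and 16
  come from dividing by (K / 4)^2.\<close>

lemma few_split_exceptions:
  fixes L :: "int set" and m c B y0 :: int and X :: nat
  assumes L: "finite L" "\<And>l. l \<in> L \<Longrightarrow> prime l \<and> l > 2 \<and> \<not> l dvd m \<and> \<not> l dvd c \<and> l \<le> B \<and> y0 \<le> l"
    and y0: "y0 > 0" "int (card L) \<le> y0\<^sup>2"
    and ne: "L \<noteq> {}"
    and big: "\<And>a. a \<in> {0..<int X} \<Longrightarrow> m\<^sup>2 * a\<^sup>2 - c \<noteq> 0 \<Longrightarrow> real_of_int \<bar>m\<^sup>2 * a\<^sup>2 - c\<bar> \<le> 2 powr (real (card L) / 4)"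
  shows "real (card {a \<in> {0..<int X}. m\<^sup>2 * a\<^sup>2 - c \<noteq> 0 \<and>
      real (card {l \<in> L. Legendre (m\<^sup>2 * a\<^sup>2 - c) l = 1}) < real (card L) / 4})
    \<le> 32 * real X / real (card L) + 16 * (real_of_int B)\<^sup>2"
proof -
  let ?f = "\<lambda>a. m\<^sup>2 * a\<^sup>2 - c"
  define E where "E = {a \<in> {0..<int X}. ?f a \<noteq> 0 \<and> real (card {l \<in> L. Legendre (?f a) l = 1}) < real (card L) / 4}"
  define F where "F = (\<lambda>a. \<Sum>l\<in>L. Legendre (?f a) l)"
  define K where "K = real (card L)"
  have K0: "K > 0" using L(1) ne by (simp add: K_def card_gt_0_iff)
  have FE: "(real_of_int (F a))\<^sup>2 \<ge> (K / 4)\<^sup>2" if a: "a \<in> E" for a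
  proof -
    define S T Z where "S = {l \<in> L. Legendre (?f a) l = 1}" and "T = {l \<in> L. Legendre (?f a) l = -1}"
      and "Z = {l \<in> L. Legendre (?f a) l = 0}"
    have fin: "finite S" "finite T" "finite Z" using L(1) by (auto simp: S_def T_def Z_def)
    have Lu: "L = S \<union> (T \<union> Z)" using Legendre_vals by (auto simp: S_def T_def Z_def)
    have disj: "S \<inter> (T \<union> Z) = {}" "T \<inter> Z = {}" by (auto simp: S_def T_def Z_def)
    have cL: "card L = card S + (card T + card Z)"
      by (subst Lu) (use fin disj in \<open>simp add: card_Un_disjoint\<close>)
    have "F a = sum (\<lambda>l. Legendre (?f a) l) (S \<union> (T \<union> Z))" unfolding F_def using Lu by simp
    also have "\<dots> = sum (\<lambda>l. Legendre (?f a) l) S + (sum (\<lambda>l. Legendre (?f a) l) T + sum (\<lambda>l. Legendre (?f a) l) Z)"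
      using fin disj by (simp add: sum.union_disjoint)
    also have "\<dots> = int (card S) - int (card T)" by (simp add: S_def T_def Z_def)
    finally have Fa: "F a = int (card S) - int (card T)" .
    have fa0: "?f a \<noteq> 0" using a by (simp add: E_def)
    have "2 ^ card Z \<le> \<bar>?f a\<bar>"
      by (rule few_prime_divisors) (use fin fa0 L(2) in \<open>auto simp: Z_def Legendre_eq_0_iff\<close>)
    hence "real_of_int (2 ^ card Z) \<le> real_of_int \<bar>?f a\<bar>" by (simp only: of_int_le_iff)
    also have "\<dots> \<le> 2 powr (K / 4)" using big[of a] a fa0 by (simp add: E_def K_def)
    finally have "2 powr real (card Z) \<le> 2 powr (K / 4)" by (simp add: powr_realpow)
    hence Zb: "real (card Z) \<le> K / 4" by simp
    have Sb: "real (card S) < K / 4" using a by (simp add: E_def S_def K_def)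
    have "K = real (card S) + real (card T) + real (card Z)" using cL by (simp add: K_def)
    moreover have "real_of_int (F a) = real (card S) - real (card T)" using Fa by simp
    ultimately have "real_of_int (F a) \<le> - (K / 4)" using Zb Sb by linarith
    hence "K / 4 \<le> - real_of_int (F a)" by simp
    hence "(K / 4)\<^sup>2 \<le> (- real_of_int (F a))\<^sup>2" using K0 by (intro power_mono) auto
    thus ?thesis by simp
  qed
  have "real (card E) * (K / 4)\<^sup>2 = (\<Sum>a\<in>E. (K / 4)\<^sup>2)" by simp
  also have "\<dots> \<le> (\<Sum>a\<in>E. (real_of_int (F a))\<^sup>2)" using FE by (intro sum_mono)
  also have "\<dots> \<le> (\<Sum>a\<in>{0..<int X}. (real_of_int (F a))\<^sup>2)" by (intro sum_mono2) (auto simp: E_def)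
  also have "\<dots> = real_of_int (\<Sum>a\<in>{0..<int X}. (F a)\<^sup>2)" by simp
  also have "\<dots> \<le> real_of_int (2 * int (card L) * int X + (int (card L))\<^sup>2 * B\<^sup>2)"
    using split_primes_moment[OF L y0, of X] unfolding F_def by (simp only: of_int_le_iff)
  also have "\<dots> = 2 * K * real X + K\<^sup>2 * (real_of_int B)\<^sup>2" by (simp add: K_def)
  finally have "real (card E) * (K / 4)\<^sup>2 \<le> 2 * K * real X + K\<^sup>2 * (real_of_int B)\<^sup>2" .
  hence "real (card E) \<le> (2 * K * real X + K\<^sup>2 * (real_of_int B)\<^sup>2) / (K / 4)\<^sup>2"
    using K0 by (simp add: pos_le_divide_eq)
  also have "\<dots> = 32 * real X / K + 16 * (real_of_int B)\<^sup>2"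
    using K0 by (simp add: field_simps power2_eq_square)
  finally show ?thesis by (simp add: E_def K_def)
qed

section \<open>Small values and large square divisors\<close>

lemma few_small_values:
  fixes P m Y X D :: int
  assumes "m \<ge> 1" "Y \<ge> 1" "D \<ge> 0"
  shows "card {a \<in> {Y<..X}. 0 < P - m * a\<^sup>2 \<and> P - m * a\<^sup>2 < D} \<le> nat (D div Y + 1)"
proof (cases "{a \<in> {Y<..X}. 0 < P - m * a\<^sup>2 \<and> P - m * a\<^sup>2 < D} = {}")
  case True
  thus ?thesis by (simp only: card.empty)
next
  case False
  let ?E = "{a \<in> {Y<..X}. 0 < P - m * a\<^sup>2 \<and> P - m * a\<^sup>2 < D}"
  have fin: "finite ?E" by (rule finite_subset[of _ "{Y<..X}"]) auto
  define a0 where "a0 = Min ?E"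
  have a0: "a0 \<in> ?E" unfolding a0_def using Min_in[OF fin False] .
  have "?E \<subseteq> {a0..a0 + D div Y}"
  proof
    fix a assume a: "a \<in> ?E"
    have ge: "a0 \<le> a" unfolding a0_def using fin a by (rule Min_le)
    have "m * ((a - a0) * (a + a0)) = (P - m * a0\<^sup>2) - (P - m * a\<^sup>2)"
      by (simp add: power2_eq_square algebra_simps)
    also have "\<dots> \<le> D" using a a0 by auto
    finally have "m * ((a - a0) * (a + a0)) \<le> D" .
    moreover have "1 * ((a - a0) * (a + a0)) \<le> m * ((a - a0) * (a + a0))"
      using assms ge a a0 by (intro mult_right_mono) auto
    moreover have "(a - a0) * Y \<le> (a - a0) * (a + a0)" using ge a a0 assms by (intro mult_left_mono) auto
    ultimately have "(a - a0) * Y \<le> D" by linarith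
    hence "((a - a0) * Y) div Y \<le> D div Y" using assms by (intro zdiv_mono1) auto
    hence "a - a0 \<le> D div Y" using assms by simp
    thus "a \<in> {a0..a0 + D div Y}" using ge by simp
  qed
  hence "card ?E \<le> card {a0..a0 + D div Y}" by (intro card_mono) auto
  thus ?thesis by simp
qed

text \<open>For fixed \<open>k\<close> the equation \<open>m a\<^sup>2 + k g\<^sup>2 = p\<^sup>h\<close> has at most one solution when \<open>m k > 1\<close>:
  for two solutions the identity
  \<open>(m a\<^sup>2 + k g\<^sup>2) (m b\<^sup>2 + k f\<^sup>2) = (m a b - k g f)\<^sup>2 + m k (a f + b g)\<^sup>2\<close> and the corresponding
  one with the other signs leave no room for the divisibility by \<open>p\<^sup>h\<close>.\<close>

lemma binary_form_unique:
  fixes p m k a g b f :: int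
  assumes p: "prime p" "odd p" "\<not> p dvd m" and mk: "m \<ge> 1" "k \<ge> 1" "m * k > 1"
    and 1: "m * a\<^sup>2 + k * g\<^sup>2 = p ^ h" "a > 0" "g > 0" "\<not> p dvd a"
    and 2: "m * b\<^sup>2 + k * f\<^sup>2 = p ^ h" "b > 0" "f > 0" "\<not> p dvd b"
    and h: "h > 0"
  shows "a = b"
proof -
  define P where "P = p ^ h"
  have P0: "P > 0" unfolding P_def using p prime_gt_0_int by simp
  have pP: "p dvd P" unfolding P_def using h by (simp add: dvd_power)
  have "p dvd m * b\<^sup>2 + k * f\<^sup>2" using 2(1) pP P_def by simp
  have nf: "\<not> p dvd f"
  proof
    assume "p dvd f"
    hence "p dvd k * f\<^sup>2" by (simp add: power2_eq_square)
    hence "p dvd m * b\<^sup>2" using \<open>p dvd m * b\<^sup>2 + k * f\<^sup>2\<close> by (simp add: dvd_add_left_iff)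
    thus False using p 2(4) prime_dvd_mult_iff prime_dvd_power by blast
  qed
  have "m * ((a * f - b * g) * (a * f + b * g)) = f\<^sup>2 * (m * a\<^sup>2 + k * g\<^sup>2) - g\<^sup>2 * (m * b\<^sup>2 + k * f\<^sup>2)"
    by (simp add: power2_eq_square algebra_simps)
  also have "\<dots> = P * (f\<^sup>2 - g\<^sup>2)" unfolding 1(1) 2(1) P_def by (simp add: algebra_simps)
  finally have "P dvd m * ((a * f - b * g) * (a * f + b * g))" by simp
  moreover have "coprime P m" unfolding P_def using p prime_imp_coprime[of p m] by simp
  ultimately have dv: "P dvd (a * f - b * g) * (a * f + b * g)" by (simp add: coprime_dvd_mult_right_iff)
  have "\<not> (p dvd a * f - b * g \<and> p dvd a * f + b * g)"
  proof
    assume "p dvd a * f - b * g \<and> p dvd a * f + b * g"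
    hence "p dvd (a * f - b * g) + (a * f + b * g)" by (metis dvd_add)
    hence "p dvd 2 * (a * f)" by simp
    hence "p dvd a * f" using p(2) by (simp add: coprime_dvd_mult_right_iff)
    thus False using p(1) 1(4) nf prime_dvd_mult_iff by blast
  qed
  hence "coprime p (a * f - b * g) \<or> coprime p (a * f + b * g)" using p(1) prime_imp_coprime by blast
  hence "P dvd a * f - b * g \<or> P dvd a * f + b * g"
    using dv unfolding P_def by (metis coprime_dvd_mult_left_iff coprime_dvd_mult_right_iff coprime_power_left_iff)
  moreover have bound: "m * k * z\<^sup>2 \<le> P\<^sup>2" if "z = a * f - b * g \<or> z = a * f + b * g" for z
  proof -
    have "(m * a * b + k * g * f)\<^sup>2 + m * k * (a * f - b * g)\<^sup>2 = (m * a\<^sup>2 + k * g\<^sup>2) * (m * b\<^sup>2 + k * f\<^sup>2)"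
      "(m * a * b - k * g * f)\<^sup>2 + m * k * (a * f + b * g)\<^sup>2 = (m * a\<^sup>2 + k * g\<^sup>2) * (m * b\<^sup>2 + k * f\<^sup>2)"
      by (simp_all add: power2_eq_square algebra_simps)
    hence "(m * a * b + k * g * f)\<^sup>2 + m * k * (a * f - b * g)\<^sup>2 = P\<^sup>2"
      "(m * a * b - k * g * f)\<^sup>2 + m * k * (a * f + b * g)\<^sup>2 = P\<^sup>2"
      unfolding 1(1) 2(1) P_def by (simp_all add: power2_eq_square)
    hence "m * k * (a * f - b * g)\<^sup>2 \<le> P\<^sup>2" "m * k * (a * f + b * g)\<^sup>2 \<le> P\<^sup>2"
      using zero_le_power2[of "m * a * b + k * g * f"] zero_le_power2[of "m * a * b - k * g * f"]
      by linarith+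
    thus ?thesis using that by blast
  qed
  \<comment> \<open>P divides one of the two expressions, while m k z^2 \<le> P^2 with m k > 1 holds
    for both. So that one vanishes, and it cannot be the positive sum.\<close>
  have z0: "z = 0" if "P dvd z" "z = a * f - b * g \<or> z = a * f + b * g" for z
  proof (rule ccontr)
    assume "z \<noteq> 0"
    hence "P \<le> \<bar>z\<bar>" using dvd_imp_le_int[OF _ that(1)] P0 by simp
    hence "P\<^sup>2 \<le> z\<^sup>2" using P0 by (simp add: abs_le_square_iff[symmetric])
    hence "m * k * P\<^sup>2 \<le> m * k * z\<^sup>2" using mk by (intro mult_left_mono) auto
    hence "m * k * P\<^sup>2 \<le> 1 * P\<^sup>2" using bound[OF that(2)] by simp
    hence "m * k \<le> 1" using P0 by (simp only: mult_le_cancel_right) simp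
    thus False using mk(3) by simp
  qed
  moreover have "a * f + b * g > 0" using 1 2 by (simp add: add_pos_pos)
  ultimately have eq: "a * f = b * g" by fastforce
  have "a\<^sup>2 * P = a\<^sup>2 * (m * b\<^sup>2) + k * (a * f)\<^sup>2" unfolding P_def 2(1)[symmetric] by (simp add: power_mult_distrib algebra_simps)
  also have "\<dots> = b\<^sup>2 * P" unfolding eq P_def 1(1)[symmetric] by (simp add: power_mult_distrib algebra_simps)
  finally have "a\<^sup>2 = b\<^sup>2" using P0 by simp
  thus ?thesis using 1 2 by (simp add: power2_eq_iff)
qed

lemma sum_inverse_squares_le:
  fixes G G0 :: int
  assumes "G \<ge> 1"
  shows "(\<Sum>g\<in>{G<..G0}. 1 / (real_of_int g)\<^sup>2) \<le> 1 / real_of_int G"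
proof (cases "G0 \<ge> G")
  case True
  have "(\<Sum>g\<in>{G<..G0}. 1 / (real_of_int g)\<^sup>2) \<le> 1 / real_of_int G - 1 / real_of_int G0"
    using True
  proof (induction G0 rule: int_ge_induct)
    case (step i)
    have i: "i \<ge> 1" using step assms by simp
    have "{G<..i + 1} = insert (i + 1) {G<..i}" using step by auto
    hence "(\<Sum>g\<in>{G<..i + 1}. 1 / (real_of_int g)\<^sup>2) = 1 / (real_of_int (i + 1))\<^sup>2 + (\<Sum>g\<in>{G<..i}. 1 / (real_of_int g)\<^sup>2)"
      by simp
    also have "1 / (real_of_int (i + 1))\<^sup>2 \<le> 1 / (real_of_int i * real_of_int (i + 1))"
      using i by (intro divide_left_mono) (auto simp: power2_eq_square)
    also have "1 / (real_of_int i * real_of_int (i + 1)) = 1 / real_of_int i - 1 / real_of_int (i + 1)"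
      using i by (simp add: field_simps)
    finally show ?case using step.IH by linarith
  qed simp
  moreover have "1 / real_of_int G0 \<ge> 0" using True assms by simp
  ultimately show ?thesis by linarith
qed (use assms in simp)

text \<open>For g up to G0 the candidates a are roots of a quadratic congruence modulo g^2. For
  larger g the cofactor k is at most p^h / G0^2, and by \<open>binary_form_unique\<close> each k
  belongs to at most one a. Only m k = 1 escapes; there p^h = a^2 + g^2, which has few solutions by
  the divisor bound.\<close>

lemma few_large_squares:
  fixes p m X G G0 :: int and D e :: real
  assumes p: "prime p" "odd p" and m: "m = 1 \<or> m = 2" and h: "h > 0" and G: "G \<ge> 1" "G0 \<ge> 1" and X: "X \<ge> 1"
    and D: "D \<ge> 1" "e \<ge> 0" "\<And>n. n > 0 \<Longrightarrow> real (ndiv n) \<le> D * real_of_int n powr e"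
  shows "real (card {a \<in> {1..X}. \<not> p dvd a \<and> 0 < p ^ h - m * a\<^sup>2 \<and> (\<exists>g>G. g\<^sup>2 dvd p ^ h - m * a\<^sup>2)})
    \<le> 3 * D * (real_of_int G0 ^ 2) powr e * (2 * real_of_int X / real_of_int G + real_of_int G0)
       + 12 * (real h + 1)\<^sup>2 + real_of_int p ^ h / real_of_int G0 ^ 2" (is "real (card ?E) \<le> _")
proof -
  define P where "P = p ^ h"
  have p2: "p > 2" using p prime_ge_2_int[of p] by (cases "p = 2") auto
  have P0: "P > 0" unfolding P_def using p2 by simp
  have Podd: "odd P" unfolding P_def using p by simp
  have pm: "\<not> p dvd m" using m p2 by (auto dest: zdvd_imp_le)
  have pP: "p dvd P" unfolding P_def using h by (simp add: dvd_power)
  define A where "A = (\<lambda>g. {a \<in> {1..X}. \<not> p dvd a \<and> g\<^sup>2 dvd P - m * a\<^sup>2})"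
  have A: "real (card (A g)) \<le> 3 * D * (real_of_int G0 ^ 2) powr e * (2 * real_of_int X * (1 / (real_of_int g)\<^sup>2) + 1)"
    if g: "g \<in> {G<..G0}" for g
  proof (cases "A g = {}")
    case True
    have "0 \<le> 3 * D * (real_of_int G0 ^ 2) powr e * (2 * real_of_int X * (1 / (real_of_int g)\<^sup>2) + 1)"
      using D X by (intro mult_nonneg_nonneg add_nonneg_nonneg) auto
    thus ?thesis using True by simp
  next
    case False
    then obtain a where a: "\<not> p dvd a" "g\<^sup>2 dvd P - m * a\<^sup>2" by (auto simp: A_def)
    have g0: "g > 0" using g G by simp
    have g2: "g\<^sup>2 > 0" using g0 by simp
    have "\<not> p dvd g"
    proof
      assume "p dvd g"
      hence "p dvd g\<^sup>2" by (simp add: power2_eq_square)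
      hence "p dvd P - m * a\<^sup>2" using a(2) dvd_trans by blast
      hence "p dvd m * a\<^sup>2" using pP by (metis dvd_diff_right_iff)
      thus False using pm a(1) p(1) prime_dvd_mult_iff prime_dvd_power by blast
    qed
    hence "coprime p g" using p(1) prime_imp_coprime by blast
    hence cP: "coprime P (g\<^sup>2)" unfolding P_def by simp
    have cm: "coprime m (g\<^sup>2)"
    proof (cases "m = 2")
      case True
      have "odd g"
      proof
        assume "even g"
        hence "2 dvd g\<^sup>2" by (simp add: power2_eq_square)
        hence "2 dvd P - m * a\<^sup>2" using a(2) dvd_trans by blast
        thus False using True Podd by simp
      qed
      thus ?thesis using True by simp
    qed (use m in simp)
    \<comment> \<open>Multiplying a by m turns m a^2 = P into x^2 = m P modulo g^2. The right side
      is coprime to g^2, as the count of square roots requires.\<close>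
    have "card (A g) \<le> card {x \<in> {0..2 * X}. g\<^sup>2 dvd x\<^sup>2 - m * P}"
    proof (rule card_inj_on_le[of "\<lambda>a. m * a"])
      show "inj_on (\<lambda>a. m * a) (A g)" using m by (auto simp: inj_on_def)
      show "(\<lambda>a. m * a) ` A g \<subseteq> {x \<in> {0..2 * X}. g\<^sup>2 dvd x\<^sup>2 - m * P}"
      proof
        fix x assume "x \<in> (\<lambda>a. m * a) ` A g"
        then obtain b where b: "x = m * b" "b \<in> {1..X}" "g\<^sup>2 dvd P - m * b\<^sup>2" by (auto simp: A_def)
        have "x\<^sup>2 - m * P = (P - m * b\<^sup>2) * (- m)" by (simp add: b(1) power2_eq_square algebra_simps)
        hence "g\<^sup>2 dvd x\<^sup>2 - m * P" using dvd_mult2[OF b(3)] by (simp only:)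
        moreover have "x \<in> {0..2 * X}" using b m by auto
        ultimately show "x \<in> {x \<in> {0..2 * X}. g\<^sup>2 dvd x\<^sup>2 - m * P}" by simp
      qed
      show "finite {x \<in> {0..2 * X}. g\<^sup>2 dvd x\<^sup>2 - m * P}" by (rule finite_subset[of _ "{0..2 * X}"]) auto
    qed
    also have "\<dots> \<le> 3 * ndiv (g\<^sup>2) * nat (2 * X div g\<^sup>2 + 1)"
      by (rule card_sqrt_interval) (use g2 X cP cm in auto)
    finally have "real (card (A g)) \<le> real (3 * ndiv (g\<^sup>2) * nat (2 * X div g\<^sup>2 + 1))" by (rule of_nat_mono)
    also have "\<dots> = 3 * real (ndiv (g\<^sup>2)) * real (nat (2 * X div g\<^sup>2 + 1))" by simp
    also have "\<dots> \<le> 3 * (D * (real_of_int G0 ^ 2) powr e) * (2 * real_of_int X * (1 / (real_of_int g)\<^sup>2) + 1)"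
    proof (intro mult_mono)
      have "real (ndiv (g\<^sup>2)) \<le> D * real_of_int (g\<^sup>2) powr e" by (rule D(3)[OF g2])
      also have "real_of_int (g\<^sup>2) powr e \<le> (real_of_int G0 ^ 2) powr e"
        using g g0 D by (intro powr_mono2) (auto intro!: power_mono)
      finally show "real (ndiv (g\<^sup>2)) \<le> D * (real_of_int G0 ^ 2) powr e" using D by (simp add: mult_left_mono)
      have "real_of_int (2 * X div g\<^sup>2) \<le> real_of_int (2 * X) / real_of_int (g\<^sup>2)"
        by (rule real_of_int_div4)
      moreover have "2 * X div g\<^sup>2 \<ge> 0" using X g2 by (simp add: pos_imp_zdiv_nonneg_iff)
      ultimately show "real (nat (2 * X div g\<^sup>2 + 1)) \<le> 2 * real_of_int X * (1 / (real_of_int g)\<^sup>2) + 1" by simp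
    qed (use D X in auto)
    finally show ?thesis by simp
  qed
  define W where "W = 3 * D * (real_of_int G0 ^ 2) powr e"
  have W0: "W \<ge> 0" unfolding W_def using D by (intro mult_nonneg_nonneg) auto
  have cA: "real (card (\<Union>g\<in>{G<..G0}. A g)) \<le> W * (2 * real_of_int X / real_of_int G + real_of_int G0)"
  proof -
    have "card (\<Union>g\<in>{G<..G0}. A g) \<le> (\<Sum>g\<in>{G<..G0}. card (A g))" by (rule card_UN_le) simp
    hence "real (card (\<Union>g\<in>{G<..G0}. A g)) \<le> (\<Sum>g\<in>{G<..G0}. real (card (A g)))"
      by (metis of_nat_mono of_nat_sum)
    also have "\<dots> \<le> (\<Sum>g\<in>{G<..G0}. W * (2 * real_of_int X * (1 / (real_of_int g)\<^sup>2) + 1))"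
      by (intro sum_mono) (use A W_def in auto)
    also have "\<dots> = W * (2 * real_of_int X * (\<Sum>g\<in>{G<..G0}. 1 / (real_of_int g)\<^sup>2) + real (card {G<..G0}))"
      by (simp only: sum_distrib_left[symmetric] sum.distrib sum_constant mult_1_right)
    also have "\<dots> \<le> W * (2 * real_of_int X * (1 / real_of_int G) + real_of_int G0)"
      using sum_inverse_squares_le[OF G(1), of G0] X G W0
      by (intro mult_left_mono add_mono) auto
    finally show ?thesis by simp
  qed
  define S where "S = {(x, y). x\<^sup>2 + y\<^sup>2 = P}"
  have finS: "finite S" unfolding S_def by (rule finite_two_squares)
  have cS: "real (card (fst ` S)) \<le> 12 * (real h + 1)\<^sup>2"
  proof -
    have "card (fst ` S) \<le> card S" using finS by (rule card_image_le)
    also have "\<dots> \<le> 12 * (ndiv P)\<^sup>2" unfolding S_def by (rule card_two_squares_le[OF P0])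
    also have "\<dots> \<le> 12 * (h + 1)\<^sup>2"
      using ndiv_prime_power[OF p(1), of h] unfolding P_def by (intro mult_left_mono power_mono) auto
    finally have "real (card (fst ` S)) \<le> real (12 * (h + 1)\<^sup>2)" by (rule of_nat_mono)
    thus ?thesis by (simp add: add.commute)
  qed
  define T where "T = {a \<in> {1..X}. \<not> p dvd a \<and> (\<exists>g k. g > G0 \<and> k \<ge> 1 \<and> m * k > 1 \<and> m * a\<^sup>2 + k * g\<^sup>2 = P)}"
  have cT: "real (card T) \<le> real_of_int P / real_of_int G0 ^ 2"
  proof -
    define Q where "Q = (\<lambda>a k. \<exists>g. g > G0 \<and> k \<ge> 1 \<and> m * k > 1 \<and> m * a\<^sup>2 + k * g\<^sup>2 = P)"
    have "\<exists>k. Q a k" if "a \<in> T" for a using that unfolding T_def Q_def by blast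
    then obtain f where f: "\<And>a. a \<in> T \<Longrightarrow> Q a (f a)" by metis
    have G02: "G0\<^sup>2 > 0" using G by simp
    have "card T \<le> card {1..P div G0\<^sup>2}"
    proof (rule card_inj_on_le[of f])
      show "inj_on f T"
      proof (rule inj_onI)
        fix a b assume ab: "a \<in> T" "b \<in> T" "f a = f b"
        obtain g where g: "g > G0" "f a \<ge> 1" "m * f a > 1" "m * a\<^sup>2 + f a * g\<^sup>2 = P" using f[OF ab(1)] unfolding Q_def by blast
        obtain g' where g': "g' > G0" "m * b\<^sup>2 + f a * g'\<^sup>2 = P" using f[OF ab(2)] ab(3) unfolding Q_def by auto
        show "a = b"
          by (rule binary_form_unique[OF p pm _ g(2,3) g(4)[unfolded P_def] _ _ _ g'(2)[unfolded P_def]])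
             (use ab g g' G m h in \<open>auto simp: T_def\<close>)
      qed
      show "f ` T \<subseteq> {1..P div G0\<^sup>2}"
      proof
        fix k assume "k \<in> f ` T"
        then obtain a where a: "a \<in> T" "k = f a" by blast
        obtain g where g: "g > G0" "k \<ge> 1" "m * a\<^sup>2 + k * g\<^sup>2 = P" using f[OF a(1)] a(2) unfolding Q_def by blast
        have "k * G0\<^sup>2 \<le> k * g\<^sup>2" using g G by (intro mult_left_mono power_mono) auto
        also have "\<dots> \<le> P" using g(3) m by (smt (verit) zero_le_mult_iff zero_le_power2)
        finally have "k * G0\<^sup>2 \<le> P" .
        hence "k * G0\<^sup>2 div G0\<^sup>2 \<le> P div G0\<^sup>2" using G02 by (intro zdiv_mono1)
        thus "k \<in> {1..P div G0\<^sup>2}" using g(2) G02 by simp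
      qed
    qed simp
    hence "real (card T) \<le> real (nat (P div G0\<^sup>2))" by simp
    also have "\<dots> \<le> real_of_int P / real_of_int G0 ^ 2"
    proof -
      have "P div G0\<^sup>2 \<ge> 0" using P0 G02 by (simp add: pos_imp_zdiv_nonneg_iff)
      moreover have "real_of_int (P div G0\<^sup>2) \<le> real_of_int P / real_of_int (G0\<^sup>2)" by (rule real_of_int_div4)
      ultimately show ?thesis by simp
    qed
    finally show ?thesis .
  qed
  have sub: "?E \<subseteq> (\<Union>g\<in>{G<..G0}. A g) \<union> (fst ` S \<union> T)"
  proof
    fix a assume "a \<in> ?E"
    then obtain g where a: "a \<in> {1..X}" "\<not> p dvd a" "0 < P - m * a\<^sup>2" "g > G" "g\<^sup>2 dvd P - m * a\<^sup>2"
      by (auto simp: P_def)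
    show "a \<in> (\<Union>g\<in>{G<..G0}. A g) \<union> (fst ` S \<union> T)"
    proof (cases "g \<le> G0")
      case True
      hence "g \<in> {G<..G0}" "a \<in> A g" using a by (auto simp: A_def)
      thus ?thesis by blast
    next
      case False
      obtain k where "P - m * a\<^sup>2 = g\<^sup>2 * k" using a(5) by (elim dvdE)
      hence k: "m * a\<^sup>2 + k * g\<^sup>2 = P" "g\<^sup>2 * k > 0" using a(3) by (simp_all add: mult.commute)
      have g0: "g > 0" using a(4) G by simp
      have k1: "k \<ge> 1" using k(2) g0 by (simp add: zero_less_mult_iff)
      show ?thesis
      proof (cases "m * k > 1")
        case True
        have "\<exists>g k. g > G0 \<and> k \<ge> 1 \<and> m * k > 1 \<and> m * a\<^sup>2 + k * g\<^sup>2 = P"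
          by (rule exI[of _ g], rule exI[of _ k]) (use k(1) k1 True False in simp)
        hence "a \<in> T" unfolding T_def using a by blast
        thus ?thesis by blast
      next
        case mk: False
        hence "m = 1" "k = 1" using m k1 by auto
        hence "(a, g) \<in> S" using k(1) by (simp add: S_def)
        thus ?thesis by force
      qed
    qed
  qed
  have finT: "finite T" by (rule finite_subset[of _ "{1..X}"]) (auto simp: T_def)
  have finA: "finite (\<Union>g\<in>{G<..G0}. A g)" by (rule finite_subset[of _ "{1..X}"]) (auto simp: A_def)
  have "card ?E \<le> card ((\<Union>g\<in>{G<..G0}. A g) \<union> (fst ` S \<union> T))"
    by (rule card_mono[OF _ sub]) (use finS finT finA in simp)
  also have "\<dots> \<le> card (\<Union>g\<in>{G<..G0}. A g) + (card (fst ` S) + card T)"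
    by (meson card_Un_le add_left_mono order_trans)
  finally have "real (card ?E) \<le> real (card (\<Union>g\<in>{G<..G0}. A g)) + (real (card (fst ` S)) + real (card T))"
    by linarith
  thus ?thesis using cA cS cT unfolding W_def P_def by simp
qed

lemma card_ordered_pairs:
  fixes S :: "int set"
  assumes "finite S"
  shows "card S * card S = 2 * card {(l, l'). l \<in> S \<and> l' \<in> S \<and> l < l'} + card S"
proof -
  let ?A = "{(l, l'). l \<in> S \<and> l' \<in> S \<and> l < l'}"
  let ?B = "{(l, l'). l \<in> S \<and> l' \<in> S \<and> l' < l}"
  let ?D = "(\<lambda>l. (l, l)) ` S"
  have fin: "finite ?A" "finite ?B" "finite ?D"
    by (rule finite_subset[of _ "S \<times> S"]; use assms in auto)+
  have "S \<times> S = ?A \<union> (?B \<union> ?D)" by auto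
  hence "card (S \<times> S) = card (?A \<union> (?B \<union> ?D))" by (rule arg_cong)
  also have "\<dots> = card ?A + (card ?B + card ?D)"
    using fin by (subst card_Un_disjoint; force?)+
  also have "card ?B = card ?A"
    by (rule bij_betw_same_card[of "\<lambda>(a, b). (b, a)"])
       (auto simp: bij_betw_def inj_on_def image_iff)
  also have "card ?D = card S" by (rule card_image) (auto simp: inj_on_def)
  finally show ?thesis by (simp add: card_cartesian_product)
qed

lemma many_reps:
  fixes S :: "int set" and B G N :: int
  assumes S: "finite S" "\<And>l. l \<in> S \<Longrightarrow> prime l \<and> l > 2 \<and> l \<le> B \<and> Legendre (- N) l = 1"
    and x: "x \<in> pure_reps N" "\<And>e. e\<^sup>2 dvd N \<Longrightarrow> e \<le> G"
    and small: "G\<^sup>2 * B ^ 4 < N"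
  shows "(real (card S))\<^sup>2 - real (card S) \<le> 2 * real (card (pure_reps N))"
proof -
  have "card {(l, l'). l \<in> S \<and> l' \<in> S \<and> l < l'} \<le> card {y. hq0 y = 0 \<and> hq_norm y = N}"
  proof (rule many_pure_quaternions[OF S(1), of N B x G])
    fix l assume l: "l \<in> S"
    have pl: "prime l" "l > 2" "l \<le> B" "Legendre (- N) l = 1" using S(2)[OF l] by auto
    obtain b where "l dvd b\<^sup>2 - - N" using QuadRes_Legendre[OF pl(4)] by blast
    hence "l dvd b\<^sup>2 + N" by simp
    moreover have "\<not> l dvd N" using pl(4) Legendre_eq_0_iff[of "- N" l] by auto
    ultimately show "prime l \<and> odd l \<and> \<not> l dvd N \<and> l \<le> B \<and> (\<exists>b. l dvd b\<^sup>2 + N)"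
      using pl prime_odd_int by blast
  next
    show "hq0 x = 0" "hq_norm x = N" using x(1) by (auto simp: pure_reps_def)
    fix e assume "qdvd e x"
    hence "e\<^sup>2 dvd N" using qdvd_norm[of e x] x(1) by (simp add: pure_reps_def)
    thus "e \<le> G" by (rule x(2))
  qed (rule small)
  hence "2 * card {(l, l'). l \<in> S \<and> l' \<in> S \<and> l < l'} + card S \<le> 2 * card (pure_reps N) + card S"
    by (simp add: pure_reps_def)
  hence "card S * card S \<le> 2 * card (pure_reps N) + card S" by (simp only: card_ordered_pairs[OF S(1)])
  hence "real (card S * card S) \<le> real (2 * card (pure_reps N) + card S)" by (rule of_nat_mono)
  thus ?thesis by (simp add: power2_eq_square)
qed

section \<open>The estimates with \<open>X\<close> as the only large parameter\<close>

lemma log_power_le: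
  fixes C e :: real
  assumes "e > 0"
  shows "eventually (\<lambda>X::nat. C \<le> real X powr e \<and> C * ln (real X) \<le> real X powr e \<and> C * (ln (real X))\<^sup>2 \<le> real X powr e) at_top"
proof -
  define M where "M = \<bar>C\<bar> + 1"
  have M: "M > 0" "C \<le> M" by (auto simp: M_def)
  have "eventually (\<lambda>X::nat. M * (ln (real X))\<^sup>2 \<le> real X powr e) at_top"
    using M(1) assms by real_asymp
  moreover have "eventually (\<lambda>X::nat. ln (real X) \<ge> 1) at_top" by real_asymp
  ultimately show ?thesis
  proof eventually_elim
    case (elim X)
    have "ln (real X) \<le> (ln (real X))\<^sup>2" using mult_left_mono[of 1 "ln (real X)" "ln (real X)"] elim(2)
      by (simp add: power2_eq_square)
    moreover from this have "M * ln (real X) \<le> M * (ln (real X))\<^sup>2" using M(1) by simp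
    moreover have "M * 1 \<le> M * ln (real X)" using M(1) elim(2) by (intro mult_left_mono) auto
    moreover have "C * ln (real X) \<le> M * ln (real X)" "C * (ln (real X))\<^sup>2 \<le> M * (ln (real X))\<^sup>2"
      using M(2) elim(2) by (auto intro!: mult_right_mono)
    ultimately show ?case using M(2) elim(1) by linarith
  qed
qed

lemma floor_ge_half:
  fixes x :: real
  assumes "x \<ge> 1"
  shows "x / 2 \<le> real_of_int \<lfloor>x\<rfloor>"
proof -
  have "\<lfloor>x\<rfloor> \<ge> 1" using assms by simp
  thus ?thesis using floor_correct[of x] by linarith
qed

text \<open>Conjugation needs G^2 * B^4 < N. With G about X^\<delta> and N at least X^(2-\<delta>),
  the exponent 1/2 - \<delta> gives X^(2-2\<delta>) on the left and is just small enough.\<close>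

definition sieve_bound :: "real \<Rightarrow> nat \<Rightarrow> nat" where
  "sieve_bound \<delta> X = nat \<lfloor>real X powr (1 / 2 - \<delta>)\<rfloor>"

definition sieve_primes :: "int \<Rightarrow> nat \<Rightarrow> real \<Rightarrow> nat \<Rightarrow> int set" where
  "sieve_primes p N0 \<delta> X =
     int ` (class_primes {p} (\<lambda>_. -1) \<inter> {sieve_bound \<delta> X div N0 <.. sieve_bound \<delta> X})"

lemma sieve_bound_le: "real (sieve_bound \<delta> X) \<le> real X powr (1 / 2 - \<delta>)"
  by (simp add: sieve_bound_def)

lemma sieve_bound_at_top:
  assumes "\<delta> \<le> 1 / 8"
  shows "filterlim (sieve_bound \<delta>) at_top at_top"
proof -
  have "1 / 2 - \<delta> > 0" using assms by simp
  hence "filterlim (\<lambda>X::nat. real X powr (1 / 2 - \<delta>)) at_top at_top" by real_asymp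
  thus ?thesis unfolding sieve_bound_def
    by (intro filterlim_compose[OF filterlim_nat_sequentially] filterlim_compose[OF filterlim_floor_sequentially])
qed

lemma finite_sieve_primes [simp]: "finite (sieve_primes p N0 \<delta> X)"
  by (simp add: sieve_primes_def)

lemma card_sieve_primes:
  "card (sieve_primes p N0 \<delta> X) = card (class_primes {p} (\<lambda>_. -1) \<inter> {sieve_bound \<delta> X div N0 <.. sieve_bound \<delta> X})"
  unfolding sieve_primes_def by (rule card_image) simp

lemma sieve_primes_D:
  assumes "l \<in> sieve_primes p N0 \<delta> X" "prime p"
  shows "prime l" "l > 2" "l \<noteq> p" "l \<le> int (sieve_bound \<delta> X)" "int (sieve_bound \<delta> X div N0) + 1 \<le> l"
proof -
  obtain k where k: "l = int k" "prime k" "k mod 8 = 5" "Legendre (int k) p = -1"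
    "k \<in> {sieve_bound \<delta> X div N0 <.. sieve_bound \<delta> X}"
    using assms by (auto simp: sieve_primes_def class_primes_def)
  show "prime l" using k by simp
  show "l > 2" using k(1) k(3) by (cases "k \<le> 2") (auto simp: le_Suc_eq numeral_2_eq_2)
  show "l \<noteq> p" using k(1,4) Legendre_eq_0_iff[of "int k" p] by auto
  show "l \<le> int (sieve_bound \<delta> X)" using k by simp
  show "int (sieve_bound \<delta> X div N0) + 1 \<le> l" using k by (simp del: of_nat_div of_nat_Suc)
qed

text \<open>A second factor X^\<delta> is given up to absorb the logarithm and the constants of the
  density theorem.\<close>

lemma card_sieve_primes_ge:
  assumes d: "0 < \<delta>" "\<delta> \<le> 1 / 8" and c: "c > 0"
    and dens: "eventually (\<lambda>x :: nat. c * real x / ln (real x) \<le> real (card (class_primes {p} (\<lambda>_. -1) \<inter> {x div N0 <.. x}))) at_top"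
  shows "eventually (\<lambda>X. real X powr (1 / 2 - 2 * \<delta>) \<le> real (card (sieve_primes p N0 \<delta> X))) at_top"
proof -
  have e1: "eventually (\<lambda>X. c * real (sieve_bound \<delta> X) / ln (real (sieve_bound \<delta> X)) \<le> real (card (sieve_primes p N0 \<delta> X))) at_top"
    unfolding card_sieve_primes by (rule eventually_compose_filterlim[OF dens sieve_bound_at_top[OF d(2)]])
  have "1 / 2 - \<delta> > 0" using d by simp
  from log_power_le[OF this, of 4] log_power_le[OF d(1), of "2 / c"] e1
  show ?thesis using eventually_ge_at_top[of 3]
  proof eventually_elim
    case (elim X)
    define b where "b = real (sieve_bound \<delta> X)"
    define y where "y = real X powr (1 / 2 - \<delta>)"
    have y4: "y \<ge> 4" using elim(1) by (simp add: y_def)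
    have b: "b \<ge> y / 2" "b \<le> y" using floor_ge_half[of y] y4 by (auto simp: b_def y_def sieve_bound_def)
    have X3: "real X \<ge> 3" using elim by simp
    have "y \<le> real X powr 1" unfolding y_def using d X3 by (intro powr_mono) auto
    hence bX: "b \<le> real X" using b X3 by simp
    have lb: "0 < ln b" "ln b \<le> ln (real X)" using b y4 bX by auto
    have lX: "ln (real X) > 0" using lb by simp
    have "real X powr (1 / 2 - 2 * \<delta>) * (2 / c * ln (real X)) \<le> real X powr (1 / 2 - 2 * \<delta>) * real X powr \<delta>"
      using elim(2) by (intro mult_left_mono) auto
    also have "\<dots> = y" unfolding y_def by (simp add: powr_add[symmetric])
    finally have "real X powr (1 / 2 - 2 * \<delta>) \<le> c * (y / 2) / ln (real X)" using c lX by (simp add: field_simps)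
    also have "\<dots> \<le> c * b / ln b" using b y4 c lb by (intro frac_le mult_left_mono) auto
    finally show ?case using elim(3) by (simp add: b_def)
  qed
qed

lemma few_split_exceptions_scaled:
  assumes p: "prime p" and d: "0 < \<delta>" "\<delta> \<le> 1 / 8" and c: "c > 0" and N0: "N0 \<ge> 1"
    and dens: "eventually (\<lambda>x :: nat. c * real x / ln (real x) \<le> real (card (class_primes {p} (\<lambda>_. -1) \<inter> {x div N0 <.. x}))) at_top"
  shows "eventually (\<lambda>X. \<forall>h m. (m = 1 \<or> m = 2) \<longrightarrow> p ^ h \<le> p\<^sup>2 * (int X)\<^sup>2 \<longrightarrow>
     real (card {a \<in> {0..<int (Suc X)}. m\<^sup>2 * a\<^sup>2 - m * p ^ h \<noteq> 0 \<and>
      real (card {l \<in> sieve_primes p N0 \<delta> X. Legendre (m\<^sup>2 * a\<^sup>2 - m * p ^ h) l = 1}) < real (card (sieve_primes p N0 \<delta> X)) / 4})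
     \<le> 80 * real X powr (1 - \<delta>)) at_top"
proof -
  have p2: "p \<ge> 2" using p prime_ge_2_int by blast
  define M where "M = 4 + 2 * (real_of_int p)\<^sup>2"
  have M: "M > 0" by (simp add: M_def add_pos_nonneg)
  \<comment> \<open>The quadratic polynomial has values of size at most M X^2, whereas there are at
    least X^(1/4) sieve primes; so only a small part of them can divide a nonzero value.\<close>
  have "eventually (\<lambda>X::nat. M * (real X)\<^sup>2 \<le> 2 powr (real X powr (1 / 4) / 4)) at_top"
    using M by real_asymp
  moreover have "eventually (\<lambda>X. sieve_bound \<delta> X \<ge> N0\<^sup>2) at_top"
    using filterlim_at_top[THEN iffD1, OF sieve_bound_at_top[OF d(2)]] by blast
  moreover note card_sieve_primes_ge[OF d c dens] eventually_ge_at_top[of "3 :: nat"]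
  ultimately show ?thesis
  proof eventually_elim
    case (elim X)
    define L where "L = sieve_primes p N0 \<delta> X"
    define b where "b = sieve_bound \<delta> X"
    have X3: "real X \<ge> 3" using elim by simp
    have K: "real (card L) \<ge> real X powr (1 / 2 - 2 * \<delta>)" using elim by (simp add: L_def)
    have "real X powr (1 / 4) \<le> real X powr (1 / 2 - 2 * \<delta>)" using d X3 by (intro powr_mono) auto
    hence K4: "real X powr (1 / 4) \<le> real (card L)" using K by simp
    have K0: "real (card L) > 0" using K X3 by (smt (verit) powr_gt_zero)
    show ?case
    proof (intro allI impI)
      fix h and m :: int assume m: "m = 1 \<or> m = 2" and h: "p ^ h \<le> p\<^sup>2 * (int X)\<^sup>2"
      have "real (card {a \<in> {0..<int (Suc X)}. m\<^sup>2 * a\<^sup>2 - m * p ^ h \<noteq> 0 \<and>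
         real (card {l \<in> L. Legendre (m\<^sup>2 * a\<^sup>2 - m * p ^ h) l = 1}) < real (card L) / 4})
         \<le> 32 * real (Suc X) / real (card L) + 16 * (real_of_int (int b))\<^sup>2"
      proof (rule few_split_exceptions)
        show "finite L" by (simp add: L_def)
        fix l assume "l \<in> L"
        note l = sieve_primes_D[OF this[unfolded L_def] p]
        have "\<not> l dvd m" using l(2) m zdvd_imp_le[of l m] by auto
        moreover have "\<not> l dvd p ^ h"
          using l(1,3) p prime_dvd_power[of l p h] primes_dvd_imp_eq by blast
        ultimately show "prime l \<and> l > 2 \<and> \<not> l dvd m \<and> \<not> l dvd m * p ^ h \<and> l \<le> int b \<and> int (b div N0) + 1 \<le> l"
          using l by (simp add: b_def prime_dvd_mult_iff del: of_nat_div)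
      next
        show "int (b div N0) + 1 > 0" by (simp del: of_nat_div)
        have "card L \<le> card {b div N0 <.. b}"
          unfolding L_def b_def card_sieve_primes by (intro card_mono) auto
        hence "card L \<le> b" by simp
        \<comment> \<open>The moment bound requires the number of sieve primes to be at most the
          square of their lower bound. They exceed b / N0, and b \<ge> N0^2 makes the square large
          enough.\<close>
        moreover have "b \<le> (b div N0 + 1)\<^sup>2"
        proof -
          have "b < N0 * (b div N0 + 1)" using N0 dividend_less_times_div[of N0 b] by simp
          hence "b * b \<le> (N0 * (b div N0 + 1)) * (N0 * (b div N0 + 1))" by (intro mult_le_mono) auto
          also have "\<dots> = N0\<^sup>2 * (b div N0 + 1)\<^sup>2" by (simp add: power2_eq_square algebra_simps)
          also have "\<dots> \<le> b * (b div N0 + 1)\<^sup>2" using elim by (intro mult_le_mono) (auto simp: b_def)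
          finally show ?thesis by (cases "b = 0") auto
        qed
        ultimately have "card L \<le> (b div N0 + 1)\<^sup>2" by simp
        hence "int (card L) \<le> int ((b div N0 + 1)\<^sup>2)" by (rule of_nat_mono)
        thus "int (card L) \<le> (int (b div N0) + 1)\<^sup>2" by (simp del: of_nat_div add: add.commute)
        show "L \<noteq> {}" using K0 by auto
      next
        fix a assume a: "a \<in> {0..<int (Suc X)}"
        have "m\<^sup>2 \<le> 2\<^sup>2" using m by auto
        moreover have "a\<^sup>2 \<le> (int X)\<^sup>2" using a by (intro power_mono) auto
        ultimately have 1: "m\<^sup>2 * a\<^sup>2 \<le> 4 * (int X)\<^sup>2" using mult_mono[of "m\<^sup>2" 4 "a\<^sup>2" "(int X)\<^sup>2"] by simp
        have 2: "m * p ^ h \<le> 2 * (p\<^sup>2 * (int X)\<^sup>2)" using m h p2 by (intro mult_mono) auto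
        have 0: "0 \<le> m\<^sup>2 * a\<^sup>2" "0 \<le> m * p ^ h" "0 \<le> p\<^sup>2 * (int X)\<^sup>2" "0 \<le> (int X)\<^sup>2" using m p2 by auto
        have "\<bar>m\<^sup>2 * a\<^sup>2 - m * p ^ h\<bar> \<le> 4 * (int X)\<^sup>2 + 2 * (p\<^sup>2 * (int X)\<^sup>2)" using 0 1 2 by linarith
        hence "\<bar>m\<^sup>2 * a\<^sup>2 - m * p ^ h\<bar> \<le> (4 + 2 * p\<^sup>2) * (int X)\<^sup>2" by (simp add: algebra_simps)
        hence "real_of_int \<bar>m\<^sup>2 * a\<^sup>2 - m * p ^ h\<bar> \<le> real_of_int ((4 + 2 * p\<^sup>2) * (int X)\<^sup>2)" by (simp only: of_int_le_iff)
        also have "\<dots> = M * (real X)\<^sup>2" by (simp add: M_def)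
        also have "\<dots> \<le> 2 powr (real X powr (1 / 4) / 4)" by (rule elim)
        also have "\<dots> \<le> 2 powr (real (card L) / 4)" using K4 by (intro powr_mono) auto
        finally show "real_of_int \<bar>m\<^sup>2 * a\<^sup>2 - m * p ^ h\<bar> \<le> 2 powr (real (card L) / 4)" .
      qed
      also have "\<dots> \<le> 64 * real X powr (1 - \<delta>) + 16 * real X powr (1 - \<delta>)"
      proof (intro add_mono mult_left_mono)
        have "32 * real (Suc X) / real (card L) \<le> 64 * real X / real X powr (1 / 2 - 2 * \<delta>)"
          using K X3 by (intro frac_le) auto
        also have "\<dots> = 64 * real X powr (1 / 2 + 2 * \<delta>)"
        proof -
          have "real X powr (1 / 2 + 2 * \<delta>) * real X powr (1 / 2 - 2 * \<delta>) = real X"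
            using X3 by (simp add: powr_add[symmetric])
          thus ?thesis using X3 by (simp add: field_simps)
        qed
        also have "\<dots> \<le> 64 * real X powr (1 - \<delta>)" using d X3 by (intro mult_left_mono powr_mono) auto
        finally show "32 * real (Suc X) / real (card L) \<le> 64 * real X powr (1 - \<delta>)" .
        have "(real_of_int (int b))\<^sup>2 \<le> (real X powr (1 / 2 - \<delta>))\<^sup>2"
          using sieve_bound_le[of \<delta> X] by (intro power_mono) (auto simp: b_def)
        also have "\<dots> = real X powr (1 - 2 * \<delta>)" by (simp add: power2_eq_square powr_add[symmetric])
        also have "\<dots> \<le> real X powr (1 - \<delta>)" using d X3 by (intro powr_mono) auto
        finally show "(real_of_int (int b))\<^sup>2 \<le> real X powr (1 - \<delta>)" .
      qed auto
      finally show "real (card {a \<in> {0..<int (Suc X)}. m\<^sup>2 * a\<^sup>2 - m * p ^ h \<noteq> 0 \<and>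
         real (card {l \<in> sieve_primes p N0 \<delta> X. Legendre (m\<^sup>2 * a\<^sup>2 - m * p ^ h) l = 1}) < real (card (sieve_primes p N0 \<delta> X)) / 4})
         \<le> 80 * real X powr (1 - \<delta>)" by (simp add: L_def)
    qed
  qed
qed

lemma exponent_le_log:
  fixes p :: int
  assumes "p \<ge> 3" "p ^ h \<le> p\<^sup>2 * (int X)\<^sup>2" "X \<ge> 1"
  shows "real h \<le> 2 + 2 * ln (real X)"
proof -
  have "real_of_int (p ^ h) \<le> real_of_int (p\<^sup>2 * (int X)\<^sup>2)" using assms(2) by (simp only: of_int_le_iff)
  hence "real_of_int p ^ h \<le> (real_of_int p)\<^sup>2 * (real X)\<^sup>2" by simp
  hence "ln (real_of_int p ^ h) \<le> ln ((real_of_int p)\<^sup>2 * (real X)\<^sup>2)" using assms by simp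
  hence 1: "real h * ln p \<le> 2 * ln p + 2 * ln (real X)"
    using assms by (simp add: ln_mult ln_realpow)
  have lp: "ln p \<ge> 1" using assms(1) exp_le by (simp add: ln_ge_iff)
  have "(real h - 2) * 1 \<le> 2 * ln (real X)"
  proof (cases "real h \<ge> 2")
    case True
    hence "(real h - 2) * 1 \<le> (real h - 2) * ln p" using lp by (intro mult_left_mono) auto
    thus ?thesis using 1 by (simp add: algebra_simps)
  next
    case False
    moreover have "ln (real X) \<ge> 0" using assms(3) by simp
    ultimately show ?thesis by simp
  qed
  thus ?thesis by simp
qed

text \<open>With G = X^\<delta> the small g save X^\<delta>. The divisor bound at exponent \<delta>
  / 4, for g^2 \<le> X^2, returns X^(\<delta>/2) of it, which explains the exponent 1 - \<delta> /
  2.\<close>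

lemma few_large_squares_scaled:
  assumes p: "prime p" "odd p" and d: "0 < \<delta>" "\<delta> \<le> 1 / 8"
    and D: "D \<ge> 1" "\<And>n. n > 0 \<Longrightarrow> real (ndiv n) \<le> D * real_of_int n powr (\<delta> / 4)"
  shows "eventually (\<lambda>X. \<forall>h m. h > 0 \<longrightarrow> (m = 1 \<or> m = 2) \<longrightarrow> p ^ h \<le> p\<^sup>2 * (int X)\<^sup>2 \<longrightarrow>
     real (card {a \<in> {1..int X}. \<not> p dvd a \<and> 0 < p ^ h - m * a\<^sup>2 \<and> (\<exists>g>\<lfloor>real X powr \<delta>\<rfloor>. g\<^sup>2 dvd p ^ h - m * a\<^sup>2)})
     \<le> (15 * D + 1 + 4 * (real_of_int p)\<^sup>2) * real X powr (1 - \<delta> / 2)) at_top"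
proof -
  have p3: "p \<ge> 3" using p prime_ge_2_int[of p] by (cases "p = 2") auto
  have d': "1 - \<delta> / 2 > 0" using d by simp
  from log_power_le[OF d', of 108] log_power_le[OF d(1), of 1]
  show ?thesis using eventually_ge_at_top[of "nat \<lceil>exp (4::real)\<rceil>"]
  proof eventually_elim
    case (elim X)
    have X4: "real X \<ge> exp 4" using elim by linarith
    have X3: "real X \<ge> 3" using X4 exp_ge_add_one_self[of "4::real"] by linarith
    have lX: "ln (real X) \<ge> 4" using X4 X3 by (simp add: ln_ge_iff)
    show ?case
    proof (intro allI impI)
      fix h and m :: int assume h0: "h > 0" and m: "m = 1 \<or> m = 2" and h: "p ^ h \<le> p\<^sup>2 * (int X)\<^sup>2"
      define z where "z = real X"
      define G where "G = \<lfloor>z powr \<delta>\<rfloor>"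
      \<comment> \<open>The exponent must lie above 1/2, so that p^h / G0^2 with p^h \<le> p^2 X^2
        is a power smaller than X, and below 1 for the term linear in G0.\<close>
      define G0 where "G0 = \<lfloor>z powr (3 / 4)\<rfloor>"
      have z: "z \<ge> 3" using X3 by (simp add: z_def)
      have g: "z powr \<delta> \<ge> 1" "z powr (3 / 4) \<ge> 1" using z d by (auto intro!: ge_one_powr_ge_zero)
      have G: "G \<ge> 1" "G0 \<ge> 1" using g by (auto simp: G_def G0_def)
      have Gh: "z powr \<delta> / 2 \<le> real_of_int G" "z powr (3 / 4) / 2 \<le> real_of_int G0"
        using floor_ge_half g by (auto simp: G_def G0_def)
      have "real (card {a \<in> {1..int X}. \<not> p dvd a \<and> 0 < p ^ h - m * a\<^sup>2 \<and> (\<exists>g>G. g\<^sup>2 dvd p ^ h - m * a\<^sup>2)})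
         \<le> 3 * D * (real_of_int G0 ^ 2) powr (\<delta> / 4) * (2 * real_of_int (int X) / real_of_int G + real_of_int G0)
         + 12 * (real h + 1)\<^sup>2 + real_of_int p ^ h / real_of_int G0 ^ 2"
        by (rule few_large_squares) (use p m h0 G D d X3 in auto)
      also have "\<dots> \<le> 15 * D * z powr (1 - \<delta> / 2) + z powr (1 - \<delta> / 2) + 4 * (real_of_int p)\<^sup>2 * z powr (1 - \<delta> / 2)"
      proof (intro add_mono)
        have 1: "(real_of_int G0 ^ 2) powr (\<delta> / 4) \<le> z powr (\<delta> / 2)"
        proof -
          have "real_of_int G0 \<le> z powr (3 / 4)" by (simp add: G0_def)
          also have "\<dots> \<le> z powr 1" using z by (intro powr_mono) auto
          finally have "real_of_int G0 ^ 2 \<le> z ^ 2" using G z by (intro power_mono) auto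
          hence "(real_of_int G0 ^ 2) powr (\<delta> / 4) \<le> (z ^ 2) powr (\<delta> / 4)" using d by (intro powr_mono2) auto
          also have "z ^ 2 = z powr 2" using z by (simp add: powr_realpow)
          also have "(z powr 2) powr (\<delta> / 4) = z powr (\<delta> / 2)" by (simp add: powr_powr)
          finally show ?thesis .
        qed
        have 2: "2 * real_of_int (int X) / real_of_int G + real_of_int G0 \<le> 5 * z powr (1 - \<delta>)"
        proof -
          have "2 * real_of_int (int X) / real_of_int G \<le> 2 * z / (z powr \<delta> / 2)"
            using Gh g z by (intro frac_le) (auto simp: z_def)
          also have "\<dots> = 4 * z powr (1 - \<delta>)" using z by (simp add: powr_diff)
          finally have 3: "2 * real_of_int (int X) / real_of_int G \<le> 4 * z powr (1 - \<delta>)" .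
          have "real_of_int G0 \<le> z powr (3 / 4)" by (simp add: G0_def)
          also have "\<dots> \<le> z powr (1 - \<delta>)" using z d by (intro powr_mono) auto
          finally show ?thesis using 3 by linarith
        qed
        have "3 * D * (real_of_int G0 ^ 2) powr (\<delta> / 4) * (2 * real_of_int (int X) / real_of_int G + real_of_int G0)
           \<le> 3 * D * z powr (\<delta> / 2) * (5 * z powr (1 - \<delta>))"
          using 1 2 D G by (intro mult_mono) auto
        also have "\<dots> = 15 * D * (z powr (\<delta> / 2) * z powr (1 - \<delta>))" by simp
        also have "z powr (\<delta> / 2) * z powr (1 - \<delta>) = z powr (1 - \<delta> / 2)" by (simp add: powr_add[symmetric])
        finally show "3 * D * (real_of_int G0 ^ 2) powr (\<delta> / 4) * (2 * real_of_int (int X) / real_of_int G + real_of_int G0)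
           \<le> 15 * D * z powr (1 - \<delta> / 2)" .
        have "real h + 1 \<le> 3 * ln z" using exponent_le_log[OF p3 h] X3 lX by (simp add: z_def)
        hence "(real h + 1)\<^sup>2 \<le> (3 * ln z)\<^sup>2" by (intro power_mono) auto
        hence "12 * (real h + 1)\<^sup>2 \<le> 108 * (ln z)\<^sup>2" by (simp add: power_mult_distrib)
        also have "\<dots> \<le> z powr (1 - \<delta> / 2)" using elim(1) by (simp add: z_def)
        finally show "12 * (real h + 1)\<^sup>2 \<le> z powr (1 - \<delta> / 2)" .
        have "real_of_int (p ^ h) \<le> real_of_int (p\<^sup>2 * (int X)\<^sup>2)" using h by (simp only: of_int_le_iff)
        hence ph: "real_of_int p ^ h \<le> (real_of_int p)\<^sup>2 * z\<^sup>2" by (simp add: z_def)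
        have "(z powr (3 / 4) / 2)\<^sup>2 \<le> real_of_int G0 ^ 2" using Gh by (intro power_mono) auto
        hence "real_of_int p ^ h / real_of_int G0 ^ 2 \<le> (real_of_int p)\<^sup>2 * z\<^sup>2 / (z powr (3 / 4) / 2)\<^sup>2"
          using ph z by (intro frac_le) auto
        also have "(z powr (3 / 4) / 2)\<^sup>2 = z powr (3 / 2) / 4" by (simp add: power2_eq_square powr_add[symmetric])
        also have "(real_of_int p)\<^sup>2 * z\<^sup>2 / (z powr (3 / 2) / 4) = 4 * (real_of_int p)\<^sup>2 * (z powr 2 / z powr (3 / 2))"
          using z by (simp add: powr_realpow)
        also have "z powr 2 / z powr (3 / 2) = z powr (1 / 2)" by (simp add: powr_diff[symmetric])
        also have "4 * (real_of_int p)\<^sup>2 * z powr (1 / 2) \<le> 4 * (real_of_int p)\<^sup>2 * z powr (1 - \<delta> / 2)"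
          using z d by (intro mult_left_mono powr_mono) auto
        finally show "real_of_int p ^ h / real_of_int G0 ^ 2 \<le> 4 * (real_of_int p)\<^sup>2 * z powr (1 - \<delta> / 2)" .
      qed
      also have "\<dots> = (15 * D + 1 + 4 * (real_of_int p)\<^sup>2) * real X powr (1 - \<delta> / 2)" by (simp add: z_def algebra_simps)
      finally show "real (card {a \<in> {1..int X}. \<not> p dvd a \<and> 0 < p ^ h - m * a\<^sup>2 \<and> (\<exists>g>\<lfloor>real X powr \<delta>\<rfloor>. g\<^sup>2 dvd p ^ h - m * a\<^sup>2)})
         \<le> (15 * D + 1 + 4 * (real_of_int p)\<^sup>2) * real X powr (1 - \<delta> / 2)" by (simp add: G_def z_def)
    qed
  qed
qed

lemma few_small_values_scaled:
  assumes d: "0 < \<delta>" "\<delta> \<le> 1 / 8" and N0: "N0 \<ge> 1" and X: "X \<ge> N0" and m: "m \<ge> 1"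
  shows "real (card {a \<in> {int (X div N0)<..int X}. 0 < P - m * a\<^sup>2 \<and> real_of_int (P - m * a\<^sup>2) < real X powr (2 - \<delta>)})
     \<le> (4 * real N0 + 1) * real X powr (1 - \<delta> / 2)"
proof -
  define z where "z = real X"
  have z: "z \<ge> 1" using X N0 by (simp add: z_def)
  define Y where "Y = int (X div N0)"
  have Y1: "Y \<ge> 1" using X N0 div_greater_zero_iff[of X N0] by (simp add: Y_def Suc_le_eq del: of_nat_div)
  have Yz: "z \<le> 2 * real N0 * real_of_int Y"
  proof -
    have "X < N0 * (X div N0 + 1)" using N0 dividend_less_times_div[of N0 X] by simp
    hence "real X \<le> real (N0 * (X div N0 + 1))" by (intro of_nat_mono) simp
    also have "\<dots> = real N0 * (real_of_int Y + 1)" by (simp add: Y_def algebra_simps del: of_nat_div)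
    also have "\<dots> \<le> real N0 * (2 * real_of_int Y)" using Y1 by (intro mult_left_mono) auto
    finally show ?thesis by (simp add: z_def)
  qed
  define D where "D = \<lceil>z powr (2 - \<delta>)\<rceil>"
  have z1: "z powr (2 - \<delta>) \<ge> 1" "z powr (1 - \<delta> / 2) \<ge> 1" using z d by (auto intro!: ge_one_powr_ge_zero)
  have D: "D \<ge> 1" "real_of_int D \<le> 2 * z powr (2 - \<delta>)" using z1 unfolding D_def by linarith+
  have "card {a \<in> {Y<..int X}. 0 < P - m * a\<^sup>2 \<and> real_of_int (P - m * a\<^sup>2) < z powr (2 - \<delta>)}
    \<le> card {a \<in> {Y<..int X}. 0 < P - m * a\<^sup>2 \<and> P - m * a\<^sup>2 < D}"
  proof (rule card_mono)
    show "finite {a \<in> {Y<..int X}. 0 < P - m * a\<^sup>2 \<and> P - m * a\<^sup>2 < D}" by (rule finite_subset[of _ "{Y<..int X}"]) auto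
    show "{a \<in> {Y<..int X}. 0 < P - m * a\<^sup>2 \<and> real_of_int (P - m * a\<^sup>2) < z powr (2 - \<delta>)}
      \<subseteq> {a \<in> {Y<..int X}. 0 < P - m * a\<^sup>2 \<and> P - m * a\<^sup>2 < D}"
      by (auto simp: D_def less_ceiling_iff simp del: of_int_diff)
  qed
  also have "\<dots> \<le> nat (D div Y + 1)" by (rule few_small_values) (use m Y1 D in auto)
  finally have "real (card {a \<in> {Y<..int X}. 0 < P - m * a\<^sup>2 \<and> real_of_int (P - m * a\<^sup>2) < z powr (2 - \<delta>)}) \<le> real (nat (D div Y + 1))"
    by (rule of_nat_mono)
  also have "\<dots> = real_of_int (D div Y) + 1" using D Y1 by (simp add: pos_imp_zdiv_nonneg_iff)
  also have "\<dots> \<le> real_of_int D / real_of_int Y + 1" using real_of_int_div4[of D Y] by simp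
  also have "real_of_int D / real_of_int Y \<le> 2 * z powr (2 - \<delta>) / (z / (2 * real N0))"
    using D Y1 Yz z N0 by (intro frac_le) (auto simp: field_simps)
  also have "\<dots> = 4 * real N0 * z powr (1 - \<delta>)"
  proof -
    have "z powr (2 - \<delta>) = z powr 1 * z powr (1 - \<delta>)" by (subst powr_add[symmetric]) (simp add: algebra_simps)
    thus ?thesis using z by simp
  qed
  also have "\<dots> \<le> 4 * real N0 * z powr (1 - \<delta> / 2)" using z d by (intro mult_left_mono powr_mono) auto
  also have "4 * real N0 * z powr (1 - \<delta> / 2) + 1 \<le> (4 * real N0 + 1) * z powr (1 - \<delta> / 2)"
    using z1 by (simp add: algebra_simps)
  finally show ?thesis by (simp add: Y_def z_def)
qed

lemma avoid_bad_sets: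
  fixes b :: real
  assumes "finite I" "finite A" "\<And>i. i \<in> I \<Longrightarrow> real (card {a \<in> A. Bad i a}) \<le> b" "real (card I) * b < real (card A)"
  obtains a where "a \<in> A" "\<And>i. i \<in> I \<Longrightarrow> \<not> Bad i a"
proof -
  have "real (card (\<Union>i\<in>I. {a \<in> A. Bad i a})) \<le> real (\<Sum>i\<in>I. card {a \<in> A. Bad i a})"
    by (intro of_nat_mono card_UN_le assms(1))
  also have "\<dots> = (\<Sum>i\<in>I. real (card {a \<in> A. Bad i a}))" by (rule of_nat_sum)
  also have "\<dots> \<le> real (card I) * b" using sum_mono[of I _ "\<lambda>_. b", OF assms(3)] by simp
  also have "\<dots> < real (card A)" by (rule assms(4))
  finally have "card (\<Union>i\<in>I. {a \<in> A. Bad i a}) < card A" by simp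
  hence "\<not> A \<subseteq> (\<Union>i\<in>I. {a \<in> A. Bad i a})"
    using card_mono[of "\<Union>i\<in>I. {a \<in> A. Bad i a}" A] assms(1,2) by auto
  thus ?thesis using that by blast
qed

text \<open>The factor m does no harm: for m = 2 an even e would make 4 divide 2 * (P - 2 a^2),
  although P is odd.\<close>

lemma square_dvd_bound:
  fixes P :: int
  assumes "m = 1 \<or> m = 2" "odd P" "e\<^sup>2 dvd m * (P - m * a\<^sup>2)" "G \<ge> 1" "\<not> (\<exists>g>G. g\<^sup>2 dvd P - m * a\<^sup>2)"
  shows "e \<le> G"
proof (rule ccontr)
  assume e: "\<not> e \<le> G"
  have "e\<^sup>2 dvd P - m * a\<^sup>2"
  proof (cases "m = 1")
    case False
    hence m: "m = 2" using assms(1) by simp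
    have "odd e"
    proof
      assume "even e"
      then obtain k where "e = 2 * k" by (elim evenE)
      hence "e\<^sup>2 = 4 * k\<^sup>2" by (simp add: power2_eq_square)
      hence "4 dvd 2 * (P - 2 * a\<^sup>2)" using assms(3) m dvd_trans[of 4 "e\<^sup>2"] by auto
      hence "2 dvd P - 2 * a\<^sup>2" by presburger
      thus False using assms(2) by simp
    qed
    hence "coprime (e\<^sup>2) 2" by simp
    thus ?thesis using assms(3) m coprime_dvd_mult_right_iff by blast
  qed (use assms(3) in simp)
  thus False using assms(5) e by auto
qed

text \<open>At least a quarter of the X^(1/2-2\<delta>) sieve primes split, and the pairs of them
  number at least X^(1-4\<delta>) / 64 up to the factor between pairs and representations. The
  factor 64 is paid for by another X^\<delta>.\<close>

lemma many_reps_scaled: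
  assumes p: "prime p" "odd p" and d: "0 < \<delta>" "\<delta> \<le> 1 / 8"
    and X: "X \<ge> 2" "64 \<le> real X powr \<delta>" "8 \<le> real X powr (1 / 2 - 2 * \<delta>)"
    and m: "m = 1 \<or> m = 2"
    and K: "real X powr (1 / 2 - 2 * \<delta>) \<le> real (card (sieve_primes p N0 \<delta> X))"
    and big: "real X powr (2 - \<delta>) \<le> real_of_int (p ^ h - m * q\<^sup>2)"
    and sq: "\<not> (\<exists>g>\<lfloor>real X powr \<delta>\<rfloor>. g\<^sup>2 dvd p ^ h - m * q\<^sup>2)"
    and split: "real (card (sieve_primes p N0 \<delta> X)) / 4 \<le> real (card {l \<in> sieve_primes p N0 \<delta> X. Legendre (m\<^sup>2 * q\<^sup>2 - m * p ^ h) l = 1})"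
    and ne: "pure_reps (m * (p ^ h - m * q\<^sup>2)) \<noteq> {}"
  shows "real X powr (1 - 5 * \<delta>) \<le> real (card (pure_reps (m * (p ^ h - m * q\<^sup>2))))"
proof -
  define N where "N = m * (p ^ h - m * q\<^sup>2)"
  define z where "z = real X"
  define G where "G = \<lfloor>z powr \<delta>\<rfloor>"
  define b where "b = int (sieve_bound \<delta> X)"
  define S where "S = {l \<in> sieve_primes p N0 \<delta> X. Legendre (m\<^sup>2 * q\<^sup>2 - m * p ^ h) l = 1}"
  have z2: "z \<ge> 2" using X by (simp add: z_def)
  have mN: "- N = m\<^sup>2 * q\<^sup>2 - m * p ^ h" by (simp add: N_def power2_eq_square algebra_simps)
  have G1: "G \<ge> 1" using X by (simp add: G_def z_def)
  obtain x where x: "x \<in> pure_reps N" using ne by (auto simp: N_def)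
  have "(real (card S))\<^sup>2 - real (card S) \<le> 2 * real (card (pure_reps N))"
  proof (rule many_reps[where B = b and G = G, OF _ _ x])
    show "finite S" by (simp add: S_def)
    fix l assume "l \<in> S"
    thus "prime l \<and> l > 2 \<and> l \<le> b \<and> Legendre (- N) l = 1"
      using sieve_primes_D[OF _ p(1)] mN by (auto simp: S_def b_def)
  next
    fix e assume "e\<^sup>2 dvd N"
    show "e \<le> G"
      by (rule square_dvd_bound[OF m _ \<open>e\<^sup>2 dvd N\<close>[unfolded N_def] G1])
         (use p sq in \<open>simp_all add: G_def z_def\<close>)
  next
    have 1: "(real_of_int G)\<^sup>2 \<le> (z powr \<delta>)\<^sup>2" using G1 by (intro power_mono) (auto simp: G_def)
    have 2: "(real_of_int b) ^ 4 \<le> (z powr (1 / 2 - \<delta>)) ^ 4"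
      using sieve_bound_le[of \<delta> X] by (intro power_mono) (auto simp: b_def z_def)
    have "real_of_int (G\<^sup>2 * b ^ 4) \<le> (z powr \<delta>)\<^sup>2 * (z powr (1 / 2 - \<delta>)) ^ 4"
      using mult_mono[OF 1 2] by simp
    also have "(z powr \<delta>)\<^sup>2 * (z powr (1 / 2 - \<delta>)) ^ 4 = z powr (2 - 2 * \<delta>)"
    proof -
      have "(z powr \<delta>)\<^sup>2 * (z powr (1 / 2 - \<delta>)) ^ 4 =
        z powr \<delta> * z powr \<delta> * (z powr (1 / 2 - \<delta>) * z powr (1 / 2 - \<delta>) * z powr (1 / 2 - \<delta>) * z powr (1 / 2 - \<delta>))"
        by (simp add: power2_eq_square eval_nat_numeral)
      also have "\<dots> = z powr (2 - 2 * \<delta>)" by (simp only: powr_add[symmetric]) (simp add: algebra_simps)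
      finally show ?thesis .
    qed
    also have "z powr (2 - 2 * \<delta>) < z powr (2 - \<delta>)" using d z2 by (intro powr_less_mono) auto
    also have "\<dots> \<le> real_of_int (p ^ h - m * q\<^sup>2)" using big by (simp only: z_def)
    also have "\<dots> \<le> real_of_int N"
    proof -
      have "0 \<le> real_of_int (p ^ h - m * q\<^sup>2)" using big powr_ge_zero order_trans by blast
      hence "0 \<le> p ^ h - m * q\<^sup>2" by (simp only: of_int_0_le_iff)
      thus ?thesis unfolding N_def of_int_le_iff using m by auto
    qed
    finally show "G\<^sup>2 * b ^ 4 < N" by (simp only: of_int_less_iff)
  qed
  moreover define s where "s = real (card S)"
  ultimately have 1: "s\<^sup>2 - s \<le> 2 * real (card (pure_reps N))" by simp
  define y where "y = z powr (1 / 2 - 2 * \<delta>)"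
  have s: "y / 4 \<le> s" using K split by (simp add: s_def S_def y_def z_def)
  have s2: "s \<ge> 2" using s X by (simp add: y_def z_def)
  have "(y / 4)\<^sup>2 \<le> s\<^sup>2" using s by (intro power_mono) (auto simp: y_def)
  moreover have "s * 2 \<le> s * s" using s2 by (intro mult_left_mono) auto
  ultimately have 2: "y\<^sup>2 / 64 \<le> real (card (pure_reps N))" using 1 by (simp add: power2_eq_square)
  have "z powr (1 - 5 * \<delta>) * 64 \<le> z powr (1 - 5 * \<delta>) * z powr \<delta>" using X by (intro mult_left_mono) (auto simp: z_def)
  also have "\<dots> = y\<^sup>2" by (simp add: y_def power2_eq_square powr_add[symmetric])
  finally show ?thesis using 2 by (simp add: z_def N_def)
qed

text \<open>Which \<open>h\<close> and \<open>m\<close> occur for a given q is not known in advance,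
  so the conclusion covers all of them. O(log X) pairs are relevant, each excludes
  O(X^(1-\<delta>/2)) integers, and the class contains at least c X / log X primes.\<close>

lemma good_prime:
  fixes p :: int
  assumes p: "prime p" "p > 2" and d: "0 < \<delta>" "\<delta> \<le> 1 / 8"
  obtains N0 :: nat where "eventually (\<lambda>X. \<exists>q. prime q \<and> q mod 8 = 5 \<and> q \<le> int X \<and> int X < int N0 * q \<and> Legendre q p = -1 \<and>
    (\<forall>h m. h > 0 \<longrightarrow> (m = 1 \<or> m = 2) \<longrightarrow> p ^ h \<le> p\<^sup>2 * q\<^sup>2 \<longrightarrow> m * q\<^sup>2 < p ^ h \<longrightarrow> pure_reps (m * (p ^ h - m * q\<^sup>2)) \<noteq> {} \<longrightarrow>
      real X powr (1 - 5 * \<delta>) \<le> real (card (pure_reps (m * (p ^ h - m * q\<^sup>2)))))) at_top"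
proof -
  have podd: "odd p" using p prime_odd_int by blast
  obtain N0 c where N0: "N0 \<ge> 1" and c: "c > 0" and
    dens: "eventually (\<lambda>x :: nat. c * real x / ln (real x) \<le> real (card (class_primes {p} (\<lambda>_. -1) \<inter> {x div N0 <.. x}))) at_top"
    by (rule class_primes_dense[of "{p}" "\<lambda>_. -1"]) (use p in auto)
  obtain D where D: "D \<ge> 1" "\<And>n. n > 0 \<Longrightarrow> real (ndiv n) \<le> D * real_of_int n powr (\<delta> / 4)"
    by (rule divisor_bound[of "\<delta> / 4"]) (use d in auto)
  define M where "M = 80 + (15 * D + 1 + 4 * (real_of_int p)\<^sup>2) + (4 * real N0 + 1)"
  have M0: "M > 0" using D by (simp add: M_def add_pos_nonneg)
  have large: "eventually (\<lambda>X. \<forall>h m. h > 0 \<longrightarrow> (m = 1 \<or> m = 2) \<longrightarrow> p ^ h \<le> p\<^sup>2 * (int X)\<^sup>2 \<longrightarrow>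
     real (card {a \<in> {1..int X}. \<not> p dvd a \<and> 0 < p ^ h - m * a\<^sup>2 \<and> (\<exists>g>\<lfloor>real X powr \<delta>\<rfloor>. g\<^sup>2 dvd p ^ h - m * a\<^sup>2)})
     \<le> (15 * D + 1 + 4 * (real_of_int p)\<^sup>2) * real X powr (1 - \<delta> / 2)) at_top"
    by (rule few_large_squares_scaled[OF p(1) podd d D(1)]) (rule D(2))
  have d2: "\<delta> / 2 > 0" and d3: "1 / 2 - 2 * \<delta> > 0" using d by auto
  have "eventually (\<lambda>X. \<exists>q. prime q \<and> q mod 8 = 5 \<and> q \<le> int X \<and> int X < int N0 * q \<and> Legendre q p = -1 \<and>
    (\<forall>h m. h > 0 \<longrightarrow> (m = 1 \<or> m = 2) \<longrightarrow> p ^ h \<le> p\<^sup>2 * q\<^sup>2 \<longrightarrow> m * q\<^sup>2 < p ^ h \<longrightarrow> pure_reps (m * (p ^ h - m * q\<^sup>2)) \<noteq> {} \<longrightarrow>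
      real X powr (1 - 5 * \<delta>) \<le> real (card (pure_reps (m * (p ^ h - m * q\<^sup>2)))))) at_top"
    using few_split_exceptions_scaled[OF p(1) d c N0 dens] large
      card_sieve_primes_ge[OF d c dens] dens log_power_le[OF d2, of "12 * M / c"] log_power_le[OF d(1), of 64]
      log_power_le[OF d3, of 8] eventually_ge_at_top[of "nat \<lceil>exp (4::real)\<rceil>"] eventually_ge_at_top[of N0]
  proof eventually_elim
    case (elim X)
    define z where "z = real X"
    define L where "L = sieve_primes p N0 \<delta> X"
    have z4: "z \<ge> exp 4" using elim(8) unfolding z_def by linarith
    have z3: "z \<ge> 3" using z4 exp_ge_add_one_self[of "4::real"] by linarith
    have lz: "ln z \<ge> 4" using z4 z3 by (simp add: ln_ge_iff)
    have X3: "X \<ge> 3" using z3 by (simp add: z_def)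
    define A where "A = int ` (class_primes {p} (\<lambda>_. -1) \<inter> {X div N0 <.. X})"
    have finA: "finite A" by (simp add: A_def)
    have cA: "c * z / ln z \<le> real (card A)" using elim(4) by (simp add: A_def z_def card_image)
    have AI: "A \<subseteq> {int (X div N0)<..int X}" by (auto simp: A_def simp del: of_nat_div)
    have A0: "A \<subseteq> {1..int X}" using AI by (auto simp del: of_nat_div)
    have AD: "prime q" "q mod 8 = 5" "Legendre q p = -1" if qA: "q \<in> A" for q
    proof -
      obtain k where k: "q = int k" "prime k" "k mod 8 = 5" "Legendre (int k) p = -1"
        using qA by (auto simp: A_def class_primes_def)
      show "prime q" "Legendre q p = -1" using k by auto
      have "q mod 8 = int (k mod 8)" by (simp add: k(1) zmod_int)
      thus "q mod 8 = 5" using k(3) by simp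
    qed
    \<comment> \<open>Bounding p^h through X rather than q makes the set of exponents independent of
      the prime still to be chosen.\<close>
    define H where "H = {h. h > 0 \<and> p ^ h \<le> p\<^sup>2 * (int X)\<^sup>2}"
    have Hsub: "H \<subseteq> {1..nat \<lfloor>3 * ln z\<rfloor>}"
    proof
      fix h assume h: "h \<in> H"
      have "real h \<le> 2 + 2 * ln z" using exponent_le_log[of p h X] h p X3 by (simp add: H_def z_def)
      hence "real h \<le> 3 * ln z" using lz by linarith
      hence "h \<le> nat \<lfloor>3 * ln z\<rfloor>" using le_nat_floor by blast
      thus "h \<in> {1..nat \<lfloor>3 * ln z\<rfloor>}" using h by (simp add: H_def)
    qed
    have finH: "finite H" using Hsub finite_subset by blast
    have "card H \<le> nat \<lfloor>3 * ln z\<rfloor>" using card_mono[OF _ Hsub] by simp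
    hence cH: "real (card H) \<le> 3 * ln z" using lz by linarith
    define Bad1 where "Bad1 = (\<lambda>(h, m) a. m\<^sup>2 * a\<^sup>2 - m * p ^ h \<noteq> 0 \<and>
      real (card {l \<in> L. Legendre (m\<^sup>2 * a\<^sup>2 - m * p ^ h) l = 1}) < real (card L) / 4)"
    define Bad2 where "Bad2 = (\<lambda>(h, m) a. \<not> p dvd a \<and> 0 < p ^ h - m * a\<^sup>2 \<and> (\<exists>g>\<lfloor>z powr \<delta>\<rfloor>. g\<^sup>2 dvd p ^ h - m * a\<^sup>2))"
    define Bad3 where "Bad3 = (\<lambda>(h, m) a. 0 < p ^ h - m * a\<^sup>2 \<and> real_of_int (p ^ h - m * a\<^sup>2) < z powr (2 - \<delta>))"
    define Bad where "Bad = (\<lambda>i a. Bad1 i a \<or> Bad2 i a \<or> Bad3 i a)"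
    obtain q where q: "q \<in> A" "\<And>i. i \<in> H \<times> {1, 2} \<Longrightarrow> \<not> Bad i q"
    proof (rule avoid_bad_sets[of "H \<times> {1, 2}" A Bad "M * z powr (1 - \<delta> / 2)"])
      show "finite (H \<times> {1, 2 :: int})" using finH by simp
      show "finite A" by (rule finA)
      fix i assume i: "i \<in> H \<times> {1, 2 :: int}"
      then obtain h m where hm: "i = (h, m)" "h > 0" "p ^ h \<le> p\<^sup>2 * (int X)\<^sup>2" "m = 1 \<or> m = 2" by (auto simp: H_def)
      have b1: "real (card {a \<in> A. Bad1 i a}) \<le> 80 * z powr (1 - \<delta> / 2)"
      proof -
        have "card {a \<in> A. Bad1 i a} \<le> card {a \<in> {0..<int (Suc X)}. Bad1 i a}"
          by (rule card_mono[OF finite_subset[of _ "{0..<int (Suc X)}"]]) (use A0 in auto)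
        hence "real (card {a \<in> A. Bad1 i a}) \<le> real (card {a \<in> {0..<int (Suc X)}. Bad1 i a})" by (rule of_nat_mono)
        also have "\<dots> \<le> 80 * z powr (1 - \<delta>)" using elim(1)[rule_format, OF hm(4,3)] by (simp add: Bad1_def hm(1) L_def z_def)
        also have "\<dots> \<le> 80 * z powr (1 - \<delta> / 2)" using z3 d by (intro mult_left_mono powr_mono) auto
        finally show ?thesis .
      qed
      have b2: "real (card {a \<in> A. Bad2 i a}) \<le> (15 * D + 1 + 4 * (real_of_int p)\<^sup>2) * z powr (1 - \<delta> / 2)"
      proof -
        have "card {a \<in> A. Bad2 i a} \<le> card {a \<in> {1..int X}. Bad2 i a}"
          by (rule card_mono[OF finite_subset[of _ "{1..int X}"]]) (use A0 in auto)
        hence "real (card {a \<in> A. Bad2 i a}) \<le> real (card {a \<in> {1..int X}. Bad2 i a})" by (rule of_nat_mono)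
        also have "\<dots> \<le> (15 * D + 1 + 4 * (real_of_int p)\<^sup>2) * z powr (1 - \<delta> / 2)"
          using elim(2)[rule_format, OF hm(2,4,3)] by (simp add: Bad2_def hm(1) z_def)
        finally show ?thesis .
      qed
      have b3: "real (card {a \<in> A. Bad3 i a}) \<le> (4 * real N0 + 1) * z powr (1 - \<delta> / 2)"
      proof -
        have "card {a \<in> A. Bad3 i a} \<le> card {a \<in> {int (X div N0)<..int X}. Bad3 i a}"
          by (rule card_mono[OF finite_subset[of _ "{int (X div N0)<..int X}"]]) (use AI in auto)
        hence "real (card {a \<in> A. Bad3 i a}) \<le> real (card {a \<in> {int (X div N0)<..int X}. Bad3 i a})" by (rule of_nat_mono)
        also have "\<dots> \<le> (4 * real N0 + 1) * z powr (1 - \<delta> / 2)"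
          using few_small_values_scaled[OF d N0 elim(9), of m "p ^ h"] hm(4) by (auto simp: Bad3_def hm(1) z_def)
        finally show ?thesis .
      qed
      have eq: "{a \<in> A. Bad i a} = {a \<in> A. Bad1 i a} \<union> ({a \<in> A. Bad2 i a} \<union> {a \<in> A. Bad3 i a})" by (auto simp: Bad_def)
      have "card {a \<in> A. Bad i a} \<le> card {a \<in> A. Bad1 i a} + (card {a \<in> A. Bad2 i a} + card {a \<in> A. Bad3 i a})"
        unfolding eq by (rule order_trans[OF card_Un_le add_left_mono[OF card_Un_le]])
      hence "real (card {a \<in> A. Bad i a}) \<le> real (card {a \<in> A. Bad1 i a}) + (real (card {a \<in> A. Bad2 i a}) + real (card {a \<in> A. Bad3 i a}))"
        by linarith
      also have "\<dots> \<le> 80 * z powr (1 - \<delta> / 2) + ((15 * D + 1 + 4 * (real_of_int p)\<^sup>2) * z powr (1 - \<delta> / 2) + (4 * real N0 + 1) * z powr (1 - \<delta> / 2))"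
        using b1 b2 b3 by (intro add_mono)
      also have "\<dots> = M * z powr (1 - \<delta> / 2)" by (simp add: M_def algebra_simps)
      finally show "real (card {a \<in> A. Bad i a}) \<le> M * z powr (1 - \<delta> / 2)" .
    next
      have "real (card (H \<times> {1, 2 :: int})) * (M * z powr (1 - \<delta> / 2)) = 2 * M * real (card H) * z powr (1 - \<delta> / 2)"
        by (simp add: card_cartesian_product)
      also have "\<dots> \<le> 2 * M * (3 * ln z) * z powr (1 - \<delta> / 2)"
        using cH M0 by (intro mult_right_mono mult_left_mono) auto
      also have "\<dots> < c * z / ln z"
      proof -
        have "12 * M / c * (ln z)\<^sup>2 \<le> z powr (\<delta> / 2)" using elim(5) by (simp add: z_def)
        hence "z powr (1 - \<delta> / 2) * (12 * M / c * (ln z)\<^sup>2) \<le> z powr (1 - \<delta> / 2) * z powr (\<delta> / 2)"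
          by (intro mult_left_mono) auto
        also have "\<dots> = z" using z3 by (simp add: powr_add[symmetric])
        finally have "12 * M * (ln z)\<^sup>2 * z powr (1 - \<delta> / 2) \<le> c * z" using c by (simp add: field_simps)
        moreover have "0 < M * (ln z)\<^sup>2 * z powr (1 - \<delta> / 2)" using M0 lz z3 by simp
        ultimately have "6 * M * (ln z)\<^sup>2 * z powr (1 - \<delta> / 2) < c * z" by simp
        thus ?thesis using lz by (simp add: field_simps power2_eq_square)
      qed
      also have "\<dots> \<le> real (card A)" by (rule cA)
      finally show "real (card (H \<times> {1, 2 :: int})) * (M * z powr (1 - \<delta> / 2)) < real (card A)" .
    qed blast
    have qX: "q \<in> {int (X div N0)<..int X}" using q(1) AI by blast
    have q1: "q \<ge> 1" using q(1) A0 by auto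
    show ?case
    proof (intro exI[of _ q] conjI allI impI)
      show "prime q" "q mod 8 = 5" "Legendre q p = -1" using AD q(1) by auto
      show "q \<le> int X" using qX by simp
      have "X < N0 * (X div N0 + 1)" using N0 dividend_less_times_div[of N0 X] by simp
      hence "int X < int (N0 * (X div N0 + 1))" by (simp only: of_nat_less_iff)
      also have "\<dots> = int N0 * (int (X div N0) + 1)" by (simp del: of_nat_div add: algebra_simps)
      also have "\<dots> \<le> int N0 * q" using qX by (intro mult_left_mono) auto
      finally show "int X < int N0 * q" .
      fix h and m :: int
      assume h: "h > 0" "p ^ h \<le> p\<^sup>2 * q\<^sup>2" "m * q\<^sup>2 < p ^ h" and m: "m = 1 \<or> m = 2"
        and ne: "pure_reps (m * (p ^ h - m * q\<^sup>2)) \<noteq> {}"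
      have "p\<^sup>2 * q\<^sup>2 \<le> p\<^sup>2 * (int X)\<^sup>2" using q1 qX by (intro mult_left_mono power_mono) auto
      hence "(h, m) \<in> H \<times> {1, 2}" using h m by (auto simp: H_def)
      from q(2)[OF this] have nb: "\<not> Bad1 (h, m) q" "\<not> Bad2 (h, m) q" "\<not> Bad3 (h, m) q" by (auto simp: Bad_def)
      have "\<not> p dvd q" using AD(3)[OF q(1)] Legendre_eq_0_iff[of q p] by auto
      show "real X powr (1 - 5 * \<delta>) \<le> real (card (pure_reps (m * (p ^ h - m * q\<^sup>2))))"
      proof (rule many_reps_scaled[OF p(1) podd d _ _ _ m elim(3) _ _ _ ne])
        show "X \<ge> 2" using X3 by simp
        show "64 \<le> real X powr \<delta>" "8 \<le> real X powr (1 / 2 - 2 * \<delta>)" using elim(6,7) by auto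
        show "real X powr (2 - \<delta>) \<le> real_of_int (p ^ h - m * q\<^sup>2)"
          using nb(3) h(3) by (simp add: Bad3_def z_def del: of_int_diff)
        show "\<not> (\<exists>g>\<lfloor>real X powr \<delta>\<rfloor>. g\<^sup>2 dvd p ^ h - m * q\<^sup>2)"
          using nb(2) h(3) \<open>\<not> p dvd q\<close> by (auto simp: Bad2_def z_def)
        have "m\<^sup>2 * q\<^sup>2 - m * p ^ h = m * (m * q\<^sup>2 - p ^ h)" by (simp add: power2_eq_square algebra_simps)
        hence "m\<^sup>2 * q\<^sup>2 - m * p ^ h \<noteq> 0" using h(3) m by auto
        thus "real (card (sieve_primes p N0 \<delta> X)) / 4 \<le> real (card {l \<in> sieve_primes p N0 \<delta> X. Legendre (m\<^sup>2 * q\<^sup>2 - m * p ^ h) l = 1})"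
          using nb(1) by (simp add: Bad1_def L_def)
      qed
    qed
  qed
  thus ?thesis by (rule that)
qed

section \<open>The exponent of the kissing number\<close>

context lps_nr
begin

lemma kiss_upper:
  assumes C: "C \<ge> 1" "\<And>n. n > 0 \<Longrightarrow> real (card (pure_reps n)) \<le> C * real_of_int n powr (1 / 2 + \<epsilon>)"
    and eps: "\<epsilon> > 0" and h: "Sys (2 * h)" "p ^ h \<le> p\<^sup>2 * q\<^sup>2"
  shows "real (kiss Vs Ed) \<le> real (card Vs) *
    (2 + 2 * C * (real_of_int p)\<^sup>2 * ((real_of_int p)\<^sup>2 * real_of_int q) powr (1 + 2 * \<epsilon>))"
proof -
  have q0: "real_of_int q > 0" and p0: "real_of_int p > 0" using q_gt_1 p_gt_1 by auto
  have "real_of_int (p ^ h) \<le> real_of_int (p\<^sup>2 * q\<^sup>2)" using h(2) by (simp only: of_int_le_iff)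
  hence P: "real_of_int p ^ h \<le> (real_of_int p)\<^sup>2 * (real_of_int q)\<^sup>2" by simp
  have 1: "real_of_int p ^ h / real_of_int q ^ 2 \<le> (real_of_int p)\<^sup>2" using P q0 by (simp add: field_simps)
  have 2: "real_of_int p ^ h / real_of_int q \<le> (real_of_int p)\<^sup>2 * real_of_int q"
    using P q0 by (simp add: field_simps power2_eq_square)
  have "real (card (Ker (2 * h))) \<le> 2 + 2 * C * (real_of_int p ^ h / real_of_int q ^ 2) * (real_of_int p ^ h / real_of_int q) powr (1 + 2 * \<epsilon>)"
    by (rule card_Ker_le[OF C eps])
  also have "\<dots> \<le> 2 + 2 * C * (real_of_int p)\<^sup>2 * ((real_of_int p)\<^sup>2 * real_of_int q) powr (1 + 2 * \<epsilon>)"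
    using 1 2 C(1) q0 p0 eps by (intro add_mono mult_mono powr_mono2) auto
  finally have K: "real (card (Ker (2 * h))) \<le> 2 + 2 * C * (real_of_int p)\<^sup>2 * ((real_of_int p)\<^sup>2 * real_of_int q) powr (1 + 2 * \<epsilon>)" .
  have "real (kiss Vs Ed) \<le> real (card Vs * card (Ker (2 * h)))" using kiss_bounds(1)[OF h(1)] by (rule of_nat_mono)
  also have "\<dots> = real (card Vs) * real (card (Ker (2 * h)))" by simp
  also have "\<dots> \<le> real (card Vs) * (2 + 2 * C * (real_of_int p)\<^sup>2 * ((real_of_int p)\<^sup>2 * real_of_int q) powr (1 + 2 * \<epsilon>))"
    using K by (intro mult_left_mono) auto
  finally show ?thesis .
qed

text \<open>Apply \<open>card_Vs_ge\<close> with the first \<open>t\<close> for which p^t reaches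
  q^3. Up to that point \<open>card (Ker (2 * v))\<close> is at most p^v up to a factor
  q^(4\<epsilon>) and constants, so the sum over v has only O(ln q) terms of that size.\<close>

lemma card_Vs_lower:
  assumes C: "C \<ge> 1" "\<And>n. n > 0 \<Longrightarrow> real (card (pure_reps n)) \<le> C * real_of_int n powr (1 / 2 + \<epsilon>)"
    and eps: "\<epsilon> > 0"
  shows "real_of_int q ^ 3 \<le> real (card Vs) *
    ((3 * ln (real_of_int q) + 2) * (2 + 2 * C * real_of_int p powr (1 + 2 * \<epsilon>) * real_of_int q powr (4 * \<epsilon>)))"
proof -
  define s where "s = real_of_int q"
  define r where "r = real_of_int p"
  have s1: "s > 1" using q_gt_1 by (simp add: s_def)
  have p3: "p \<ge> 3" using p_gt_1 odd_p by (cases "p = 2") auto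
  have r3: "r \<ge> 3" using p3 by (simp add: r_def)
  have lr: "ln r \<ge> 1" using r3 exp_le by (simp add: ln_ge_iff)
  have "\<exists>t. s ^ 3 \<le> r ^ t" using real_arch_pow[of r "s ^ 3"] r3 by (meson less_imp_le less_le_trans one_less_numeral_iff order_less_le_trans semiring_norm(77))
  define t where "t = (LEAST t. s ^ 3 \<le> r ^ t)"
  have t1: "s ^ 3 \<le> r ^ t" unfolding t_def by (rule LeastI_ex) fact
  have s3: "s ^ 3 > 1" using s1 by simp
  obtain u where u: "t = Suc u" using t1 s3 by (cases t) auto
  have "\<not> s ^ 3 \<le> r ^ u" using not_less_Least[of u "\<lambda>t. s ^ 3 \<le> r ^ t"] u by (simp add: t_def)
  hence u2: "r ^ u < s ^ 3" by simp
  have t2: "r ^ t \<le> r * s ^ 3" using u2 r3 u by simp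
  have "real u * 1 \<le> real u * ln r" using lr by (intro mult_left_mono) auto
  also have "\<dots> = ln (r ^ u)" using r3 by (simp add: ln_realpow)
  also have "\<dots> \<le> ln (s ^ 3)" using u2 r3 s1 by (subst ln_le_cancel_iff) auto
  also have "\<dots> = 3 * ln s" using s1 by (simp add: ln_realpow)
  finally have tl: "real t + 1 \<le> 3 * ln s + 2" using u by simp
  have bound: "real (card (Ker (2 * v))) / r ^ v \<le> 2 + 2 * C * r powr (1 + 2 * \<epsilon>) * s powr (4 * \<epsilon>)" if v: "v \<le> t" for v
  proof -
    define w where "w = r ^ v"
    have w1: "w \<ge> 1" using r3 by (simp add: w_def)
    have "w \<le> r ^ t" unfolding w_def using v r3 by (intro power_increasing) auto
    hence "w \<le> r * s ^ 3" using t2 by simp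
    hence ws: "w / s \<le> r * s\<^sup>2" using s1 by (simp add: field_simps power2_eq_square power3_eq_cube)
    have "real (card (Ker (2 * v))) \<le> 2 + 2 * C * (w / s ^ 2) * (w / s) powr (1 + 2 * \<epsilon>)"
      using card_Ker_le[OF C eps, of v] by (simp add: w_def r_def s_def)
    hence "real (card (Ker (2 * v))) / w \<le> (2 + 2 * C * (w / s ^ 2) * (w / s) powr (1 + 2 * \<epsilon>)) / w"
      using w1 by (intro divide_right_mono) auto
    also have "\<dots> = 2 / w + 2 * C / s ^ 2 * (w / s) powr (1 + 2 * \<epsilon>)" using w1 by (simp add: add_divide_distrib)
    also have "2 / w \<le> 2" using w1 by (simp add: field_simps)
    also have "2 * C / s ^ 2 * (w / s) powr (1 + 2 * \<epsilon>) \<le> 2 * C / s ^ 2 * (r * s\<^sup>2) powr (1 + 2 * \<epsilon>)"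
      using ws w1 s1 C(1) eps by (intro mult_left_mono powr_mono2) auto
    also have "(r * s\<^sup>2) powr (1 + 2 * \<epsilon>) = r powr (1 + 2 * \<epsilon>) * (s\<^sup>2 * s powr (4 * \<epsilon>))"
    proof -
      have "(s\<^sup>2) powr (1 + 2 * \<epsilon>) = (s powr 2) powr (1 + 2 * \<epsilon>)" using s1 by (simp add: powr_realpow)
      also have "\<dots> = s powr (2 + 4 * \<epsilon>)" by (simp add: powr_powr algebra_simps)
      also have "\<dots> = s\<^sup>2 * s powr (4 * \<epsilon>)" using s1 by (simp add: powr_add powr_realpow)
      finally show ?thesis using r3 s1 by (simp add: powr_mult)
    qed
    also have "2 * C / s ^ 2 * (r powr (1 + 2 * \<epsilon>) * (s\<^sup>2 * s powr (4 * \<epsilon>))) = 2 * C * r powr (1 + 2 * \<epsilon>) * s powr (4 * \<epsilon>)"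
      using s1 by simp
    finally show ?thesis by (simp add: w_def)
  qed
  define T where "T = 2 + 2 * C * r powr (1 + 2 * \<epsilon>) * s powr (4 * \<epsilon>)"
  have T0: "T \<ge> 0" using C(1) by (simp add: T_def)
  have "(\<Sum>v\<le>t. real (card (Ker (2 * v))) / r ^ v) \<le> (\<Sum>v\<le>t. T)"
    using bound by (intro sum_mono) (auto simp: T_def)
  also have "\<dots> = (real t + 1) * T" by simp
  also have "\<dots> \<le> (3 * ln s + 2) * T" using tl T0 by (intro mult_right_mono)
  finally have sum: "(\<Sum>v\<le>t. real (card (Ker (2 * v))) / r ^ v) \<le> (3 * ln s + 2) * T" .
  have "s ^ 3 \<le> r ^ t" by (rule t1)
  also have "\<dots> \<le> real (card Vs) * (\<Sum>v\<le>t. real (card (Ker (2 * v))) / r ^ v)"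
    using card_Vs_ge[of t] by (simp add: r_def)
  also have "\<dots> \<le> real (card Vs) * ((3 * ln s + 2) * T)" using sum by (intro mult_left_mono) auto
  finally show ?thesis by (simp add: s_def r_def T_def)
qed

lemma card_Vs_upper: "real (card Vs) \<le> 2 * real_of_int q ^ 3"
proof -
  have q1: "q > 1" by (rule q_gt_1)
  have "real (card Vs * nat (q - 1)) \<le> real (nat q ^ 4)" using card_Vs_le by (rule of_nat_mono)
  hence "real (card Vs) * (real_of_int q - 1) \<le> real_of_int q ^ 4" using q1 by simp
  moreover have "real (card Vs) * (real_of_int q / 2) \<le> real (card Vs) * (real_of_int q - 1)"
    using q1 by (intro mult_left_mono) auto
  ultimately have "real (card Vs) * (real_of_int q / 2) \<le> real_of_int q ^ 4" by simp
  also have "\<dots> = 2 * real_of_int q ^ 3 * (real_of_int q / 2)" by (simp add: eval_nat_numeral)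
  finally show ?thesis using q1 by (simp add: mult_le_cancel_right)
qed

lemma kiss_lower:
  assumes h: "Sys (2 * h)" and m: "m \<ge> 1" "m * q\<^sup>2 < p ^ h" "p ^ h \<le> p\<^sup>2 * q\<^sup>2"
  shows "real (card Vs) * real (card (pure_reps (m * (p ^ h - m * q\<^sup>2)))) \<le> (4 + 4 * ln (real_of_int q)) * real (kiss Vs Ed)"
proof -
  have p3: "p \<ge> 3" using p_gt_1 odd_p by (cases "p = 2") auto
  have "real h \<le> 2 + 2 * ln (real (nat q))" by (rule exponent_le_log[OF p3]) (use m(3) q_gt_1 in auto)
  hence h2: "2 * real h \<le> 4 + 4 * ln (real_of_int q)" using q_gt_1 by simp
  have "card Vs * card (pure_reps (m * (p ^ h - m * q\<^sup>2))) \<le> card Vs * card {k \<in> Ker (2 * h). nonreal k \<and> hq0 k > 0}"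
    by (intro mult_le_mono rep_nonreal_card m) simp
  also have "\<dots> \<le> 2 * h * kiss Vs Ed" by (rule kiss_bounds(2)[OF h])
  finally have "real (card Vs * card (pure_reps (m * (p ^ h - m * q\<^sup>2)))) \<le> real (2 * h * kiss Vs Ed)" by (rule of_nat_mono)
  also have "\<dots> = 2 * real h * real (kiss Vs Ed)" by simp
  also have "\<dots> \<le> (4 + 4 * ln (real_of_int q)) * real (kiss Vs Ed)" using h2 by (intro mult_right_mono) auto
  finally show ?thesis by simp
qed

end

text \<open>Here l, v, k stand for the logarithms of q, of the number of vertices and of the kissing
  number: v is about 3 l and k about v + l.\<close>

lemma ratio_near_four_thirds:
  fixes l v k \<delta> :: real
  assumes "l > 0" "0 < \<delta>" "\<delta> \<le> 1 / 8" "(3 - 6 * \<delta>) * l \<le> v" "v \<le> (3 + \<delta>) * l"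
    "v + (1 - 6 * \<delta>) * l \<le> k" "k \<le> v + (1 + 3 * \<delta>) * l"
  shows "\<bar>k / v - 4 / 3\<bar> \<le> 3 * \<delta>"
proof -
  have dl: "\<delta> * l > 0" "\<delta> * (\<delta> * l) \<le> 1 / 8 * (\<delta> * l)" "\<delta> * l \<le> 1 / 8 * l" using assms by (auto intro!: mult_right_mono)
  have v: "2 * l \<le> v" using assms(1,4) dl by (simp add: algebra_simps)
  have dv: "2 * (\<delta> * l) \<le> \<delta> * v" using mult_left_mono[OF v, of \<delta>] assms(2) by simp
  have "\<bar>k - 4 / 3 * v\<bar> \<le> 3 * (\<delta> * v)"
  proof -
    have "3 * k - 4 * v \<le> 15 * (\<delta> * l)" using assms(4,7) by (simp add: algebra_simps)
    moreover have "4 * v - 3 * k \<le> 19 * (\<delta> * l)" using assms(5,6) by (simp add: algebra_simps)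
    moreover have "19 * (\<delta> * l) \<le> 9 * (\<delta> * v)"
    proof -
      have "\<delta> * ((3 - 6 * \<delta>) * l) \<le> \<delta> * v" using assms(2,4) by (intro mult_left_mono) auto
      hence "3 * (\<delta> * l) - 6 * (\<delta> * (\<delta> * l)) \<le> \<delta> * v" by (simp add: algebra_simps)
      thus ?thesis using dl by linarith
    qed
    ultimately show ?thesis using dl by linarith
  qed
  moreover have "k / v - 4 / 3 = (k - 4 / 3 * v) / v" using v assms(1) by (simp add: field_simps)
  ultimately show ?thesis using v assms(1) by (simp add: abs_divide field_simps)
qed

lemma kiss_exponent_close:
  fixes p :: int
  assumes p: "prime p" "p mod 4 = 1" and d: "0 < \<delta>" "\<delta> \<le> 1 / 8"
  shows "\<exists>q. prime q \<and> q mod 4 = 1 \<and> q \<noteq> p \<and> Legendre p q = -1 \<and>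
    \<bar>ln (real (kiss (LPS_vertices p q) (LPS_adj p q))) / ln (real (card (LPS_vertices p q))) - 4 / 3\<bar> \<le> 3 * \<delta>"
proof -
  have p2: "p > 2" using p prime_gt_1_int[OF p(1)] by (cases "p = 2") auto
  obtain C where C: "C \<ge> 1" "\<And>n. n > 0 \<Longrightarrow> real (card (pure_reps n)) \<le> C * real_of_int n powr (1 / 2 + \<delta>)"
    using pure_reps_bound[OF d(1)] by blast
  obtain N0 where N0: "eventually (\<lambda>X. \<exists>q. prime q \<and> q mod 8 = 5 \<and> q \<le> int X \<and> int X < int N0 * q \<and> Legendre q p = -1 \<and>
    (\<forall>h m. h > 0 \<longrightarrow> (m = 1 \<or> m = 2) \<longrightarrow> p ^ h \<le> p\<^sup>2 * q\<^sup>2 \<longrightarrow> m * q\<^sup>2 < p ^ h \<longrightarrow> pure_reps (m * (p ^ h - m * q\<^sup>2)) \<noteq> {} \<longrightarrow>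
      real X powr (1 - 5 * \<delta>) \<le> real (card (pure_reps (m * (p ^ h - m * q\<^sup>2)))))) at_top"
    by (rule good_prime[OF p(1) p2 d])
  define r where "r = real_of_int p"
  \<comment> \<open>\<open>A\<close> and \<open>E\<close> collect all constants that depend only on
    p and \<delta>; for large q they are absorbed by small powers of q.\<close>
  define A where "A = 2 + 2 * C * r\<^sup>2 * (r\<^sup>2) powr (1 + 2 * \<delta>)"
  define E where "E = 2 + 2 * C * r powr (1 + 2 * \<delta>)"
  have AE: "A \<ge> 2" "E \<ge> 2" using C(1) by (auto simp: A_def E_def)
  have "eventually (\<lambda>x::nat. A \<le> real x powr \<delta> \<and> 5 * E * ln (real x) \<le> real x powr (2 * \<delta>) \<and> 8 * ln (real x) \<le> real x powr \<delta> \<and>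
      2 \<le> real x powr \<delta> \<and> 1 < ln (real x) \<and> real x > r \<and> ln (real x) \<ge> 2) at_top"
  proof -
    have "2 * \<delta> > 0" using d by simp
    have "eventually (\<lambda>x::nat. ln (real x) \<ge> 2) at_top" "eventually (\<lambda>x::nat. real x > r) at_top" by real_asymp+
    with log_power_le[OF d(1), of A] log_power_le[OF \<open>2 * \<delta> > 0\<close>, of "5 * E"] log_power_le[OF d(1), of 8]
    show ?thesis by eventually_elim simp
  qed
  then obtain Q0 where Q0: "\<And>x. x \<ge> Q0 \<Longrightarrow> A \<le> real x powr \<delta> \<and> 5 * E * ln (real x) \<le> real x powr (2 * \<delta>) \<and>
      8 * ln (real x) \<le> real x powr \<delta> \<and> 2 \<le> real x powr \<delta> \<and> 1 < ln (real x) \<and> real x > r \<and> ln (real x) \<ge> 2"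
    unfolding eventually_at_top_linorder by blast
  have "eventually (\<lambda>X. X \<ge> N0 * Q0) at_top" by (rule eventually_ge_at_top)
  with N0 have "eventually (\<lambda>X. X \<ge> N0 * Q0 \<and> (\<exists>q. prime q \<and> q mod 8 = 5 \<and> q \<le> int X \<and> int X < int N0 * q \<and> Legendre q p = -1 \<and>
    (\<forall>h m. h > 0 \<longrightarrow> (m = 1 \<or> m = 2) \<longrightarrow> p ^ h \<le> p\<^sup>2 * q\<^sup>2 \<longrightarrow> m * q\<^sup>2 < p ^ h \<longrightarrow> pure_reps (m * (p ^ h - m * q\<^sup>2)) \<noteq> {} \<longrightarrow>
      real X powr (1 - 5 * \<delta>) \<le> real (card (pure_reps (m * (p ^ h - m * q\<^sup>2))))))) at_top" by eventually_elim simp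
  then obtain X q where X: "X \<ge> N0 * Q0" and q: "prime q" "q mod 8 = 5" "q \<le> int X" "int X < int N0 * q" "Legendre q p = -1"
    and reps: "\<And>h m. h > 0 \<Longrightarrow> m = 1 \<or> m = 2 \<Longrightarrow> p ^ h \<le> p\<^sup>2 * q\<^sup>2 \<Longrightarrow> m * q\<^sup>2 < p ^ h \<Longrightarrow> pure_reps (m * (p ^ h - m * q\<^sup>2)) \<noteq> {} \<Longrightarrow>
      real X powr (1 - 5 * \<delta>) \<le> real (card (pure_reps (m * (p ^ h - m * q\<^sup>2))))"
    unfolding eventually_at_top_linorder by blast
  \<comment> \<open>Since q exceeds X / N0, choosing X large forces q itself beyond the threshold
    \<open>Q0\<close>.\<close>
  have "int N0 * int Q0 < int N0 * q" using X q(4) by (metis of_nat_mult of_nat_mono order_le_less_trans)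
  hence qQ: "int Q0 < q" by (simp add: mult_less_cancel_left)
  define s where "s = real_of_int q"
  have big: "A \<le> s powr \<delta>" "5 * E * ln s \<le> s powr (2 * \<delta>)" "8 * ln s \<le> s powr \<delta>" "2 \<le> s powr \<delta>" "s > r" "ln s \<ge> 2"
    using Q0[of "nat q"] qQ by (auto simp: s_def)
  have s1: "s > 1" using q(1) prime_gt_1_int by (auto simp: s_def)
  have q4: "q mod 4 = 1" using q(2) by presburger
  have qp: "p < q" using big(5) by (simp add: s_def r_def)
  have leg: "Legendre p q = -1" using Legendre_reciprocity[of p q] p p2 q(1,5) q4 qp by simp
  interpret lps_nr p q
  proof unfold_locales
    show "prime p" "p mod 4 = 1" "prime q" "p < q" by (rule p(1) p(2) q(1) qp)+
    show "odd q" using q4 by presburger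
    fix z
    show "\<not> q dvd z\<^sup>2 - p"
    proof
      assume "q dvd z\<^sup>2 - p"
      hence "[z\<^sup>2 = p] (mod q)" by (simp add: cong_iff_dvd_diff)
      hence "QuadRes q p" by (auto simp: QuadRes_def)
      thus False using leg by (simp add: Legendre_def split: if_splits)
    qed
  qed
  obtain h m where hm: "m = 1 \<or> m = 2" "Sys (2 * h)" "m * q\<^sup>2 < p ^ h" "p ^ h \<le> p\<^sup>2 * q\<^sup>2"
    "pure_reps (m * (p ^ h - m * q\<^sup>2)) \<noteq> {}"
    by (rule girth_choice[OF pure_reps_6_mod_8])
  have h0: "h > 0" using hm(2) by (cases h) (auto simp: Sys_def)
  define n where "n = real (card Vs)"
  define k where "k = real (kiss Vs Ed)"
  have n_low: "s powr (3 - 6 * \<delta>) \<le> n"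
  proof -
    have "s ^ 3 \<le> n * ((3 * ln s + 2) * (2 + 2 * C * r powr (1 + 2 * \<delta>) * s powr (4 * \<delta>)))"
      using card_Vs_lower[OF C d(1)] by (simp add: s_def r_def n_def)
    also have "\<dots> \<le> n * ((5 * ln s) * (E * s powr (4 * \<delta>)))"
    proof (intro mult_left_mono mult_mono)
      have "1 \<le> s powr (4 * \<delta>)" using s1 d by (intro ge_one_powr_ge_zero) auto
      thus "2 + 2 * C * r powr (1 + 2 * \<delta>) * s powr (4 * \<delta>) \<le> E * s powr (4 * \<delta>)" by (simp add: E_def algebra_simps)
    qed (use big C in \<open>auto simp: n_def\<close>)
    also have "\<dots> = n * (s powr (4 * \<delta>) * (5 * E * ln s))" by simp
    also have "\<dots> \<le> n * (s powr (4 * \<delta>) * s powr (2 * \<delta>))" using big by (intro mult_left_mono) (auto simp: n_def)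
    also have "s powr (4 * \<delta>) * s powr (2 * \<delta>) = s powr (6 * \<delta>)" by (simp add: powr_add[symmetric])
    finally have "s powr 3 \<le> n * s powr (6 * \<delta>)" using s1 by (simp add: powr_realpow)
    thus ?thesis using s1 by (simp add: powr_diff field_simps)
  qed
  have "s powr (3 - 6 * \<delta>) > 0" using s1 by simp
  hence n0: "n > 0" using n_low by linarith
  have n_up: "n \<le> s powr (3 + \<delta>)"
  proof -
    have "n \<le> 2 * s ^ 3" using card_Vs_upper by (simp add: n_def s_def)
    also have "\<dots> \<le> s powr \<delta> * s ^ 3" using big s1 by (intro mult_right_mono) auto
    also have "\<dots> = s powr (3 + \<delta>)" using s1 by (simp add: powr_add powr_realpow)
    finally show ?thesis .
  qed
  have k_up: "k \<le> n * s powr (1 + 3 * \<delta>)"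
  proof -
    have "k \<le> n * (2 + 2 * C * r\<^sup>2 * (r\<^sup>2 * s) powr (1 + 2 * \<delta>))"
      using kiss_upper[OF C d(1) hm(2,4)] by (simp add: k_def n_def r_def s_def)
    also have "\<dots> \<le> n * (A * s powr (1 + 2 * \<delta>))"
    proof (intro mult_left_mono)
      have "1 \<le> s powr (1 + 2 * \<delta>)" using s1 d by (intro ge_one_powr_ge_zero) auto
      thus "2 + 2 * C * r\<^sup>2 * (r\<^sup>2 * s) powr (1 + 2 * \<delta>) \<le> A * s powr (1 + 2 * \<delta>)"
        using s1 by (simp add: A_def powr_mult algebra_simps)
    qed (use n0 in simp)
    also have "\<dots> \<le> n * (s powr \<delta> * s powr (1 + 2 * \<delta>))" using big n0 by (intro mult_left_mono mult_right_mono) auto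
    also have "s powr \<delta> * s powr (1 + 2 * \<delta>) = s powr (1 + 3 * \<delta>)" by (simp add: powr_add[symmetric] add.commute)
    finally show ?thesis .
  qed
  have k_low: "n * s powr (1 - 6 * \<delta>) \<le> k"
  proof -
    have "s powr (1 - 5 * \<delta>) \<le> real X powr (1 - 5 * \<delta>)" using q(3) s1 d by (intro powr_mono2) (auto simp: s_def)
    also have "\<dots> \<le> real (card (pure_reps (m * (p ^ h - m * q\<^sup>2))))" using reps[OF h0 hm(1,4,3,5)] .
    finally have "n * s powr (1 - 5 * \<delta>) \<le> n * real (card (pure_reps (m * (p ^ h - m * q\<^sup>2))))" using n0 by simp
    also have "\<dots> \<le> (4 + 4 * ln s) * k" using kiss_lower[OF hm(2) _ hm(3,4)] hm(1) by (auto simp: n_def s_def k_def)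
    also have "\<dots> \<le> s powr \<delta> * k" using big by (intro mult_right_mono) (auto simp: k_def)
    finally have "n * (s powr (1 - 6 * \<delta>) * s powr \<delta>) \<le> s powr \<delta> * k" by (simp add: powr_add[symmetric])
    hence "s powr \<delta> * (n * s powr (1 - 6 * \<delta>)) \<le> s powr \<delta> * k" by (simp add: mult.assoc mult.commute mult.left_commute)
    thus ?thesis using s1 by simp
  qed
  have "n * s powr (1 - 6 * \<delta>) > 0" using n0 s1 by simp
  hence k0: "k > 0" using k_low by linarith
  have "\<bar>ln k / ln n - 4 / 3\<bar> \<le> 3 * \<delta>"
  proof (rule ratio_near_four_thirds[of "ln s" _ "ln n"])
    show "ln s > 0" using s1 by simp
    have "(3 - 6 * \<delta>) * ln s = ln (s powr (3 - 6 * \<delta>))" using s1 by (simp add: ln_powr)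
    also have "\<dots> \<le> ln n" using n_low n0 s1 by (subst ln_le_cancel_iff) auto
    finally show "(3 - 6 * \<delta>) * ln s \<le> ln n" .
    have "ln n \<le> ln (s powr (3 + \<delta>))" using n_up n0 s1 by (subst ln_le_cancel_iff) auto
    also have "\<dots> = (3 + \<delta>) * ln s" using s1 by (simp add: ln_powr)
    finally show "ln n \<le> (3 + \<delta>) * ln s" .
    have "ln n + (1 - 6 * \<delta>) * ln s = ln (n * s powr (1 - 6 * \<delta>))" using s1 n0 by (simp add: ln_mult ln_powr)
    also have "\<dots> \<le> ln k" using k_low k0 n0 s1 by (subst ln_le_cancel_iff) auto
    finally show "ln n + (1 - 6 * \<delta>) * ln s \<le> ln k" .
    have "ln k \<le> ln (n * s powr (1 + 3 * \<delta>))" using k_up k0 n0 s1 by (subst ln_le_cancel_iff) auto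
    also have "\<dots> = ln n + (1 + 3 * \<delta>) * ln s" using s1 n0 by (simp add: ln_mult ln_powr)
    finally show "ln k \<le> ln n + (1 + 3 * \<delta>) * ln s" .
  qed (rule d)+
  thus ?thesis using q(1) q4 qp leg by (intro exI[of _ q]) (simp add: k_def n_def)
qed

theorem theorem1p3:
  fixes p :: int
  assumes "prime p" and "[p = 1] (mod 4)"
  shows "\<exists>q :: nat \<Rightarrow> int.
     (\<forall>k. prime (q k) \<and> [q k = 1] (mod 4) \<and> q k \<noteq> p \<and> Legendre p (q k) = -1) \<and>
     (\<lambda>k. ln (real (kiss (LPS_vertices p (q k)) (LPS_adj p (q k))))
          / ln (real (card (LPS_vertices p (q k))))) \<longlonglongrightarrow> 4 / 3"
proof -
  define f where "f = (\<lambda>q. ln (real (kiss (LPS_vertices p q) (LPS_adj p q))) / ln (real (card (LPS_vertices p q))))"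
  have p4: "p mod 4 = 1" using assms(2) by (simp add: cong_def)
  \<comment> \<open>The tolerance \<delta> = 1 / (8 (k + 1)) never exceeds 1/8, as
    \<open>kiss_exponent_close\<close> demands, and tends to 0.\<close>
  have "\<exists>q. prime q \<and> q mod 4 = 1 \<and> q \<noteq> p \<and> Legendre p q = -1 \<and> \<bar>f q - 4 / 3\<bar> \<le> 3 * (1 / (8 * real (Suc k)))" for k
    unfolding f_def by (rule kiss_exponent_close[OF assms(1) p4]) (auto simp: field_simps)
  then obtain q where q: "\<And>k. prime (q k) \<and> q k mod 4 = 1 \<and> q k \<noteq> p \<and> Legendre p (q k) = -1 \<and> \<bar>f (q k) - 4 / 3\<bar> \<le> 3 * (1 / (8 * real (Suc k)))"
    by metis
  have "(\<lambda>k. f (q k) - 4 / 3) \<longlonglongrightarrow> 0"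
  proof (rule Lim_null_comparison)
    show "eventually (\<lambda>k. norm (f (q k) - 4 / 3) \<le> 3 * (1 / (8 * real (Suc k)))) sequentially"
      unfolding real_norm_def using q by (intro always_eventually allI) blast
    show "(\<lambda>k. 3 * (1 / (8 * real (Suc k)))) \<longlonglongrightarrow> 0" by real_asymp
  qed
  hence "(\<lambda>k. f (q k)) \<longlonglongrightarrow> 4 / 3" by (simp add: LIM_zero_iff)
  thus ?thesis using q by (intro exI[of _ q]) (auto simp: f_def cong_def)
qed

end
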